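(* Assume the setting below. For $v\in C_0^\eta(M,\mathbb R^d)$ define $v_t=\int_0^tv\circ T_s\,ds$ and $S_t=\int_0^t\int_0^s(v\circ T_r)\otimes(v\circ T_s)\,dr\,ds$. (a) If $H\in L^p(Y)$ for some $p\ge2$ and $\inf H>0$, then there exists $C>0$ such that $|v_t|_{p-1}\le Ct^{1/2}\|v\|_\eta$ for all $v\in C_0^\eta(M,\mathbb R^d)$, $t>0$. (b) If $H\in L^p(Y)$ for some $p\ge4$ and $\inf H>0$, then there exists $C>0$ such that $|S_t|_{(p-1)/2}\le Ct\|v\|_\eta^2$ for all $v\in C_0^\eta(M,\mathbb R^d)$, $t>0$.
   Context: Setting (nonuniformly expanding semiflow). Let $(M,d)$ be a bounded metric space, $Y\subset X\subset M$ Borel subsets and $T_t:M\to M$ a measurable semiflow. Let $h:X\to(0,\infty)$ be such that $f(x)=T_{h(x)}x$ defines $f:X\to X$, and $\tau:Y\to\mathbb Z^+$ such that $F(y)=f^{\tau(y)}y$ defines $F:Y\to Y$. Let $\mu_0$ be a finite Borel measure on $X$ with $\mu_0(Y)>0$, $f$ nonsingular and ergodic for $\mu_0$, $\tau\in L^1$. There is an at most countable measurable partition $\{Y_j\}$ of $Y$ with $\tau$ constant on each $Y_j$, and constants $\lambda>1$, $C\ge1$, $\eta\in(0,1]$ such that for all $j$: (1) $F$ restricts to a measure-theoretic bijection from $Y_j$ onto $Y$; (2) $d(Fy,Fy')\ge\lambda d(y,y')$ for $y,y'\in Y_j$; (3) $\zeta_0=\frac{d\mu_0|_Y}{d\mu_0|_Y\circ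 F}$ satisfies $|\log\zeta_0(y)-\log\zeta_0(y')|\le Cd(Fy,Fy')^\eta$ for $y,y'\in Y_j$. Let $\mu_Y$ be the unique ergodic $F$-invariant probability measure on $Y$ absolutely continuous w.r.t. $\mu_0$. With $\bar\tau=\int\tau\,d\mu_Y$, let $\mu_X=\pi_*\mu^\tau$, where $\mu^\tau=(\mu_Y\times\text{counting})/\bar\tau$ on $\{(y,\ell):0\le\ell\le\tau(y)-1\}$ and $\pi(y,\ell)=f^\ell y$. Assume $h\in L^1(\mu_X)$ and let $\mu_M$ be the image of $(\mu_X\times\text{Lebesgue})/\int h\,d\mu_X$ on $\{(x,u):0\le u\le h(x)\}$ under $(x,u)\mapsto T_ux$. The separation time $s(y,y')$ is the least $n\ge0$ with $F^ny,F^ny'$ in distinct $Y_j$; $d_\theta(y,y')=\theta^{s(y,y')}$. The induced roof function is $H(y)=\sum_{\ell=0}^{\tau(y)-1}h(f^\ell y)$. Assume there are $\theta\in(0,1)$ and $C\ge1$ such that for all $j$: $\sup_{y\ne y'\in Y_j}|H(y)-H(y')|/d_\theta(y,y')\le C\inf_{Y_j}H$, and $d(T_ty,T_ty')\le C\theta^{s(y,y')}$ for $y,y'\in Y_j$, $t\in[0,H(y)]\cap[0,H(y')]$. For $v:M\to\mathbb R^d$, $\|v\|_\eta=|v|_\infty+\sup_{x\ne x'}|v(x)-v(x')|/d(x,x')^\eta$; $C_0^\eta(M,\mathbb R^d)$ is the set of $v$ with $\|v\|_\eta<\infty$ and $\int v\,d\mu_M=0$. $a\otimes b=ab^T$. Norms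 $|\cdot|_q$ in the conclusions are on $L^q(M,\mu_M)$. *)

theory Defs
  imports "HOL-Analysis.Analysis" "HOL-Probability.Probability"
begin

definition fmap :: "(real \<Rightarrow> 'm \<Rightarrow> 'm) \<Rightarrow> ('m \<Rightarrow> real) \<Rightarrow> 'm \<Rightarrow> 'm" where
  "fmap T h x = T (h x) x"

definition Fmap :: "(real \<Rightarrow> 'm \<Rightarrow> 'm) \<Rightarrow> ('m \<Rightarrow> real) \<Rightarrow> ('m \<Rightarrow> nat) \<Rightarrow> 'm \<Rightarrow> 'm" where
  "Fmap T h \<tau> y = (fmap T h ^^ \<tau> y) y"

definition Hroof :: "(real \<Rightarrow> 'm \<Rightarrow> 'm) \<Rightarrow> ('m \<Rightarrow> real) \<Rightarrow> ('m \<Rightarrow> nat) \<Rightarrow> 'm \<Rightarrow> real" where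
  "Hroof T h \<tau> y = (\<Sum>l<\<tau> y. h ((fmap T h ^^ l) y))"

definition same_cell :: "'m set set \<Rightarrow> 'm \<Rightarrow> 'm \<Rightarrow> bool" where
  "same_cell P y y' = (\<exists>Q\<in>P. y \<in> Q \<and> y' \<in> Q)"

definition sep_time :: "'m set set \<Rightarrow> ('m \<Rightarrow> 'm) \<Rightarrow> 'm \<Rightarrow> 'm \<Rightarrow> enat" where
  "sep_time P F y y' =
     (if \<exists>n. \<not> same_cell P ((F ^^ n) y) ((F ^^ n) y')
      then enat (LEAST n. \<not> same_cell P ((F ^^ n) y) ((F ^^ n) y')) else \<infinity>)"

definition dtheta :: "real \<Rightarrow> 'm set set \<Rightarrow> ('m \<Rightarrow> 'm) \<Rightarrow> 'm \<Rightarrow> 'm \<Rightarrow> real" where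
  "dtheta \<theta> P F y y' = (case sep_time P F y y' of enat n \<Rightarrow> \<theta> ^ n | \<infinity> \<Rightarrow> 0)"

definition nonsingular_on :: "'m measure \<Rightarrow> 'm set \<Rightarrow> ('m \<Rightarrow> 'm) \<Rightarrow> bool" where
  "nonsingular_on \<mu> S g = (\<forall>A\<in>sets \<mu>. emeasure \<mu> (g -` A \<inter> S) = 0 \<longleftrightarrow> emeasure \<mu> A = 0)"

definition ergodic_on :: "'m measure \<Rightarrow> 'm set \<Rightarrow> ('m \<Rightarrow> 'm) \<Rightarrow> bool" where
  "ergodic_on \<mu> S g = (\<forall>A\<in>sets \<mu>. g -` A \<inter> S = A \<longrightarrow> emeasure \<mu> A = 0 \<or> emeasure \<mu> (S - A) = 0)"

definition invariant_on :: "'m measure \<Rightarrow> 'm set \<Rightarrow> ('m \<Rightarrow> 'm) \<Rightarrow> bool" where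
  "invariant_on \<mu> S g = (\<forall>A\<in>sets \<mu>. emeasure \<mu> (g -` A \<inter> S) = emeasure \<mu> A)"

text \<open>mu_X = pi_* mu^tau: mu_X(A) = (1/taubar) int_Y #{l < tau y. f^l y \<in> A} d mu_Y.\<close>
definition tower_measure :: "'m::metric_space set \<Rightarrow> ('m \<Rightarrow> 'm) \<Rightarrow> ('m \<Rightarrow> nat) \<Rightarrow> 'm measure \<Rightarrow> 'm measure" where
  "tower_measure X f \<tau> \<mu>Y = measure_of X (sets (restrict_space borel X))
     (\<lambda>A. (\<integral>\<^sup>+ y. of_nat (card {l. l < \<tau> y \<and> (f ^^ l) y \<in> A}) \<partial>\<mu>Y)
            / ennreal (\<integral> y. real (\<tau> y) \<partial>\<mu>Y))"

text \<open>mu_M = image of (mu_X x Leb)/int h on {(x,u). 0 \<le> u \<le> h x} under (x,u) \<mapsto> T u x.\<close>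
definition suspension_measure :: "(real \<Rightarrow> 'm::metric_space \<Rightarrow> 'm) \<Rightarrow> ('m \<Rightarrow> real) \<Rightarrow> 'm measure \<Rightarrow> 'm measure" where
  "suspension_measure T h \<mu>X = measure_of UNIV (sets borel)
     (\<lambda>A. (\<integral>\<^sup>+ x. emeasure lborel {u \<in> {0..h x}. T u x \<in> A} \<partial>\<mu>X) / ennreal (\<integral> x. h x \<partial>\<mu>X))"

definition holder_const :: "real \<Rightarrow> ('m::metric_space \<Rightarrow> 'b::real_normed_vector) \<Rightarrow> real" where
  "holder_const \<eta> v = Sup (insert 0 {norm (v x - v x') / dist x x' powr \<eta> | x x'. x \<noteq> x'})"

definition holder_norm :: "real \<Rightarrow> ('m::metric_space \<Rightarrow> 'b::real_normed_vector) \<Rightarrow> real" where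
  "holder_norm \<eta> v = (SUP x. norm (v x)) + holder_const \<eta> v"

definition C0eta :: "real \<Rightarrow> 'm::metric_space measure \<Rightarrow> ('m \<Rightarrow> real^'d) set" where
  "C0eta \<eta> \<mu> = {v. bounded (range v)
      \<and> bdd_above {norm (v x - v x') / dist x x' powr \<eta> | x x'. x \<noteq> x'}
      \<and> (\<integral> x. v x \<partial>\<mu>) = 0}"

definition Lq_norm :: "'m measure \<Rightarrow> real \<Rightarrow> ('m \<Rightarrow> 'b::real_normed_vector) \<Rightarrow> ennreal" where
  "Lq_norm \<mu> q g = (let I = (\<integral>\<^sup>+ x. ennreal (norm (g x) powr q) \<partial>\<mu>) in
      if I = \<infinity> then \<infinity> else ennreal (enn2real I powr (1 / q)))"

definition outer :: "real^'d \<Rightarrow> real^'d \<Rightarrow> real^'d^'d" where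
  "outer a b = (\<chi> i j. a $ i * b $ j)"

definition vt :: "(real \<Rightarrow> 'm \<Rightarrow> 'm) \<Rightarrow> ('m \<Rightarrow> real^'d) \<Rightarrow> real \<Rightarrow> 'm \<Rightarrow> real^'d" where
  "vt T v t x = (LINT s:{0..t}|lborel. v (T s x))"

definition St :: "(real \<Rightarrow> 'm \<Rightarrow> 'm) \<Rightarrow> ('m \<Rightarrow> real^'d) \<Rightarrow> real \<Rightarrow> 'm \<Rightarrow> real^'d^'d" where
  "St T v t x = (LINT s:{0..t}|lborel. (LINT r:{0..s}|lborel. outer (v (T r x)) (v (T s x))))"

end

theory Submission
  imports Defs
begin

text \<open>
  Let \<open>V y = \<integral>\<^sub>0\<^sup>H\<^sup>(\<^sup>y\<^sup>) v (T\<^sub>u y) du\<close> be the observable induced on \<open>Y\<close>. The transfer operator \<open>P\<close> of the full branch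
  map \<open>F\<close> contracts in a seminorm built from a one-step coupling of inverse branches, and maps \<open>V\<close> to a
  bounded Lipschitz function, so \<open>V = m + \<xi> \<circ> F - \<xi>\<close> with \<open>\<xi>\<close> bounded and \<open>P m = 0\<close>. Read backwards in
  time, the Birkhoff sums of \<open>m\<close> form a martingale, and so do the iterated sums once one factor is
  replaced by \<open>m\<close>; elementary moment and pathwise Doob inequalities bound their maxima in \<open>L\<^sup>p\<close> and
  \<open>L\<^sup>p\<^sup>/\<^sup>2\<close>. Since \<open>inf H > 0\<close>, at most \<open>t / inf H + 1\<close> returns occur up to time \<open>t\<close>, and the fibre length
  \<open>H\<close> in the formula for \<open>\<mu>M\<close> costs exactly one power of integrability.

  The contraction needs the density of \<open>\<mu>Y\<close> to be log-Hoelder, whereas only absolute continuity is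
  given: the density is fixed by the transfer operator of \<open>\<mu>0\<close>, whose \<open>n\<close>-th power maps every function
  constant on \<open>n\<close>-cylinders to a uniformly log-Hoelder one, and such functions are dense in \<open>L\<^sup>1\<close>.
\<close>

section \<open>Moments of martingale arrays\<close>

text \<open>The Markov property holds only modulo null sets, while the seminorm contraction compares
  individual points. Null sets are therefore removed once: deleting all images and preimages of the
  exceptional sets leaves a set \<open>Z\<close> of full measure on which every branch is an honest
  bijection, and later almost-everywhere identities become pointwise by shrinking \<open>Z\<close>.
  The rate survives the loss of a power for the following reason. Over \<open>n\<close> returns a
  Birkhoff sum has size \<open>sqrt n\<close> in \<open>L^p\<close>, and on the flow one integrates
  \<open>H * G powr (p - 1)\<close> with \<open>G\<close> of that size. Rescaling \<open>G\<close>
  by \<open>sqrt n\<close> before Young's inequality keeps the rate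
  \<open>n powr ((p - 1) / 2)\<close>. For \<open>S_t\<close> the dominating function lies only in
  \<open>L^(p/2)\<close>, so its square root takes the place of \<open>G\<close>. The constants must
  not depend on the observable. All base estimates are made for one class of scalar functions with
  fixed bounds; the components of \<open>v\<close> enter it after division by the Hoelder norm,
  which returns by homogeneity, linearly for \<open>v_t\<close> and quadratically for
  \<open>S_t\<close>.\<close>

lemma one_plus_powr_le:
  fixes x q :: real
  assumes "2 \<le> q" "\<bar>x\<bar> \<le> 1/2"
  shows "(1 + x) powr q \<le> 1 + q * x + q * (q - 1) * 2 powr q * x\<^sup>2"
proof (cases "x = 0")
  case False
  define diff :: "nat \<Rightarrow> real \<Rightarrow> real" where
    "diff k = (if k = 0 then (\<lambda>t. t powr q) else if k = 1 then (\<lambda>t. q * t powr (q - 1))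
               else (\<lambda>t. q * ((q - 1) * t powr (q - 2))))" for k
  have D: "DERIV (diff m) t :> diff (Suc m) t" if "m < 2" "1/2 \<le> t" "t \<le> 3/2" for m t
  proof -
    have "m = 0 \<or> m = 1" using that by auto
    then show ?thesis
    proof
      assume "m = 0" then show ?thesis using that
        by (auto simp: diff_def intro!: derivative_eq_intros has_real_derivative_powr)
    next
      assume "m = 1" then show ?thesis using that
        by (auto simp: diff_def intro!: derivative_eq_intros)
    qed
  qed
  have "\<exists>t. (if 1 + x < 1 then 1 + x < t \<and> t < 1 else 1 < t \<and> t < 1 + x) \<and>
      (1 + x) powr q = (\<Sum>m<2. (diff m 1 / fact m) * ((1 + x) - 1) ^ m) + (diff 2 t / fact 2) * ((1 + x) - 1) ^ 2"
    by (rule Taylor[of 2 diff "\<lambda>t. t powr q" "1/2" "3/2" 1 "1 + x"])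
       (use D assms False in \<open>auto simp: diff_def abs_le_iff\<close>)
  then obtain t where t: "if 1 + x < 1 then 1 + x < t \<and> t < 1 else 1 < t \<and> t < 1 + x"
    and eq: "(1 + x) powr q = (\<Sum>m<2. (diff m 1 / fact m) * x ^ m) + (diff 2 t / fact 2) * x ^ 2"
    by auto
  have tb: "0 < t" "t \<le> 2" using t assms by (auto simp: abs_le_iff split: if_splits)
  have "t powr (q - 2) \<le> 2 powr (q - 2)" using tb assms by (intro powr_mono2) auto
  also have "\<dots> \<le> 2 powr q" by (intro powr_mono) auto
  finally have tp: "t powr (q - 2) \<le> 2 powr q" .
  have "(diff 2 t / fact 2) * x ^ 2 = (q * (q - 1) / 2 * t powr (q - 2)) * x\<^sup>2"
    by (simp add: diff_def)
  also have "\<dots> \<le> (q * (q - 1) * 2 powr q) * x\<^sup>2"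
    using tp assms by (intro mult_right_mono mult_mono) auto
  finally have "(diff 2 t / fact 2) * x ^ 2 \<le> q * (q - 1) * 2 powr q * x\<^sup>2" .
  moreover have "(\<Sum>m<2. (diff m 1 / fact m) * x ^ m) = 1 + q * x"
    by (simp add: numeral_2_eq_2 diff_def)
  ultimately show ?thesis using eq by linarith
qed auto

text \<open>Second-order expansion of \<open>\<bar>x\<bar> powr q\<close> at \<open>a\<close>,
  uniform down to \<open>a = 0\<close>: if \<open>b\<close> is not small against \<open>a\<close>,
  all terms are absorbed by \<open>\<bar>b\<bar> powr q\<close>, otherwise the Taylor bound applies
  to \<open>x = b / a\<close>. The first-order term is kept exactly, since it is the one whose
  integral vanishes for martingale increments.\<close>

lemma powr_expansion:
  fixes q :: real
  assumes q: "2 \<le> q"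
  obtains K where "K > 0" and
    "\<And>a b :: real. \<bar>a + b\<bar> powr q \<le> \<bar>a\<bar> powr q + q * (sgn a * \<bar>a\<bar> powr (q - 1)) * b
        + K * (\<bar>a\<bar> powr (q - 2) * b\<^sup>2 + \<bar>b\<bar> powr q)"
proof -
  \<comment> \<open>The first two summands absorb the left side and the linear term when
    \<open>\<bar>a\<bar> \<le> 2 * \<bar>b\<bar>\<close>; the third is the Taylor remainder.\<close>
  define K where "K = 3 powr q + q * 2 powr (q - 1) + q * (q - 1) * 2 powr q"
  have parts: "0 < 3 powr q" "0 \<le> q * 2 powr (q - 1)" "0 \<le> q * (q - 1) * 2 powr q" using q by auto
  have K: "K > 0" unfolding K_def using parts by linarith
  have "\<bar>a + b\<bar> powr q \<le> \<bar>a\<bar> powr q + q * (sgn a * \<bar>a\<bar> powr (q - 1)) * b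
        + K * (\<bar>a\<bar> powr (q - 2) * b\<^sup>2 + \<bar>b\<bar> powr q)" for a b :: real
  proof (cases "\<bar>a\<bar> \<le> 2 * \<bar>b\<bar>")
    case True
    have "\<bar>a + b\<bar> powr q \<le> (3 * \<bar>b\<bar>) powr q" using True q by (intro powr_mono2) auto
    also have "\<dots> = 3 powr q * \<bar>b\<bar> powr q" by (simp add: powr_mult)
    finally have 1: "\<bar>a + b\<bar> powr q \<le> 3 powr q * \<bar>b\<bar> powr q" .
    have "\<bar>q * (sgn a * \<bar>a\<bar> powr (q - 1)) * b\<bar> \<le> q * \<bar>a\<bar> powr (q - 1) * \<bar>b\<bar>"
      using q by (auto simp: abs_mult sgn_if)
    also have "\<dots> \<le> q * (2 * \<bar>b\<bar>) powr (q - 1) * \<bar>b\<bar>"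
      using True q by (intro mult_right_mono mult_left_mono powr_mono2) auto
    also have "\<dots> = q * 2 powr (q - 1) * (\<bar>b\<bar> powr (q - 1) * \<bar>b\<bar>)" by (simp add: powr_mult)
    also have "\<bar>b\<bar> powr (q - 1) * \<bar>b\<bar> = \<bar>b\<bar> powr q"
      using powr_add[of "\<bar>b\<bar>" "q - 1" 1] by (cases "b = 0") auto
    finally have 2: "\<bar>q * (sgn a * \<bar>a\<bar> powr (q - 1)) * b\<bar> \<le> q * 2 powr (q - 1) * \<bar>b\<bar> powr q" .
    have "(3 powr q + q * 2 powr (q - 1)) * \<bar>b\<bar> powr q \<le> K * (\<bar>a\<bar> powr (q - 2) * b\<^sup>2 + \<bar>b\<bar> powr q)"
      using parts unfolding K_def by (intro mult_mono) auto
    moreover have "- (q * (sgn a * \<bar>a\<bar> powr (q - 1)) * b) \<le> q * 2 powr (q - 1) * \<bar>b\<bar> powr q"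
      using 2 by linarith
    ultimately show ?thesis using 1 powr_ge_zero[of "\<bar>a\<bar>" q]
      by (simp only: distrib_right)
  next
    case False
    define x where "x = b / a"
    have a: "a \<noteq> 0" and x: "\<bar>x\<bar> \<le> 1/2" using False by (auto simp: x_def field_simps)
    have x1: "0 < 1 + x" using x by linarith
    have ax: "b = a * x" using a by (simp add: x_def)
    have "\<bar>a + b\<bar> = \<bar>a * (1 + x)\<bar>" unfolding ax by (simp add: distrib_left)
    also have "\<dots> = \<bar>a\<bar> * (1 + x)" using x1 by (simp add: abs_mult)
    finally have "\<bar>a + b\<bar> powr q = \<bar>a\<bar> powr q * (1 + x) powr q" using x1 by (simp add: powr_mult)
    also have "\<dots> \<le> \<bar>a\<bar> powr q * (1 + q * x + q * (q - 1) * 2 powr q * x\<^sup>2)"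
      by (intro mult_left_mono one_plus_powr_le q x) auto
    also have "\<dots> = \<bar>a\<bar> powr q + q * (\<bar>a\<bar> powr q * x) + (q * (q - 1) * 2 powr q) * (\<bar>a\<bar> powr q * x\<^sup>2)"
      by (simp add: algebra_simps)
    also have "\<bar>a\<bar> powr q * x = sgn a * \<bar>a\<bar> powr (q - 1) * b"
    proof -
      have "\<bar>a\<bar> powr q = \<bar>a\<bar> powr (q - 1) * \<bar>a\<bar>"
        using powr_add[of "\<bar>a\<bar>" "q - 1" 1] a by auto
      then show ?thesis unfolding ax by (simp add: abs_sgn)
    qed
    also have "\<bar>a\<bar> powr q * x\<^sup>2 = \<bar>a\<bar> powr (q - 2) * b\<^sup>2"
    proof -
      have "\<bar>a\<bar> powr q = \<bar>a\<bar> powr (q - 2) * a\<^sup>2"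
        using powr_add[of "\<bar>a\<bar>" "q - 2" 2] a by auto
      then show ?thesis unfolding ax by (simp add: power_mult_distrib)
    qed
    also have "(q * (q - 1) * 2 powr q) * (\<bar>a\<bar> powr (q - 2) * b\<^sup>2) \<le> K * (\<bar>a\<bar> powr (q - 2) * b\<^sup>2 + \<bar>b\<bar> powr q)"
      using parts unfolding K_def by (intro mult_mono) auto
    finally show ?thesis by (simp add: mult.assoc)
  qed
  then show thesis using K that by blast
qed

text \<open>Young's inequality with a free parameter, by comparing \<open>b\<close> with
  \<open>a / s\<close>. The later choice \<open>s = sqrt n\<close> puts the coefficient
  \<open>1 / n\<close> before \<open>a powr q\<close>, small enough to be iterated \<open>n\<close>
  times.\<close>

lemma powr_young:
  fixes a b s q :: real
  assumes "2 \<le> q" "0 \<le> a" "0 \<le> b" "0 < s"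
  shows "a powr (q - 2) * b\<^sup>2 \<le> s powr (- 2) * a powr q + s powr (q - 2) * b powr q"
proof (cases "a = 0 \<or> b = 0")
  case True then show ?thesis using assms by (auto simp: powr_def)
next
  case False
  then have ab: "0 < a" "0 < b" using assms by auto
  have sq: "c\<^sup>2 = c powr 2" if "0 < c" for c :: real using that by simp
  show ?thesis
  proof (cases "b \<le> a / s")
    case True
    have "a powr (q - 2) * b\<^sup>2 \<le> a powr (q - 2) * (a / s)\<^sup>2"
      using True ab by (intro mult_left_mono power_mono) auto
    also have "\<dots> = s powr (- 2) * a powr q"
      using ab assms by (simp add: power_divide powr_minus powr_diff field_simps)
    finally show ?thesis by (smt (verit) mult_nonneg_nonneg powr_ge_zero)
  next
    case False
    then have "a \<le> s * b" using assms by (simp add: field_simps)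
    then have "a powr (q - 2) * b\<^sup>2 \<le> (s * b) powr (q - 2) * b\<^sup>2"
      using ab assms by (intro mult_right_mono powr_mono2) auto
    also have "\<dots> = s powr (q - 2) * b powr q"
      using ab assms by (simp add: powr_mult powr_diff field_simps)
    finally show ?thesis by (smt (verit) mult_nonneg_nonneg powr_ge_zero)
  qed
qed

lemma powr_times_le:
  fixes a b q :: real
  assumes "1 \<le> q" "0 \<le> a" "0 \<le> b"
  shows "a powr (q - 1) * b \<le> a powr q + b powr q"
proof (cases "a \<le> b")
  case True
  have "a powr (q - 1) * b \<le> b powr (q - 1) * b" using True assms by (intro mult_right_mono powr_mono2) auto
  also have "\<dots> = b powr q" using powr_add[of b "q - 1" 1] assms by (cases "b = 0") auto
  finally show ?thesis by (simp add: add_increasing)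
next
  case False
  have "a powr (q - 1) * b \<le> a powr (q - 1) * a" using False assms by (intro mult_left_mono) auto
  also have "\<dots> = a powr q" using powr_add[of a "q - 1" 1] assms by (cases "a = 0") auto
  finally show ?thesis by (simp add: add_increasing2)
qed

lemma powr_add_le:
  fixes a b q :: real
  assumes "0 \<le> q" "0 \<le> a" "0 \<le> b"
  shows "(a + b) powr q \<le> 2 powr q * (a powr q + b powr q)"
proof -
  have "(a + b) powr q \<le> (2 * max a b) powr q" using assms by (intro powr_mono2) auto
  also have "\<dots> = 2 powr q * max a b powr q" using assms by (simp add: powr_mult)
  also have "\<dots> \<le> 2 powr q * (a powr q + b powr q)"
    by (intro mult_left_mono) (auto simp: max_def)
  finally show ?thesis .
qed

section \<open>Running maxima and Doob's inequality\<close>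

fun runmax :: "(nat \<Rightarrow> real) \<Rightarrow> nat \<Rightarrow> real" where
  "runmax s 0 = s 0"
| "runmax s (Suc n) = max (runmax s n) (s (Suc n))"

lemma runmax_ge: "k \<le> n \<Longrightarrow> s k \<le> runmax s n"
  by (induction n) (auto simp: le_Suc_eq)

lemma runmax_attained: "\<exists>k\<le>n. runmax s n = s k"
  by (induction n) (auto simp: max_def intro: le_SucI)

lemma runmax_le_iff: "runmax s n \<le> c \<longleftrightarrow> (\<forall>k\<le>n. s k \<le> c)"
  by (induction n) (auto simp: le_Suc_eq)

lemma runmax_nonneg: "(\<And>k. 0 \<le> s k) \<Longrightarrow> 0 \<le> runmax s n"
  using runmax_ge[of 0 n s] order_trans by blast

lemma runmax_cong: "(\<And>k. k \<le> n \<Longrightarrow> s k = t k) \<Longrightarrow> runmax s n = runmax t n"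
  by (induction n) auto

lemma borel_measurable_runmax [measurable]:
  assumes "\<And>k. (\<lambda>x. s x k) \<in> borel_measurable M"
  shows "(\<lambda>x. runmax (s x) n) \<in> borel_measurable M"
  by (induction n) (use assms in auto)

lemma runmax_powr_le_sum:
  assumes "\<And>k. 0 \<le> s k"
  shows "runmax s n powr q \<le> (\<Sum>k\<le>n. s k powr q)"
proof -
  obtain k where "k \<le> n" "runmax s n = s k" using runmax_attained by blast
  then show ?thesis by (auto intro!: member_le_sum)
qed

text \<open>This is the tangent inequality
  \<open>b powr q \<ge> a powr q + q * a powr (q - 1) * (b - a)\<close> of a convex function. Its
  sharp constants are needed: errors would accumulate in the induction of
  \<open>doob_pathwise\<close>.\<close>

lemma powr_young_product:
  fixes a b q :: real
  assumes "1 < q" "0 \<le> a" "0 \<le> b"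
  shows "q * (a powr (q - 1) * b) \<le> (q - 1) * a powr q + b powr q"
proof (cases "a = 0 \<or> b = 0")
  case True then show ?thesis using assms by auto
next
  case False
  then have ab: "0 < a" "0 < b" using assms by auto
  have "(a powr q) powr ((q - 1)/q) * (b powr q) powr (1/q) \<le> ((q - 1)/q) * a powr q + (1/q) * b powr q"
    using ab assms by (intro Youngs_inequality_0) (auto simp: field_simps)
  moreover have "q * ((q - 1) / q) = q - 1" "q * (1 / q) = 1" using assms by auto
  ultimately have "a powr (q - 1) * b \<le> ((q - 1)/q) * a powr q + (1/q) * b powr q"
    using ab by (simp only: powr_powr) simp
  then show ?thesis using assms by (simp add: field_simps)
qed

text \<open>A deterministic Doob inequality: the left side is a discrete stochastic integral against
  \<open>s\<close>, whose expectation has a sign when \<open>s\<close> is a submartingale. In the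
  induction step the maximum either stays, and both sides grow equally, or jumps to
  \<open>s (Suc n)\<close>, where the tangent inequality closes the gap.\<close>

lemma doob_pathwise:
  fixes s :: "nat \<Rightarrow> real"
  assumes q: "1 < q" and s: "\<And>k. 0 \<le> s k"
  shows "q * (\<Sum>i<n. runmax s i powr (q - 1) * (s (Suc i) - s i))
      \<le> q * (runmax s n powr (q - 1) * s n) - (q - 1) * runmax s n powr q"
proof (induction n)
  case 0
  have "s 0 powr (q - 1) * s 0 = s 0 powr q"
    using powr_add[of "s 0" "q - 1" 1] s[of 0] by (cases "s 0 = 0") auto
  then show ?case using q by (simp add: algebra_simps)
next
  case (Suc n)
  let ?a = "runmax s n" and ?b = "s (Suc n)"
  have a: "0 \<le> ?a" by (rule runmax_nonneg) (rule s)
  have "q * (?a powr (q - 1) * ?b) - (q - 1) * ?a powr q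
      \<le> q * (runmax s (Suc n) powr (q - 1) * ?b) - (q - 1) * runmax s (Suc n) powr q"
  proof (cases "?b \<le> ?a")
    case False
    have "?b powr (q - 1) * ?b = ?b powr q"
      using powr_add[of ?b "q - 1" 1] s[of "Suc n"] by (cases "?b = 0") auto
    then show ?thesis using False powr_young_product[OF q a s[of "Suc n"]]
      by (simp add: max_def algebra_simps)
  qed (auto simp: max_def)
  then show ?case using Suc by (simp add: algebra_simps)
qed

lemma integrable_powr_add:
  fixes f g :: "'a \<Rightarrow> real"
  assumes "f \<in> borel_measurable M" "g \<in> borel_measurable M" "0 \<le> q"
    and "integrable M (\<lambda>x. \<bar>f x\<bar> powr q)" "integrable M (\<lambda>x. \<bar>g x\<bar> powr q)"
  shows "integrable M (\<lambda>x. \<bar>f x + g x\<bar> powr q)"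
proof (rule Bochner_Integration.integrable_bound)
  show "integrable M (\<lambda>x. 2 powr q * (\<bar>f x\<bar> powr q + \<bar>g x\<bar> powr q))" using assms by auto
  show "AE x in M. norm (\<bar>f x + g x\<bar> powr q) \<le> norm (2 powr q * (\<bar>f x\<bar> powr q + \<bar>g x\<bar> powr q))"
  proof (rule AE_I2)
    fix x
    have "\<bar>f x + g x\<bar> powr q \<le> (\<bar>f x\<bar> + \<bar>g x\<bar>) powr q" using assms by (intro powr_mono2) auto
    also have "\<dots> \<le> 2 powr q * (\<bar>f x\<bar> powr q + \<bar>g x\<bar> powr q)" using assms by (intro powr_add_le) auto
    finally show "norm (\<bar>f x + g x\<bar> powr q) \<le> norm (2 powr q * (\<bar>f x\<bar> powr q + \<bar>g x\<bar> powr q))" by simp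
  qed
qed (use assms in measurable)

text \<open>The bounded factor \<open>h\<close> stands for the sign of a partial sum.\<close>

lemma integrable_powr_times:
  fixes f g :: "'a \<Rightarrow> real"
  assumes "f \<in> borel_measurable M" "g \<in> borel_measurable M" "h \<in> borel_measurable M" "1 \<le> q"
    and "integrable M (\<lambda>x. \<bar>f x\<bar> powr q)" "integrable M (\<lambda>x. \<bar>g x\<bar> powr q)"
    and "\<And>x. \<bar>h x\<bar> \<le> 1"
  shows "integrable M (\<lambda>x. h x * \<bar>f x\<bar> powr (q - 1) * g x)"
proof (rule Bochner_Integration.integrable_bound)
  show "integrable M (\<lambda>x. \<bar>f x\<bar> powr q + \<bar>g x\<bar> powr q)" using assms by auto
  show "AE x in M. norm (h x * \<bar>f x\<bar> powr (q - 1) * g x) \<le> norm (\<bar>f x\<bar> powr q + \<bar>g x\<bar> powr q)"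
  proof (rule AE_I2)
    fix x
    have "norm (h x * \<bar>f x\<bar> powr (q - 1) * g x) = \<bar>h x\<bar> * (\<bar>f x\<bar> powr (q - 1) * \<bar>g x\<bar>)"
      by (simp add: abs_mult)
    also have "\<dots> \<le> 1 * (\<bar>f x\<bar> powr (q - 1) * \<bar>g x\<bar>)" using assms by (intro mult_right_mono) auto
    also have "\<dots> \<le> \<bar>f x\<bar> powr q + \<bar>g x\<bar> powr q" using powr_times_le[of q "\<bar>f x\<bar>" "\<bar>g x\<bar>"] assms by auto
    finally show "norm (h x * \<bar>f x\<bar> powr (q - 1) * g x) \<le> norm (\<bar>f x\<bar> powr q + \<bar>g x\<bar> powr q)" by simp
  qed
qed (use assms in measurable)

text \<open>The two vanishing integrals are what remains of the martingale property of the partial sums.\<close>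

definition martingale_array :: "'a measure \<Rightarrow> real \<Rightarrow> nat \<Rightarrow> real \<Rightarrow> (nat \<Rightarrow> 'a \<Rightarrow> real) \<Rightarrow> bool" where
  "martingale_array M q n R d \<longleftrightarrow> 1 \<le> n \<and> 0 \<le> R \<and>
     (\<forall>i<n. d i \<in> borel_measurable M \<and> integrable M (\<lambda>x. \<bar>d i x\<bar> powr q) \<and> (\<integral>x. \<bar>d i x\<bar> powr q \<partial>M) \<le> R \<and>
       (\<integral>x. sgn (\<Sum>l<i. d l x) * \<bar>\<Sum>l<i. d l x\<bar> powr (q - 1) * d i x \<partial>M) = 0 \<and>
       (\<integral>x. sgn (\<Sum>l<i. d l x) * \<bar>runmax (\<lambda>k. \<bar>\<Sum>l<k. d l x\<bar>) i\<bar> powr (q - 1) * d i x \<partial>M) = 0)"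

text \<open>A Burkholder-type bound. In the expansion of the \<open>q\<close>-th power of a partial
  sum the linear term integrates to zero, and Young's inequality with parameter
  \<open>sqrt n\<close> makes the remaining growth factor per step \<open>1 + K / n\<close>, so that
  \<open>n\<close> steps cost only \<open>exp K\<close>. The constant precedes the quantifier over
  measures and arrays: it depends on \<open>q\<close> alone.\<close>

lemma martingale_moment_bound:
  fixes q :: real
  assumes q: "2 \<le> q"
  shows "\<exists>K>0. \<forall>(M :: 'a measure) n R d. martingale_array M q n R d
      \<longrightarrow> (\<integral>x. \<bar>\<Sum>i<n. d i x\<bar> powr q \<partial>M) \<le> K * real n powr (q / 2) * R"
proof -
  obtain K where K: "K > 0" and exp: "\<And>a b :: real. \<bar>a + b\<bar> powr q \<le> \<bar>a\<bar> powr q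
        + q * (sgn a * \<bar>a\<bar> powr (q - 1)) * b + K * (\<bar>a\<bar> powr (q - 2) * b\<^sup>2 + \<bar>b\<bar> powr q)"
    using powr_expansion[OF q] by metis
  define K' where "K' = 2 * K * exp K"
  have "K' > 0" using K by (simp add: K'_def)
  moreover have "(\<integral>x. \<bar>\<Sum>i<n. d i x\<bar> powr q \<partial>M) \<le> K' * real n powr (q / 2) * R"
    if *: "martingale_array M q n R d" for M :: "'a measure" and n d R
  proof -
    have n: "1 \<le> n" and R: "0 \<le> R" and d[measurable]: "\<And>i. i < n \<Longrightarrow> d i \<in> borel_measurable M"
      and di: "\<And>i. i < n \<Longrightarrow> integrable M (\<lambda>x. \<bar>d i x\<bar> powr q)"
      and dR: "\<And>i. i < n \<Longrightarrow> (\<integral>x. \<bar>d i x\<bar> powr q \<partial>M) \<le> R"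
      and orth: "\<And>k. k < n \<Longrightarrow> (\<integral>x. sgn (\<Sum>i<k. d i x) * \<bar>\<Sum>i<k. d i x\<bar> powr (q - 1) * d k x \<partial>M) = 0"
      using * by (auto simp: martingale_array_def)
    define S where "S k x = (\<Sum>i<k. d i x)" for k x
    have Sm: "S k \<in> borel_measurable M" if "k \<le> n" for k
      unfolding S_def using that by (intro borel_measurable_sum d) auto
    have SSuc: "S (Suc k) x = S k x + d k x" for k x by (simp add: S_def)
    have Si: "integrable M (\<lambda>x. \<bar>S k x\<bar> powr q)" if "k \<le> n" for k
      using that
    proof (induction k)
      case 0 then show ?case by (simp add: S_def)
    next
      case (Suc k)
      then show ?case unfolding SSuc using q Sm[of k] d[of k] di[of k] by (intro integrable_powr_add) auto
    qed
    \<comment> \<open>The additive error of one step. The factor 2 merges the bare term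
      \<open>\<bar>d k x\<bar> powr q\<close> into the one weighted by
      \<open>real n powr (q / 2 - 1)\<close>, which is at least 1.\<close>
    define B where "B = 2 * K * real n powr (q / 2 - 1) * R"
    have B: "0 \<le> B" using K R by (simp add: B_def)
    have n1: "1 \<le> real n powr (q / 2 - 1)" using n q by (intro ge_one_powr_ge_zero) auto
    have step: "(\<integral>x. \<bar>S (Suc k) x\<bar> powr q \<partial>M) \<le> (1 + K / n) * (\<integral>x. \<bar>S k x\<bar> powr q \<partial>M) + B" if k: "k < n" for k
    proof -
      have i1: "integrable M (\<lambda>x. sgn (S k x) * \<bar>S k x\<bar> powr (q - 1) * d k x)"
        using k q Sm[of k] d[of k] Si[of k] di[of k] by (intro integrable_powr_times) (auto simp: abs_sgn_eq)
      have pt: "\<bar>S (Suc k) x\<bar> powr q \<le> (1 + K / n) * \<bar>S k x\<bar> powr q + q * (sgn (S k x) * \<bar>S k x\<bar> powr (q - 1) * d k x)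
            + 2 * K * real n powr (q / 2 - 1) * \<bar>d k x\<bar> powr q" for x
      proof -
        have "\<bar>S k x\<bar> powr (q - 2) * (d k x)\<^sup>2 = \<bar>S k x\<bar> powr (q - 2) * \<bar>d k x\<bar>\<^sup>2" by simp
        also have "\<dots> \<le> sqrt n powr (- 2) * \<bar>S k x\<bar> powr q + sqrt n powr (q - 2) * \<bar>d k x\<bar> powr q"
          using n q by (intro powr_young) auto
        also have "sqrt n powr (- 2) = 1 / n" using n by (simp add: powr_minus field_simps)
        also have "sqrt n powr (q - 2) = real n powr (q / 2 - 1)"
          using n by (simp add: powr_half_sqrt[symmetric] powr_powr diff_divide_distrib)
        finally have "K * (\<bar>S k x\<bar> powr (q - 2) * (d k x)\<^sup>2 + \<bar>d k x\<bar> powr q)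
           \<le> K * ((1 / n * \<bar>S k x\<bar> powr q + real n powr (q / 2 - 1) * \<bar>d k x\<bar> powr q) + real n powr (q / 2 - 1) * \<bar>d k x\<bar> powr q)"
          using K n1 by (intro mult_left_mono add_mono) (auto simp: mult_le_cancel_right1)
        then show ?thesis unfolding SSuc using exp[of "S k x" "d k x"] by (simp add: algebra_simps)
      qed
      have "(\<integral>x. \<bar>S (Suc k) x\<bar> powr q \<partial>M) \<le> (\<integral>x. (1 + K / n) * \<bar>S k x\<bar> powr q + q * (sgn (S k x) * \<bar>S k x\<bar> powr (q - 1) * d k x)
            + 2 * K * real n powr (q / 2 - 1) * \<bar>d k x\<bar> powr q \<partial>M)"
        using k i1 Si[of k] Si[of "Suc k"] di[of k] pt by (intro integral_mono) auto
      also have "\<dots> = (1 + K / n) * (\<integral>x. \<bar>S k x\<bar> powr q \<partial>M) + q * (\<integral>x. sgn (S k x) * \<bar>S k x\<bar> powr (q - 1) * d k x \<partial>M)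
            + 2 * K * real n powr (q / 2 - 1) * (\<integral>x. \<bar>d k x\<bar> powr q \<partial>M)"
        using k i1 Si[of k] di[of k] by simp
      also have "\<dots> \<le> (1 + K / n) * (\<integral>x. \<bar>S k x\<bar> powr q \<partial>M) + q * 0 + 2 * K * real n powr (q / 2 - 1) * R"
        using orth[OF k] dR[OF k] K q unfolding S_def by (intro add_mono mult_left_mono) auto
      finally show ?thesis by (simp add: B_def)
    qed
    have g1: "1 \<le> 1 + K / n" using K by simp
    \<comment> \<open>Discrete Gronwall argument: at most \<open>k\<close> errors \<open>B\<close>,
      each amplified by at most \<open>(1 + K / n) ^ k\<close>.\<close>
    have "(\<integral>x. \<bar>S k x\<bar> powr q \<partial>M) \<le> real k * (1 + K / n) ^ k * B" if "k \<le> n" for k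
      using that
    proof (induction k)
      case 0 then show ?case by (simp add: S_def)
    next
      case (Suc k)
      have "(\<integral>x. \<bar>S (Suc k) x\<bar> powr q \<partial>M) \<le> (1 + K / n) * (real k * (1 + K / n) ^ k * B) + (1 + K / n) ^ Suc k * B"
      proof (rule order_trans[OF step add_mono])
        show "B \<le> (1 + K / n) ^ Suc k * B" using one_le_power[OF g1, of "Suc k"] B by (simp add: mult_le_cancel_right1 del: power_Suc)
      qed (use Suc g1 in auto)
      also have "\<dots> = real (Suc k) * (1 + K / n) ^ Suc k * B" by (simp only: of_nat_Suc power_Suc) algebra
      finally show ?case .
    qed
    then have "(\<integral>x. \<bar>S n x\<bar> powr q \<partial>M) \<le> real n * (1 + K / n) ^ n * B" by simp
    also have "\<dots> \<le> real n * exp K * B"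
    proof -
      have "(1 + K / n) ^ n \<le> exp (K / n) ^ n" using K by (intro power_mono exp_ge_add_one_self) auto
      also have "\<dots> = exp K" using n by (simp add: exp_of_nat_mult[symmetric])
      finally show ?thesis using B by (intro mult_right_mono mult_left_mono) auto
    qed
    also have "\<dots> = K' * (real n * real n powr (q / 2 - 1)) * R" by (simp add: B_def K'_def)
    also have "real n * real n powr (q / 2 - 1) = real n powr (q / 2)"
      using n by (simp add: powr_diff)
    finally show ?thesis by (simp add: S_def)
  qed
  ultimately show ?thesis by blast
qed

text \<open>Integrating \<open>doob_pathwise\<close> along \<open>\<bar>S\<bar>\<close>. The
  stochastic integral is bounded below by a sum of terms
  \<open>sgn (S k x) * X k x powr (q - 1) * d k x\<close>, whose integrals are the second family
  required to vanish in \<open>martingale_array\<close>; what remains compares the maximum with the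
  last partial sum.\<close>

lemma martingale_maximal_bound:
  fixes q :: real
  assumes q: "2 \<le> q"
  shows "\<exists>K>0. \<forall>(M :: 'a measure) n R d. martingale_array M q n R d
      \<longrightarrow> integrable M (\<lambda>x. runmax (\<lambda>l. \<bar>\<Sum>i<l. d i x\<bar>) n powr q) \<and>
          (\<integral>x. runmax (\<lambda>l. \<bar>\<Sum>i<l. d i x\<bar>) n powr q \<partial>M) \<le> K * real n powr (q / 2) * R"
proof -
  obtain K where K: "K > 0" and mb: "\<forall>(M :: 'a measure) n R d. martingale_array M q n R d
      \<longrightarrow> (\<integral>x. \<bar>\<Sum>i<n. d i x\<bar> powr q \<partial>M) \<le> K * real n powr (q / 2) * R"
    using martingale_moment_bound[OF q] by blast
  define K' where "K' = 4 powr q * K"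
  have "K' > 0" using K by (simp add: K'_def)
  moreover have "integrable M (\<lambda>x. runmax (\<lambda>l. \<bar>\<Sum>i<l. d i x\<bar>) n powr q) \<and>
          (\<integral>x. runmax (\<lambda>l. \<bar>\<Sum>i<l. d i x\<bar>) n powr q \<partial>M) \<le> K' * real n powr (q / 2) * R"
    if *: "martingale_array M q n R d" for M :: "'a measure" and n d R
  proof -
    have n: "1 \<le> n" and R: "0 \<le> R" and d[measurable]: "\<And>i. i < n \<Longrightarrow> d i \<in> borel_measurable M"
      and di: "\<And>i. i < n \<Longrightarrow> integrable M (\<lambda>x. \<bar>d i x\<bar> powr q)"
      and dR: "\<And>i. i < n \<Longrightarrow> (\<integral>x. \<bar>d i x\<bar> powr q \<partial>M) \<le> R"
      and orth: "\<And>k. k < n \<Longrightarrow> (\<integral>x. sgn (\<Sum>i<k. d i x) * \<bar>\<Sum>i<k. d i x\<bar> powr (q - 1) * d k x \<partial>M) = 0"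
      and orth2: "\<And>k. k < n \<Longrightarrow> (\<integral>x. sgn (\<Sum>i<k. d i x) * \<bar>runmax (\<lambda>l. \<bar>\<Sum>i<l. d i x\<bar>) k\<bar> powr (q - 1) * d k x \<partial>M) = 0"
      using * by (auto simp: martingale_array_def)
    define S where "S k x = (\<Sum>i<k. d i x)" for k x
    define X where "X k x = runmax (\<lambda>l. \<bar>S l x\<bar>) k" for k x
    have Sm: "S k \<in> borel_measurable M" if "k \<le> n" for k
      unfolding S_def using that by (intro borel_measurable_sum d) auto
    have SSuc: "S (Suc k) x = S k x + d k x" for k x by (simp add: S_def)
    have Si: "integrable M (\<lambda>x. \<bar>S k x\<bar> powr q)" if "k \<le> n" for k
      using that
    proof (induction k)
      case 0 then show ?case by (simp add: S_def)
    next
      case (Suc k)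
      then show ?case unfolding SSuc using q Sm[of k] d[of k] di[of k] by (intro integrable_powr_add) auto
    qed
    have X0: "0 \<le> X k x" for k x unfolding X_def by (rule runmax_nonneg) simp
    have Xm: "X k \<in> borel_measurable M" if "k \<le> n" for k
      using that unfolding X_def
      by (induction k) (use Sm in auto)
    have Xi: "integrable M (\<lambda>x. \<bar>X k x\<bar> powr q)" if "k \<le> n" for k
    proof (rule Bochner_Integration.integrable_bound)
      show "integrable M (\<lambda>x. \<Sum>l\<le>k. \<bar>S l x\<bar> powr q)" using that Si by (intro Bochner_Integration.integrable_sum) auto
      show "AE x in M. norm (\<bar>X k x\<bar> powr q) \<le> norm (\<Sum>l\<le>k. \<bar>S l x\<bar> powr q)"
      proof (rule AE_I2)
        fix x
        have "\<bar>X k x\<bar> powr q \<le> (\<Sum>l\<le>k. \<bar>S l x\<bar> powr q)"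
          using X0[of k x] runmax_powr_le_sum[of "\<lambda>l. \<bar>S l x\<bar>" k q] by (simp add: X_def)
        then show "norm (\<bar>X k x\<bar> powr q) \<le> norm (\<Sum>l\<le>k. \<bar>S l x\<bar> powr q)" by simp
      qed
    qed (use Xm[OF that] in measurable)
    have orth2': "(\<integral>x. sgn (S k x) * \<bar>X k x\<bar> powr (q - 1) * d k x \<partial>M) = 0" if "k < n" for k
      using orth2[OF that] by (simp add: S_def X_def)
    have Ii: "integrable M (\<lambda>x. sgn (S k x) * \<bar>X k x\<bar> powr (q - 1) * d k x)" if "k < n" for k
      using that q Sm[of k] Xm[of k] d[of k] Xi[of k] di[of k] by (intro integrable_powr_times) (auto simp: abs_sgn_eq)
    have pt: "X n x powr q \<le> 4 powr q * \<bar>S n x\<bar> powr q - 4 * (\<Sum>k<n. sgn (S k x) * \<bar>X k x\<bar> powr (q - 1) * d k x)" for x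
    proof -
      have "(\<Sum>k<n. sgn (S k x) * \<bar>X k x\<bar> powr (q - 1) * d k x) \<le> (\<Sum>k<n. X k x powr (q - 1) * (\<bar>S (Suc k) x\<bar> - \<bar>S k x\<bar>))"
      proof (rule sum_mono)
        fix k
        \<comment> \<open>The sign is a subgradient of the modulus.\<close>
        have "sgn (S k x) * d k x \<le> \<bar>S (Suc k) x\<bar> - \<bar>S k x\<bar>" unfolding SSuc by (auto simp: sgn_if)
        from mult_left_mono[OF this, of "X k x powr (q - 1)"]
        show "sgn (S k x) * \<bar>X k x\<bar> powr (q - 1) * d k x \<le> X k x powr (q - 1) * (\<bar>S (Suc k) x\<bar> - \<bar>S k x\<bar>)"
          using X0[of k x] by (simp add: mult_ac)
      qed
      then have "q * (\<Sum>k<n. sgn (S k x) * \<bar>X k x\<bar> powr (q - 1) * d k x)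
          \<le> q * (\<Sum>k<n. X k x powr (q - 1) * (\<bar>S (Suc k) x\<bar> - \<bar>S k x\<bar>))" using q by (intro mult_left_mono) auto
      also have "\<dots> \<le> q * (X n x powr (q - 1) * \<bar>S n x\<bar>) - (q - 1) * X n x powr q"
        unfolding X_def using q by (intro doob_pathwise) auto
      finally have A: "(q - 1) * X n x powr q + q * (\<Sum>k<n. sgn (S k x) * \<bar>X k x\<bar> powr (q - 1) * d k x)
           \<le> q * (X n x powr (q - 1) * \<bar>S n x\<bar>)" by simp
      \<comment> \<open>As \<open>q - 1 \<ge> q / 2\<close>, half of \<open>X n x powr q\<close> is
        available on the left. Spending a quarter here leaves a quarter, whence the factors 4 in the
        claim.\<close>
      have B: "X n x powr (q - 1) * \<bar>S n x\<bar> \<le> X n x powr q / 4 + 4 powr (q - 1) * \<bar>S n x\<bar> powr q"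
      proof (cases "4 * \<bar>S n x\<bar> \<le> X n x")
        case True
        have "X n x powr (q - 1) * \<bar>S n x\<bar> \<le> X n x powr (q - 1) * (X n x / 4)"
          using True by (intro mult_left_mono) auto
        also have "\<dots> = X n x powr q / 4" using powr_add[of "X n x" "q - 1" 1] X0[of n x] by (cases "X n x = 0") auto
        finally show ?thesis by (simp add: add_increasing2)
      next
        case False
        have "X n x powr (q - 1) * \<bar>S n x\<bar> \<le> (4 * \<bar>S n x\<bar>) powr (q - 1) * \<bar>S n x\<bar>"
          using False X0[of n x] q by (intro mult_right_mono powr_mono2) auto
        also have "\<dots> = 4 powr (q - 1) * \<bar>S n x\<bar> powr q"
          using powr_add[of "\<bar>S n x\<bar>" "q - 1" 1] by (cases "S n x = 0") (auto simp: powr_mult)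
        finally show ?thesis using powr_ge_zero[of "X n x" q] by linarith
      qed
      have "q / 2 * X n x powr q \<le> (q - 1) * X n x powr q" using q by (intro mult_right_mono) auto
      then have "q * (X n x powr q / 2 + (\<Sum>k<n. sgn (S k x) * \<bar>X k x\<bar> powr (q - 1) * d k x)) \<le> q * (X n x powr (q - 1) * \<bar>S n x\<bar>)"
        using A by (simp add: distrib_left)
      then have "X n x powr q / 2 + (\<Sum>k<n. sgn (S k x) * \<bar>X k x\<bar> powr (q - 1) * d k x) \<le> X n x powr (q - 1) * \<bar>S n x\<bar>"
        using q by simp
      moreover have "4 * (4 powr (q - 1) * \<bar>S n x\<bar> powr q) = 4 powr q * \<bar>S n x\<bar> powr q" by (simp add: powr_diff)
      ultimately show ?thesis using B by linarith
    qed
    have Is: "integrable M (\<lambda>x. \<Sum>k<n. sgn (S k x) * \<bar>X k x\<bar> powr (q - 1) * d k x)"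
      using Ii by (intro Bochner_Integration.integrable_sum) auto
    have Iz: "(\<integral>x. (\<Sum>k<n. sgn (S k x) * \<bar>X k x\<bar> powr (q - 1) * d k x) \<partial>M) = 0"
      using Ii orth2' by (subst Bochner_Integration.integral_sum) auto
    have Xn: "integrable M (\<lambda>x. X n x powr q)" using Xi[of n] X0 by simp
    have "(\<integral>x. X n x powr q \<partial>M) \<le> (\<integral>x. 4 powr q * \<bar>S n x\<bar> powr q - 4 * (\<Sum>k<n. sgn (S k x) * \<bar>X k x\<bar> powr (q - 1) * d k x) \<partial>M)"
      using Si[of n] Is Xn pt by (intro integral_mono Bochner_Integration.integrable_diff integrable_mult_right) auto
    also have "\<dots> = 4 powr q * (\<integral>x. \<bar>S n x\<bar> powr q \<partial>M)"
      using Si[of n] Is Iz by (subst Bochner_Integration.integral_diff) auto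
    also have "\<dots> \<le> 4 powr q * (K * real n powr (q / 2) * R)"
      unfolding S_def using mb * by (intro mult_left_mono) auto
    finally show ?thesis using Xn by (simp add: K'_def X_def S_def mult_ac)
  qed
  ultimately show ?thesis by blast
qed

section \<open>A calculus of moment bounds\<close>

lemma sum_powr_le:
  fixes a :: "nat \<Rightarrow> real"
  assumes q: "1 \<le> q" and a: "\<And>j. 0 \<le> a j" and n: "1 \<le> n"
  shows "(\<Sum>j<n. a j) powr q \<le> real n powr (q - 1) * (\<Sum>j<n. a j powr q)"
proof -
  \<comment> \<open>The mean. Summing the tangent inequality at \<open>A\<close> over all
    \<open>a j\<close> makes the linear terms cancel, which is Jensen's inequality for the power
    \<open>q\<close>.\<close>
  define A where "A = (\<Sum>j<n. a j) / n"
  have A: "0 \<le> A" unfolding A_def by (intro divide_nonneg_nonneg sum_nonneg a) auto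
  have "real n * A powr q \<le> (\<Sum>j<n. a j powr q)"
  proof (cases "q = 1")
    case True then show ?thesis using A a n by (simp add: A_def sum_nonneg)
  next
    case False
    then have q1: "1 < q" using q by simp
    have AA: "A powr (q - 1) * A = A powr q"
      using powr_add[of A "q - 1" 1] A by (cases "A = 0") auto
    have "(\<Sum>j<n. q * (A powr (q - 1) * a j)) \<le> (\<Sum>j<n. (q - 1) * A powr q + a j powr q)"
      by (intro sum_mono powr_young_product q1 A a)
    also have "(\<Sum>j<n. q * (A powr (q - 1) * a j)) = q * (A powr (q - 1) * (real n * A))"
      using n by (simp add: sum_distrib_left[symmetric] A_def)
    also have "\<dots> = q * real n * A powr q" unfolding AA[symmetric] by simp
    also have "(\<Sum>j<n. (q - 1) * A powr q + a j powr q) = q * real n * A powr q - real n * A powr q + (\<Sum>j<n. a j powr q)"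
      by (simp add: sum.distrib left_diff_distrib right_diff_distrib)
    finally show ?thesis by linarith
  qed
  then have "((\<Sum>j<n. a j) / n) powr q \<le> (\<Sum>j<n. a j powr q) / n"
    using n by (simp add: A_def field_simps)
  then have "(\<Sum>j<n. a j) powr q / real n powr q \<le> (\<Sum>j<n. a j powr q) / n"
    using a n by (simp add: powr_divide sum_nonneg)
  then have "(\<Sum>j<n. a j) powr q \<le> (\<Sum>j<n. a j powr q) / n * real n powr q"
    using n by (simp add: field_simps)
  also have "\<dots> = real n powr (q - 1) * (\<Sum>j<n. a j powr q)"
    using n by (simp add: powr_diff)
  finally show ?thesis .
qed

text \<open>Bundles measurability with a bound on the \<open>q\<close>-th power of the
  \<open>L^q\<close> norm, not on the norm itself. Working with the nonnegative integral lets such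
  bounds be combined without integrability side conditions.\<close>

definition moment_le :: "'a measure \<Rightarrow> real \<Rightarrow> ('a \<Rightarrow> real) \<Rightarrow> real \<Rightarrow> bool" where
  "moment_le M q f c \<longleftrightarrow> f \<in> borel_measurable M \<and> 0 \<le> c \<and> (\<integral>\<^sup>+x. ennreal (\<bar>f x\<bar> powr q) \<partial>M) \<le> ennreal c"

lemma moment_leD: "moment_le M q f c \<Longrightarrow> f \<in> borel_measurable M" "moment_le M q f c \<Longrightarrow> 0 \<le> c"
  "moment_le M q f c \<Longrightarrow> (\<integral>\<^sup>+x. ennreal (\<bar>f x\<bar> powr q) \<partial>M) \<le> ennreal c"
  by (auto simp: moment_le_def)

lemma moment_le_weaken: "moment_le M q f c \<Longrightarrow> c \<le> d \<Longrightarrow> moment_le M q f d"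
  by (auto simp: moment_le_def intro: order_trans ennreal_leI)

lemma moment_le_mono:
  assumes "moment_le M q g c" "f \<in> borel_measurable M" "0 \<le> q" "\<And>x. x \<in> space M \<Longrightarrow> \<bar>f x\<bar> \<le> \<bar>g x\<bar>"
  shows "moment_le M q f c"
proof -
  have "(\<integral>\<^sup>+x. ennreal (\<bar>f x\<bar> powr q) \<partial>M) \<le> (\<integral>\<^sup>+x. ennreal (\<bar>g x\<bar> powr q) \<partial>M)"
    using assms by (intro nn_integral_mono ennreal_leI powr_mono2) auto
  then show ?thesis using assms by (auto simp: moment_le_def)
qed

lemma moment_le_dominated:
  assumes "moment_le M q g c" "moment_le M q h d" "f \<in> borel_measurable M" "0 \<le> e"
    and "\<And>x. x \<in> space M \<Longrightarrow> \<bar>f x\<bar> powr r \<le> e * (\<bar>g x\<bar> powr q + \<bar>h x\<bar> powr q)"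
  shows "moment_le M r f (e * (c + d))"
proof -
  note [measurable] = moment_leD(1)[OF assms(1)] moment_leD(1)[OF assms(2)]
  have "(\<integral>\<^sup>+x. ennreal (\<bar>f x\<bar> powr r) \<partial>M)
      \<le> (\<integral>\<^sup>+x. ennreal e * (ennreal (\<bar>g x\<bar> powr q) + ennreal (\<bar>h x\<bar> powr q)) \<partial>M)"
  proof (rule nn_integral_mono)
    fix x assume "x \<in> space M"
    then have "ennreal (\<bar>f x\<bar> powr r) \<le> ennreal (e * (\<bar>g x\<bar> powr q + \<bar>h x\<bar> powr q))" by (intro ennreal_leI assms)
    also have "\<dots> = ennreal e * (ennreal (\<bar>g x\<bar> powr q) + ennreal (\<bar>h x\<bar> powr q))"
      using assms by (simp add: ennreal_mult)
    finally show "ennreal (\<bar>f x\<bar> powr r) \<le> ennreal e * (ennreal (\<bar>g x\<bar> powr q) + ennreal (\<bar>h x\<bar> powr q))" .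
  qed
  also have "\<dots> = ennreal e * ((\<integral>\<^sup>+x. ennreal (\<bar>g x\<bar> powr q) \<partial>M) + (\<integral>\<^sup>+x. ennreal (\<bar>h x\<bar> powr q) \<partial>M))"
    by (simp add: nn_integral_cmult nn_integral_add)
  also have "\<dots> \<le> ennreal e * (ennreal c + ennreal d)"
    using assms by (intro mult_left_mono add_mono moment_leD(3)) auto
  also have "\<dots> = ennreal (e * (c + d))"
    using assms moment_leD(2)[OF assms(1)] moment_leD(2)[OF assms(2)] by (simp add: ennreal_mult)
  finally show ?thesis using assms moment_leD(2)[OF assms(1)] moment_leD(2)[OF assms(2)]
    by (auto simp: moment_le_def)
qed

lemma moment_le_add:
  assumes "moment_le M q f c" "moment_le M q g d" "0 \<le> q"
  shows "moment_le M q (\<lambda>x. f x + g x) (2 powr q * (c + d))"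
proof (rule moment_le_dominated[OF assms(1,2)])
  fix x
  have "\<bar>f x + g x\<bar> powr q \<le> (\<bar>f x\<bar> + \<bar>g x\<bar>) powr q" using assms by (intro powr_mono2) auto
  also have "\<dots> \<le> 2 powr q * (\<bar>f x\<bar> powr q + \<bar>g x\<bar> powr q)" using assms by (intro powr_add_le) auto
  finally show "\<bar>f x + g x\<bar> powr q \<le> 2 powr q * (\<bar>f x\<bar> powr q + \<bar>g x\<bar> powr q)" .
qed (use assms moment_leD(1)[OF assms(1)] moment_leD(1)[OF assms(2)] in auto)

text \<open>A crude substitute for the Cauchy-Schwarz inequality: the product is at most the square
  of the larger factor. The bounds are added instead of averaged geometrically, so the factors
  should first be rescaled to comparable size.\<close>

lemma moment_le_mult:
  assumes "moment_le M (2 * q) f c" "moment_le M (2 * q) g d" "0 \<le> q"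
  shows "moment_le M q (\<lambda>x. f x * g x) (c + d)"
proof -
  have "\<bar>f x * g x\<bar> powr q \<le> 1 * (\<bar>f x\<bar> powr (2 * q) + \<bar>g x\<bar> powr (2 * q))" for x
  proof -
    have *: "a powr q * b powr q \<le> b powr (2 * q)" if "0 \<le> a" "a \<le> b" for a b :: real
    proof -
      have "a powr q * b powr q \<le> b powr q * b powr q" using that assms by (intro mult_right_mono powr_mono2) auto
      then show ?thesis by (simp add: powr_add[symmetric])
    qed
    show ?thesis
      using *[of "\<bar>f x\<bar>" "\<bar>g x\<bar>"] *[of "\<bar>g x\<bar>" "\<bar>f x\<bar>"] powr_ge_zero[of "\<bar>f x\<bar>" "2 * q"] powr_ge_zero[of "\<bar>g x\<bar>" "2 * q"]
      by (cases "\<bar>f x\<bar> \<le> \<bar>g x\<bar>") (auto simp: abs_mult powr_mult mult.commute add_increasing add_increasing2)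
  qed
  from moment_le_dominated[OF assms(1,2) _ _ this] show ?thesis
    using moment_leD(1)[OF assms(1)] moment_leD(1)[OF assms(2)] by simp
qed

lemma moment_le_scale:
  assumes "moment_le M q f c"
  shows "moment_le M q (\<lambda>x. a * f x) (\<bar>a\<bar> powr q * c)"
proof -
  note [measurable] = moment_leD(1)[OF assms(1)]
  have "(\<integral>\<^sup>+x. ennreal (\<bar>a * f x\<bar> powr q) \<partial>M) = ennreal (\<bar>a\<bar> powr q) * (\<integral>\<^sup>+x. ennreal (\<bar>f x\<bar> powr q) \<partial>M)"
    by (simp add: abs_mult powr_mult ennreal_mult nn_integral_cmult)
  also have "\<dots> \<le> ennreal (\<bar>a\<bar> powr q) * ennreal c" by (intro mult_left_mono moment_leD assms) auto
  finally show ?thesis using moment_leD(2)[OF assms] by (auto simp: moment_le_def ennreal_mult)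
qed

lemma (in prob_space) moment_le_const: "moment_le M q (\<lambda>x. a) (\<bar>a\<bar> powr q)"
  by (auto simp: moment_le_def emeasure_space_1)

text \<open>No cancellation is assumed, so \<open>n\<close> terms cost \<open>real n powr q\<close>.
  This is exactly the growth allowed for iterated sums.\<close>

lemma moment_le_sum:
  fixes f :: "nat \<Rightarrow> 'a \<Rightarrow> real"
  assumes "\<And>j. moment_le M q (f j) c" "1 \<le> q" "1 \<le> n"
  shows "moment_le M q (\<lambda>x. \<Sum>j<n. \<bar>f j x\<bar>) (real n powr q * c)"
proof -
  have [measurable]: "f j \<in> borel_measurable M" for j using assms(1) moment_leD(1) by blast
  have c: "0 \<le> c" using assms(1) moment_leD(2) by blast
  have "(\<integral>\<^sup>+x. ennreal (\<bar>\<Sum>j<n. \<bar>f j x\<bar>\<bar> powr q) \<partial>M)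
     \<le> (\<integral>\<^sup>+x. ennreal (real n powr (q - 1)) * (\<Sum>j<n. ennreal (\<bar>f j x\<bar> powr q)) \<partial>M)"
  proof (rule nn_integral_mono)
    fix x
    have "\<bar>\<Sum>j<n. \<bar>f j x\<bar>\<bar> powr q \<le> real n powr (q - 1) * (\<Sum>j<n. \<bar>f j x\<bar> powr q)"
      using sum_powr_le[of q "\<lambda>j. \<bar>f j x\<bar>" n] assms by (simp add: sum_nonneg)
    then show "ennreal (\<bar>\<Sum>j<n. \<bar>f j x\<bar>\<bar> powr q) \<le> ennreal (real n powr (q - 1)) * (\<Sum>j<n. ennreal (\<bar>f j x\<bar> powr q))"
      by (simp add: ennreal_mult[symmetric] sum_nonneg ennreal_leI)
  qed
  also have "\<dots> = ennreal (real n powr (q - 1)) * (\<Sum>j<n. \<integral>\<^sup>+x. ennreal (\<bar>f j x\<bar> powr q) \<partial>M)"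
    by (subst nn_integral_cmult, simp, subst nn_integral_sum) auto
  also have "\<dots> \<le> ennreal (real n powr (q - 1)) * (\<Sum>j<n. ennreal c)"
    by (intro mult_left_mono sum_mono moment_leD assms) auto
  also have "\<dots> = ennreal (real n powr (q - 1) * (real n * c))"
    using c by (simp add: ennreal_mult ennreal_of_nat_eq_real_of_nat)
  also have "real n powr (q - 1) * (real n * c) = real n powr q * c" using assms by (simp add: powr_diff)
  finally show ?thesis using c by (auto simp: moment_le_def)
qed

text \<open>Bounding a maximum by the sum of powers costs one factor \<open>Suc n\<close> on the
  moment, which is below the \<open>n powr (q / 2)\<close> of a Birkhoff sum up to a factor 2 once
  \<open>q \<ge> 2\<close>.\<close>

lemma moment_le_runmax:
  fixes f :: "nat \<Rightarrow> 'a \<Rightarrow> real"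
  assumes "\<And>j. moment_le M q (f j) c"
  shows "moment_le M q (\<lambda>x. runmax (\<lambda>j. \<bar>f j x\<bar>) n) (real (Suc n) * c)"
proof -
  have [measurable]: "f j \<in> borel_measurable M" for j using assms(1) moment_leD(1) by blast
  have c: "0 \<le> c" using assms(1) moment_leD(2) by blast
  have "(\<integral>\<^sup>+x. ennreal (\<bar>runmax (\<lambda>j. \<bar>f j x\<bar>) n\<bar> powr q) \<partial>M) \<le> (\<integral>\<^sup>+x. (\<Sum>j\<le>n. ennreal (\<bar>f j x\<bar> powr q)) \<partial>M)"
  proof (rule nn_integral_mono)
    fix x
    have "\<bar>runmax (\<lambda>j. \<bar>f j x\<bar>) n\<bar> powr q \<le> (\<Sum>j\<le>n. \<bar>f j x\<bar> powr q)"
      using runmax_powr_le_sum[of "\<lambda>j. \<bar>f j x\<bar>" n q] runmax_nonneg[of "\<lambda>j. \<bar>f j x\<bar>" n] by simp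
    then show "ennreal (\<bar>runmax (\<lambda>j. \<bar>f j x\<bar>) n\<bar> powr q) \<le> (\<Sum>j\<le>n. ennreal (\<bar>f j x\<bar> powr q))"
      by (simp add: ennreal_leI)
  qed
  also have "\<dots> = (\<Sum>j\<le>n. \<integral>\<^sup>+x. ennreal (\<bar>f j x\<bar> powr q) \<partial>M)" by (subst nn_integral_sum) auto
  also have "\<dots> \<le> (\<Sum>j\<le>n. ennreal c)" by (intro sum_mono moment_leD assms)
  also have "\<dots> = ennreal (real (Suc n) * c)"
    using c by (simp add: ennreal_mult ennreal_of_nat_eq_real_of_nat del: of_nat_Suc)
  finally show ?thesis using c by (auto simp: moment_le_def)
qed

lemma moment_le_integral:
  assumes "moment_le M q f c"
  shows "integrable M (\<lambda>x. \<bar>f x\<bar> powr q)" "(\<integral>x. \<bar>f x\<bar> powr q \<partial>M) \<le> c"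
proof -
  note [measurable] = moment_leD(1)[OF assms(1)]
  have fin: "(\<integral>\<^sup>+x. ennreal (\<bar>f x\<bar> powr q) \<partial>M) < \<infinity>"
    using moment_leD(3)[OF assms] by (auto simp: le_less_trans)
  show i: "integrable M (\<lambda>x. \<bar>f x\<bar> powr q)" by (rule integrableI_nonneg) (use fin in auto)
  have "ennreal (\<integral>x. \<bar>f x\<bar> powr q \<partial>M) \<le> ennreal c"
    using moment_leD(3)[OF assms] nn_integral_eq_integral[OF i] by simp
  then show "(\<integral>x. \<bar>f x\<bar> powr q \<partial>M) \<le> c" using moment_leD(2)[OF assms] by (simp add: ennreal_le_iff)
qed

lemma moment_leI_integral:
  assumes "f \<in> borel_measurable M" "integrable M (\<lambda>x. \<bar>f x\<bar> powr q)" "(\<integral>x. \<bar>f x\<bar> powr q \<partial>M) \<le> c"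
  shows "moment_le M q f c"
proof -
  have "0 \<le> c" by (rule order_trans[OF _ assms(3)]) simp
  then show ?thesis using assms nn_integral_eq_integral[OF assms(2)] by (auto simp: moment_le_def intro: ennreal_leI order_trans)
qed

text \<open>Here \<open>w = exp (- C * \<gamma> ^ n)\<close> is the share of mass that two points
  agreeing to level \<open>n\<close> can send down common branches. Coupled mass gains a level and
  costs \<open>\<phi> (Suc n)\<close>; the rest costs at most 1. The weights make this average a
  strict contraction at every level while staying above \<open>\<gamma> ^ n / 2\<close>.\<close>

lemma coupling_weights:
  fixes \<gamma> C :: real
  assumes \<gamma>: "0 < \<gamma>" "\<gamma> < 1" and C: "0 \<le> C"
  shows "\<exists>\<kappa> \<phi>. 0 < \<kappa> \<and> \<kappa> < 1 \<and> (\<forall>n::nat. 0 < \<phi> n \<and> \<phi> n \<le> 1 \<and> \<gamma> ^ n / 2 \<le> \<phi> n \<and>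
     (1 - exp (- C * \<gamma> ^ n)) + exp (- C * \<gamma> ^ n) * \<phi> (Suc n) \<le> \<kappa> * \<phi> n)"
proof -
  have "(\<lambda>n. C * \<gamma> ^ n) \<longlonglongrightarrow> C * 0" using \<gamma> by (intro tendsto_intros LIMSEQ_realpow_zero) auto
  then have "eventually (\<lambda>n. C * \<gamma> ^ n < (1 - \<gamma>) / 4) sequentially"
    using \<gamma> by (intro order_tendstoD(2)) auto
  then obtain S where S: "C * \<gamma> ^ S < (1 - \<gamma>) / 4" by (auto simp: eventually_sequentially)
  define c where "c = exp (- C)"
  have c: "0 < c" "c \<le> 1" using C by (auto simp: c_def)
  \<comment> \<open>Beyond \<open>S\<close> almost all mass couples and geometric weights suffice.
    Below \<open>S\<close> only the share \<open>c = exp (- C)\<close> is guaranteed, so the deficit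
    \<open>1 - \<phi> n\<close> is made to grow by \<open>2 / c\<close> per level: coupling the
    share \<open>c\<close> then yields twice the deficit needed. Both formulas give
    \<open>1 / 2\<close> at \<open>n = S\<close>.\<close>
  define \<phi> where "\<phi> n = (if n \<le> S then 1 - (c / 2) ^ (S - n) / 2 else \<gamma> ^ (n - S) / 2)" for n
  \<comment> \<open>The first entry is the rate beyond level \<open>S\<close>, the second the worst
    rate below it, attained at level 0.\<close>
  define \<kappa> where "\<kappa> = max ((1 + \<gamma>) / 2) (1 - (c / 2) ^ S / 2)"
  have cp: "0 < (c / 2) ^ k" "(c / 2) ^ k \<le> 1" for k using c by (auto intro!: power_le_one)
  have \<kappa>: "0 < \<kappa>" "\<kappa> < 1" using \<gamma> cp[of S] by (auto simp: \<kappa>_def)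
  have main: "(1 - exp (- C * \<gamma> ^ n)) + exp (- C * \<gamma> ^ n) * \<phi> (Suc n) \<le> \<kappa> * \<phi> n" for n
  proof (cases "n < S")
    case True
    define a where "a = (c / 2) ^ (S - n) / 2"
    have a: "0 < a" "a \<le> 1/2" using cp[of "S - n"] by (auto simp: a_def)
    have w: "c \<le> exp (- C * \<gamma> ^ n)"
      unfolding c_def using C \<gamma> by (auto simp: mult_left_le power_le_one)
    have "\<phi> (Suc n) = 1 - (c / 2) ^ (S - Suc n) / 2" using True by (simp add: \<phi>_def)
    moreover have "(c / 2) ^ (S - n) = c / 2 * (c / 2) ^ (S - Suc n)"
      using True by (metis Suc_diff_Suc power_Suc)
    ultimately have phiS: "c * (1 - \<phi> (Suc n)) = 2 * a" by (simp add: a_def)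
    have "0 \<le> 1 - \<phi> (Suc n)" using phiS a c by (smt (verit) mult_pos_neg)
    then have "2 * a \<le> exp (- C * \<gamma> ^ n) * (1 - \<phi> (Suc n))"
      unfolding phiS[symmetric] using w by (intro mult_right_mono) auto
    then have "(1 - exp (- C * \<gamma> ^ n)) + exp (- C * \<gamma> ^ n) * \<phi> (Suc n) \<le> 1 - 2 * a" by (simp add: algebra_simps)
    also have "\<dots> \<le> (1 - a) * (1 - a)" by (simp add: algebra_simps)
    also have "\<dots> \<le> \<kappa> * (1 - a)"
    proof (intro mult_right_mono)
      have "(c / 2) ^ S \<le> (c / 2) ^ (S - n)" using c by (intro power_decreasing) auto
      then show "1 - a \<le> \<kappa>" by (auto simp: \<kappa>_def a_def)
    qed (use a in auto)
    also have "1 - a = \<phi> n" using True by (simp add: \<phi>_def a_def)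
    finally show ?thesis .
  next
    case False
    then obtain k where n: "n = S + k" by (metis le_add_diff_inverse not_less)
    have phin: "\<phi> n = \<gamma> ^ k / 2" "\<phi> (Suc n) = \<gamma> * \<gamma> ^ k / 2" unfolding \<phi>_def n by (auto simp: Suc_diff_le)
    have e: "1 - exp (- C * \<gamma> ^ n) \<le> C * \<gamma> ^ n" using exp_ge_add_one_self[of "- C * \<gamma> ^ n"] by simp
    have "exp (- C * \<gamma> ^ n) * \<phi> (Suc n) \<le> 1 * \<phi> (Suc n)"
      using C \<gamma> by (intro mult_right_mono) (auto simp: phin)
    then have "(1 - exp (- C * \<gamma> ^ n)) + exp (- C * \<gamma> ^ n) * \<phi> (Suc n) \<le> C * \<gamma> ^ n + \<gamma> * \<gamma> ^ k / 2"
      using e by (simp add: phin)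
    also have "\<dots> = \<gamma> ^ k * (C * \<gamma> ^ S + \<gamma> / 2)" by (simp add: n power_add algebra_simps)
    also have "\<dots> \<le> \<gamma> ^ k * ((1 + \<gamma>) / 4)" using S \<gamma> by (intro mult_left_mono) auto
    also have "\<dots> = (1 + \<gamma>) / 2 * \<phi> n" by (simp add: phin)
    also have "\<dots> \<le> \<kappa> * \<phi> n" using \<gamma> by (intro mult_right_mono) (auto simp: \<kappa>_def phin)
    finally show ?thesis .
  qed
  have "0 < \<phi> n \<and> \<phi> n \<le> 1 \<and> \<gamma> ^ n / 2 \<le> \<phi> n" for n
  proof (cases "n \<le> S")
    case True
    have "\<gamma> ^ n \<le> 1" using \<gamma> by (intro power_le_one) auto
    then show ?thesis using True cp[of "S - n"] by (auto simp: \<phi>_def)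
  next
    case False
    have "\<gamma> ^ n \<le> \<gamma> ^ (n - S)" "\<gamma> ^ (n - S) \<le> 1" using \<gamma> by (auto intro!: power_decreasing power_le_one)
    then show ?thesis using False \<gamma> by (auto simp: \<phi>_def)
  qed
  then show ?thesis using main \<kappa> by blast
qed

section \<open>Gibbs-Markov maps\<close>

text \<open>The weights \<open>g\<close> sum to one, so \<open>P\<close> is a Markov operator with
  stationary measure \<open>N\<close>: they are inverse Jacobians taken with respect to the
  invariant measure. Cylinders occur only through \<open>rel n\<close>, agreement to level
  \<open>n\<close>, which an inverse branch raises by one. Level 0 relates all points, so distortion
  at \<open>n = 0\<close> is a global bound.\<close>

locale gibbs_markov = prob_space N for N :: "'a measure" +
  fixes F :: "'a \<Rightarrow> 'a" and J :: "'j set" and \<psi> :: "'j \<Rightarrow> 'a \<Rightarrow> 'a" and g :: "'j \<Rightarrow> 'a \<Rightarrow> real"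
    and rel :: "nat \<Rightarrow> 'a \<Rightarrow> 'a \<Rightarrow> bool" and \<gamma> Cd :: real
  assumes J: "countable J"
    and F_meas [measurable]: "F \<in> measurable N N"
    and \<psi>_meas: "\<And>j. j \<in> J \<Longrightarrow> \<psi> j \<in> measurable N N"
    and F_\<psi>: "\<And>j z. j \<in> J \<Longrightarrow> z \<in> space N \<Longrightarrow> F (\<psi> j z) = z"
    and g_meas: "\<And>j. j \<in> J \<Longrightarrow> g j \<in> borel_measurable N"
    and g_nonneg: "\<And>j z. j \<in> J \<Longrightarrow> z \<in> space N \<Longrightarrow> 0 \<le> g j z"
    and g_sum: "\<And>z. z \<in> space N \<Longrightarrow> (\<integral>\<^sup>+j. ennreal (g j z) \<partial>count_space J) = 1"
    and transfer: "\<And>w :: 'a \<Rightarrow> ennreal. w \<in> borel_measurable N \<Longrightarrow>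
        (\<integral>\<^sup>+z. w z \<partial>N) = (\<integral>\<^sup>+z. (\<integral>\<^sup>+j. ennreal (g j z) * w (\<psi> j z) \<partial>count_space J) \<partial>N)"
    and rel_0: "\<And>z z'. rel 0 z z'"
    and rel_sym: "\<And>n z z'. rel n z z' \<Longrightarrow> rel n z' z"
    and rel_\<psi>: "\<And>n j z z'. j \<in> J \<Longrightarrow> z \<in> space N \<Longrightarrow> z' \<in> space N \<Longrightarrow> rel n z z' \<Longrightarrow> rel (Suc n) (\<psi> j z) (\<psi> j z')"
    and \<gamma>: "0 < \<gamma>" "\<gamma> < 1" and Cd: "0 \<le> Cd"
    and g_distortion: "\<And>n j z z'. j \<in> J \<Longrightarrow> z \<in> space N \<Longrightarrow> z' \<in> space N \<Longrightarrow> rel n z z' \<Longrightarrow>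
        g j z \<le> exp (Cd * \<gamma> ^ n) * g j z'"
begin

definition P :: "('a \<Rightarrow> real) \<Rightarrow> 'a \<Rightarrow> real" where
  "P u z = (\<integral>j. g j z * u (\<psi> j z) \<partial>count_space J)"

lemma \<psi>_space: "j \<in> J \<Longrightarrow> z \<in> space N \<Longrightarrow> \<psi> j z \<in> space N"
  using \<psi>_meas measurable_space by metis

lemma joint_\<psi>: "(\<lambda>x. \<psi> (snd x) (fst x)) \<in> measurable (N \<Otimes>\<^sub>M count_space J) N"
  by (rule measurable_compose_countable'[OF _ _ J, where f = "\<lambda>j x. \<psi> j (fst x)"])
     (auto intro: measurable_compose[OF measurable_fst \<psi>_meas])

lemma joint_g: "(\<lambda>x. g (snd x) (fst x)) \<in> borel_measurable (N \<Otimes>\<^sub>M count_space J)"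
  by (rule measurable_compose_countable'[OF _ _ J, where f = "\<lambda>j x. g j (fst x)"])
     (auto intro: measurable_compose[OF measurable_fst g_meas])

lemma sigma_finite_J: "sigma_finite_measure (count_space J)"
  by (rule sigma_finite_measure_count_space_countable[OF J])

lemma P_meas [measurable]:
  assumes [measurable]: "u \<in> borel_measurable N"
  shows "P u \<in> borel_measurable N"
proof -
  interpret J: sigma_finite_measure "count_space J" by (rule sigma_finite_J)
  note [measurable] = joint_g measurable_compose[OF joint_\<psi> assms]
  show ?thesis unfolding P_def
    by (rule J.borel_measurable_lebesgue_integral) (simp add: case_prod_beta')
qed

text \<open>\<open>transfer\<close> speaks of nonnegative functions. As an identity of measures it
  can be applied to Bochner integrals of signed functions as well.\<close>

lemma N_eq_distr:
  "N = distr (density (N \<Otimes>\<^sub>M count_space J) (\<lambda>x. ennreal (g (snd x) (fst x)))) N (\<lambda>x. \<psi> (snd x) (fst x))"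
  (is "N = distr ?D N ?f")
proof (rule measure_eqI)
  interpret J: sigma_finite_measure "count_space J" by (rule sigma_finite_J)
  note [measurable] = joint_g joint_\<psi>
  fix A assume A[measurable]: "A \<in> sets N"
  have "emeasure (distr ?D N ?f) A = (\<integral>\<^sup>+x. indicator A x \<partial>distr ?D N ?f)" by simp
  also have "\<dots> = (\<integral>\<^sup>+x. indicator A (?f x) \<partial>?D)" by (subst nn_integral_distr) (auto simp: joint_\<psi>)
  also have "\<dots> = (\<integral>\<^sup>+x. ennreal (g (snd x) (fst x)) * indicator A (?f x) \<partial>(N \<Otimes>\<^sub>M count_space J))"
    by (subst nn_integral_density) auto
  also have "\<dots> = (\<integral>\<^sup>+z. (\<integral>\<^sup>+j. ennreal (g j z) * indicator A (\<psi> j z) \<partial>count_space J) \<partial>N)"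
    by (subst J.nn_integral_fst[symmetric]) auto
  also have "\<dots> = (\<integral>\<^sup>+z. indicator A z \<partial>N)" by (rule transfer[symmetric]) simp
  finally show "emeasure N A = emeasure (distr ?D N ?f) A" by simp
qed simp

lemma integral_P:
  assumes u: "integrable N u"
  shows "integrable N (P u)" "(\<integral>z. P u z \<partial>N) = (\<integral>z. u z \<partial>N)"
proof -
  interpret J: sigma_finite_measure "count_space J" by (rule sigma_finite_J)
  interpret NJ: pair_sigma_finite N "count_space J" ..
  note [measurable] = joint_g joint_\<psi>
  have um[measurable]: "u \<in> borel_measurable N" using u by auto
  let ?D = "density (N \<Otimes>\<^sub>M count_space J) (\<lambda>x. ennreal (g (snd x) (fst x)))"
  have gn: "AE x in N \<Otimes>\<^sub>M count_space J. 0 \<le> g (snd x) (fst x)"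
    by (rule AE_I2) (auto simp: space_pair_measure g_nonneg)
  have "integrable (distr ?D N (\<lambda>x. \<psi> (snd x) (fst x))) u" using u N_eq_distr by simp
  then have "integrable ?D (\<lambda>x. u (\<psi> (snd x) (fst x)))" by (subst (asm) integrable_distr_eq) auto
  then have i: "integrable (N \<Otimes>\<^sub>M count_space J) (\<lambda>x. g (snd x) (fst x) * u (\<psi> (snd x) (fst x)))"
    by (subst (asm) integrable_density) (use gn in auto)
  show "integrable N (P u)" using NJ.integrable_fst'[OF i] by (simp add: P_def[abs_def])
  have "(\<integral>z. u z \<partial>N) = (\<integral>z. u z \<partial>distr ?D N (\<lambda>x. \<psi> (snd x) (fst x)))" using N_eq_distr by simp
  also have "\<dots> = (\<integral>x. u (\<psi> (snd x) (fst x)) \<partial>?D)" by (subst integral_distr) auto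
  also have "\<dots> = (\<integral>x. g (snd x) (fst x) * u (\<psi> (snd x) (fst x)) \<partial>(N \<Otimes>\<^sub>M count_space J))"
    by (subst integral_density) (use gn in auto)
  also have "\<dots> = (\<integral>z. P u z \<partial>N)" using NJ.integral_fst'[OF i] by (simp add: P_def[abs_def])
  finally show "(\<integral>z. P u z \<partial>N) = (\<integral>z. u z \<partial>N)" by simp
qed

text \<open>\<open>transfer\<close> is applied to an indicator composed with \<open>F\<close>; each
  branch undoes \<open>F\<close> and the weights sum to one.\<close>

lemma invariant: "distr N N F = N"
proof (rule measure_eqI)
  fix A assume "A \<in> sets (distr N N F)"
  then have A[measurable]: "A \<in> sets N" by simp
  have "emeasure (distr N N F) A = (\<integral>\<^sup>+z. indicator A z \<partial>distr N N F)" by simp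
  also have "\<dots> = (\<integral>\<^sup>+z. indicator A (F z) \<partial>N)" by (subst nn_integral_distr) auto
  also have "\<dots> = (\<integral>\<^sup>+z. (\<integral>\<^sup>+j. ennreal (g j z) * indicator A (F (\<psi> j z)) \<partial>count_space J) \<partial>N)"
    by (rule transfer) simp
  also have "\<dots> = (\<integral>\<^sup>+z. indicator A z \<partial>N)"
  proof (rule nn_integral_cong)
    fix z assume z: "z \<in> space N"
    have "(\<integral>\<^sup>+j. ennreal (g j z) * indicator A (F (\<psi> j z)) \<partial>count_space J)
        = (\<integral>\<^sup>+j. ennreal (g j z) * indicator A z \<partial>count_space J)"
      by (rule nn_integral_cong) (simp add: F_\<psi> z)
    also have "\<dots> = indicator A z" by (subst nn_integral_multc) (auto simp: g_sum z)
    finally show "(\<integral>\<^sup>+j. ennreal (g j z) * indicator A (F (\<psi> j z)) \<partial>count_space J) = indicator A z" .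
  qed
  finally show "emeasure (distr N N F) A = emeasure N A" by simp
qed simp

lemma funpow_meas [measurable]: "F ^^ k \<in> measurable N N"
  by (induction k) (auto simp: id_def[symmetric] intro: measurable_comp[OF _ F_meas] simp del: funpow.simps simp: funpow.simps(1) funpow.simps(2))

lemma invariant_funpow: "distr N N (F ^^ k) = N"
proof (induction k)
  case 0 then show ?case using distr_id[of N] by (simp add: id_def)
next
  case (Suc k)
  have "distr N N (F ^^ Suc k) = distr (distr N N (F ^^ k)) N F"
    by (simp add: distr_distr)
  then show ?case using Suc invariant by (simp add: comp_def)
qed

lemma nn_integral_funpow:
  "w \<in> borel_measurable N \<Longrightarrow> (\<integral>\<^sup>+z. w ((F ^^ k) z) \<partial>N) = (\<integral>\<^sup>+z. w z \<partial>N)"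
  using nn_integral_distr[OF funpow_meas[of k], of w] by (simp add: invariant_funpow)

lemma integral_funpow:
  fixes w :: "'a \<Rightarrow> real"
  shows "w \<in> borel_measurable N \<Longrightarrow> (\<integral>z. w ((F ^^ k) z) \<partial>N) = (\<integral>z. w z \<partial>N)"
  using integral_distr[OF funpow_meas[of k], of w] by (simp add: invariant_funpow)

lemma moment_le_funpow:
  assumes "moment_le N q f c"
  shows "moment_le N q (\<lambda>z. f ((F ^^ k) z)) c"
  using assms nn_integral_funpow[of "\<lambda>z. ennreal (\<bar>f z\<bar> powr q)" k]
  by (auto simp: moment_le_def intro: measurable_compose[OF funpow_meas])

lemma g_integrable: "z \<in> space N \<Longrightarrow> integrable (count_space J) (\<lambda>j. g j z)"
  by (rule integrableI_nonneg) (auto simp: AE_count_space g_nonneg g_sum)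

lemma g_integral: "z \<in> space N \<Longrightarrow> (\<integral>j. g j z \<partial>count_space J) = 1"
  using g_sum[of z] by (subst integral_eq_nn_integral) (auto simp: AE_count_space g_nonneg)

lemma g_times_bounded_integrable:
  assumes z: "z \<in> space N" and u: "\<And>j. j \<in> J \<Longrightarrow> \<bar>u j\<bar> \<le> B"
  shows "integrable (count_space J) (\<lambda>j. g j z * u j)"
proof (rule Bochner_Integration.integrable_bound)
  show "integrable (count_space J) (\<lambda>j. g j z * B)" using g_integrable[OF z] by simp
  show "AE j in count_space J. norm (g j z * u j) \<le> norm (g j z * B)"
    using u g_nonneg[OF _ z] by (auto simp: AE_count_space abs_mult intro!: mult_left_mono order_trans[OF u abs_ge_self])
qed simp

text \<open>One coupling step. From \<open>z\<close> and \<open>z'\<close> the common part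
  \<open>w * g j z'\<close> of the weights is sent down the same branch \<open>j\<close>, where the
  two images agree to level \<open>Suc n\<close>; the leftover masses \<open>1 - w\<close> are
  paired arbitrarily and contribute at most the oscillation \<open>L\<close> of
  \<open>u\<close>.\<close>

lemma P_contracts:
  assumes L: "0 \<le> L" and \<phi>1: "\<And>n. \<phi> n \<le> 1"
    and w: "\<And>n. (1 - exp (- Cd * \<gamma> ^ n)) + exp (- Cd * \<gamma> ^ n) * \<phi> (Suc n) \<le> \<kappa> * \<phi> n"
    and u: "\<And>n y y'. y \<in> space N \<Longrightarrow> y' \<in> space N \<Longrightarrow> rel n y y' \<Longrightarrow> u y - u y' \<le> L * \<phi> n"
    and z: "z \<in> space N" "z' \<in> space N" "rel n z z'"
  shows "P u z - P u z' \<le> \<kappa> * L * \<phi> n"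
proof -
  define I where "I = Inf (u ` space N)"
  have uL: "u y - u y' \<le> L" if "y \<in> space N" "y' \<in> space N" for y y'
    using u[OF that rel_0] \<phi>1[of 0] L by (smt (verit) mult_left_le)
  have bb: "bdd_below (u ` space N)"
    by (rule bdd_belowI[of _ "u z - L"]) (use uL z in force)
  have I: "I \<le> u y" if "y \<in> space N" for y unfolding I_def using that bb by (intro cInf_lower) auto
  have IL: "u y \<le> I + L" if y: "y \<in> space N" for y
  proof -
    have "u y - L \<le> I" unfolding I_def using z uL[OF y] by (intro cInf_greatest) force+
    then show ?thesis by simp
  qed
  define B where "B = \<bar>I\<bar> + L"
  have uB: "\<bar>u y\<bar> \<le> B" if "y \<in> space N" for y using I[OF that] IL[OF that] L by (auto simp: B_def)
  define w where "w = exp (- Cd * \<gamma> ^ n)"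
  have w01: "0 < w" "w \<le> 1" using Cd \<gamma> by (auto simp: w_def)
  have gw: "w * g j z' \<le> g j z" if "j \<in> J" for j
  proof -
    have "g j z' \<le> exp (Cd * \<gamma> ^ n) * g j z" using g_distortion[OF that z(2,1) rel_sym[OF z(3)]] .
    then have "w * g j z' \<le> w * (exp (Cd * \<gamma> ^ n) * g j z)" using w01 by (intro mult_left_mono) auto
    also have "\<dots> = g j z" by (simp add: w_def exp_minus field_simps)
    finally show ?thesis .
  qed
  note ints = g_times_bounded_integrable[OF z(1), where B = B] g_times_bounded_integrable[OF z(2), where B = B]
  have i1: "integrable (count_space J) (\<lambda>j. g j z * u (\<psi> j z))" and i2: "integrable (count_space J) (\<lambda>j. g j z' * u (\<psi> j z'))"
    by (intro ints uB \<psi>_space z; assumption)+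
  \<comment> \<open>Leftover mass at \<open>z\<close> is bounded by the upper value
    \<open>I + L\<close>, leftover mass at \<open>z'\<close> from below by \<open>I\<close>, and
    only the coupled part sees the difference of \<open>u\<close> along one branch.\<close>
  have pt: "g j z * u (\<psi> j z) - g j z' * u (\<psi> j z') \<le> (g j z - w * g j z') * (I + L) + w * (L * \<phi> (Suc n)) * g j z' - (1 - w) * I * g j z'"
    if j: "j \<in> J" for j
  proof -
    have sp: "\<psi> j z \<in> space N" "\<psi> j z' \<in> space N" using j z \<psi>_space by auto
    have a: "(g j z - w * g j z') * u (\<psi> j z) \<le> (g j z - w * g j z') * (I + L)"
      using gw[OF j] IL[OF sp(1)] by (intro mult_left_mono) auto
    have b: "w * g j z' * (u (\<psi> j z) - u (\<psi> j z')) \<le> w * g j z' * (L * \<phi> (Suc n))"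
      using w01 g_nonneg[OF j z(2)] u[OF sp rel_\<psi>[OF j z]] by (intro mult_left_mono) auto
    have c: "(1 - w) * g j z' * I \<le> (1 - w) * g j z' * u (\<psi> j z')"
      using w01 g_nonneg[OF j z(2)] I[OF sp(2)] by (intro mult_left_mono) auto
    show ?thesis using a b c by (simp add: algebra_simps)
  qed
  have "P u z - P u z' = (\<integral>j. g j z * u (\<psi> j z) - g j z' * u (\<psi> j z') \<partial>count_space J)"
    unfolding P_def using i1 i2 by simp
  also have "\<dots> \<le> (\<integral>j. (g j z - w * g j z') * (I + L) + w * (L * \<phi> (Suc n)) * g j z' - (1 - w) * I * g j z' \<partial>count_space J)"
    using i1 i2 g_integrable[OF z(1)] g_integrable[OF z(2)] pt by (intro integral_mono) auto
  also have "\<dots> = (1 - w) * (I + L) + w * (L * \<phi> (Suc n)) - (1 - w) * I"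
    using g_integrable[OF z(1)] g_integrable[OF z(2)] g_integral[OF z(1)] g_integral[OF z(2)] by simp
  also have "\<dots> = L * ((1 - w) + w * \<phi> (Suc n))" by (simp add: algebra_simps)
  also have "\<dots> \<le> L * (\<kappa> * \<phi> n)" using w[of n] L by (intro mult_left_mono) (auto simp: w_def)
  finally show ?thesis by (simp add: mult_ac)
qed

text \<open>Exponential decay of \<open>P ^^ k\<close> on centred functions in the supremum norm,
  with a rate that depends on the system only. Since \<open>\<gamma> ^ n \<le> 2 * \<phi> n\<close>,
  a function with geometric oscillation starts with constant \<open>2 * D\<close> in the contracted
  seminorm.\<close>

lemma P_funpow_decay:
  "\<exists>\<kappa>. 0 < \<kappa> \<and> \<kappa> < 1 \<and> (\<forall>U D k z. 0 \<le> D \<longrightarrow> U \<in> borel_measurable N \<longrightarrow> (\<integral>z. U z \<partial>N) = 0 \<longrightarrow>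
     (\<forall>n y y'. y \<in> space N \<longrightarrow> y' \<in> space N \<longrightarrow> rel n y y' \<longrightarrow> U y - U y' \<le> D * \<gamma> ^ n) \<longrightarrow>
     z \<in> space N \<longrightarrow> \<bar>(P ^^ k) U z\<bar> \<le> 2 * D * \<kappa> ^ k)"
proof -
  obtain \<kappa> \<phi> where \<kappa>: "0 < \<kappa>" "\<kappa> < 1" and \<phi>: "\<And>n. 0 < \<phi> n" "\<And>n. \<phi> n \<le> 1" "\<And>n. \<gamma> ^ n / 2 \<le> \<phi> n"
    and w: "\<And>n. (1 - exp (- Cd * \<gamma> ^ n)) + exp (- Cd * \<gamma> ^ n) * \<phi> (Suc n) \<le> \<kappa> * \<phi> n"
    using coupling_weights[OF \<gamma> Cd] by blast
  have "\<bar>(P ^^ k) U z\<bar> \<le> 2 * D * \<kappa> ^ k"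
    if D: "0 \<le> D" and Um: "U \<in> borel_measurable N" and U0: "(\<integral>z. U z \<partial>N) = 0"
      and U: "\<And>n y y'. y \<in> space N \<Longrightarrow> y' \<in> space N \<Longrightarrow> rel n y y' \<Longrightarrow> U y - U y' \<le> D * \<gamma> ^ n"
      and z: "z \<in> space N" for U D k z
  proof -
    have osc: "(P ^^ k) U y - (P ^^ k) U y' \<le> (2 * D * \<kappa> ^ k) * \<phi> n"
      if "y \<in> space N" "y' \<in> space N" "rel n y y'" for n y y'
      using that
    proof (induction k arbitrary: n y y')
      case 0
      have "U y - U y' \<le> D * \<gamma> ^ n" using U 0 by blast
      also have "\<dots> \<le> D * (2 * \<phi> n)" using D \<phi>(3)[of n] by (intro mult_left_mono) auto
      finally show ?case by simp
    next
      case (Suc k)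
      have "P ((P ^^ k) U) y - P ((P ^^ k) U) y' \<le> \<kappa> * (2 * D * \<kappa> ^ k) * \<phi> n"
        by (rule P_contracts[OF _ \<phi>(2) w]) (use Suc D \<kappa> in auto)
      then show ?case by (simp add: mult_ac)
    qed
    define B where "B = 2 * D * \<kappa> ^ k"
    have B0: "0 \<le> B" using D \<kappa> by (simp add: B_def)
    have oscB: "(P ^^ k) U y - (P ^^ k) U y' \<le> B" if "y \<in> space N" "y' \<in> space N" for y y'
      using osc[OF that rel_0] \<phi>(2)[of 0] B0 unfolding B_def[symmetric] by (smt (verit) mult_left_le)
    have Pm: "(P ^^ i) U \<in> borel_measurable N" for i by (induction i) (use Um P_meas in auto)
    have UD: "U y - U y' \<le> D" if "y \<in> space N" "y' \<in> space N" for y y' using U[OF that rel_0] by simp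
    have "integrable N U \<and> (\<integral>y. U y \<partial>N) = 0"
    proof -
      have "\<bar>U y\<bar> \<le> \<bar>U z\<bar> + D" if "y \<in> space N" for y using UD[OF that z] UD[OF z that] by linarith
      then show ?thesis using U0 Um by (auto intro!: integrable_const_bound[of _ "\<bar>U z\<bar> + D"])
    qed
    then have "integrable N ((P ^^ i) U) \<and> (\<integral>y. (P ^^ i) U y \<partial>N) = 0" for i
      by (induction i) (auto simp: integral_P)
    then have i: "integrable N ((P ^^ k) U)" and i0: "(\<integral>y. (P ^^ k) U y \<partial>N) = 0" by auto
    \<comment> \<open>As \<open>(P ^^ k) U\<close> has mean zero, averaging its differences over
      \<open>y\<close> bounds its value at \<open>z\<close> by its oscillation.\<close>
    have "(\<integral>y. (P ^^ k) U z - (P ^^ k) U y \<partial>N) \<le> (\<integral>y. B \<partial>N)"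
      using i z oscB by (intro integral_mono) auto
    moreover have "(\<integral>y. (P ^^ k) U y - (P ^^ k) U z \<partial>N) \<le> (\<integral>y. B \<partial>N)"
      using i z oscB by (intro integral_mono) auto
    ultimately show ?thesis using i i0 by (simp add: prob_space B_def abs_le_iff)
  qed
  then show ?thesis using \<kappa> by blast
qed

text \<open>The conditional expectation of \<open>m\<close> given the sigma-algebra pulled back by
  \<open>F\<close> vanishes, in tested form. Test functions are arbitrary measurable ones: where a
  product fails to be integrable, its Bochner integral is 0 by convention.\<close>

definition martingale_fn :: "('a \<Rightarrow> real) \<Rightarrow> bool" where
  "martingale_fn m \<longleftrightarrow> m \<in> borel_measurable N \<and>
     (\<forall>\<phi>\<in>borel_measurable N. (\<integral>z. \<phi> (F z) * m z \<partial>N) = 0)"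

text \<open>\<open>P\<close> is dual to composition with \<open>F\<close>, hence pulls functions of
  \<open>F\<close> out: applied to \<open>\<phi> (F z) * m z\<close> it gives
  \<open>\<phi> z * P m z\<close>.\<close>

lemma martingale_fnI:
  assumes m[measurable]: "m \<in> borel_measurable N" and P0: "\<And>z. z \<in> space N \<Longrightarrow> P m z = 0"
  shows "martingale_fn m"
  unfolding martingale_fn_def
proof (intro conjI ballI)
  fix \<phi> :: "'a \<Rightarrow> real" assume [measurable]: "\<phi> \<in> borel_measurable N"
  show "(\<integral>z. \<phi> (F z) * m z \<partial>N) = 0"
  proof (cases "integrable N (\<lambda>z. \<phi> (F z) * m z)")
    case True
    have "(\<integral>z. \<phi> (F z) * m z \<partial>N) = (\<integral>z. P (\<lambda>z. \<phi> (F z) * m z) z \<partial>N)" using integral_P(2)[OF True] by simp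
    also have "\<dots> = (\<integral>z. \<phi> z * P m z \<partial>N)"
    proof (rule Bochner_Integration.integral_cong[OF refl])
      fix z assume z: "z \<in> space N"
      have "P (\<lambda>z. \<phi> (F z) * m z) z = (\<integral>j. \<phi> z * (g j z * m (\<psi> j z)) \<partial>count_space J)"
        unfolding P_def by (rule Bochner_Integration.integral_cong) (auto simp: F_\<psi> z)
      then show "P (\<lambda>z. \<phi> (F z) * m z) z = \<phi> z * P m z" by (simp add: P_def)
    qed
    also have "\<dots> = (\<integral>z. 0 \<partial>N)" by (rule Bochner_Integration.integral_cong) (auto simp: P0)
    finally show ?thesis by simp
  qed (simp add: not_integrable_integral_eq)
qed fact

text \<open>The summands are increments of a martingale with respect to the decreasing filtration of the
  past under \<open>F\<close>, read backwards in time.\<close>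

lemma martingale_array_reverse:
  assumes m: "martingale_fn m" and b[measurable]: "\<And>i. b i \<in> borel_measurable N"
    and n: "1 \<le> n" and mom: "\<And>i. i < n \<Longrightarrow> moment_le N q (\<lambda>z. m z * b i (F z)) R"
  shows "martingale_array N q n R (\<lambda>i z. m ((F ^^ (n - 1 - i)) z) * b i ((F ^^ (n - i)) z))"
proof -
  note [measurable] = m[unfolded martingale_fn_def, THEN conjunct1]
  note mz = m[unfolded martingale_fn_def, THEN conjunct2, rule_format]
  define d where "d i z = m ((F ^^ (n - 1 - i)) z) * b i ((F ^^ (n - i)) z)" for i z
  \<comment> \<open>The \<open>i\<close>-th partial sum as a function of
    \<open>y = (F ^^ (n - i)) z\<close>. The next increment is \<open>m\<close> at
    \<open>(F ^^ (n - 1 - i)) z\<close> times a function of that same \<open>y\<close>, so the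
    partial sum is a legitimate test function.\<close>
  define s where "s i y = (\<Sum>l<i. m ((F ^^ (i - 1 - l)) y) * b l ((F ^^ (i - l)) y))" for i y
  have [measurable]: "s i \<in> borel_measurable N" for i unfolding s_def by measurable
  have fp: "(F ^^ a) ((F ^^ c) z) = (F ^^ (a + c)) z" for a c z by (simp add: funpow_add)
  have Sd: "(\<Sum>l<k. d l z) = s k ((F ^^ (i - k)) ((F ^^ (n - i)) z))" if "k \<le> i" "i \<le> n" for i k z
    unfolding s_def d_def fp using that by (intro sum.cong) auto
  have F1: "(F ^^ (n - i)) z = F ((F ^^ (n - 1 - i)) z)" if "i < n" for i z
  proof -
    have "n - i = Suc (n - 1 - i)" using that by simp
    then show ?thesis by simp
  qed
  have dF: "d i z = m ((F ^^ (n - 1 - i)) z) * b i (F ((F ^^ (n - 1 - i)) z))" if "i < n" for i z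
    using F1[OF that, of z] by (simp add: d_def)
  have dmom: "moment_le N q (d i) R" if "i < n" for i
    using moment_le_funpow[OF mom[OF that], of "n - 1 - i"] dF[OF that] by (simp add: fun_eq_iff cong: measurable_cong)
      (simp add: d_def[abs_def] F1[OF that])
  have zero: "(\<integral>z. \<Phi> ((F ^^ (n - i)) z) * d i z \<partial>N) = 0" if i: "i < n" and [measurable]: "\<Phi> \<in> borel_measurable N" for \<Phi> i
  proof -
    have "(\<integral>z. \<Phi> ((F ^^ (n - i)) z) * d i z \<partial>N)
       = (\<integral>z. (\<lambda>y. (\<Phi> (F y) * b i (F y)) * m y) ((F ^^ (n - 1 - i)) z) \<partial>N)"
      by (simp add: dF[OF i] F1[OF i] mult_ac)
    also have "\<dots> = (\<integral>y. (\<Phi> (F y) * b i (F y)) * m y \<partial>N)" by (rule integral_funpow) measurable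
    also have "\<dots> = 0" using mz[of "\<lambda>y. \<Phi> y * b i y"] by simp
    finally show ?thesis .
  qed
  have z1: "(\<integral>z. sgn (\<Sum>l<i. d l z) * \<bar>\<Sum>l<i. d l z\<bar> powr (q - 1) * d i z \<partial>N) = 0" if "i < n" for i
    using zero[OF that, of "\<lambda>y. sgn (s i y) * \<bar>s i y\<bar> powr (q - 1)"] Sd[of i i] that by simp
  have z2: "(\<integral>z. sgn (\<Sum>l<i. d l z) * \<bar>runmax (\<lambda>k. \<bar>\<Sum>l<k. d l z\<bar>) i\<bar> powr (q - 1) * d i z \<partial>N) = 0" if i: "i < n" for i
  proof -
    have "runmax (\<lambda>k. \<bar>\<Sum>l<k. d l z\<bar>) i = runmax (\<lambda>k. \<bar>s k ((F ^^ (i - k)) ((F ^^ (n - i)) z))\<bar>) i" for z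
      using i by (intro runmax_cong) (simp add: Sd)
    then show ?thesis
      using zero[OF i, of "\<lambda>y. sgn (s i y) * \<bar>runmax (\<lambda>k. \<bar>s k ((F ^^ (i - k)) y)\<bar>) i\<bar> powr (q - 1)"] Sd[of i i] i by simp
  qed
  have "d i \<in> borel_measurable N" for i unfolding d_def by measurable
  moreover have "0 \<le> R" using mom[of 0] n moment_leD(2) by force
  ultimately have "martingale_array N q n R d"
    unfolding martingale_array_def using n z1 z2 moment_le_integral[OF dmom] by auto
  then show ?thesis by (simp add: d_def[abs_def])
qed

text \<open>The coefficients \<open>b i\<close> depend only on the later point
  \<open>(F ^^ (n - i)) z\<close> and so preserve the martingale property. Constant coefficients
  give Birkhoff sums, \<open>b i = bsum W i\<close> gives iterated sums.\<close>

lemma martingale_reverse_maximal: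
  assumes q: "2 \<le> q"
  shows "\<exists>K>0. \<forall>m b n R. martingale_fn m \<longrightarrow> (\<forall>i. b i \<in> borel_measurable N) \<longrightarrow> 1 \<le> n \<longrightarrow>
     (\<forall>i<n. moment_le N q (\<lambda>z. m z * b i (F z)) R) \<longrightarrow>
     moment_le N q (\<lambda>z. runmax (\<lambda>k. \<bar>\<Sum>i<k. m ((F ^^ (n - 1 - i)) z) * b i ((F ^^ (n - i)) z)\<bar>) n) (K * real n powr (q / 2) * R)"
proof -
  obtain K where K: "K > 0" "\<forall>(M :: 'a measure) n R d. martingale_array M q n R d
      \<longrightarrow> integrable M (\<lambda>x. runmax (\<lambda>l. \<bar>\<Sum>i<l. d i x\<bar>) n powr q) \<and>
          (\<integral>x. runmax (\<lambda>l. \<bar>\<Sum>i<l. d i x\<bar>) n powr q \<partial>M) \<le> K * real n powr (q / 2) * R"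
    using martingale_maximal_bound[OF q] by blast
  have "moment_le N q (\<lambda>z. runmax (\<lambda>k. \<bar>\<Sum>i<k. m ((F ^^ (n - 1 - i)) z) * b i ((F ^^ (n - i)) z)\<bar>) n) (K * real n powr (q / 2) * R)"
    if m: "martingale_fn m" and b: "\<And>i. b i \<in> borel_measurable N" and "1 \<le> n" "\<And>i. i < n \<Longrightarrow> moment_le N q (\<lambda>z. m z * b i (F z)) R" for m b n R
  proof -
    note [measurable] = m[unfolded martingale_fn_def, THEN conjunct1] b
    have nn: "\<bar>runmax (\<lambda>l. \<bar>f l\<bar>) k\<bar> = runmax (\<lambda>l. \<bar>f l\<bar>) k" for f :: "nat \<Rightarrow> real" and k
      using runmax_nonneg[of "\<lambda>l. \<bar>f l\<bar>"] by simp
    show ?thesis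
      using K(2)[rule_format, OF martingale_array_reverse[OF that]]
      by (intro moment_leI_integral) (auto simp: nn)
  qed
  then show ?thesis using K(1) by blast
qed

definition bsum :: "('a \<Rightarrow> real) \<Rightarrow> nat \<Rightarrow> 'a \<Rightarrow> real" where
  "bsum V k z = (\<Sum>j<k. V ((F ^^ j) z))"

lemma bsum_meas [measurable]: "V \<in> borel_measurable N \<Longrightarrow> bsum V k \<in> borel_measurable N"
  unfolding bsum_def by (intro borel_measurable_sum measurable_compose[OF funpow_meas])

lemma bsum_Suc: "bsum V (Suc k) z = bsum V k z + V ((F ^^ k) z)"
  by (simp add: bsum_def)

lemma bsum_0 [simp]: "bsum V 0 z = 0"
  by (simp add: bsum_def)

lemma bsum_add: "bsum V (k + l) z = bsum V k z + bsum V l ((F ^^ k) z)"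
proof (induction l)
  case (Suc l)
  then show ?case by (simp add: bsum_Suc funpow_add add.commute[of k l])
qed simp

end

section \<open>Martingale decomposition of unbounded observables\<close>

locale gibbs_markov_roof = gibbs_markov N F J \<psi> g rel \<gamma> Cd
  for N :: "'a measure" and F and J :: "'j set" and \<psi> g rel \<gamma> Cd +
  fixes G :: "'j \<Rightarrow> real" and K0 :: real and Hf :: "'a \<Rightarrow> real"
  assumes G: "\<And>j. j \<in> J \<Longrightarrow> 0 \<le> G j" and K0: "0 \<le> K0"
    and gG: "\<And>z. z \<in> space N \<Longrightarrow> (\<integral>\<^sup>+j. ennreal (g j z * G j) \<partial>count_space J) \<le> ennreal K0"
    and Hf_meas [measurable]: "Hf \<in> borel_measurable N"
begin

text \<open>The class of induced observables with every constant fixed beforehand, so that the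
  estimates below are uniform over it. Size and oscillation on branch \<open>j\<close> are measured
  by the same \<open>G j\<close>, since the roof is regular only relative to its size on a
  cell.\<close>

definition admissible :: "('a \<Rightarrow> real) \<Rightarrow> bool" where
  "admissible V \<longleftrightarrow> V \<in> borel_measurable N \<and> integrable N V \<and> (\<integral>z. V z \<partial>N) = 0 \<and>
     (\<forall>z\<in>space N. \<bar>V z\<bar> \<le> Hf z) \<and> (\<forall>j\<in>J. \<forall>z\<in>space N. \<bar>V (\<psi> j z)\<bar> \<le> G j) \<and>
     (\<forall>n. \<forall>j\<in>J. \<forall>z\<in>space N. \<forall>z'\<in>space N. rel n z z' \<longrightarrow> \<bar>V (\<psi> j z) - V (\<psi> j z')\<bar> \<le> \<gamma> ^ n * G j)"

lemma gG_integrable: "z \<in> space N \<Longrightarrow> integrable (count_space J) (\<lambda>j. g j z * G j)"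
  using gG[of z] by (intro integrableI_nonneg) (auto simp: AE_count_space g_nonneg G le_less_trans)

lemma gG_integral: "z \<in> space N \<Longrightarrow> (\<integral>j. g j z * G j \<partial>count_space J) \<le> K0"
  using gG[of z] K0 nn_integral_eq_integral[OF gG_integrable[of z]]
  by (simp add: AE_count_space g_nonneg G ennreal_le_iff)

lemma gV_integrable:
  assumes "z \<in> space N" "\<And>j. j \<in> J \<Longrightarrow> \<bar>V j\<bar> \<le> G j"
  shows "integrable (count_space J) (\<lambda>j. g j z * V j)"
  by (rule Bochner_Integration.integrable_bound[OF gG_integrable[OF assms(1)]])
     (use assms g_nonneg in \<open>auto simp: AE_count_space abs_mult intro!: mult_left_mono order_trans[OF assms(2) abs_ge_self]\<close>)

text \<open>Averaging tames the unbounded \<open>V\<close>: the weights change by the relative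
  amount \<open>exp (Cd * \<gamma> ^ n) - 1\<close>, the values by
  \<open>\<gamma> ^ n * G j\<close>, and \<open>gG\<close> bounds the weighted sum of
  \<open>G\<close> by \<open>K0\<close> at every point.\<close>

lemma P_admissible_lipschitz:
  assumes V: "admissible V" and z: "z \<in> space N" "z' \<in> space N" "rel n z z'"
  shows "P V z - P V z' \<le> K0 * (Cd * exp Cd + 1) * \<gamma> ^ n"
proof -
  define e where "e = exp (Cd * \<gamma> ^ n) - 1"
  have \<gamma>n: "0 \<le> \<gamma> ^ n" "\<gamma> ^ n \<le> 1" using \<gamma> by (auto intro: power_le_one)
  have e0: "0 \<le> e" using Cd \<gamma>n by (simp add: e_def)
  have e1: "e \<le> Cd * exp Cd * \<gamma> ^ n"
  proof -
    have "1 - Cd * \<gamma> ^ n \<le> exp (- (Cd * \<gamma> ^ n))" using exp_ge_add_one_self[of "- (Cd * \<gamma> ^ n)"] by simp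
    then have "exp (Cd * \<gamma> ^ n) * (1 - Cd * \<gamma> ^ n) \<le> 1" by (simp add: exp_minus field_simps)
    then have "e \<le> (Cd * \<gamma> ^ n) * exp (Cd * \<gamma> ^ n)" by (simp add: e_def algebra_simps)
    also have "\<dots> \<le> (Cd * \<gamma> ^ n) * exp Cd" using Cd \<gamma>n by (intro mult_left_mono) (auto simp: mult_left_le)
    finally show ?thesis by (simp add: mult_ac)
  qed
  have gd: "\<bar>g j z - g j z'\<bar> \<le> e * g j z'" if j: "j \<in> J" for j
  proof -
    have a: "g j z \<le> (e + 1) * g j z'" using g_distortion[OF j z] by (simp add: e_def)
    have b: "g j z' \<le> (e + 1) * g j z" using g_distortion[OF j z(2,1) rel_sym[OF z(3)]] by (simp add: e_def)
    show ?thesis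
    proof (cases "g j z \<le> g j z'")
      case True
      have "g j z' - g j z \<le> e * g j z" using b by (simp add: algebra_simps)
      also have "\<dots> \<le> e * g j z'" using True e0 by (intro mult_left_mono) auto
      finally show ?thesis using True by simp
    qed (use a in \<open>simp add: algebra_simps\<close>)
  qed
  have Vb: "\<bar>V (\<psi> j y)\<bar> \<le> G j" if "j \<in> J" "y \<in> space N" for j y using V that by (auto simp: admissible_def)
  have i: "integrable (count_space J) (\<lambda>j. g j y * V (\<psi> j y))" if "y \<in> space N" for y
    using that Vb by (intro gV_integrable) auto
  have pt: "g j z * V (\<psi> j z) - g j z' * V (\<psi> j z') \<le> (e + \<gamma> ^ n) * (g j z' * G j)" if j: "j \<in> J" for j
  proof -
    have "(g j z - g j z') * V (\<psi> j z) \<le> \<bar>g j z - g j z'\<bar> * \<bar>V (\<psi> j z)\<bar>" by (metis abs_ge_self abs_mult)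
    also have "\<dots> \<le> (e * g j z') * G j" using gd[OF j] Vb[OF j z(1)] by (intro mult_mono) auto
    finally have A: "(g j z - g j z') * V (\<psi> j z) \<le> (e * g j z') * G j" .
    have "\<bar>V (\<psi> j z) - V (\<psi> j z')\<bar> \<le> \<gamma> ^ n * G j" using V j z by (auto simp: admissible_def)
    then have B: "g j z' * (V (\<psi> j z) - V (\<psi> j z')) \<le> g j z' * (\<gamma> ^ n * G j)"
      using g_nonneg[OF j z(2)] by (intro mult_left_mono) auto
    show ?thesis using A B by (simp add: algebra_simps)
  qed
  have "P V z - P V z' = (\<integral>j. g j z * V (\<psi> j z) - g j z' * V (\<psi> j z') \<partial>count_space J)"
    unfolding P_def using i z by simp
  also have "\<dots> \<le> (\<integral>j. (e + \<gamma> ^ n) * (g j z' * G j) \<partial>count_space J)"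
    using i z gG_integrable[OF z(2)] pt by (intro integral_mono) auto
  also have "\<dots> \<le> (e + \<gamma> ^ n) * K0" using gG_integral[OF z(2)] e0 \<gamma>n by (auto intro!: mult_left_mono)
  also have "\<dots> \<le> (Cd * exp Cd * \<gamma> ^ n + \<gamma> ^ n) * K0" using e1 K0 by (intro mult_right_mono) auto
  finally show ?thesis by (simp add: algebra_simps)
qed

text \<open>Gordin's martingale-coboundary decomposition, with \<open>\<xi> = (\<Sum>n\<ge>1. P\<^sup>n V)\<close>.\<close>

lemma martingale_coboundary:
  "\<exists>K1\<ge>0. \<forall>V. admissible V \<longrightarrow> (\<exists>\<xi> m. \<xi> \<in> borel_measurable N \<and> martingale_fn m \<and>
      (\<forall>z\<in>space N. \<bar>\<xi> z\<bar> \<le> K1 \<and> V z = m z + \<xi> (F z) - \<xi> z))"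
proof -
  define D where "D = K0 * (Cd * exp Cd + 1)"
  have D: "0 \<le> D" unfolding D_def using K0 Cd by auto
  obtain \<kappa> where \<kappa>: "0 < \<kappa>" "\<kappa> < 1" and decay: "\<And>U D k z. 0 \<le> D \<Longrightarrow> U \<in> borel_measurable N \<Longrightarrow> (\<integral>z. U z \<partial>N) = 0 \<Longrightarrow>
     (\<forall>n y y'. y \<in> space N \<longrightarrow> y' \<in> space N \<longrightarrow> rel n y y' \<longrightarrow> U y - U y' \<le> D * \<gamma> ^ n) \<Longrightarrow>
     z \<in> space N \<Longrightarrow> \<bar>(P ^^ k) U z\<bar> \<le> 2 * D * \<kappa> ^ k"
    using P_funpow_decay by blast
  \<comment> \<open>The sum of the geometric majorant \<open>2 * D * \<kappa> ^ k\<close>.\<close>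
  define K1 where "K1 = 2 * D / (1 - \<kappa>)"
  have "K1 \<ge> 0" using D \<kappa> by (simp add: K1_def)
  moreover have "\<exists>\<xi> m. \<xi> \<in> borel_measurable N \<and> martingale_fn m \<and>
      (\<forall>z\<in>space N. \<bar>\<xi> z\<bar> \<le> K1 \<and> V z = m z + \<xi> (F z) - \<xi> z)" if V: "admissible V" for V
  proof -
    have Vm[measurable]: "V \<in> borel_measurable N" using V by (auto simp: admissible_def)
    define U where "U = P V"
    have U: "\<bar>(P ^^ k) U z\<bar> \<le> 2 * D * \<kappa> ^ k" if "z \<in> space N" for k z
    proof (rule decay[OF D _ _ _ that])
      show "U \<in> borel_measurable N" by (simp add: U_def)
      show "(\<integral>z. U z \<partial>N) = 0" unfolding U_def using integral_P(2) V by (simp add: admissible_def)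
    qed (use P_admissible_lipschitz[OF V] in \<open>auto simp: U_def D_def\<close>)
    have Pm[measurable]: "(P ^^ k) U \<in> borel_measurable N" for k by (induction k) (auto simp: U_def)
    have geo: "summable (\<lambda>k. 2 * D * \<kappa> ^ k)" using \<kappa> by (intro summable_mult summable_geometric) auto
    have geos: "(\<Sum>k. 2 * D * \<kappa> ^ k) = K1" using \<kappa> by (subst suminf_mult) (auto simp: K1_def suminf_geometric)
    have sm: "summable (\<lambda>k. \<bar>(P ^^ k) U z\<bar>)" if "z \<in> space N" for z
      using U[OF that] by (intro summable_comparison_test'[OF geo]) auto
    define \<xi> where "\<xi> z = (\<Sum>k. (P ^^ k) U z)" for z
    have \<xi>m[measurable]: "\<xi> \<in> borel_measurable N" unfolding \<xi>_def by measurable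
    have \<xi>b: "\<bar>\<xi> z\<bar> \<le> K1" if z: "z \<in> space N" for z
    proof -
      have "\<bar>\<xi> z\<bar> \<le> (\<Sum>k. \<bar>(P ^^ k) U z\<bar>)" unfolding \<xi>_def by (rule summable_rabs[OF sm[OF z]])
      also have "\<dots> \<le> (\<Sum>k. 2 * D * \<kappa> ^ k)" using U[OF z] by (intro suminf_le sm z geo) auto
      finally show ?thesis by (simp add: geos)
    qed
    \<comment> \<open>Applying \<open>P\<close> shifts the series by one and drops its first term;
      geometric decay justifies the exchange with the sum over branches.\<close>
    have P\<xi>: "P \<xi> z = \<xi> z - U z" if z: "z \<in> space N" for z
    proof -
      have sp: "\<psi> j z \<in> space N" if "j \<in> J" for j using \<psi>_space that z by auto
      have int: "integrable (count_space J) (\<lambda>j. g j z * (P ^^ k) U (\<psi> j z))" for k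
        by (rule g_times_bounded_integrable[OF z]) (use U sp in auto)
      have "P \<xi> z = (\<integral>j. (\<Sum>k. g j z * (P ^^ k) U (\<psi> j z)) \<partial>count_space J)"
        unfolding P_def[of \<xi> z] \<xi>_def
        by (intro Bochner_Integration.integral_cong refl suminf_mult[symmetric] summable_rabs_cancel[OF sm]) (auto simp: sp)
      also have "\<dots> = (\<Sum>k. \<integral>j. g j z * (P ^^ k) U (\<psi> j z) \<partial>count_space J)"
      proof (rule integral_suminf[OF int])
        show "AE j in count_space J. summable (\<lambda>k. norm (g j z * (P ^^ k) U (\<psi> j z)))"
          by (auto simp: AE_count_space abs_mult intro!: summable_mult sm sp)
        show "summable (\<lambda>k. \<integral>j. norm (g j z * (P ^^ k) U (\<psi> j z)) \<partial>count_space J)"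
        proof (rule summable_comparison_test'[OF geo])
          fix k
          have "(\<integral>j. norm (g j z * (P ^^ k) U (\<psi> j z)) \<partial>count_space J) \<le> (\<integral>j. g j z * (2 * D * \<kappa> ^ k) \<partial>count_space J)"
            using int[of k] g_integrable[OF z] U sp g_nonneg[OF _ z]
            by (intro integral_mono integrable_norm) (auto simp: abs_mult intro!: mult_left_mono)
          also have "\<dots> = 2 * D * \<kappa> ^ k" using g_integral[OF z] by simp
          finally show "norm (\<integral>j. norm (g j z * (P ^^ k) U (\<psi> j z)) \<partial>count_space J) \<le> 2 * D * \<kappa> ^ k" by simp
        qed
      qed
      also have "\<dots> = (\<Sum>k. (P ^^ Suc k) U z)" by (simp add: P_def[of "(P ^^ k) U" z for k])
      also have "\<dots> = \<xi> z - U z"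
        using suminf_split_head[OF summable_rabs_cancel[OF sm[OF z]]] by (simp add: \<xi>_def)
      finally show ?thesis .
    qed
    define m where "m z = V z - \<xi> (F z) + \<xi> z" for z
    have [measurable]: "m \<in> borel_measurable N" unfolding m_def by measurable
    have "P m z = 0" if z: "z \<in> space N" for z
    proof -
      have sp: "\<psi> j z \<in> space N" if "j \<in> J" for j using \<psi>_space that z by auto
      have i1: "integrable (count_space J) (\<lambda>j. g j z * V (\<psi> j z))"
        using V z by (intro gV_integrable) (auto simp: admissible_def)
      have i2: "integrable (count_space J) (\<lambda>j. g j z * \<xi> (\<psi> j z))"
        by (rule g_times_bounded_integrable[OF z, of _ K1]) (use \<xi>b sp in auto)
      have "P m z = (\<integral>j. g j z * V (\<psi> j z) - g j z * \<xi> z + g j z * \<xi> (\<psi> j z) \<partial>count_space J)"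
        unfolding P_def m_def by (rule Bochner_Integration.integral_cong) (auto simp: F_\<psi> z algebra_simps)
      also have "\<dots> = P V z - \<xi> z + P \<xi> z"
        using i1 i2 g_integrable[OF z] g_integral[OF z] by (simp add: P_def)
      finally show ?thesis using P\<xi>[OF z] by (simp add: U_def)
    qed
    then have "martingale_fn m" by (intro martingale_fnI) auto
    then show ?thesis using \<xi>m \<xi>b by (intro exI[of _ \<xi>] exI[of _ m]) (auto simp: m_def)
  qed
  ultimately show ?thesis by blast
qed

text \<open>A forward partial sum is the difference of two partial sums read from the end, so a
  maximal inequality for the reversed martingale controls the forward maximum at the price of a
  factor 2.\<close>

lemma sum_reverse:
  fixes a :: "nat \<Rightarrow> real"
  assumes "k \<le> n"
  shows "(\<Sum>j<k. a j) = (\<Sum>i<n. a (n - 1 - i)) - (\<Sum>i<n - k. a (n - 1 - i))"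
proof -
  have *: "(\<Sum>i<l. a (n - 1 - i)) = (\<Sum>j<n. a j) - (\<Sum>j<n - l. a j)" if "l \<le> n" for l
    using that
  proof (induction l)
    case (Suc l)
    then have "n - l = Suc (n - Suc l)" "n - 1 - l = n - Suc l" by auto
    then show ?case using Suc by simp
  qed simp
  show ?thesis using *[of n] *[of "n - k"] assms by simp
qed

lemma martingale_moment:
  assumes "moment_le N p Hf c" "0 \<le> p" "martingale_fn m" "admissible V"
    and "\<And>z. z \<in> space N \<Longrightarrow> \<bar>\<xi> z\<bar> \<le> K1" "\<And>z. z \<in> space N \<Longrightarrow> V z = m z + \<xi> (F z) - \<xi> z"
  shows "moment_le N p m (2 powr p * (c + \<bar>2 * K1\<bar> powr p))"
proof (rule moment_le_mono[OF moment_le_add[OF assms(1) moment_le_const[of p "2 * K1"] assms(2)]])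
  show "m \<in> borel_measurable N" using assms by (simp add: martingale_fn_def)
  fix z assume z: "z \<in> space N"
  then have "\<bar>V z\<bar> \<le> Hf z" "F z \<in> space N" using assms(4) measurable_space[OF F_meas] by (auto simp: admissible_def)
  then show "\<bar>m z\<bar> \<le> \<bar>Hf z + 2 * K1\<bar>" using assms(5)[OF z] assms(5)[of "F z"] assms(6)[OF z] by linarith
qed fact

lemma bsum_coboundary:
  assumes "\<And>z. z \<in> space N \<Longrightarrow> V z = m z + \<xi> (F z) - \<xi> z" "z \<in> space N"
  shows "bsum V k z = bsum m k z + \<xi> ((F ^^ k) z) - \<xi> z"
proof (induction k)
  case (Suc k)
  have "(F ^^ k) z \<in> space N" using measurable_space[OF funpow_meas assms(2)] .
  then show ?case using Suc assms(1)[of "(F ^^ k) z"] by (simp add: bsum_Suc)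
qed simp

text \<open>The coboundary telescopes to a bounded term, and \<open>m\<close> differs from
  \<open>V\<close> by at most \<open>2 * K1\<close>, hence inherits the \<open>p\<close>-th moment
  of \<open>Hf\<close>. Only the reversed martingale contributes growth.\<close>

lemma birkhoff_maximal:
  assumes p: "2 \<le> p" and Hp: "moment_le N p Hf c"
  shows "\<exists>K>0. \<forall>V n. admissible V \<longrightarrow> 1 \<le> n \<longrightarrow>
     moment_le N p (\<lambda>z. runmax (\<lambda>k. \<bar>bsum V k z\<bar>) n) (K * real n powr (p / 2))"
proof -
  obtain K1 where K1: "K1 \<ge> 0" and dec: "\<And>V. admissible V \<Longrightarrow> (\<exists>\<xi> m. \<xi> \<in> borel_measurable N \<and> martingale_fn m \<and>
      (\<forall>z\<in>space N. \<bar>\<xi> z\<bar> \<le> K1 \<and> V z = m z + \<xi> (F z) - \<xi> z))"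
    using martingale_coboundary by blast
  obtain K where K: "K > 0" and rm: "\<And>m b n R. martingale_fn m \<Longrightarrow> (\<forall>i. b i \<in> borel_measurable N) \<Longrightarrow> 1 \<le> n \<Longrightarrow>
     (\<forall>i<n. moment_le N p (\<lambda>z. m z * b i (F z)) R) \<Longrightarrow>
     moment_le N p (\<lambda>z. runmax (\<lambda>k. \<bar>\<Sum>i<k. m ((F ^^ (n - 1 - i)) z) * b i ((F ^^ (n - i)) z)\<bar>) n) (K * real n powr (p / 2) * R)"
    using martingale_reverse_maximal[OF p] by blast
  define R where "R = 2 powr p * (c + \<bar>2 * K1\<bar> powr p)"
  have R: "0 \<le> R" using moment_leD(2)[OF Hp] by (simp add: R_def)
  define K' where "K' = 2 powr p * (\<bar>2\<bar> powr p * (K * R) + \<bar>2 * K1\<bar> powr p) + 1"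
  have K': "K' > 0" using K R by (simp add: K'_def add_nonneg_pos)
  have "moment_le N p (\<lambda>z. runmax (\<lambda>k. \<bar>bsum V k z\<bar>) n) (K' * real n powr (p / 2))" if V: "admissible V" and n: "1 \<le> n" for V n
  proof -
    have [measurable]: "V \<in> borel_measurable N" using V by (simp add: admissible_def)
    obtain \<xi> m where \<xi>m: "\<xi> \<in> borel_measurable N" and m: "martingale_fn m"
      and \<xi>: "\<And>z. z \<in> space N \<Longrightarrow> \<bar>\<xi> z\<bar> \<le> K1" and Veq: "\<And>z. z \<in> space N \<Longrightarrow> V z = m z + \<xi> (F z) - \<xi> z"
      using dec[OF V] by blast
    have mR: "moment_le N p m R" unfolding R_def using martingale_moment[OF Hp _ m V \<xi> Veq] p by simp
    define X where "X z = runmax (\<lambda>k. \<bar>\<Sum>i<k. m ((F ^^ (n - 1 - i)) z) * 1\<bar>) n" for z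
    have X: "moment_le N p X (K * real n powr (p / 2) * R)"
      using rm[OF m _ n, of "\<lambda>_ _. 1" R] mR by (simp add: X_def[abs_def])
    have n1: "1 \<le> real n powr (p / 2)" using n p by (intro ge_one_powr_ge_zero) auto
    have "moment_le N p (\<lambda>z. runmax (\<lambda>k. \<bar>bsum V k z\<bar>) n) (2 powr p * (\<bar>2\<bar> powr p * (K * real n powr (p / 2) * R) + \<bar>2 * K1\<bar> powr p))"
    proof (rule moment_le_mono[OF moment_le_add[OF moment_le_scale[OF X, of 2] moment_le_const[of p "2 * K1"]]])
      fix z assume z: "z \<in> space N"
      \<comment> \<open>Two reversed partial sums, of lengths \<open>n\<close> and
        \<open>n - k\<close>, and the values of \<open>\<xi>\<close> at both ends of the orbit
        segment.\<close>
      have "\<bar>bsum V k z\<bar> \<le> 2 * X z + 2 * K1" if k: "k \<le> n" for k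
      proof -
        have "bsum m k z = (\<Sum>i<n. m ((F ^^ (n - 1 - i)) z)) - (\<Sum>i<n - k. m ((F ^^ (n - 1 - i)) z))"
          unfolding bsum_def by (rule sum_reverse[OF k])
        moreover have "\<bar>\<Sum>i<n. m ((F ^^ (n - 1 - i)) z)\<bar> \<le> X z" "\<bar>\<Sum>i<n - k. m ((F ^^ (n - 1 - i)) z)\<bar> \<le> X z"
          unfolding X_def using runmax_ge[of n n "\<lambda>k. \<bar>\<Sum>i<k. m ((F ^^ (n - 1 - i)) z) * 1\<bar>"]
            runmax_ge[of "n - k" n "\<lambda>k. \<bar>\<Sum>i<k. m ((F ^^ (n - 1 - i)) z) * 1\<bar>"] by auto
        moreover have "\<bar>\<xi> ((F ^^ k) z)\<bar> \<le> K1" "\<bar>\<xi> z\<bar> \<le> K1" using \<xi> z measurable_space[OF funpow_meas z] by auto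
        ultimately show ?thesis using bsum_coboundary[of V m \<xi> z k, OF Veq z] by linarith
      qed
      then have "runmax (\<lambda>k. \<bar>bsum V k z\<bar>) n \<le> 2 * X z + 2 * K1" by (simp add: runmax_le_iff)
      then show "\<bar>runmax (\<lambda>k. \<bar>bsum V k z\<bar>) n\<bar> \<le> \<bar>2 * X z + 2 * K1\<bar>"
        using runmax_nonneg[of "\<lambda>k. \<bar>bsum V k z\<bar>" n] by simp
    qed (use p in auto)
    moreover have "2 powr p * (\<bar>2\<bar> powr p * (K * real n powr (p / 2) * R) + \<bar>2 * K1\<bar> powr p)
       \<le> 2 powr p * (\<bar>2\<bar> powr p * (K * real n powr (p / 2) * R) + \<bar>2 * K1\<bar> powr p * real n powr (p / 2)) + 1 * real n powr (p / 2)"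
    proof -
      have "\<bar>2 * K1\<bar> powr p * 1 \<le> \<bar>2 * K1\<bar> powr p * real n powr (p / 2)" using n1 by (intro mult_left_mono) auto
      then show ?thesis using n1 by (intro add_increasing2 mult_left_mono add_left_mono) auto
    qed
    ultimately show ?thesis by (rule moment_le_weaken[OF _ order_trans]) (simp add: K'_def algebra_simps)
  qed
  then show ?thesis using K' by blast
qed

section \<open>Iterated sums\<close>

definition isum :: "('a \<Rightarrow> real) \<Rightarrow> ('a \<Rightarrow> real) \<Rightarrow> nat \<Rightarrow> 'a \<Rightarrow> real" where
  "isum V W k z = (\<Sum>j<k. bsum V j z * W ((F ^^ j) z))"

text \<open>The inner sum is replaced by its martingale part and summed by parts. The tail of
  \<open>W\<close> is taken up to the fixed \<open>n\<close> instead of \<open>k\<close>, so that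
  the coefficients of \<open>m\<close> do not change with \<open>k\<close>; the second term corrects
  for this.\<close>

lemma isum_decomposition:
  assumes Veq: "\<And>z. z \<in> space N \<Longrightarrow> V z = m z + \<xi> (F z) - \<xi> z" and z: "z \<in> space N" and k: "k \<le> n"
  shows "isum V W k z = (\<Sum>l<k. m ((F ^^ l) z) * (bsum W n z - bsum W (Suc l) z))
      - bsum m k z * (bsum W n z - bsum W k z) + (\<Sum>j<k. \<xi> ((F ^^ j) z) * W ((F ^^ j) z)) - \<xi> z * bsum W k z"
  unfolding isum_def
  by (induction k) (simp_all add: bsum_coboundary[of V m \<xi> z, OF Veq z] bsum_Suc algebra_simps)

text \<open>Read backwards, the first sum of the decomposition is again a martingale, with
  coefficients \<open>bsum W i\<close> of size \<open>sqrt i\<close>. Products of two quantities in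
  \<open>L^(2q)\<close> of size \<open>sqrt n\<close> give the order \<open>n\<close> in
  \<open>L^q\<close>.\<close>

lemma iterated_maximal:
  assumes q: "2 \<le> q" and Hp: "moment_le N (2 * q) Hf c"
  shows "\<exists>K>0. \<forall>V W n. admissible V \<longrightarrow> admissible W \<longrightarrow> 1 \<le> n \<longrightarrow>
     moment_le N q (\<lambda>z. runmax (\<lambda>k. \<bar>isum V W k z\<bar>) n) (K * real n powr q)"
proof -
  obtain K1 where K1: "K1 \<ge> 0" and dec: "\<And>V. admissible V \<Longrightarrow> (\<exists>\<xi> m. \<xi> \<in> borel_measurable N \<and> martingale_fn m \<and>
      (\<forall>z\<in>space N. \<bar>\<xi> z\<bar> \<le> K1 \<and> V z = m z + \<xi> (F z) - \<xi> z))"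
    using martingale_coboundary by blast
  obtain K where K: "K > 0" and rm: "\<And>m b n R. martingale_fn m \<Longrightarrow> (\<forall>i. b i \<in> borel_measurable N) \<Longrightarrow> 1 \<le> n \<Longrightarrow>
     (\<forall>i<n. moment_le N q (\<lambda>z. m z * b i (F z)) R) \<Longrightarrow>
     moment_le N q (\<lambda>z. runmax (\<lambda>k. \<bar>\<Sum>i<k. m ((F ^^ (n - 1 - i)) z) * b i ((F ^^ (n - i)) z)\<bar>) n) (K * real n powr (q / 2) * R)"
    using martingale_reverse_maximal[OF q] by blast
  have p: "2 \<le> 2 * q" using q by simp
  obtain K2 where K2: "K2 > 0" and bm: "\<And>V n. admissible V \<Longrightarrow> 1 \<le> n \<Longrightarrow>
     moment_le N (2 * q) (\<lambda>z. runmax (\<lambda>k. \<bar>bsum V k z\<bar>) n) (K2 * real n powr q)"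
    using birkhoff_maximal[OF p Hp] by auto
  define R where "R = 2 powr (2 * q) * (c + \<bar>2 * K1\<bar> powr (2 * q))"
  have c: "0 \<le> c" using moment_leD(2)[OF Hp] .
  have R: "0 \<le> R" using c by (simp add: R_def)
  define c1 where "c1 = 2 powr (2 * q) * (\<bar>2\<bar> powr (2 * q) * K2 + \<bar>5 * K1\<bar> powr (2 * q))"
  have c1: "0 \<le> c1" using K2 by (simp add: c1_def)
  define K' where "K' = 2 powr q * (\<bar>2\<bar> powr q * (K * (R + K2)) + 2 powr q * ((c1 + K2) + \<bar>K1\<bar> powr q * (c + 1))) + 1"
  have K': "K' > 0" using K R K2 c c1 by (simp add: K'_def add_nonneg_pos)
  have "moment_le N q (\<lambda>z. runmax (\<lambda>k. \<bar>isum V W k z\<bar>) n) (K' * real n powr q)"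
    if V: "admissible V" and W: "admissible W" and n: "1 \<le> n" for V W n
  proof -
    have [measurable]: "V \<in> borel_measurable N" "W \<in> borel_measurable N" using V W by (auto simp: admissible_def)
    obtain \<xi> m where \<xi>m[measurable]: "\<xi> \<in> borel_measurable N" and m: "martingale_fn m"
      and \<xi>: "\<And>z. z \<in> space N \<Longrightarrow> \<bar>\<xi> z\<bar> \<le> K1" and Veq: "\<And>z. z \<in> space N \<Longrightarrow> V z = m z + \<xi> (F z) - \<xi> z"
      using dec[OF V] by blast
    note [measurable] = m[unfolded martingale_fn_def, THEN conjunct1]
    have mR: "moment_le N (2 * q) m R" unfolding R_def using martingale_moment[OF Hp _ m V \<xi> Veq] q by simp
    \<comment> \<open>The common size of both factors; dividing by it balances them before
      \<open>moment_le_mult\<close>, whose bounds add up.\<close>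
    define s where "s = sqrt (real n)"
    have s: "0 < s" "s * s = n" using n by (auto simp: s_def)
    have sp: "s powr q = real n powr (q / 2)" "s powr (2 * q) = real n powr q"
      unfolding s_def using n by (auto simp: powr_half_sqrt[symmetric] powr_powr)
    have npos: "0 < real n powr q" "1 \<le> real n powr q" using n q by (auto intro: ge_one_powr_ge_zero)
    have resc: "\<bar>1 / s\<bar> powr (2 * q) * (x * real n powr q) = x" for x
      using s npos by (simp add: powr_divide sp)
    define A where "A z = runmax (\<lambda>k. \<bar>bsum V k z\<bar>) n" for z
    define B where "B z = runmax (\<lambda>k. \<bar>bsum W k z\<bar>) n" for z
    have A: "moment_le N (2 * q) A (K2 * real n powr q)" and B: "moment_le N (2 * q) B (K2 * real n powr q)"
      using bm[OF V n] bm[OF W n] by (simp_all add: A_def[abs_def] B_def[abs_def])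
    have A0: "0 \<le> A z" and B0: "0 \<le> B z" for z by (auto simp: A_def B_def intro!: runmax_nonneg)
    note [measurable] = moment_leD(1)[OF A] moment_leD(1)[OF B]
    have B': "moment_le N (2 * q) (\<lambda>z. 1 / s * B z) K2" using moment_le_scale[OF B, of "1 / s"] by (simp only: resc)
    have b: "moment_le N q (\<lambda>z. m z * bsum W i (F z)) (real n powr (q / 2) * (R + K2))" if "i < n" for i
    proof -
      have "moment_le N (2 * q) (\<lambda>z. 1 / s * bsum W i ((F ^^ 1) z)) K2"
      proof (rule moment_le_mono[OF moment_le_funpow[OF B', of 1]])
        fix z
        have "\<bar>bsum W i ((F ^^ 1) z)\<bar> \<le> B ((F ^^ 1) z)" unfolding B_def using that by (intro runmax_ge) auto
        then show "\<bar>1 / s * bsum W i ((F ^^ 1) z)\<bar> \<le> \<bar>1 / s * B ((F ^^ 1) z)\<bar>" using s B0[of "F z"]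
          by (simp add: abs_mult divide_right_mono)
      qed (use q in auto)
      from moment_le_scale[OF moment_le_mult[OF mR this], of s] q s
      show ?thesis by (simp add: sp)
    qed
    define D where "D k z = (\<Sum>i<k. m ((F ^^ (n - 1 - i)) z) * bsum W i ((F ^^ (n - i)) z))" for k z
    define XD where "XD z = runmax (\<lambda>k. \<bar>D k z\<bar>) n" for z
    have "moment_le N q XD (K * real n powr (q / 2) * (real n powr (q / 2) * (R + K2)))"
      using rm[OF m _ n, of "bsum W"] b by (simp add: XD_def[abs_def] D_def)
    then have XD: "moment_le N q XD (K * (R + K2) * real n powr q)"
      by (simp add: mult_ac powr_add[symmetric])
    \<comment> \<open>The correction term is at most \<open>(A z + 2 * K1) * (2 * B z)\<close>,
      since \<open>bsum m\<close> and \<open>bsum V\<close> differ by at most \<open>2 * K1\<close>;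
      the boundary term \<open>\<xi> z * bsum W k z\<close> adds another
      \<open>K1 * B z\<close>.\<close>
    have t2: "moment_le N q (\<lambda>z. (2 * A z + 5 * K1) * B z) ((c1 + K2) * real n powr q)"
    proof -
      have "moment_le N (2 * q) (\<lambda>z. 2 * A z + 5 * K1) (2 powr (2 * q) * (\<bar>2\<bar> powr (2 * q) * (K2 * real n powr q) + \<bar>5 * K1\<bar> powr (2 * q)))"
        using moment_le_add[OF moment_le_scale[OF A, of 2] moment_le_const[of "2 * q" "5 * K1"]] q by simp
      moreover have "2 powr (2 * q) * (\<bar>2\<bar> powr (2 * q) * (K2 * real n powr q) + \<bar>5 * K1\<bar> powr (2 * q)) \<le> c1 * real n powr q"
      proof -
        have "\<bar>5 * K1\<bar> powr (2 * q) * 1 \<le> \<bar>5 * K1\<bar> powr (2 * q) * real n powr q" using npos by (intro mult_left_mono) auto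
        then show ?thesis unfolding c1_def by (simp add: algebra_simps mult_left_mono)
      qed
      ultimately have "moment_le N (2 * q) (\<lambda>z. 2 * A z + 5 * K1) (c1 * real n powr q)" by (rule moment_le_weaken)
      from moment_le_scale[OF this, of "1 / s"] have "moment_le N (2 * q) (\<lambda>z. 1 / s * (2 * A z + 5 * K1)) c1" by (simp only: resc)
      from moment_le_scale[OF moment_le_mult[OF this B'], of n]
      have "moment_le N q (\<lambda>z. n * (1 / s * (2 * A z + 5 * K1) * (1 / s * B z))) (real n powr q * (c1 + K2))" using q by simp
      moreover have "n * (1 / s * (2 * A z + 5 * K1) * (1 / s * B z)) = (2 * A z + 5 * K1) * B z" for z
        using s by (simp flip: s(2))
      ultimately show ?thesis by (simp add: mult.commute)
    qed
    \<comment> \<open>The sum of products of \<open>\<xi>\<close> and \<open>W\<close> along the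
      orbit needs no cancellation, as order \<open>n\<close> is what is claimed.\<close>
    have t3: "moment_le N q (\<lambda>z. K1 * (\<Sum>j<n. \<bar>W ((F ^^ j) z)\<bar>)) (\<bar>K1\<bar> powr q * (c + 1) * real n powr q)"
    proof -
      have "moment_le N q (\<lambda>z. Hf z * 1) (c + 1)"
        using moment_le_mult[OF Hp moment_le_const[of "2 * q" 1]] q by simp
      then have "moment_le N q W (c + 1)"
        by (rule moment_le_mono) (use q W in \<open>auto simp: admissible_def intro: order_trans[OF _ abs_ge_self]\<close>)
      from moment_le_scale[OF moment_le_sum[OF moment_le_funpow[OF this]]] q n show ?thesis by (simp add: mult_ac)
    qed
    have fin: "moment_le N q (\<lambda>z. runmax (\<lambda>k. \<bar>isum V W k z\<bar>) n)
      (2 powr q * (\<bar>2\<bar> powr q * (K * (R + K2) * real n powr q) + 2 powr q * ((c1 + K2) * real n powr q + \<bar>K1\<bar> powr q * (c + 1) * real n powr q)))"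
    proof (rule moment_le_mono[OF moment_le_add[OF moment_le_scale[OF XD, of 2] moment_le_add[OF t2 t3]]])
      show "(\<lambda>z. runmax (\<lambda>k. \<bar>isum V W k z\<bar>) n) \<in> borel_measurable N" unfolding isum_def by measurable
      fix z assume z: "z \<in> space N"
      define \<Sigma> where "\<Sigma> = (\<Sum>j<n. \<bar>W ((F ^^ j) z)\<bar>)"
      have \<Sigma>0: "0 \<le> \<Sigma>" unfolding \<Sigma>_def by (intro sum_nonneg) auto
      have zk: "\<bar>\<xi> ((F ^^ k) z)\<bar> \<le> K1" for k using \<xi> measurable_space[OF funpow_meas z] by auto
      have "\<bar>isum V W k z\<bar> \<le> 2 * XD z + ((2 * A z + 5 * K1) * B z + K1 * \<Sigma>)" if k: "k \<le> n" for k
      proof -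
        \<comment> \<open>With \<open>l = n - 1 - i\<close> the tail of \<open>W\<close> becomes
          \<open>bsum W i\<close> at \<open>(F ^^ (n - i)) z\<close>, the form of coefficient
          required by the reversed maximal inequality.\<close>
        define a where "a l = m ((F ^^ l) z) * (bsum W n z - bsum W (Suc l) z)" for l
        have ab: "a (n - 1 - i) = m ((F ^^ (n - 1 - i)) z) * bsum W i ((F ^^ (n - i)) z)" if "i < n" for i
        proof -
          have "bsum W n z = bsum W (n - i) z + bsum W i ((F ^^ (n - i)) z)" using bsum_add[of W "n - i" i z] that by simp
          moreover have "Suc (n - 1 - i) = n - i" using that by simp
          ultimately show ?thesis by (simp add: a_def)
        qed
        have "(\<Sum>l<k. a l) = D n z - D (n - k) z"
          unfolding sum_reverse[OF k, of a] D_def by (intro arg_cong2[of _ _ _ _ "(-)"] sum.cong) (auto simp: ab[simplified])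
        moreover have "\<bar>D n z\<bar> \<le> XD z" "\<bar>D (n - k) z\<bar> \<le> XD z" unfolding XD_def
          using runmax_ge[of n n "\<lambda>k. \<bar>D k z\<bar>"] runmax_ge[of "n - k" n "\<lambda>k. \<bar>D k z\<bar>"] by auto
        ultimately have 1: "\<bar>\<Sum>l<k. a l\<bar> \<le> 2 * XD z" by linarith
        have Bk: "\<bar>bsum W k z\<bar> \<le> B z" "\<bar>bsum W n z\<bar> \<le> B z" and Ak: "\<bar>bsum V k z\<bar> \<le> A z"
          unfolding A_def B_def
          using k runmax_ge[of k n "\<lambda>k. \<bar>bsum W k z\<bar>"] runmax_ge[of n n "\<lambda>k. \<bar>bsum W k z\<bar>"] runmax_ge[of k n "\<lambda>k. \<bar>bsum V k z\<bar>"] by auto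
        have "\<bar>bsum m k z\<bar> \<le> A z + 2 * K1" using Ak bsum_coboundary[of V m \<xi> z k, OF Veq z] zk[of k] zk[of 0] by simp
        then have "\<bar>bsum m k z\<bar> * \<bar>bsum W n z - bsum W k z\<bar> \<le> (A z + 2 * K1) * (2 * B z)"
          using Bk by (intro mult_mono) auto
        then have 2: "\<bar>bsum m k z * (bsum W n z - bsum W k z)\<bar> \<le> (A z + 2 * K1) * (2 * B z)" by (simp add: abs_mult)
        have "\<bar>\<Sum>j<k. \<xi> ((F ^^ j) z) * W ((F ^^ j) z)\<bar> \<le> (\<Sum>j<k. K1 * \<bar>W ((F ^^ j) z)\<bar>)"
          using zk by (intro order_trans[OF sum_abs] sum_mono) (auto simp: abs_mult intro!: mult_right_mono)
        also have "\<dots> \<le> (\<Sum>j<n. K1 * \<bar>W ((F ^^ j) z)\<bar>)" using k K1 by (intro sum_mono2) auto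
        finally have 3: "\<bar>\<Sum>j<k. \<xi> ((F ^^ j) z) * W ((F ^^ j) z)\<bar> \<le> K1 * \<Sigma>" by (simp add: \<Sigma>_def sum_distrib_left)
        have 4: "\<bar>\<xi> z * bsum W k z\<bar> \<le> K1 * B z" using zk[of 0] Bk K1 by (auto simp: abs_mult intro!: mult_mono)
        show ?thesis using isum_decomposition[of V m \<xi> z k n W, OF Veq z k] 1 2 3 4
          unfolding a_def[symmetric] by (simp add: algebra_simps)
      qed
      then have "runmax (\<lambda>k. \<bar>isum V W k z\<bar>) n \<le> 2 * XD z + ((2 * A z + 5 * K1) * B z + K1 * \<Sigma>)" by (simp add: runmax_le_iff)
      then show "\<bar>runmax (\<lambda>k. \<bar>isum V W k z\<bar>) n\<bar> \<le> \<bar>2 * XD z + ((2 * A z + 5 * K1) * B z + K1 * (\<Sum>j<n. \<bar>W ((F ^^ j) z)\<bar>))\<bar>"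
        using runmax_nonneg[of "\<lambda>k. \<bar>isum V W k z\<bar>" n] by (simp add: \<Sigma>_def)
    qed (use q in auto)
    show ?thesis by (rule moment_le_weaken[OF fin]) (use npos in \<open>simp add: K'_def algebra_simps\<close>)
  qed
  then show ?thesis using K' by blast
qed

end

section \<open>Regularity of the invariant density\<close>

text \<open>\<open>\<nu>\<close> is the reference measure, later \<open>\<mu>0\<close> restricted to
  \<open>Y\<close>, and \<open>D\<close> bounds all distances. The function \<open>\<zeta>\<close>
  is the inverse Jacobian of \<open>F\<close> for \<open>\<nu>\<close>; bijectivity of the branches
  is known only up to null sets.\<close>

locale full_branch =
  fixes Y :: "'m::metric_space set" and F :: "'m \<Rightarrow> 'm" and \<P> :: "'m set set" and \<nu> :: "'m measure"
    and \<zeta> :: "'m \<Rightarrow> real" and lam C \<eta> D :: real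
  assumes Y: "Y \<in> sets borel"
    and D: "\<And>x y :: 'm. dist x y \<le> D"
    and sets_\<nu>: "sets \<nu> = sets (restrict_space borel Y)"
    and finite_\<nu>: "finite_measure \<nu>"
    and F_Y: "F \<in> measurable \<nu> \<nu>"
    and part_count: "countable \<P>" and part_disj: "disjoint \<P>" and part_union: "\<Union>\<P> = Y"
    and part_sets: "\<And>P. P \<in> \<P> \<Longrightarrow> P \<in> sets borel"
    and lam: "lam > 1" and C: "C \<ge> 0" and \<eta>: "0 < \<eta>"
    and \<zeta>_meas: "\<zeta> \<in> borel_measurable \<nu>"
    and \<zeta>_pos: "\<And>y. y \<in> Y \<Longrightarrow> \<zeta> y > 0"
    and markov: "\<And>P. P \<in> \<P> \<Longrightarrow> \<exists>P' Q. P' \<subseteq> P \<and> P' \<in> sets \<nu> \<and> Q \<in> sets \<nu>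
        \<and> emeasure \<nu> (P - P') = 0 \<and> emeasure \<nu> (Y - Q) = 0 \<and> bij_betw F P' Q
        \<and> (\<forall>A \<in> sets \<nu>. A \<subseteq> P' \<longrightarrow> F ` A \<in> sets \<nu>
             \<and> emeasure \<nu> A = (\<integral>\<^sup>+ z \<in> F ` A. ennreal (\<zeta> (inv_into P' F z)) \<partial>\<nu>))"
    and expanding: "\<And>P y y'. P \<in> \<P> \<Longrightarrow> y \<in> P \<Longrightarrow> y' \<in> P \<Longrightarrow> dist (F y) (F y') \<ge> lam * dist y y'"
    and distortion: "\<And>P y y'. P \<in> \<P> \<Longrightarrow> y \<in> P \<Longrightarrow> y' \<in> P \<Longrightarrow>
        \<bar>ln (\<zeta> y) - ln (\<zeta> y')\<bar> \<le> C * dist (F y) (F y') powr \<eta>"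
begin

sublocale finite_measure \<nu> by (rule finite_\<nu>)

abbreviation br :: "'m set \<Rightarrow> 'm \<Rightarrow> 'm" where "br P \<equiv> inv_into P F"

lemma space_\<nu>: "space \<nu> = Y"
  using sets_eq_imp_space_eq[OF sets_\<nu>] Y by (simp add: space_restrict_space)

lemma sets_\<nu>_iff: "A \<in> sets \<nu> \<longleftrightarrow> A \<in> sets borel \<and> A \<subseteq> Y"
  using sets_\<nu> Y by (auto simp: sets_restrict_space_iff)

lemma Y_\<nu>: "Y \<in> sets \<nu>" using Y by (simp add: sets_\<nu>_iff)

lemma part_\<nu>: "P \<in> \<P> \<Longrightarrow> P \<in> sets \<nu>"
  using part_sets part_union by (auto simp: sets_\<nu>_iff)

lemma F_in_Y: "y \<in> Y \<Longrightarrow> F y \<in> Y"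
  using measurable_space[OF F_Y] by (simp add: space_\<nu>)

lemma inj_F: "P \<in> \<P> \<Longrightarrow> inj_on F P"
proof (rule inj_onI)
  fix y y' assume "P \<in> \<P>" "y \<in> P" "y' \<in> P" "F y = F y'"
  then have "lam * dist y y' \<le> 0" using expanding[of P y y'] by simp
  then have "dist y y' \<le> 0" using lam by (simp add: mult_le_0_iff)
  then show "y = y'" by simp
qed

lemma br_F: "P \<in> \<P> \<Longrightarrow> y \<in> P \<Longrightarrow> br P (F y) = y"
  using inj_F by simp

text \<open>A set of full measure on which the map is an exact full-branch system: \<open>F\<close>
  maps it into itself and each of its points has, in every cell, a preimage that again belongs to
  it. The operators below can then be evaluated pointwise on \<open>Z\<close>.\<close>

definition good :: "'m set \<Rightarrow> bool" where
  "good Z \<longleftrightarrow> Z \<in> sets \<nu> \<and> Y - Z \<in> null_sets \<nu> \<and> F ` Z \<subseteq> Z \<and> (\<forall>P\<in>\<P>. Z \<subseteq> F ` (P \<inter> Z) \<and>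
     (\<forall>A\<in>sets \<nu>. A \<subseteq> P \<inter> Z \<longrightarrow> F ` A \<in> sets \<nu> \<and> emeasure \<nu> A = (\<integral>\<^sup>+z\<in>F ` A. ennreal (\<zeta> (br P z)) \<partial>\<nu>)))"

lemma good_exists:
  assumes N: "N \<in> null_sets \<nu>"
  shows "\<exists>Z. good Z \<and> Z \<inter> N = {}"
proof -
  define \<Phi> where "\<Phi> P R Q \<longleftrightarrow> R \<subseteq> P \<and> R \<in> sets \<nu> \<and> Q \<in> sets \<nu>
        \<and> emeasure \<nu> (P - R) = 0 \<and> emeasure \<nu> (Y - Q) = 0 \<and> bij_betw F R Q
        \<and> (\<forall>A \<in> sets \<nu>. A \<subseteq> R \<longrightarrow> F ` A \<in> sets \<nu>
             \<and> emeasure \<nu> A = (\<integral>\<^sup>+ z \<in> F ` A. ennreal (\<zeta> (inv_into R F z)) \<partial>\<nu>))" for P R Q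
  have "\<forall>P\<in>\<P>. \<exists>R Q. \<Phi> P R Q" unfolding \<Phi>_def using markov by (rule ballI)
  then obtain R Q where "\<forall>P\<in>\<P>. \<Phi> P (R P) (Q P)" by metis
  then have RQ: "\<And>P. P \<in> \<P> \<Longrightarrow> R P \<subseteq> P \<and> R P \<in> sets \<nu> \<and> Q P \<in> sets \<nu>
        \<and> emeasure \<nu> (P - R P) = 0 \<and> emeasure \<nu> (Y - Q P) = 0 \<and> bij_betw F (R P) (Q P)
        \<and> (\<forall>A \<in> sets \<nu>. A \<subseteq> R P \<longrightarrow> F ` A \<in> sets \<nu>
             \<and> emeasure \<nu> A = (\<integral>\<^sup>+ z \<in> F ` A. ennreal (\<zeta> (inv_into (R P) F z)) \<partial>\<nu>))"
    unfolding \<Phi>_def by (rule bspec)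
  have RQ_null: "P - R P \<in> null_sets \<nu>" "Y - Q P \<in> null_sets \<nu>" and RP: "R P \<subseteq> P" "R P \<in> sets \<nu>" if "P \<in> \<P>" for P
    using RQ[OF that] part_\<nu>[OF that] Y_\<nu> by (auto intro!: null_setsI)
  \<comment> \<open>Expansion makes \<open>F\<close> injective on the whole cell, so the inverse on
    the smaller set \<open>R P\<close> agrees with \<open>br P\<close> and one inverse branch serves
    throughout.\<close>
  have inv_eq: "inv_into (R P) F z = br P z" if P: "P \<in> \<P>" and A: "A \<subseteq> R P" "z \<in> F ` A" for P A z
  proof -
    obtain y where y: "y \<in> R P" "z = F y" using A by auto
    have "inj_on F (R P)" using RQ[OF P] by (auto simp: bij_betw_def)
    moreover have "y \<in> P" using y RQ[OF P] by blast
    ultimately show ?thesis using y br_F[OF P, of y] by simp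
  qed
  have img: "F ` A \<in> sets \<nu>" and cv: "emeasure \<nu> A = (\<integral>\<^sup>+z\<in>F ` A. ennreal (\<zeta> (br P z)) \<partial>\<nu>)"
    if "P \<in> \<P>" "A \<in> sets \<nu>" "A \<subseteq> R P" for P A
  proof -
    show "F ` A \<in> sets \<nu>" using RQ that by blast
    have "(\<integral>\<^sup>+z\<in>F ` A. ennreal (\<zeta> (inv_into (R P) F z)) \<partial>\<nu>) = (\<integral>\<^sup>+z\<in>F ` A. ennreal (\<zeta> (br P z)) \<partial>\<nu>)"
      using inv_eq[OF that(1,3)] by (intro nn_integral_cong) (auto simp: indicator_def)
    then show "emeasure \<nu> A = (\<integral>\<^sup>+z\<in>F ` A. ennreal (\<zeta> (br P z)) \<partial>\<nu>)" using RQ that by metis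
  qed
  \<comment> \<open>If \<open>A\<close> is null, the change of variables makes the integral of
    \<open>\<zeta>\<close> along the branch over \<open>F\<close>
    A\<open>vanish; as\<close>\<zeta>\<open>is positive,\<close>F \<open>A\<close> is null.\<close>
  have null_img: "F ` A \<in> null_sets \<nu>" if P: "P \<in> \<P>" and A: "A \<in> null_sets \<nu>" "A \<subseteq> R P" for P A
  proof -
    have As: "A \<in> sets \<nu>" using A by auto
    have FA: "F ` A \<in> sets \<nu>" by (rule img[OF P As A(2)])
    have brA: "br P (F y) = y" "y \<in> Y" if "y \<in> A" for y
    proof -
      have "y \<in> P" using that A(2) RQ[OF P] by blast
      then show "br P (F y) = y" by (rule br_F[OF P])
      show "y \<in> Y" using that As by (auto simp: sets_\<nu>_iff)
    qed
    have m: "br P \<in> measurable (restrict_space \<nu> (F ` A)) \<nu>"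
    proof (rule measurableI)
      fix z assume "z \<in> space (restrict_space \<nu> (F ` A))"
      then obtain y where "y \<in> A" "z = F y" by (auto simp: space_restrict_space)
      then show "br P z \<in> space \<nu>" using brA[of y] by (simp add: space_\<nu>)
    next
      fix B assume B: "B \<in> sets \<nu>"
      have "br P -` B \<inter> F ` A = F ` (A \<inter> B)" using brA by force
      moreover have "F ` (A \<inter> B) \<in> sets \<nu>" using A(2) As B by (intro img[OF P]) auto
      ultimately show "br P -` B \<inter> space (restrict_space \<nu> (F ` A)) \<in> sets (restrict_space \<nu> (F ` A))"
        using FA sets.sets_into_space[OF FA] by (auto simp: sets_restrict_space_iff space_restrict_space Int_absorb2)
    qed
    have "(\<lambda>z. \<zeta> (br P z)) \<in> borel_measurable (restrict_space \<nu> (F ` A))" using measurable_compose[OF m \<zeta>_meas] .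
    then have mm: "(\<lambda>z. ennreal (\<zeta> (br P z)) * indicator (F ` A) z) \<in> borel_measurable \<nu>"
      using FA by (subst borel_measurable_restrict_space_iff_ennreal[symmetric]) (auto intro: measurable_compose)
    have "(\<integral>\<^sup>+z\<in>F ` A. ennreal (\<zeta> (br P z)) \<partial>\<nu>) = 0" using cv[OF P As A(2)] A(1) by auto
    then have "AE z in \<nu>. ennreal (\<zeta> (br P z)) * indicator (F ` A) z = 0" using nn_integral_0_iff_AE[OF mm] by simp
    moreover have "ennreal (\<zeta> (br P z)) \<noteq> 0" if z: "z \<in> F ` A" for z
    proof -
      obtain y where y: "y \<in> A" "z = F y" using z by auto
      then have "br P z = y" "y \<in> Y" using brA[of y] by auto
      then show ?thesis using \<zeta>_pos[of y] by simp
    qed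
    ultimately have "AE z in \<nu>. z \<notin> F ` A" by (auto elim!: eventually_mono simp: indicator_def split: if_splits)
    then show ?thesis using FA by (simp add: AE_iff_null_sets)
  qed
  have null_vimage: "F -` B \<inter> Y \<in> null_sets \<nu>" if B: "B \<in> null_sets \<nu>" for B
  proof -
    have m: "F -` B \<inter> Y \<in> sets \<nu>" using measurable_sets[OF F_Y, of B] B by (simp add: space_\<nu> null_setsD2)
    have "F -` B \<inter> R P \<in> null_sets \<nu>" if P: "P \<in> \<P>" for P
    proof -
      have RY: "R P \<subseteq> Y" using RP[OF P] sets_\<nu>_iff by auto
      then have A: "F -` B \<inter> R P \<in> sets \<nu>" using sets.Int[OF m, of "R P"] RP[OF P] by (simp add: Int_assoc Int_absorb1)
      have "F ` (F -` B \<inter> R P) \<in> null_sets \<nu>"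
        using B img[OF P A] by (intro null_sets_subset[OF B]) auto
      then have "emeasure \<nu> (F -` B \<inter> R P) = 0" using cv[OF P A] by (simp add: nn_integral_null_set)
      then show ?thesis using A by auto
    qed
    then have "(\<Union>P\<in>\<P>. F -` B \<inter> R P) \<union> (\<Union>P\<in>\<P>. P - R P) \<in> null_sets \<nu>"
      using part_count RQ_null by (intro null_sets.Un null_sets_UN') auto
    moreover have "F -` B \<inter> Y \<subseteq> (\<Union>P\<in>\<P>. F -` B \<inter> R P) \<union> (\<Union>P\<in>\<P>. P - R P)" using part_union by auto
    ultimately show ?thesis using m null_sets_subset by blast
  qed
  \<comment> \<open>Starts from the prescribed null set together with all defects of domain and of
    range.\<close>
  define B where "B = rec_nat (N \<union> (\<Union>P\<in>\<P>. P - R P) \<union> (\<Union>P\<in>\<P>. Y - Q P))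
     (\<lambda>_ b. b \<union> (F -` b \<inter> Y) \<union> (\<Union>P\<in>\<P>. F ` (b \<inter> R P)))"
  have B0: "B 0 = N \<union> (\<Union>P\<in>\<P>. P - R P) \<union> (\<Union>P\<in>\<P>. Y - Q P)"
    and BS: "\<And>n. B (Suc n) = B n \<union> (F -` B n \<inter> Y) \<union> (\<Union>P\<in>\<P>. F ` (B n \<inter> R P))" by (simp_all add: B_def)
  have Bn: "B n \<in> null_sets \<nu>" for n
  proof (induction n)
    case 0
    show ?case unfolding B0 using N part_count RQ_null
      by (intro null_sets.Un null_sets_UN') auto
  next
    case (Suc n)
    have "F ` (B n \<inter> R P) \<in> null_sets \<nu>" if "P \<in> \<P>" for P
      using RP[OF that] Suc by (intro null_img[OF that]) (auto intro: null_set_Int2)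
    then show ?case unfolding BS using Suc null_vimage part_count by (intro null_sets.Un null_sets_UN') auto
  qed
  define Z where "Z = Y - (\<Union>n. B n)"
  have Zs: "Z \<in> sets \<nu>" unfolding Z_def using Bn Y_\<nu> by auto
  have "(\<Union>n. B n) \<in> null_sets \<nu>" using Bn by (intro null_sets_UN) auto
  then have "Y - Z \<in> null_sets \<nu>" by (rule null_sets_subset) (use Zs Y_\<nu> in \<open>auto simp: Z_def\<close>)
  moreover have ZN: "Z \<inter> N = {}" using B0 by (auto simp: Z_def)
  moreover have ZR: "P \<inter> Z \<subseteq> R P" "Z \<subseteq> Q P" if "P \<in> \<P>" for P using B0 that by (auto simp: Z_def)
  moreover have "F ` Z \<subseteq> Z"
  proof
    fix z assume "z \<in> F ` Z"
    then obtain y where y: "y \<in> Y" "\<And>n. y \<notin> B n" "z = F y" by (auto simp: Z_def)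
    have "z \<notin> B n" for n using y(1,3) y(2)[of "Suc n"] by (auto simp: BS)
    then show "z \<in> Z" using y F_in_Y by (auto simp: Z_def)
  qed
  moreover have "Z \<subseteq> F ` (P \<inter> Z)" if P: "P \<in> \<P>" for P
  proof
    fix z assume z: "z \<in> Z"
    have "F ` R P = Q P" using RQ[OF P] by (simp add: bij_betw_def)
    then have "z \<in> F ` R P" using z ZR[OF P] by auto
    then obtain y where y: "y \<in> R P" "F y = z" by auto
    have "y \<notin> B n" for n
    proof
      assume "y \<in> B n"
      then have "z \<in> B (Suc n)" using y P by (auto simp: BS)
      then show False using z by (auto simp: Z_def)
    qed
    then have "y \<in> P \<inter> Z" using y RP[OF P] part_union P by (auto simp: Z_def)
    then show "z \<in> F ` (P \<inter> Z)" using y by auto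
  qed
  ultimately have "good Z" unfolding good_def
  proof (intro conjI ballI impI)
    fix P A assume *: "P \<in> \<P>" "A \<in> sets \<nu>" "A \<subseteq> P \<inter> Z"
    have "A \<subseteq> R P" by (rule order_trans[OF *(3) ZR(1)[OF *(1)]])
    then show "F ` A \<in> sets \<nu>" "emeasure \<nu> A = (\<integral>\<^sup>+z\<in>F ` A. ennreal (\<zeta> (br P z)) \<partial>\<nu>)"
      using img[OF *(1,2)] cv[OF *(1,2)] by auto
  qed (use Zs in simp_all)
  then show ?thesis using ZN by blast
qed

text \<open>The transfer operator of the reference measure. Values in \<open>ennreal\<close> make
  the sum over branches meaningful before anything is known about summability.\<close>

definition P0 :: "('m \<Rightarrow> ennreal) \<Rightarrow> 'm \<Rightarrow> ennreal" where
  "P0 w z = (\<integral>\<^sup>+P. ennreal (\<zeta> (br P z)) * w (br P z) \<partial>count_space \<P>)"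

context
  fixes Z assumes good: "good Z"
begin

lemma good_sets: "Z \<in> sets \<nu>" "Z \<subseteq> Y" "Z \<in> sets borel"
  using good by (auto simp: good_def sets_\<nu>_iff)

lemma good_Int: "Z \<inter> Y = Z" "Z \<inter> Y \<in> sets \<nu>"
  using good_sets by (auto simp: Int_absorb2)

lemma good_onto: "P \<in> \<P> \<Longrightarrow> Z \<subseteq> F ` (P \<inter> Z)"
  using good unfolding good_def by blast

lemma good_cv:
  assumes "P \<in> \<P>" "A \<in> sets \<nu>" "A \<subseteq> P \<inter> Z"
  shows "F ` A \<in> sets \<nu>" "emeasure \<nu> A = (\<integral>\<^sup>+z\<in>F ` A. ennreal (\<zeta> (br P z)) \<partial>\<nu>)"
  using good assms unfolding good_def by blast+

lemma good_F: "z \<in> Z \<Longrightarrow> F z \<in> Z"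
  using good by (auto simp: good_def)

lemma good_br: assumes "P \<in> \<P>" "z \<in> Z" shows "br P z \<in> P" "br P z \<in> Z" "F (br P z) = z"
proof -
  obtain y where "y \<in> P \<inter> Z" "F y = z" using good_onto[OF assms(1)] assms(2) by blast
  then show "br P z \<in> P" "br P z \<in> Z" "F (br P z) = z" using br_F[OF assms(1), of y] by auto
qed

abbreviation "\<nu>Z \<equiv> restrict_space \<nu> Z"

lemma space_\<nu>Z: "space \<nu>Z = Z"
  using good_sets by (simp add: space_restrict_space space_\<nu> Int_absorb2)

lemma sets_\<nu>Z_iff: "A \<in> sets \<nu>Z \<longleftrightarrow> A \<in> sets \<nu> \<and> A \<subseteq> Z"
  using good_sets good_Int by (subst sets_restrict_space_iff) (auto simp: space_\<nu>)

lemma emeasure_\<nu>Z: "A \<in> sets \<nu>Z \<Longrightarrow> emeasure \<nu>Z A = emeasure \<nu> A"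
  using good_Int by (subst emeasure_restrict_space) (auto simp: space_\<nu> sets_\<nu>Z_iff)

lemma sigma_finite_\<nu>Z: "sigma_finite_measure \<nu>Z"
  by (rule finite_measure.axioms(1)[OF finite_measure_restrict_space]) (use good_sets finite_\<nu> space_\<nu> in auto)

lemma F_meas_Z: "F \<in> measurable \<nu>Z \<nu>Z"
  by (rule measurable_restrict_space3[OF F_Y]) (use good_F in auto)

lemma br_meas: assumes P: "P \<in> \<P>" shows "br P \<in> measurable \<nu>Z \<nu>Z"
proof (rule measurableI)
  fix A assume A: "A \<in> sets \<nu>Z"
  have "br P -` A \<inter> space \<nu>Z = F ` (A \<inter> P)"
  proof (intro subset_antisym subsetI)
    fix z assume "z \<in> br P -` A \<inter> space \<nu>Z"
    then show "z \<in> F ` (A \<inter> P)" using good_br[OF P, of z] by (intro image_eqI[of _ F "br P z"]) (auto simp: space_\<nu>Z)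
  next
    fix z assume "z \<in> F ` (A \<inter> P)"
    then obtain y where "y \<in> A" "y \<in> P" "z = F y" by blast
    then show "z \<in> br P -` A \<inter> space \<nu>Z" using br_F[OF P, of y] good_F[of y] A by (auto simp: space_\<nu>Z sets_\<nu>Z_iff)
  qed
  moreover have "F ` (A \<inter> P) \<in> sets \<nu>" using A part_\<nu>[OF P] by (intro good_cv[OF P]) (auto simp: sets_\<nu>Z_iff)
  moreover have "F ` (A \<inter> P) \<subseteq> Z" using A good_F by (auto simp: sets_\<nu>Z_iff)
  ultimately show "br P -` A \<inter> space \<nu>Z \<in> sets \<nu>Z" by (simp add: sets_\<nu>Z_iff)
qed (use good_br[OF P] in \<open>auto simp: space_\<nu>Z\<close>)

lemma \<zeta>_meas_Z: "\<zeta> \<in> borel_measurable \<nu>Z"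
  using \<zeta>_meas by (rule measurable_restrict_space1)

text \<open>The hypothesis concerns sets only; read as an equality between a restricted measure and
  the image of a weighted one, it extends to all nonnegative functions.\<close>

lemma branch_change_of_variables:
  assumes P: "P \<in> \<P>" and w: "w \<in> borel_measurable \<nu>Z"
  shows "(\<integral>\<^sup>+z. w z * indicator P z \<partial>\<nu>Z) = (\<integral>\<^sup>+z. ennreal (\<zeta> (br P z)) * w (br P z) \<partial>\<nu>Z)"
proof -
  note [measurable] = br_meas[OF P] \<zeta>_meas_Z w
  have PZ[measurable]: "P \<inter> Z \<in> sets \<nu>Z" using part_\<nu>[OF P] good_sets by (auto simp: sets_\<nu>Z_iff)
  define D1 where "D1 = density \<nu>Z (\<lambda>z. indicator (P \<inter> Z) z)"
  define D2 where "D2 = distr (density \<nu>Z (\<lambda>z. ennreal (\<zeta> (br P z)))) \<nu>Z (br P)"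
  have "D1 = D2"
  proof (rule measure_eqI)
    show "sets D1 = sets D2" by (simp add: D1_def D2_def)
    fix A assume "A \<in> sets D1"
    then have A[measurable]: "A \<in> sets \<nu>Z" by (simp add: D1_def)
    have AP: "A \<inter> P \<in> sets \<nu>" "A \<inter> P \<subseteq> P \<inter> Z" using A part_\<nu>[OF P] by (auto simp: sets_\<nu>Z_iff)
    have "emeasure D1 A = (\<integral>\<^sup>+z. indicator (P \<inter> Z) z * indicator A z \<partial>\<nu>Z)"
      unfolding D1_def by (subst emeasure_density) auto
    also have "\<dots> = (\<integral>\<^sup>+z. indicator (A \<inter> P) z \<partial>\<nu>Z)"
      by (rule nn_integral_cong) (auto simp: indicator_def space_\<nu>Z)
    also have "\<dots> = emeasure \<nu> (A \<inter> P)" using AP by (subst nn_integral_indicator) (auto simp: sets_\<nu>Z_iff emeasure_\<nu>Z)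
    also have "\<dots> = (\<integral>\<^sup>+z\<in>F ` (A \<inter> P). ennreal (\<zeta> (br P z)) \<partial>\<nu>)" by (rule good_cv[OF P AP])
    also have "\<dots> = (\<integral>\<^sup>+z. ennreal (\<zeta> (br P z)) * indicator (F ` (A \<inter> P)) z * indicator Z z \<partial>\<nu>)"
      using AP good_F by (intro nn_integral_cong) (auto simp: indicator_def)
    also have "\<dots> = (\<integral>\<^sup>+z. ennreal (\<zeta> (br P z)) * indicator (F ` (A \<inter> P)) z \<partial>\<nu>Z)"
      using good_Int by (subst nn_integral_restrict_space) (auto simp: space_\<nu>)
    also have "\<dots> = (\<integral>\<^sup>+z. ennreal (\<zeta> (br P z)) * indicator A (br P z) \<partial>\<nu>Z)"
    proof (rule nn_integral_cong)
      fix z assume "z \<in> space \<nu>Z"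
      then have z: "z \<in> Z" by (simp add: space_\<nu>Z)
      have "z \<in> F ` (A \<inter> P) \<longleftrightarrow> br P z \<in> A" using good_br[OF P z] br_F[OF P] by (auto intro!: image_eqI[of _ F "br P z"])
      then show "ennreal (\<zeta> (br P z)) * indicator (F ` (A \<inter> P)) z = ennreal (\<zeta> (br P z)) * indicator A (br P z)"
        by (auto simp: indicator_def)
    qed
    also have "\<dots> = (\<integral>\<^sup>+z. indicator A z \<partial>D2)" unfolding D2_def
      by (subst nn_integral_distr) (auto simp: nn_integral_density)
    also have "\<dots> = emeasure D2 A" by (subst nn_integral_indicator) (auto simp: D2_def)
    finally show "emeasure D1 A = emeasure D2 A" .
  qed
  moreover have "(\<integral>\<^sup>+z. w z \<partial>D1) = (\<integral>\<^sup>+z. w z * indicator P z \<partial>\<nu>Z)"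
    unfolding D1_def by (subst nn_integral_density) (auto intro!: nn_integral_cong simp: indicator_def space_\<nu>Z)
  moreover have "(\<integral>\<^sup>+z. w z \<partial>D2) = (\<integral>\<^sup>+z. ennreal (\<zeta> (br P z)) * w (br P z) \<partial>\<nu>Z)"
    unfolding D2_def by (subst nn_integral_distr) (auto simp: nn_integral_density)
  ultimately show ?thesis by simp
qed

lemma joint_branch_measurable:
  assumes w: "w \<in> borel_measurable \<nu>Z"
  shows "(\<lambda>x. ennreal (\<zeta> (br (snd x) (fst x))) * w (br (snd x) (fst x))) \<in> borel_measurable (\<nu>Z \<Otimes>\<^sub>M count_space \<P>)"
proof (rule measurable_compose_countable'[OF _ measurable_snd part_count,
    where f = "\<lambda>P x. ennreal (\<zeta> (br P (fst x))) * w (br P (fst x))"])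
  fix P assume "P \<in> \<P>"
  note [measurable] = br_meas[OF this] \<zeta>_meas_Z w
  show "(\<lambda>x. ennreal (\<zeta> (br P (fst x))) * w (br P (fst x))) \<in> borel_measurable (\<nu>Z \<Otimes>\<^sub>M count_space \<P>)"
    by measurable
qed

lemma P0_meas: "w \<in> borel_measurable \<nu>Z \<Longrightarrow> P0 w \<in> borel_measurable \<nu>Z"
proof -
  interpret J: sigma_finite_measure "count_space \<P>" by (rule sigma_finite_measure_count_space_countable[OF part_count])
  assume "w \<in> borel_measurable \<nu>Z"
  from joint_branch_measurable[OF this] show ?thesis
    unfolding P0_def by (intro J.borel_measurable_nn_integral) (simp add: case_prod_beta')
qed

lemma sum_indicator_partition:
  assumes "y \<in> Y"
  shows "(\<integral>\<^sup>+P. c * indicator P y \<partial>count_space \<P>) = (c :: ennreal)"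
proof -
  obtain Q where Q: "Q \<in> \<P>" "y \<in> Q" using assms part_union by auto
  have "(\<integral>\<^sup>+P. c * indicator P y \<partial>count_space \<P>) = (\<integral>\<^sup>+P. c * indicator {Q} P \<partial>count_space \<P>)"
  proof (rule nn_integral_cong)
    fix P assume "P \<in> space (count_space \<P>)"
    then have "y \<in> P \<longleftrightarrow> P = Q" using Q part_disj by (auto simp: disjoint_def)
    then show "c * indicator P y = c * indicator {Q} P" by (auto simp: indicator_def)
  qed
  also have "\<dots> = c" using Q by (simp add: nn_integral_cmult_indicator)
  finally show ?thesis .
qed

text \<open>Summing the change of variables over the cells reassembles the integral over
  \<open>Y\<close>; Tonelli's theorem exchanges sum and integral on both sides.\<close>

lemma P0_integral:
  assumes w: "w \<in> borel_measurable \<nu>Z"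
  shows "(\<integral>\<^sup>+z. P0 w z \<partial>\<nu>Z) = (\<integral>\<^sup>+z. w z \<partial>\<nu>Z)"
proof -
  interpret J: sigma_finite_measure "count_space \<P>" by (rule sigma_finite_measure_count_space_countable[OF part_count])
  interpret n: sigma_finite_measure \<nu>Z by (rule sigma_finite_\<nu>Z)
  interpret pair_sigma_finite \<nu>Z "count_space \<P>" ..
  have m2: "(\<lambda>x. w (fst x) * indicator (snd x) (fst x)) \<in> borel_measurable (\<nu>Z \<Otimes>\<^sub>M count_space \<P>)"
  proof (rule measurable_compose_countable'[OF _ measurable_snd part_count, where f = "\<lambda>P x. w (fst x) * indicator P (fst x)"])
    fix P assume P: "P \<in> \<P>"
    have "P \<inter> Z \<in> sets \<nu>Z" using part_\<nu>[OF P] good_sets by (auto simp: sets_\<nu>Z_iff)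
    then have [measurable]: "indicator P \<in> borel_measurable \<nu>Z" by (intro borel_measurable_indicator') (simp add: space_\<nu>Z vimage_def Int_commute Collect_conj_eq[symmetric] Int_def conj_commute)
    note [measurable] = w
    show "(\<lambda>x. w (fst x) * indicator P (fst x)) \<in> borel_measurable (\<nu>Z \<Otimes>\<^sub>M count_space \<P>)" by measurable
  qed
  have "(\<integral>\<^sup>+z. P0 w z \<partial>\<nu>Z) = (\<integral>\<^sup>+P. (\<integral>\<^sup>+z. ennreal (\<zeta> (br P z)) * w (br P z) \<partial>\<nu>Z) \<partial>count_space \<P>)"
    unfolding P0_def by (rule Fubini'[symmetric]) (use joint_branch_measurable[OF w] in \<open>simp add: case_prod_beta'\<close>)
  also have "\<dots> = (\<integral>\<^sup>+P. (\<integral>\<^sup>+z. w z * indicator P z \<partial>\<nu>Z) \<partial>count_space \<P>)"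
    by (rule nn_integral_cong) (simp add: branch_change_of_variables w)
  also have "\<dots> = (\<integral>\<^sup>+z. (\<integral>\<^sup>+P. w z * indicator P z \<partial>count_space \<P>) \<partial>\<nu>Z)"
    by (rule Fubini') (use m2 in \<open>simp add: case_prod_beta'\<close>)
  also have "\<dots> = (\<integral>\<^sup>+z. w z \<partial>\<nu>Z)"
    by (rule nn_integral_cong) (use good_sets in \<open>auto simp: space_\<nu>Z sum_indicator_partition\<close>)
  finally show ?thesis .
qed

lemma P0_mono: "(\<And>y. y \<in> Z \<Longrightarrow> u y \<le> v y) \<Longrightarrow> z \<in> Z \<Longrightarrow> P0 u z \<le> P0 v z"
  unfolding P0_def by (intro nn_integral_mono mult_left_mono) (auto simp: good_br)

lemma P0_add: "P0 (\<lambda>y. u y + v y) z = P0 u z + P0 v z"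
  unfolding P0_def by (subst nn_integral_add[symmetric]) (auto simp: distrib_left)

lemma P0_funpow_meas: "w \<in> borel_measurable \<nu>Z \<Longrightarrow> (P0 ^^ n) w \<in> borel_measurable \<nu>Z"
  by (induction n) (auto simp: P0_meas)

lemma P0_funpow_integral: "w \<in> borel_measurable \<nu>Z \<Longrightarrow> (\<integral>\<^sup>+z. (P0 ^^ n) w z \<partial>\<nu>Z) = (\<integral>\<^sup>+z. w z \<partial>\<nu>Z)"
  by (induction n) (auto simp: P0_integral P0_funpow_meas)

lemma P0_funpow_mono: "(\<And>y. y \<in> Z \<Longrightarrow> u y \<le> v y) \<Longrightarrow> z \<in> Z \<Longrightarrow> (P0 ^^ n) u z \<le> (P0 ^^ n) v z"
  by (induction n arbitrary: z) (auto intro: P0_mono)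

lemma P0_funpow_add: "(P0 ^^ n) (\<lambda>y. u y + v y) z = (P0 ^^ n) u z + (P0 ^^ n) v z"
proof -
  have "(P0 ^^ n) (\<lambda>y. u y + v y) = (\<lambda>z. (P0 ^^ n) u z + (P0 ^^ n) v z)"
  proof (induction n)
    case (Suc n)
    show ?case by (rule ext) (simp add: Suc P0_add)
  qed simp
  then show ?thesis by simp
qed

lemma nn_integral_\<nu>Z:
  assumes "w \<in> borel_measurable \<nu>"
  shows "(\<integral>\<^sup>+z. w z \<partial>\<nu>Z) = (\<integral>\<^sup>+z. w z \<partial>\<nu>)"
proof -
  have "(\<integral>\<^sup>+z. w z \<partial>\<nu>Z) = (\<integral>\<^sup>+z. w z * indicator Z z \<partial>\<nu>)"
    using good_Int by (subst nn_integral_restrict_space) (auto simp: space_\<nu>)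
  also have "\<dots> = (\<integral>\<^sup>+z. w z \<partial>\<nu>)"
  proof (rule nn_integral_cong_AE)
    have "Y - Z \<in> null_sets \<nu>" using good by (simp add: good_def)
    then have "AE z in \<nu>. z \<notin> Y - Z" by (rule AE_not_in)
    then show "AE z in \<nu>. w z * indicator Z z = w z" using AE_space by eventually_elim (auto simp: space_\<nu>)
  qed
  finally show ?thesis .
qed

end

end

section \<open>Cylinders and approximation by cylinder functions\<close>

context full_branch
begin

definition same_cyl :: "nat \<Rightarrow> 'm \<Rightarrow> 'm \<Rightarrow> bool" where
  "same_cyl n y y' \<longleftrightarrow> (\<forall>k<n. \<exists>P\<in>\<P>. (F ^^ k) y \<in> P \<and> (F ^^ k) y' \<in> P)"

lemma same_cyl_0 [simp]: "same_cyl 0 y y'"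
  by (simp add: same_cyl_def)

lemma same_cyl_sym: "same_cyl n y y' \<Longrightarrow> same_cyl n y' y"
  by (auto simp: same_cyl_def)

lemma same_cyl_trans: "same_cyl n y y' \<Longrightarrow> same_cyl n y' y'' \<Longrightarrow> same_cyl n y y''"
  unfolding same_cyl_def
proof (intro allI impI)
  fix k assume k: "k < n" and *: "\<forall>k<n. \<exists>P\<in>\<P>. (F ^^ k) y \<in> P \<and> (F ^^ k) y' \<in> P" "\<forall>k<n. \<exists>P\<in>\<P>. (F ^^ k) y' \<in> P \<and> (F ^^ k) y'' \<in> P"
  from * k obtain P Q where PQ: "P \<in> \<P>" "Q \<in> \<P>" "(F ^^ k) y \<in> P" "(F ^^ k) y' \<in> P" "(F ^^ k) y' \<in> Q" "(F ^^ k) y'' \<in> Q"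
    by meson
  then have "P = Q" using part_disj by (auto simp: disjoint_def)
  then show "\<exists>P\<in>\<P>. (F ^^ k) y \<in> P \<and> (F ^^ k) y'' \<in> P" using PQ by blast
qed

lemma same_cyl_mono: "m \<le> n \<Longrightarrow> same_cyl n y y' \<Longrightarrow> same_cyl m y y'"
  by (auto simp: same_cyl_def)

lemma same_cyl_Suc: "same_cyl (Suc n) y y' \<longleftrightarrow> (\<exists>P\<in>\<P>. y \<in> P \<and> y' \<in> P) \<and> same_cyl n (F y) (F y')"
  unfolding same_cyl_def by (subst All_less_Suc2) (simp add: funpow_swap1)

lemma same_cyl_expand: "same_cyl n y y' \<Longrightarrow> lam ^ n * dist y y' \<le> dist ((F ^^ n) y) ((F ^^ n) y')"
proof (induction n arbitrary: y y')
  case (Suc n)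
  then obtain P where P: "P \<in> \<P>" "y \<in> P" "y' \<in> P" and s: "same_cyl n (F y) (F y')" by (auto simp: same_cyl_Suc)
  have "lam ^ Suc n * dist y y' = lam ^ n * (lam * dist y y')" by simp
  also have "\<dots> \<le> lam ^ n * dist (F y) (F y')" using expanding[OF P] lam by (intro mult_left_mono) auto
  also have "\<dots> \<le> dist ((F ^^ Suc n) y) ((F ^^ Suc n) y')" using Suc.IH[OF s] by (simp add: funpow_swap1)
  finally show ?case .
qed simp

text \<open>The factor by which \<open>dist powr \<eta>\<close> shrinks under each inverse
  branch.\<close>

definition r where "r = lam powr (- \<eta>)"

lemma r: "0 < r" "r < 1"
  using lam \<eta> by (auto simp: r_def powr_less_one)

lemma same_cyl_dist_powr:
  assumes "same_cyl n y y'"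
  shows "dist y y' powr \<eta> \<le> r ^ n * dist ((F ^^ n) y) ((F ^^ n) y') powr \<eta>"
proof -
  have "dist y y' \<le> inverse (lam ^ n) * dist ((F ^^ n) y) ((F ^^ n) y')"
    using same_cyl_expand[OF assms] lam by (simp add: field_simps)
  then have "dist y y' powr \<eta> \<le> (inverse (lam ^ n) * dist ((F ^^ n) y) ((F ^^ n) y')) powr \<eta>"
    using \<eta> by (intro powr_mono2) auto
  also have "\<dots> = inverse (lam ^ n) powr \<eta> * dist ((F ^^ n) y) ((F ^^ n) y') powr \<eta>"
    using lam by (simp add: powr_mult)
  also have "inverse (lam ^ n) powr \<eta> = r ^ n"
  proof -
    have "inverse (lam ^ n) = lam powr (- real n)" using lam by (simp add: powr_minus powr_realpow)
    then have "inverse (lam ^ n) powr \<eta> = lam powr (- \<eta> * real n)" by (simp add: powr_powr mult.commute)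
    also have "\<dots> = r ^ n" using lam r by (simp add: powr_realpow[symmetric] r_def powr_powr)
    finally show ?thesis .
  qed
  finally show ?thesis .
qed

lemma same_cyl_dist_powr_le:
  assumes "same_cyl n y y'" shows "dist y y' powr \<eta> \<le> D powr \<eta> * r ^ n"
proof -
  have "r ^ n * dist ((F ^^ n) y) ((F ^^ n) y') powr \<eta> \<le> r ^ n * D powr \<eta>"
    using D r \<eta> by (intro mult_left_mono powr_mono2) auto
  then show ?thesis using same_cyl_dist_powr[OF assms] by (simp add: mult.commute)
qed

lemma funpow_Y: "y \<in> Y \<Longrightarrow> (F ^^ k) y \<in> Y"
  by (induction k) (auto simp: F_in_Y)

definition cyl :: "nat \<Rightarrow> 'm \<Rightarrow> 'm set" where
  "cyl n y = {y'\<in>Y. same_cyl n y y'}"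

lemma cyl_refl: "y \<in> Y \<Longrightarrow> y \<in> cyl n y"
proof -
  assume y: "y \<in> Y"
  have "\<exists>P\<in>\<P>. (F ^^ k) y \<in> P" for k using funpow_Y[OF y, of k] unfolding part_union[symmetric] by blast
  then show ?thesis using y by (simp add: cyl_def same_cyl_def)
qed

lemma countable_measurable_cyl: "countable (cyl n ` Y) \<and> (\<forall>y\<in>Y. cyl n y \<in> sets \<nu>)"
proof (induction n)
  case 0
  have "cyl 0 ` Y \<subseteq> {Y}" by (auto simp: cyl_def)
  then have "countable (cyl 0 ` Y)" by (rule countable_subset) simp
  then show ?case using Y_\<nu> by (simp add: cyl_def)
next
  case (Suc n)
  have eq: "cyl (Suc n) y = P \<inter> (F -` cyl n (F y) \<inter> Y)" if P: "P \<in> \<P>" "y \<in> P" for y P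
  proof -
    have "(\<exists>Q\<in>\<P>. y \<in> Q \<and> y' \<in> Q) \<longleftrightarrow> y' \<in> P" for y' using P part_disj by (auto simp: disjoint_def)
    then show ?thesis using F_in_Y P part_union by (auto simp: cyl_def same_cyl_Suc)
  qed
  have "cyl (Suc n) ` Y \<subseteq> (\<lambda>(P, c). P \<inter> (F -` c \<inter> Y)) ` (\<P> \<times> cyl n ` Y)"
  proof
    fix c assume "c \<in> cyl (Suc n) ` Y"
    then obtain y P where "y \<in> Y" "c = cyl (Suc n) y" "P \<in> \<P>" "y \<in> P" using part_union by auto
    then show "c \<in> (\<lambda>(P, c). P \<inter> (F -` c \<inter> Y)) ` (\<P> \<times> cyl n ` Y)"
      using eq[of P y] F_in_Y[of y] by (intro image_eqI[of _ _ "(P, cyl n (F y))"]) auto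
  qed
  then have c: "countable (cyl (Suc n) ` Y)"
    by (rule countable_subset) (intro countable_image countable_SIGMA part_count conjunct1[OF Suc.IH])
  have "cyl (Suc n) y \<in> sets \<nu>" if y: "y \<in> Y" for y
  proof -
  from y obtain P where P: "P \<in> \<P>" "y \<in> P" using part_union by auto
  have "F -` cyl n (F y) \<inter> Y \<in> sets \<nu>" using measurable_sets[OF F_Y conjunct2[OF Suc.IH, rule_format, OF F_in_Y[OF y]]] by (simp add: space_\<nu>)
  then show ?thesis unfolding eq[OF P] using part_\<nu>[OF P(1)] by auto
  qed
  then show ?case using c by blast
qed

lemmas countable_cyl = countable_measurable_cyl[THEN conjunct1]
lemmas cyl_sets = countable_measurable_cyl[THEN conjunct2, rule_format]

text \<open>Unions of \<open>n\<close>-cylinders in \<open>Y\<close>. There are countably many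
  cylinders, so all of these sets are measurable.\<close>

definition sat :: "nat \<Rightarrow> 'm set \<Rightarrow> bool" where
  "sat n E \<longleftrightarrow> E \<subseteq> Y \<and> (\<forall>y\<in>E. \<forall>y'\<in>Y. same_cyl n y y' \<longrightarrow> y' \<in> E)"

lemma sat_sets: assumes "sat n E" shows "E \<in> sets \<nu>"
proof -
  have "E = \<Union>(cyl n ` E)"
  proof
    show "E \<subseteq> \<Union>(cyl n ` E)" using assms cyl_refl by (auto simp: sat_def)
    show "\<Union>(cyl n ` E) \<subseteq> E" using assms by (auto simp: sat_def cyl_def)
  qed
  moreover have "countable (cyl n ` E)"
    using countable_cyl[of n] assms by (meson countable_subset image_mono sat_def)
  moreover have "c \<in> sets \<nu>" if "c \<in> cyl n ` E" for c using that assms cyl_sets by (auto simp: sat_def)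
  ultimately show ?thesis using sets.countable_Union[of "cyl n ` E" \<nu>] by auto
qed

lemma sat_mono: "sat m E \<Longrightarrow> m \<le> n \<Longrightarrow> sat n E"
  by (auto simp: sat_def dest: same_cyl_mono)

lemma sat_compl: "sat n E \<Longrightarrow> sat n (Y - E)"
  by (auto simp: sat_def dest: same_cyl_sym)

lemma sat_UN: "(\<And>i. i \<in> I \<Longrightarrow> sat n (E i)) \<Longrightarrow> sat n (\<Union>i\<in>I. E i)"
  unfolding sat_def by blast

definition approximable :: "'m set \<Rightarrow> bool" where
  "approximable E \<longleftrightarrow> (\<forall>e>0. \<exists>n E'. sat n E' \<and> measure \<nu> ((E - E') \<union> (E' - E)) < e)"

text \<open>The \<open>n\<close>-cylinders contained in an open set exhaust it as \<open>n\<close>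
  grows, because expansion makes the cylinder diameters at most \<open>D / lam ^ n\<close>.\<close>

lemma approximable_open:
  assumes U: "open U" shows "approximable (U \<inter> Y)"
  unfolding approximable_def
proof (intro allI impI)
  fix e :: real assume e: "e > 0"
  define V where "V n = {y\<in>Y. \<forall>y'\<in>Y. same_cyl n y y' \<longrightarrow> y' \<in> U}" for n
  have sV: "sat n (V n)" for n unfolding sat_def V_def by (auto dest: same_cyl_trans)
  have Vm: "V n \<in> sets \<nu>" for n using sat_sets[OF sV] .
  have VU: "V n \<subseteq> U \<inter> Y" for n using cyl_refl by (auto simp: V_def cyl_def)
  have inc: "incseq V"
    unfolding V_def by (rule incseq_SucI) (use same_cyl_mono[OF le_SucI[OF order_refl]] in blast)
  have "(\<Union>n. V n) = U \<inter> Y"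
  proof (intro subset_antisym subsetI)
    fix y assume y: "y \<in> U \<inter> Y"
    then obtain \<epsilon> where \<epsilon>: "\<epsilon> > 0" "ball y \<epsilon> \<subseteq> U" using U open_contains_ball by blast
    have "(\<lambda>n. inverse lam ^ n * D) \<longlonglongrightarrow> 0 * D" using lam by (intro tendsto_intros LIMSEQ_realpow_zero) (auto simp: inverse_less_1_iff)
    then have "eventually (\<lambda>n. inverse lam ^ n * D < \<epsilon>) sequentially" using \<epsilon> by (intro order_tendstoD(2)) auto
    then obtain n where n: "inverse lam ^ n * D < \<epsilon>" by (auto simp: eventually_sequentially)
    have "y' \<in> U" if "same_cyl n y y'" for y'
    proof -
      have "lam ^ n * dist y y' \<le> D" using same_cyl_expand[OF that] D order_trans by blast
      then have "dist y y' \<le> inverse lam ^ n * D" using lam by (simp add: field_simps power_inverse)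
      then show ?thesis using n \<epsilon> by (auto simp: subset_iff)
    qed
    then show "y \<in> (\<Union>n. V n)" using y by (auto simp: V_def)
  qed (use VU in auto)
  then have "(\<lambda>n. measure \<nu> (V n)) \<longlonglongrightarrow> measure \<nu> (U \<inter> Y)"
    using finite_Lim_measure_incseq[OF _ inc] Vm by auto
  then have "eventually (\<lambda>n. measure \<nu> (U \<inter> Y) - e < measure \<nu> (V n)) sequentially" using e by (intro order_tendstoD(1)) auto
  then obtain n where n: "measure \<nu> (U \<inter> Y) - e < measure \<nu> (V n)" by (auto simp: eventually_sequentially)
  have UY: "U \<inter> Y \<in> sets \<nu>" using U Y by (auto simp: sets_\<nu>_iff)
  have "(U \<inter> Y - V n) \<union> (V n - U \<inter> Y) = U \<inter> Y - V n" using VU by auto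
  then have "measure \<nu> ((U \<inter> Y - V n) \<union> (V n - U \<inter> Y)) = measure \<nu> (U \<inter> Y) - measure \<nu> (V n)"
    using VU UY Vm by (simp add: finite_measure_Diff)
  then show "\<exists>n E'. sat n E' \<and> measure \<nu> ((U \<inter> Y - E') \<union> (E' - U \<inter> Y)) < e" using n sV by (intro exI[of _ n] exI[of _ "V n"]) auto
qed

text \<open>Half of the error pays for cutting the union at finitely many sets, half for
  approximating each of these. The sum of their levels serves as a common level. Disjointness is not
  assumed, so the lemma fits an induction over the generated sigma-algebra.\<close>

lemma approximable_UN:
  fixes E :: "nat \<Rightarrow> 'm set"
  assumes E: "\<And>i. E i \<in> sets \<nu>" and ap: "\<And>i. approximable (E i)"
  shows "approximable (\<Union>i. E i)"
  unfolding approximable_def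
proof (intro allI impI)
  fix e :: real assume e: "e > 0"
  define A where "A n = (\<Union>i<n. E i)" for n
  have inc: "incseq A" unfolding incseq_def A_def by (intro allI impI UN_mono) auto
  have Am: "A n \<in> sets \<nu>" for n using E by (auto simp: A_def)
  have UA: "(\<Union>n. A n) = (\<Union>i. E i)" by (auto simp: A_def)
  have "(\<lambda>n. measure \<nu> (A n)) \<longlonglongrightarrow> measure \<nu> (\<Union>i. E i)"
    using finite_Lim_measure_incseq[OF _ inc] Am UA by auto
  then have "eventually (\<lambda>n. measure \<nu> (\<Union>i. E i) - e / 2 < measure \<nu> (A n)) sequentially" using e by (intro order_tendstoD(1)) auto
  then obtain k where k: "measure \<nu> (\<Union>i. E i) - e / 2 < measure \<nu> (A k)" by (auto simp: eventually_sequentially)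
  define e' where "e' = e / (2 * (real k + 1))"
  have e': "e' > 0" "real k * e' < e / 2" using e by (auto simp: e'_def field_simps)
  have "\<forall>i. \<exists>n E'. sat n E' \<and> measure \<nu> ((E i - E') \<union> (E' - E i)) < e'" using ap e' by (auto simp: approximable_def)
  then obtain n E' where nE: "\<And>i. sat (n i) (E' i)" "\<And>i. measure \<nu> ((E i - E' i) \<union> (E' i - E i)) < e'" by metis
  define m where "m = (\<Sum>i<k. n i)"
  have "sat m (\<Union>i<k. E' i)"
    by (intro sat_UN sat_mono[OF nE(1)]) (auto simp: m_def intro!: member_le_sum)
  moreover have "measure \<nu> (((\<Union>i. E i) - (\<Union>i<k. E' i)) \<union> ((\<Union>i<k. E' i) - (\<Union>i. E i))) < e"
  proof -
    have E'm: "E' i \<in> sets \<nu>" for i using sat_sets[OF nE(1)] .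
    have "((\<Union>i. E i) - (\<Union>i<k. E' i)) \<union> ((\<Union>i<k. E' i) - (\<Union>i. E i))
       \<subseteq> ((\<Union>i. E i) - A k) \<union> (\<Union>i<k. (E i - E' i) \<union> (E' i - E i))" by (auto simp: A_def)
    then have "measure \<nu> (((\<Union>i. E i) - (\<Union>i<k. E' i)) \<union> ((\<Union>i<k. E' i) - (\<Union>i. E i)))
       \<le> measure \<nu> (((\<Union>i. E i) - A k) \<union> (\<Union>i<k. (E i - E' i) \<union> (E' i - E i)))"
      using E E'm Am by (intro finite_measure_mono) auto
    also have "\<dots> \<le> measure \<nu> ((\<Union>i. E i) - A k) + measure \<nu> (\<Union>i<k. (E i - E' i) \<union> (E' i - E i))"
      using E E'm Am by (intro measure_Un_le) auto
    also have "measure \<nu> ((\<Union>i. E i) - A k) = measure \<nu> (\<Union>i. E i) - measure \<nu> (A k)"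
      using E Am[of k] by (intro finite_measure_Diff) (auto simp: A_def)
    also have "\<dots> + measure \<nu> (\<Union>i<k. (E i - E' i) \<union> (E' i - E i))
        \<le> (measure \<nu> (\<Union>i. E i) - measure \<nu> (A k)) + (\<Sum>i<k. measure \<nu> ((E i - E' i) \<union> (E' i - E i)))"
      using E E'm by (intro add_left_mono measure_UNION_le) auto
    also have "\<dots> \<le> (measure \<nu> (\<Union>i. E i) - measure \<nu> (A k)) + (\<Sum>i<k. e')"
      using nE(2) by (intro add_left_mono sum_mono less_imp_le) auto
    also have "\<dots> < e" using k e' by simp
    finally show ?thesis .
  qed
  ultimately show "\<exists>n E''. sat n E'' \<and> measure \<nu> (((\<Union>i. E i) - E'') \<union> (E'' - (\<Union>i. E i))) < e" by (intro exI conjI)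
qed

lemma approximable_sets: assumes "E \<in> sets \<nu>" shows "approximable E"
proof -
  have E: "E \<in> sigma_sets UNIV {S. open S}" "E \<subseteq> Y" using assms by (auto simp: sets_\<nu>_iff borel_def)
  have "approximable (E \<inter> Y)" using E(1)
  proof induction
    case (Basic a) then show ?case using approximable_open by auto
  next
    case Empty
    show ?case unfolding approximable_def by (intro allI impI exI[of _ 0] exI[of _ "{}"]) (auto simp: sat_def)
  next
    case (Compl a)
    have eq: "(UNIV - a) \<inter> Y = Y - a \<inter> Y" by auto
    show ?case unfolding eq approximable_def
    proof (intro allI impI)
      fix e :: real assume "e > 0"
      then obtain n E' where *: "sat n E'" "measure \<nu> ((a \<inter> Y - E') \<union> (E' - a \<inter> Y)) < e" using Compl.IH by (auto simp: approximable_def)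
      have "(Y - a \<inter> Y - (Y - E')) \<union> (Y - E' - (Y - a \<inter> Y)) = (a \<inter> Y - E') \<union> (E' - a \<inter> Y)"
        using *(1) by (auto simp: sat_def)
      then show "\<exists>n E'. sat n E' \<and> measure \<nu> ((Y - a \<inter> Y - E') \<union> (E' - (Y - a \<inter> Y))) < e"
        using * sat_compl by (intro exI[of _ n] exI[of _ "Y - E'"]) auto
    qed
  next
    case (Union a)
    have "a i \<in> sets borel" for i using Union.hyps by (simp add: borel_def)
    then have "a i \<inter> Y \<in> sets \<nu>" for i using Y by (auto simp: sets_\<nu>_iff)
    from approximable_UN[OF this Union.IH] have "approximable (\<Union>i. a i \<inter> Y)" .
    moreover have "(\<Union>i. a i \<inter> Y) = (\<Union>i. a i) \<inter> Y" by auto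
    ultimately show ?case by simp
  qed
  then show ?thesis using E(2) by (simp add: Int_absorb2)
qed

text \<open>Two-sided domination replaces the \<open>L\<^sup>1\<close> distance, so that everything stays in \<open>ennreal\<close>.\<close>

definition approximates :: "nat \<Rightarrow> ('m \<Rightarrow> ennreal) \<Rightarrow> ('m \<Rightarrow> ennreal) \<Rightarrow> ('m \<Rightarrow> ennreal) \<Rightarrow> bool" where
  "approximates n w e u \<longleftrightarrow> w \<in> borel_measurable \<nu> \<and> e \<in> borel_measurable \<nu> \<and>
     (\<forall>y\<in>Y. \<forall>y'\<in>Y. same_cyl n y y' \<longrightarrow> w y = w y') \<and>
     (\<forall>y\<in>Y. u y \<le> w y + e y \<and> w y \<le> u y + e y)"

definition approximable_fn :: "('m \<Rightarrow> ennreal) \<Rightarrow> bool" where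
  "approximable_fn u \<longleftrightarrow> (\<forall>\<epsilon>>0. \<exists>n w e. approximates n w e u \<and> (\<integral>\<^sup>+y. e y \<partial>\<nu>) \<le> ennreal \<epsilon>)"

text \<open>Cylinder functions are dense in \<open>L^1\<close>. For an increasing supremum one
  member with nearly the full integral is approximated, and its distance to the supremum is added to
  the error function; finiteness of the integral is what makes that distance small.\<close>

lemma approximable_fn_integrable:
  assumes "u \<in> borel_measurable \<nu>" "(\<integral>\<^sup>+y. u y \<partial>\<nu>) < \<infinity>"
  shows "approximable_fn u"
  using assms
proof (induction rule: borel_measurable_induct)
  case (cong f g)
  then have "approximable_fn g" using nn_integral_cong[of \<nu> f g] by auto
  then show ?case using cong(3) unfolding approximable_fn_def approximates_def by (simp add: space_\<nu>)
next
  case (set A)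
  show ?case unfolding approximable_fn_def
  proof (intro allI impI)
    fix \<epsilon> :: real assume "\<epsilon> > 0"
    then obtain n E' where E': "sat n E'" "measure \<nu> ((A - E') \<union> (E' - A)) < \<epsilon>"
      using approximable_sets[OF set(1)] by (auto simp: approximable_def)
    note [measurable] = set(1) sat_sets[OF E'(1)]
    have "(\<integral>\<^sup>+y. indicator ((A - E') \<union> (E' - A)) y \<partial>\<nu>) = ennreal (measure \<nu> ((A - E') \<union> (E' - A)))"
      by (subst nn_integral_indicator) (auto simp: emeasure_eq_measure)
    then have "(\<integral>\<^sup>+y. indicator ((A - E') \<union> (E' - A)) y \<partial>\<nu>) \<le> ennreal \<epsilon>" using E'(2) by (simp add: ennreal_leI)
    moreover have "indicator E' y = (indicator E' y' :: ennreal)" if "y \<in> Y" "y' \<in> Y" "same_cyl n y y'" for y y'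
    proof -
      have "y \<in> E' \<longleftrightarrow> y' \<in> E'" using E'(1) that same_cyl_sym[OF that(3)] unfolding sat_def by blast
      then show ?thesis by (simp add: indicator_def)
    qed
    moreover have "(indicator A y :: ennreal) \<le> indicator E' y + indicator ((A - E') \<union> (E' - A)) y \<and>
        (indicator E' y :: ennreal) \<le> indicator A y + indicator ((A - E') \<union> (E' - A)) y" for y
      by (auto simp: indicator_def)
    moreover have "(indicator E' :: 'm \<Rightarrow> ennreal) \<in> borel_measurable \<nu>"
      "(indicator ((A - E') \<union> (E' - A)) :: 'm \<Rightarrow> ennreal) \<in> borel_measurable \<nu>" by measurable
    ultimately have "approximates n (indicator E') (indicator ((A - E') \<union> (E' - A))) (indicator A) \<and>
        (\<integral>\<^sup>+y. indicator ((A - E') \<union> (E' - A)) y \<partial>\<nu>) \<le> ennreal \<epsilon>"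
      unfolding approximates_def by blast
    then show "\<exists>n w e. approximates n w e (indicator A) \<and> (\<integral>\<^sup>+y. e y \<partial>\<nu>) \<le> ennreal \<epsilon>" by blast
  qed
next
  case (mult u c)
  show ?case
  proof (cases "c = 0")
    case True
    have "approximable_fn (\<lambda>y. 0)" unfolding approximable_fn_def approximates_def by (intro allI impI exI[of _ 0] exI[of _ "\<lambda>_. 0"]) auto
    then show ?thesis using True by simp
  next
    case False
    define c' where "c' = enn2real c"
    have c': "c = ennreal c'" "c' > 0" using mult(1) False by (auto simp: c'_def ennreal_enn2real_if enn2real_positive_iff less_top[symmetric] zero_less_iff_neq_zero)
    have "(\<integral>\<^sup>+y. c * u y \<partial>\<nu>) = c * (\<integral>\<^sup>+y. u y \<partial>\<nu>)" using mult by (intro nn_integral_cmult) auto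
    then have "(\<integral>\<^sup>+y. u y \<partial>\<nu>) < \<infinity>" using mult.prems False by (auto simp: ennreal_mult_less_top)
    then have ap: "approximable_fn u" by (rule mult)
    show ?thesis unfolding approximable_fn_def
    proof (intro allI impI)
      fix \<epsilon> :: real assume "\<epsilon> > 0"
      then have "\<epsilon> / c' > 0" using c' by simp
      then obtain n w e where A1: "approximates n w e (u)" "(\<integral>\<^sup>+y. e y \<partial>\<nu>) \<le> ennreal (\<epsilon> / c')"
        using ap unfolding approximable_fn_def by blast
      have *: "w \<in> borel_measurable \<nu>" "e \<in> borel_measurable \<nu>" "\<forall>y\<in>Y. \<forall>y'\<in>Y. same_cyl n y y' \<longrightarrow> w y = w y'" "\<forall>y\<in>Y. u y \<le> w y + e y \<and> w y \<le> u y + e y" "(\<integral>\<^sup>+y. e y \<partial>\<nu>) \<le> ennreal (\<epsilon> / c')"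
        using A1 unfolding approximates_def by blast+
      have "(\<integral>\<^sup>+y. c * e y \<partial>\<nu>) = c * (\<integral>\<^sup>+y. e y \<partial>\<nu>)" using * by (intro nn_integral_cmult) auto
      also have "\<dots> \<le> c * ennreal (\<epsilon> / c')" using * by (intro mult_left_mono) auto
      also have "\<dots> = ennreal \<epsilon>" using c' \<open>\<epsilon> > 0\<close> by (simp add: ennreal_mult[symmetric])
      finally have i: "(\<integral>\<^sup>+y. c * e y \<partial>\<nu>) \<le> ennreal \<epsilon>" .
      have "approximates n (\<lambda>y. c * w y) (\<lambda>y. c * e y) (\<lambda>y. c * u y)"
        unfolding approximates_def
      proof (intro conjI ballI impI)
        fix y y' assume "y \<in> Y" "y' \<in> Y" "same_cyl n y y'"
        then show "c * w y = c * w y'" using *(3) by simp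
      next
        fix y assume "y \<in> Y"
        then have "u y \<le> w y + e y" "w y \<le> u y + e y" using *(4) by blast+
        then show "c * u y \<le> c * w y + c * e y" "c * w y \<le> c * u y + c * e y"
          unfolding distrib_left[symmetric] by (intro mult_left_mono; simp)+
      qed (use *(1,2) in measurable)
      with i show "\<exists>n w e. approximates n w e (\<lambda>y. c * u y) \<and> (\<integral>\<^sup>+y. e y \<partial>\<nu>) \<le> ennreal \<epsilon>" by blast
    qed
  qed
next
  case (add u v)
  have "(\<integral>\<^sup>+y. v y + u y \<partial>\<nu>) = (\<integral>\<^sup>+y. v y \<partial>\<nu>) + (\<integral>\<^sup>+y. u y \<partial>\<nu>)" using add by (intro nn_integral_add) auto
  then have "(\<integral>\<^sup>+y. v y \<partial>\<nu>) < \<infinity>" "(\<integral>\<^sup>+y. u y \<partial>\<nu>) < \<infinity>" using add.prems by auto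
  then have ap: "approximable_fn u" "approximable_fn v" using add.IH by auto
  show ?case unfolding approximable_fn_def
  proof (intro allI impI)
    fix \<epsilon> :: real assume "\<epsilon> > 0"
    then have e2: "\<epsilon> / 2 > 0" by simp
    obtain n w e where A1: "approximates n w e (u)" "(\<integral>\<^sup>+y. e y \<partial>\<nu>) \<le> ennreal (\<epsilon> / 2)"
        using ap(1) e2 unfolding approximable_fn_def by blast
      have *: "w \<in> borel_measurable \<nu>" "e \<in> borel_measurable \<nu>" "\<forall>y\<in>Y. \<forall>y'\<in>Y. same_cyl n y y' \<longrightarrow> w y = w y'" "\<forall>y\<in>Y. u y \<le> w y + e y \<and> w y \<le> u y + e y" "(\<integral>\<^sup>+y. e y \<partial>\<nu>) \<le> ennreal (\<epsilon> / 2)"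
        using A1 unfolding approximates_def by blast+
    obtain n' w' e' where A2: "approximates n' w' e' (v)" "(\<integral>\<^sup>+y. e' y \<partial>\<nu>) \<le> ennreal (\<epsilon> / 2)"
        using ap(2) e2 unfolding approximable_fn_def by blast
      have **: "w' \<in> borel_measurable \<nu>" "e' \<in> borel_measurable \<nu>" "\<forall>y\<in>Y. \<forall>y'\<in>Y. same_cyl n' y y' \<longrightarrow> w' y = w' y'" "\<forall>y\<in>Y. v y \<le> w' y + e' y \<and> w' y \<le> v y + e' y" "(\<integral>\<^sup>+y. e' y \<partial>\<nu>) \<le> ennreal (\<epsilon> / 2)"
        using A2 unfolding approximates_def by blast+
    have "(\<integral>\<^sup>+y. e' y + e y \<partial>\<nu>) = (\<integral>\<^sup>+y. e' y \<partial>\<nu>) + (\<integral>\<^sup>+y. e y \<partial>\<nu>)" using * ** by (intro nn_integral_add) auto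
    also have "\<dots> \<le> ennreal (\<epsilon> / 2) + ennreal (\<epsilon> / 2)" using * ** by (intro add_mono) auto
    also have "\<dots> = ennreal \<epsilon>" using \<open>\<epsilon> > 0\<close> by (simp add: ennreal_plus[symmetric] del: ennreal_plus)
    finally have i: "(\<integral>\<^sup>+y. e' y + e y \<partial>\<nu>) \<le> ennreal \<epsilon>" .
    have "v y + u y \<le> (w' y + w y) + (e' y + e y) \<and> w' y + w y \<le> (v y + u y) + (e' y + e y)" if "y \<in> Y" for y
    proof -
      have "v y + u y \<le> (w' y + e' y) + (w y + e y)" "w' y + w y \<le> (v y + e' y) + (u y + e y)"
        using *(4) **(4) that by (intro add_mono; blast)+
      then show ?thesis by (simp add: ac_simps)
    qed
    moreover have "w' y + w y = w' y' + w y'" if "y \<in> Y" "y' \<in> Y" "same_cyl (max n n') y y'" for y y'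
    proof -
      have "same_cyl n y y'" "same_cyl n' y y'" using that(3) by (auto intro: same_cyl_mono[rotated])
      then show ?thesis using *(3) **(3) that by simp
    qed
    moreover have "(\<lambda>y. w' y + w y) \<in> borel_measurable \<nu>" "(\<lambda>y. e' y + e y) \<in> borel_measurable \<nu>"
      using *(1,2) **(1,2) by auto
    ultimately have "approximates (max n n') (\<lambda>y. w' y + w y) (\<lambda>y. e' y + e y) (\<lambda>y. v y + u y)"
      unfolding approximates_def by blast
    with i show "\<exists>n w e. approximates n w e (\<lambda>y. v y + u y) \<and> (\<integral>\<^sup>+y. e y \<partial>\<nu>) \<le> ennreal \<epsilon>" by blast
  qed
next
  case (seq U)
  define S where "S = (SUP i. U i)"
  have Sm[measurable]: "S \<in> borel_measurable \<nu>"
  proof -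
    have "S = (\<lambda>y. SUP i. U i y)" by (simp add: S_def fun_eq_iff image_comp)
    then show ?thesis using seq(1) by (auto intro!: borel_measurable_SUP)
  qed
  have Ule: "U i y \<le> S y" for i y unfolding S_def SUP_apply by (rule SUP_upper) simp
  have Sfin: "(\<integral>\<^sup>+y. S y \<partial>\<nu>) < \<infinity>" using seq.prems by (simp add: S_def)
  have Ufin: "(\<integral>\<^sup>+y. U i y \<partial>\<nu>) < \<infinity>" for i
    by (rule le_less_trans[OF nn_integral_mono[OF Ule] Sfin])
  then have ap: "approximable_fn (U i)" for i using seq.IH by auto
  have "(\<integral>\<^sup>+y. S y \<partial>\<nu>) = (SUP i. \<integral>\<^sup>+y. U i y \<partial>\<nu>)"
    unfolding S_def SUP_apply using seq by (intro nn_integral_monotone_convergence_SUP) auto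
  show ?case unfolding approximable_fn_def S_def[symmetric]
  proof (intro allI impI)
    fix \<epsilon> :: real assume "\<epsilon> > 0"
    then have e2: "\<epsilon> / 2 > 0" by simp
    \<comment> \<open>Otherwise passing to the supremum would give an inequality of the form
      \<open>a + \<epsilon> / 2 \<le> a\<close>, impossible for finite \<open>a\<close>.\<close>
    have "\<exists>i. (\<integral>\<^sup>+y. S y \<partial>\<nu>) \<le> (\<integral>\<^sup>+y. U i y \<partial>\<nu>) + ennreal (\<epsilon> / 2)"
    proof (rule ccontr)
      assume "\<not> ?thesis"
      then have "(\<integral>\<^sup>+y. U i y \<partial>\<nu>) + ennreal (\<epsilon> / 2) \<le> (\<integral>\<^sup>+y. S y \<partial>\<nu>)" for i by (auto simp: not_le intro: less_imp_le)
      then have "(SUP i. (\<integral>\<^sup>+y. U i y \<partial>\<nu>) + ennreal (\<epsilon> / 2)) \<le> (\<integral>\<^sup>+y. S y \<partial>\<nu>)" by (intro SUP_least)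
      then have "(\<integral>\<^sup>+y. S y \<partial>\<nu>) + ennreal (\<epsilon> / 2) \<le> (\<integral>\<^sup>+y. S y \<partial>\<nu>)"
        by (simp add: \<open>(\<integral>\<^sup>+y. S y \<partial>\<nu>) = _\<close> ennreal_SUP_add_left)
      moreover obtain a where "0 \<le> a" "(\<integral>\<^sup>+y. S y \<partial>\<nu>) = ennreal a" using Sfin by (cases "\<integral>\<^sup>+y. S y \<partial>\<nu>") auto
      ultimately show False using e2 by (simp add: ennreal_plus[symmetric] del: ennreal_plus)
    qed
    then obtain i where i: "(\<integral>\<^sup>+y. S y \<partial>\<nu>) \<le> (\<integral>\<^sup>+y. U i y \<partial>\<nu>) + ennreal (\<epsilon> / 2)" by blast
    obtain n w e where A1: "approximates n w e (U i)" "(\<integral>\<^sup>+y. e y \<partial>\<nu>) \<le> ennreal (\<epsilon> / 2)"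
        using ap[of i] e2 unfolding approximable_fn_def by blast
      have *: "w \<in> borel_measurable \<nu>" "e \<in> borel_measurable \<nu>" "\<forall>y\<in>Y. \<forall>y'\<in>Y. same_cyl n y y' \<longrightarrow> w y = w y'" "\<forall>y\<in>Y. U i y \<le> w y + e y \<and> w y \<le> U i y + e y" "(\<integral>\<^sup>+y. e y \<partial>\<nu>) \<le> ennreal (\<epsilon> / 2)"
        using A1 unfolding approximates_def by blast+
    note [measurable] = *(1,2) seq(1)[of i]
    have "(\<integral>\<^sup>+y. (S y - U i y) + e y \<partial>\<nu>) = (\<integral>\<^sup>+y. S y - U i y \<partial>\<nu>) + (\<integral>\<^sup>+y. e y \<partial>\<nu>)" by (intro nn_integral_add) auto
    also have "(\<integral>\<^sup>+y. S y - U i y \<partial>\<nu>) = (\<integral>\<^sup>+y. S y \<partial>\<nu>) - (\<integral>\<^sup>+y. U i y \<partial>\<nu>)"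
      using Ufin[of i] Ule by (intro nn_integral_diff) auto
    also have "\<dots> + (\<integral>\<^sup>+y. e y \<partial>\<nu>) \<le> ennreal (\<epsilon> / 2) + ennreal (\<epsilon> / 2)"
      using i *(5) Ufin[of i] by (intro add_mono) (auto simp: ennreal_minus_le_iff add.commute)
    also have "\<dots> = ennreal \<epsilon>" using \<open>\<epsilon> > 0\<close> by (simp add: ennreal_plus[symmetric] del: ennreal_plus)
    finally have ii: "(\<integral>\<^sup>+y. (S y - U i y) + e y \<partial>\<nu>) \<le> ennreal \<epsilon>" .
    have "S y \<le> w y + ((S y - U i y) + e y) \<and> w y \<le> S y + ((S y - U i y) + e y)" if "y \<in> Y" for y
    proof -
      have "S y = U i y + (S y - U i y)" by (rule add_diff_inverse_ennreal[OF Ule, symmetric])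
      also have "\<dots> \<le> (w y + e y) + (S y - U i y)" using *(4) that by (intro add_right_mono) blast
      finally have 1: "S y \<le> w y + ((S y - U i y) + e y)" by (simp add: ac_simps)
      have "w y \<le> U i y + e y" using *(4) that by blast
      also have "\<dots> \<le> S y + ((S y - U i y) + e y)" using Ule by (intro add_mono) (auto intro: add_increasing)
      finally show ?thesis using 1 by blast
    qed
    then have "approximates n w (\<lambda>y. (S y - U i y) + e y) S"
      unfolding approximates_def using *(1-3) by (intro conjI) (auto simp del: add_diff_inverse_ennreal)
    with ii show "\<exists>n w e. approximates n w e S \<and> (\<integral>\<^sup>+y. e y \<partial>\<nu>) \<le> ennreal \<epsilon>" by blast
  qed
qed

end

section \<open>Log-Hoelder regularity under the transfer operator\<close>

context full_branch
begin

lemma \<zeta>_distortion: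
  assumes P: "P \<in> \<P>" "y \<in> P" "y' \<in> P"
  shows "\<zeta> y \<le> exp (C * dist (F y) (F y') powr \<eta>) * \<zeta> y'"
proof -
  have pos: "\<zeta> y > 0" "\<zeta> y' > 0" using P part_union \<zeta>_pos by auto
  have "ln (\<zeta> y) \<le> C * dist (F y) (F y') powr \<eta> + ln (\<zeta> y')" using distortion[OF P] by linarith
  then have "exp (ln (\<zeta> y)) \<le> exp (C * dist (F y) (F y') powr \<eta> + ln (\<zeta> y'))" by (simp only: exp_le_cancel_iff)
  then show ?thesis using pos by (simp add: exp_add)
qed

text \<open>Regularity inside \<open>n\<close>-cylinders, measured by the distance after
  \<open>n\<close> steps. A function constant on \<open>n\<close>-cylinders satisfies it with
  \<open>c = 0\<close>, and at level 0 it is global log-Hoelder regularity.\<close>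

definition log_holder :: "'m set \<Rightarrow> nat \<Rightarrow> real \<Rightarrow> ('m \<Rightarrow> ennreal) \<Rightarrow> bool" where
  "log_holder Z n c w \<longleftrightarrow> (\<forall>y\<in>Z. \<forall>y'\<in>Z. same_cyl n y y' \<longrightarrow>
     w y \<le> ennreal (exp (c * dist ((F ^^ n) y) ((F ^^ n) y') powr \<eta>)) * w y')"

lemma same_cyl_br:
  assumes "good Z" "P \<in> \<P>" "z \<in> Z" "z' \<in> Z" "same_cyl n z z'"
  shows "same_cyl (Suc n) (br P z) (br P z')"
  using assms good_br[OF assms(1,2,3)] good_br[OF assms(1,2,4)] by (auto simp: same_cyl_Suc)

text \<open>Branch by branch: with \<open>d\<close> the \<open>\<eta>\<close>-power of the distance
  after \<open>n\<close> steps, \<open>w\<close> contributes \<open>c * d\<close> and the Jacobian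
  contributes \<open>C\<close> times the present distance, which is at most
  \<open>C * r ^ n * d\<close>. Each application thus lowers the level by one at geometrically small
  cost.\<close>

lemma log_holder_P0:
  assumes g: "good Z" and w: "log_holder Z (Suc n) c w"
  shows "log_holder Z n (c + C * r ^ n) (P0 w)"
  unfolding log_holder_def
proof (intro ballI impI)
  fix z z' assume z: "z \<in> Z" "z' \<in> Z" "same_cyl n z z'"
  define d where "d = dist ((F ^^ n) z) ((F ^^ n) z') powr \<eta>"
  have "ennreal (\<zeta> (br P z)) * w (br P z) \<le> ennreal (exp ((c + C * r ^ n) * d)) * (ennreal (\<zeta> (br P z')) * w (br P z'))"
    if P: "P \<in> \<P>" for P
  proof -
    note b = good_br[OF g P z(1)] good_br[OF g P z(2)]
    have \<zeta>0: "0 \<le> \<zeta> (br P z')" using \<zeta>_pos[of "br P z'"] b good_sets[OF g] by force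
    have "\<zeta> (br P z) \<le> exp (C * dist z z' powr \<eta>) * \<zeta> (br P z')" using \<zeta>_distortion[OF P b(1,4)] b by simp
    also have "\<dots> \<le> exp (C * (r ^ n * d)) * \<zeta> (br P z')"
      using same_cyl_dist_powr[OF z(3)] C \<zeta>0 by (intro mult_right_mono) (auto simp: d_def intro!: mult_left_mono)
    finally have 1: "ennreal (\<zeta> (br P z)) \<le> ennreal (exp (C * (r ^ n * d))) * ennreal (\<zeta> (br P z'))"
      using \<zeta>0 by (simp add: ennreal_mult[symmetric] ennreal_leI)
    have "w (br P z) \<le> ennreal (exp (c * dist ((F ^^ Suc n) (br P z)) ((F ^^ Suc n) (br P z')) powr \<eta>)) * w (br P z')"
      using w b same_cyl_br[OF g P z] by (auto simp: log_holder_def)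
    then have 2: "w (br P z) \<le> ennreal (exp (c * d)) * w (br P z')"
      using b by (simp add: d_def funpow_swap1)
    have "ennreal (\<zeta> (br P z)) * w (br P z)
       \<le> (ennreal (exp (C * (r ^ n * d))) * ennreal (\<zeta> (br P z'))) * (ennreal (exp (c * d)) * w (br P z'))"
      by (intro mult_mono 1 2) auto
    also have "\<dots> = (ennreal (exp (C * (r ^ n * d))) * ennreal (exp (c * d))) * (ennreal (\<zeta> (br P z')) * w (br P z'))"
      by (simp only: ac_simps)
    also have "ennreal (exp (C * (r ^ n * d))) * ennreal (exp (c * d)) = ennreal (exp ((c + C * r ^ n) * d))"
      by (simp add: ennreal_mult[symmetric] exp_add[symmetric] algebra_simps)
    finally show ?thesis .
  qed
  then have "P0 w z \<le> (\<integral>\<^sup>+P. ennreal (exp ((c + C * r ^ n) * d)) * (ennreal (\<zeta> (br P z')) * w (br P z')) \<partial>count_space \<P>)"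
    unfolding P0_def by (intro nn_integral_mono) auto
  then show "P0 w z \<le> ennreal (exp ((c + C * r ^ n) * dist ((F ^^ n) z) ((F ^^ n) z') powr \<eta>)) * P0 w z'"
    unfolding P0_def d_def by (simp add: nn_integral_cmult)
qed

lemma log_holder_P0_funpow:
  assumes g: "good Z" and w: "log_holder Z n c w"
  shows "log_holder Z 0 (c + C * (\<Sum>k<n. r ^ k)) ((P0 ^^ n) w)"
  using w
proof (induction n arbitrary: c w)
  case (Suc n)
  have "log_holder Z 0 (c + C * r ^ n + C * (\<Sum>k<n. r ^ k)) ((P0 ^^ n) (P0 w))"
    by (rule Suc.IH[OF log_holder_P0[OF g Suc.prems]])
  then show ?case by (simp add: funpow_swap1 algebra_simps)
qed simp

text \<open>The total \<open>C * (1 + r + r ^ 2 + \<dots>)\<close> of the costs of lowering the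
  level.\<close>

definition C3 where "C3 = C / (1 - r)"

lemma C3: "0 \<le> C3" using C r by (simp add: C3_def)

text \<open>The regularity constant does not depend on \<open>n\<close>: the start is constant 0 at
  level \<open>n\<close>, and the \<open>n\<close> costs add up to at most
  \<open>C3\<close>.\<close>

lemma saturated_P0_funpow:
  assumes g: "good Z" and w: "\<And>y y'. y \<in> Y \<Longrightarrow> y' \<in> Y \<Longrightarrow> same_cyl n y y' \<Longrightarrow> w y = w y'"
    and z: "z \<in> Z" "z' \<in> Z"
  shows "(P0 ^^ n) w z \<le> ennreal (exp (C3 * dist z z' powr \<eta>)) * (P0 ^^ n) w z'"
proof -
  have "log_holder Z n 0 w"
    unfolding log_holder_def
  proof (intro ballI impI)
    fix y y' assume "y \<in> Z" "y' \<in> Z" "same_cyl n y y'"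
    then have "w y = w y'" using good_sets(2)[OF g] by (intro w) auto
    then show "w y \<le> ennreal (exp (0 * dist ((F ^^ n) y) ((F ^^ n) y') powr \<eta>)) * w y'" by simp
  qed
  from log_holder_P0_funpow[OF g this] z
  have "(P0 ^^ n) w z \<le> ennreal (exp (C * (\<Sum>k<n. r ^ k) * dist z z' powr \<eta>)) * (P0 ^^ n) w z'" by (auto simp: log_holder_def)
  also have "\<dots> \<le> ennreal (exp (C3 * dist z z' powr \<eta>)) * (P0 ^^ n) w z'"
  proof -
    have "(\<Sum>k<n. r ^ k) \<le> (\<Sum>k. r ^ k)" using r by (intro sum_le_suminf summable_geometric) auto
    then have "C * (\<Sum>k<n. r ^ k) \<le> C3" using r C unfolding C3_def by (simp add: suminf_geometric divide_inverse mult_left_mono)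
    then show ?thesis by (intro mult_right_mono ennreal_leI) (auto intro!: mult_right_mono)
  qed
  finally show ?thesis .
qed

end

section \<open>The invariant density and the normalised operator\<close>

locale full_branch_acip = full_branch Y F \<P> \<nu> \<zeta> lam C \<eta> D
  for Y :: "'m::metric_space set" and F \<P> \<nu> \<zeta> lam C \<eta> D +
  fixes \<mu> :: "'m measure"
  assumes sets_\<mu>: "sets \<mu> = sets \<nu>" and prob_\<mu>: "prob_space \<mu>" and ac: "absolutely_continuous \<nu> \<mu>"
    and inv_\<mu>: "\<And>A. A \<in> sets \<nu> \<Longrightarrow> emeasure \<mu> (F -` A \<inter> Y) = emeasure \<mu> A"
begin

sublocale mu: prob_space \<mu> by (rule prob_\<mu>)

lemma space_\<mu>: "space \<mu> = Y"
  using sets_eq_imp_space_eq[OF sets_\<mu>] space_\<nu> by simp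

definition \<rho> where "\<rho> = RN_deriv \<nu> \<mu>"

lemma \<rho>_meas [measurable]: "\<rho> \<in> borel_measurable \<nu>" by (simp add: \<rho>_def)

lemma density_\<rho>: "density \<nu> \<rho> = \<mu>"
  unfolding \<rho>_def by (rule density_RN_deriv[OF ac sets_\<mu>])

lemma nn_integral_\<mu>: "w \<in> borel_measurable \<nu> \<Longrightarrow> (\<integral>\<^sup>+y. w y \<partial>\<mu>) = (\<integral>\<^sup>+y. \<rho> y * w y \<partial>\<nu>)"
  by (subst density_\<rho>[symmetric]) (rule nn_integral_density, auto)

lemma \<rho>_integral: "(\<integral>\<^sup>+y. \<rho> y \<partial>\<nu>) = 1"
  using nn_integral_\<mu>[of "\<lambda>_. 1"] by (simp add: mu.emeasure_space_1)

lemma meas_Z: "good Z \<Longrightarrow> w \<in> borel_measurable \<nu> \<Longrightarrow> w \<in> borel_measurable (restrict_space \<nu> Z)"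
  by (rule measurable_restrict_space1)

text \<open>Invariance of \<open>\<mu>\<close> and duality of \<open>P0\<close> with composition by
  \<open>F\<close> show that \<open>P0 \<rho>\<close> and \<open>\<rho>\<close> are densities of the
  same finite measure.\<close>

lemma \<rho>_invariant_AE:
  assumes g: "good Z"
  shows "AE z in restrict_space \<nu> Z. P0 \<rho> z = \<rho> z"
proof (rule finite_measure.density_unique_finite_measure)
  let ?n = "restrict_space \<nu> Z"
  show "finite_measure ?n" by (rule finite_measure_restrict_space) (use good_sets[OF g] finite_\<nu> in \<open>auto simp: space_\<nu>\<close>)
  have \<rho>Z[measurable]: "\<rho> \<in> borel_measurable ?n" by (rule meas_Z[OF g \<rho>_meas])
  show "P0 \<rho> \<in> borel_measurable ?n" "\<rho> \<in> borel_measurable ?n" by (auto intro: P0_meas[OF g])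
  note [measurable] = F_meas_Z[OF g]
  fix A assume A[measurable]: "A \<in> sets ?n"
  have A\<nu>: "A \<in> sets \<nu>" "A \<subseteq> Z" using A sets_\<nu>Z_iff[OF g] by auto
  have "(\<integral>\<^sup>+z. P0 \<rho> z * indicator A z \<partial>?n) = (\<integral>\<^sup>+z. P0 (\<lambda>y. \<rho> y * indicator A (F y)) z \<partial>?n)"
  proof (rule nn_integral_cong)
    fix z assume "z \<in> space ?n"
    then have z: "z \<in> Z" using space_\<nu>Z[OF g] by simp
    have "P0 (\<lambda>y. \<rho> y * indicator A (F y)) z = (\<integral>\<^sup>+P. ennreal (\<zeta> (br P z)) * \<rho> (br P z) * indicator A z \<partial>count_space \<P>)"
      unfolding P0_def by (rule nn_integral_cong) (simp add: good_br[OF g _ z] mult.assoc)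
    also have "\<dots> = P0 \<rho> z * indicator A z" unfolding P0_def by (rule nn_integral_multc) simp
    finally show "P0 \<rho> z * indicator A z = P0 (\<lambda>y. \<rho> y * indicator A (F y)) z" by simp
  qed
  also have "\<dots> = (\<integral>\<^sup>+z. \<rho> z * indicator A (F z) \<partial>?n)" by (rule P0_integral[OF g]) measurable
  also have "\<dots> = (\<integral>\<^sup>+z. \<rho> z * indicator (F -` A \<inter> Y) z \<partial>?n)"
    by (rule nn_integral_cong) (use good_sets[OF g] space_\<nu>Z[OF g] in \<open>auto simp: indicator_def\<close>)
  also have "\<dots> = (\<integral>\<^sup>+z. \<rho> z * indicator (F -` A \<inter> Y) z \<partial>\<nu>)"
  proof (rule nn_integral_\<nu>Z[OF g])
    have "F -` A \<inter> Y \<in> sets \<nu>" using measurable_sets[OF F_Y A\<nu>(1)] by (simp add: space_\<nu>)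
    then show "(\<lambda>z. \<rho> z * indicator (F -` A \<inter> Y) z) \<in> borel_measurable \<nu>" by measurable
  qed
  also have "\<dots> = emeasure \<mu> (F -` A \<inter> Y)"
    using measurable_sets[OF F_Y A\<nu>(1)] by (subst density_\<rho>[symmetric], subst emeasure_density) (auto simp: space_\<nu>)
  also have "\<dots> = emeasure \<mu> A" by (rule inv_\<mu>[OF A\<nu>(1)])
  also have "\<dots> = (\<integral>\<^sup>+z. \<rho> z * indicator A z \<partial>\<nu>)"
    using A\<nu> by (subst density_\<rho>[symmetric], subst emeasure_density) auto
  also have "\<dots> = (\<integral>\<^sup>+z. \<rho> z * indicator A z \<partial>?n)"
    by (intro nn_integral_\<nu>Z[OF g, symmetric] borel_measurable_times_ennreal borel_measurable_indicator \<rho>_meas A\<nu>(1))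
  finally show "(\<integral>\<^sup>+z. P0 \<rho> z * indicator A z \<partial>?n) = (\<integral>\<^sup>+z. \<rho> z * indicator A z \<partial>?n)" .
qed auto

text \<open>Turns a statement valid almost everywhere into one valid at every point of a smaller
  good set.\<close>

lemma AE_good_exists:
  assumes g: "good Z" and ae: "AE z in restrict_space \<nu> Z. Q z"
  shows "\<exists>Z'. good Z' \<and> Z' \<subseteq> Z \<and> (\<forall>z\<in>Z'. Q z)"
proof -
  obtain N where N: "N \<in> null_sets (restrict_space \<nu> Z)" "{z \<in> Z. \<not> Q z} \<subseteq> N"
    using ae space_\<nu>Z[OF g] by (auto simp: eventually_ae_filter)
  have "N \<in> sets (restrict_space \<nu> Z)" using N(1) by auto
  then have "N \<in> null_sets \<nu>" using null_setsD1[OF N(1)] emeasure_\<nu>Z[OF g, of N] sets_\<nu>Z_iff[OF g, of N] by (auto simp: null_sets_def)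
  moreover have "Y - Z \<in> null_sets \<nu>" using g by (simp add: good_def)
  ultimately obtain Z' where Z': "good Z'" "Z' \<inter> (N \<union> (Y - Z)) = {}" using good_exists[of "N \<union> (Y - Z)"] by auto
  then have "Z' \<subseteq> Z" using good_sets(2)[OF Z'(1)] by blast
  then show ?thesis using Z' N(2) by blast
qed

text \<open>As \<open>\<rho>\<close> is fixed by every power of \<open>P0\<close>, it equals
  \<open>P0 ^^ n\<close> of a cylinder function up to the image of a small error. The first part is
  regular with constant \<open>C3\<close> whatever the level, so the regularity passes to the limit
  although the levels \<open>n k\<close> may tend to infinity.\<close>

lemma regular_density:
  "\<exists>Z. good Z \<and> (\<forall>z\<in>Z. P0 \<rho> z = \<rho> z \<and> 0 < \<rho> z \<and> \<rho> z < \<top>) \<and>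
     (\<forall>z\<in>Z. \<forall>z'\<in>Z. \<rho> z \<le> ennreal (exp (C3 * dist z z' powr \<eta>)) * \<rho> z')"
proof -
  obtain Z1 where Z1: "good Z1" using good_exists[of "{}"] by auto
  have "AE z in restrict_space \<nu> Z1. P0 \<rho> z = \<rho> z \<and> \<rho> z \<noteq> \<infinity>"
  proof -
    have "AE z in restrict_space \<nu> Z1. \<rho> z \<noteq> \<infinity>"
      using nn_integral_\<nu>Z[OF Z1 \<rho>_meas] \<rho>_integral by (intro nn_integral_PInf_AE meas_Z[OF Z1 \<rho>_meas]) auto
    with \<rho>_invariant_AE[OF Z1] show ?thesis by auto
  qed
  from AE_good_exists[OF Z1 this] obtain Z2 where Z2: "good Z2" and \<rho>inv: "\<And>z. z \<in> Z2 \<Longrightarrow> P0 \<rho> z = \<rho> z" and \<rho>fin: "\<And>z. z \<in> Z2 \<Longrightarrow> \<rho> z \<noteq> \<infinity>"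
    by auto
  have \<rho>inv_n: "(P0 ^^ n) \<rho> z = \<rho> z" if "z \<in> Z2" for n z
    using that
  proof (induction n arbitrary: z)
    case (Suc n)
    have "P0 ((P0 ^^ n) \<rho>) z = P0 \<rho> z"
      unfolding P0_def[of "(P0 ^^ n) \<rho>" z] P0_def[of \<rho> z] by (rule nn_integral_cong) (use Suc good_br[OF Z2] in auto)
    then show ?case using \<rho>inv Suc by simp
  qed simp
  have "approximable_fn \<rho>" by (rule approximable_fn_integrable) (auto simp: \<rho>_integral)
  \<comment> \<open>Geometric errors are summable, and \<open>P0\<close> preserves integrals, so the
    transported errors \<open>a k\<close> tend to zero almost everywhere and not merely in
    \<open>L^1\<close>.\<close>
  then have "\<forall>k::nat. \<exists>n w e. approximates n w e \<rho> \<and> (\<integral>\<^sup>+y. e y \<partial>\<nu>) \<le> ennreal ((1/2) ^ k)"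
    unfolding approximable_fn_def by simp
  then obtain n w e where nwe: "\<And>k::nat. approximates (n k) (w k) (e k) \<rho>" "\<And>k::nat. (\<integral>\<^sup>+y. e k y \<partial>\<nu>) \<le> ennreal ((1/2) ^ k)"
    by metis
  have wm: "w k \<in> borel_measurable \<nu>" and em: "e k \<in> borel_measurable \<nu>" for k using nwe(1)[of k] by (auto simp: approximates_def)
  define a where "a k = (P0 ^^ n k) (e k)" for k
  have am[measurable]: "a k \<in> borel_measurable (restrict_space \<nu> Z2)" for k
    unfolding a_def by (rule P0_funpow_meas[OF Z2 meas_Z[OF Z2 em]])
  have "(\<integral>\<^sup>+z. (\<Sum>k. a k z) \<partial>restrict_space \<nu> Z2) = (\<Sum>k. \<integral>\<^sup>+z. a k z \<partial>restrict_space \<nu> Z2)"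
    by (rule nn_integral_suminf) simp
  also have "\<dots> = (\<Sum>k. \<integral>\<^sup>+z. e k z \<partial>\<nu>)"
    unfolding a_def using P0_funpow_integral[OF Z2 meas_Z[OF Z2 em]] nn_integral_\<nu>Z[OF Z2 em] by simp
  also have "\<dots> \<le> (\<Sum>k. ennreal ((1/2) ^ k))" by (intro suminf_le nwe) auto
  also have "\<dots> = ennreal (\<Sum>k. (1/2) ^ k)" by (rule suminf_ennreal2) (auto intro: summable_geometric)
  finally have "(\<integral>\<^sup>+z. (\<Sum>k. a k z) \<partial>restrict_space \<nu> Z2) \<noteq> \<infinity>" by (auto simp: top_unique)
  then have "AE z in restrict_space \<nu> Z2. (\<Sum>k. a k z) \<noteq> \<infinity>" by (intro nn_integral_PInf_AE) auto
  from AE_good_exists[OF Z2 this] obtain Z3 where Z3: "good Z3" "Z3 \<subseteq> Z2" and asum: "\<And>z. z \<in> Z3 \<Longrightarrow> (\<Sum>k. a k z) \<noteq> \<infinity>" by auto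
  have a0: "(\<lambda>k. a k z) \<longlonglongrightarrow> 0" if z: "z \<in> Z3" for z
  proof -
    have fin: "a k z \<noteq> \<top>" for k using asum[OF z] by (metis ennreal_suminf_lessD infinity_ennreal_def top.not_eq_extremum)
    define b where "b k = enn2real (a k z)" for k
    have ab: "a k z = ennreal (b k)" and b0: "0 \<le> b k" for k using fin[of k] by (auto simp: b_def ennreal_enn2real_if)
    have "summable b" using asum[OF z] unfolding ab by (intro summable_suminf_not_top b0) auto
    then have "b \<longlonglongrightarrow> 0" by (rule summable_LIMSEQ_zero)
    then show ?thesis unfolding ab using tendsto_ennrealI[of b 0 sequentially] by simp
  qed
  have reg: "\<rho> z \<le> ennreal (exp (C3 * dist z z' powr \<eta>)) * \<rho> z'" if z: "z \<in> Z3" "z' \<in> Z3" for z z'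
  proof -
    define E where "E = ennreal (exp (C3 * dist z z' powr \<eta>))"
    have z2: "z \<in> Z2" "z' \<in> Z2" using z Z3 by auto
    have dom: "\<rho> y \<le> w k y + e k y" "w k y \<le> \<rho> y + e k y" if "y \<in> Z2" for y k
      using nwe(1)[of k] that good_sets(2)[OF Z2] by (auto simp: approximates_def)
    \<comment> \<open>Pass from \<open>\<rho>\<close> to the cylinder function at \<open>z\<close>,
      move to \<open>z'\<close> by its regularity, return to \<open>\<rho>\<close> there; both
      passages cost the transported error.\<close>
    have "\<rho> z \<le> E * (\<rho> z' + a k z') + a k z" for k
    proof -
      have "\<rho> z = (P0 ^^ n k) \<rho> z" using \<rho>inv_n z2 by simp
      also have "\<dots> \<le> (P0 ^^ n k) (\<lambda>y. w k y + e k y) z" by (rule P0_funpow_mono[OF Z2 dom(1) z2(1)])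
      also have "\<dots> = (P0 ^^ n k) (w k) z + a k z" by (simp add: P0_funpow_add[OF Z2] a_def)
      also have "(P0 ^^ n k) (w k) z \<le> E * (P0 ^^ n k) (w k) z'"
        unfolding E_def using nwe(1)[of k] z2 by (intro saturated_P0_funpow[OF Z2]) (auto simp: approximates_def)
      also have "(P0 ^^ n k) (w k) z' \<le> (P0 ^^ n k) (\<lambda>y. \<rho> y + e k y) z'" by (rule P0_funpow_mono[OF Z2 dom(2) z2(2)])
      also have "\<dots> = \<rho> z' + a k z'" using \<rho>inv_n z2 by (simp add: P0_funpow_add[OF Z2] a_def)
      finally show ?thesis by (simp add: add_mono mult_left_mono)
    qed
    moreover have "(\<lambda>k. E * (\<rho> z' + a k z') + a k z) \<longlonglongrightarrow> E * (\<rho> z' + 0) + 0"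
      using a0 z by (intro tendsto_add ennreal_tendsto_cmult tendsto_const) (auto simp: E_def)
    ultimately have "\<rho> z \<le> E * (\<rho> z' + 0) + 0" by (intro LIMSEQ_le_const) auto
    then show ?thesis by (simp add: E_def)
  qed
  \<comment> \<open>The density has integral 1, so it is positive somewhere; regularity spreads
    positivity to every point.\<close>
  have "\<exists>z0\<in>Z3. 0 < \<rho> z0"
  proof (rule ccontr)
    assume "\<not> ?thesis"
    then have "(\<integral>\<^sup>+z. \<rho> z \<partial>restrict_space \<nu> Z3) = (\<integral>\<^sup>+z. 0 \<partial>restrict_space \<nu> Z3)"
      by (intro nn_integral_cong) (auto simp: space_\<nu>Z[OF Z3(1)])
    then show False using nn_integral_\<nu>Z[OF Z3(1) \<rho>_meas] \<rho>_integral by simp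
  qed
  then obtain z0 where z0: "z0 \<in> Z3" "0 < \<rho> z0" by auto
  have "0 < \<rho> z" if "z \<in> Z3" for z using reg[OF z0(1) that] z0(2) by (auto simp: zero_less_iff_neq_zero)
  then show ?thesis using Z3 reg \<rho>inv \<rho>fin by (intro exI[of _ Z3]) (auto simp: less_top subset_iff)
qed

text \<open>Conjugating \<open>P0\<close> by the density normalises it: the weights
  \<open>\<zeta> * \<rho>\<close> at the preimage, divided by \<open>\<rho> z\<close>, sum to one
  precisely because \<open>P0 \<rho> = \<rho>\<close>. The rate \<open>\<gamma>\<close> is left free
  above \<open>r\<close>, so that it can also dominate the contraction rate of the flow.\<close>

theorem gibbs_markov_exists:
  "\<exists>Z g Cd. good Z \<and> (\<forall>\<gamma>. r \<le> \<gamma> \<longrightarrow> \<gamma> < 1 \<longrightarrow>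
     gibbs_markov (restrict_space \<mu> Z) F \<P> (\<lambda>P. inv_into P F) g same_cyl \<gamma> Cd)"
proof -
  obtain Z where Z: "good Z" and \<rho>1: "\<And>z. z \<in> Z \<Longrightarrow> P0 \<rho> z = \<rho> z" and \<rho>2: "\<And>z. z \<in> Z \<Longrightarrow> 0 < \<rho> z" "\<And>z. z \<in> Z \<Longrightarrow> \<rho> z < \<top>"
     and reg: "\<And>z z'. z \<in> Z \<Longrightarrow> z' \<in> Z \<Longrightarrow> \<rho> z \<le> ennreal (exp (C3 * dist z z' powr \<eta>)) * \<rho> z'"
    using regular_density by auto
  define R where "R z = enn2real (\<rho> z)" for z
  have R: "\<rho> z = ennreal (R z)" "0 < R z" if "z \<in> Z" for z
    using \<rho>2[OF that] by (auto simp: R_def ennreal_enn2real_if enn2real_positive_iff)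
  have Rreg: "R z \<le> exp (C3 * dist z z' powr \<eta>) * R z'" if "z \<in> Z" "z' \<in> Z" for z z'
    using reg[OF that] R[OF that(1)] R[OF that(2)] by (simp add: ennreal_mult[symmetric] ennreal_le_iff)
  define g where "g P z = \<zeta> (br P z) * R (br P z) / R z" for P z
  \<comment> \<open>The Jacobian contributes \<open>C\<close>, the density contributes
    \<open>C3\<close> at the preimages and once more in the denominators;
    \<open>D powr \<eta> * r ^ n\<close> bounds \<open>dist powr \<eta>\<close> for points in a
    common \<open>n\<close>-cylinder.\<close>
  define Cd where "Cd = (C + 2 * C3) * D powr \<eta>"
  let ?N = "restrict_space \<mu> Z" and ?n = "restrict_space \<nu> Z"
  have sN: "sets ?N = sets ?n" by (rule sets_restrict_space_cong[OF sets_\<mu>])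
  have spN: "space ?N = Z" using sets_eq_imp_space_eq[OF sN] space_\<nu>Z[OF Z] by simp
  have meas: "f \<in> measurable ?n M \<Longrightarrow> f \<in> measurable ?N M" for f M using sN by (simp cong: measurable_cong_sets)
  have Z\<mu>: "Z \<inter> space \<mu> \<in> sets \<mu>" using good_sets[OF Z] by (simp add: space_\<mu> sets_\<mu> Int_absorb2)
  have N_eq: "(\<integral>\<^sup>+z. w z \<partial>?N) = (\<integral>\<^sup>+z. \<rho> z * w z \<partial>?n)" if w: "w \<in> borel_measurable ?n" for w
  proof -
    have w': "(\<lambda>z. w z * indicator Z z) \<in> borel_measurable \<nu>"
      using w good_sets[OF Z] by (subst borel_measurable_restrict_space_iff_ennreal[symmetric]) (auto simp: space_\<nu> Int_absorb2)
    have "(\<integral>\<^sup>+z. w z \<partial>?N) = (\<integral>\<^sup>+z. w z * indicator Z z \<partial>\<mu>)" by (rule nn_integral_restrict_space[OF Z\<mu>])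
    also have "\<dots> = (\<integral>\<^sup>+z. \<rho> z * (w z * indicator Z z) \<partial>\<nu>)" by (rule nn_integral_\<mu>[OF w'])
    also have "\<dots> = (\<integral>\<^sup>+z. \<rho> z * w z \<partial>?n)"
      using good_Int[OF Z] by (subst nn_integral_restrict_space) (auto simp: space_\<nu> mult.assoc)
    finally show ?thesis .
  qed
  have Rm: "R \<in> borel_measurable ?n" unfolding R_def using meas_Z[OF Z \<rho>_meas] by measurable
  have gm: "g P \<in> borel_measurable ?n" if "P \<in> \<P>" for P
  proof -
    note [measurable] = br_meas[OF Z that] \<zeta>_meas_Z[OF Z] Rm
    show ?thesis unfolding g_def by measurable
  qed
  have g0: "0 \<le> g P z" if "P \<in> \<P>" "z \<in> Z" for P z
    unfolding g_def using R(2)[OF good_br(2)[OF Z that]] R(2)[OF that(2)] \<zeta>_pos[of "br P z"] good_br[OF Z that] good_sets[OF Z]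
    by (intro divide_nonneg_nonneg mult_nonneg_nonneg) force+
  have \<rho>g: "ennreal (\<zeta> (br P z)) * \<rho> (br P z) = \<rho> z * ennreal (g P z)" if "P \<in> \<P>" "z \<in> Z" for P z
  proof -
    have "\<zeta> (br P z) * R (br P z) = R z * g P z" using R(2)[OF that(2)] by (simp add: g_def)
    moreover have "0 \<le> \<zeta> (br P z)" using \<zeta>_pos[of "br P z"] good_br[OF Z that] good_sets[OF Z] by force
    ultimately show ?thesis using R(1)[OF that(2)] R(1)[OF good_br(2)[OF Z that]] R(2)[OF that(2)] R(2)[OF good_br(2)[OF Z that]] g0[OF that]
      by (simp add: ennreal_mult[symmetric])
  qed
  \<comment> \<open>\<open>\<rho> z\<close> is positive and finite on \<open>Z\<close>, so it can be
    cancelled from the fixed-point equation.\<close>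
  have gsum: "(\<integral>\<^sup>+P. ennreal (g P z) \<partial>count_space \<P>) = 1" if z: "z \<in> Z" for z
  proof -
    have "\<rho> z * (\<integral>\<^sup>+P. ennreal (g P z) \<partial>count_space \<P>) = (\<integral>\<^sup>+P. \<rho> z * ennreal (g P z) \<partial>count_space \<P>)"
      by (rule nn_integral_cmult[symmetric]) simp
    also have "\<dots> = P0 \<rho> z" unfolding P0_def by (rule nn_integral_cong) (simp add: \<rho>g z)
    also have "\<dots> = \<rho> z * 1" using \<rho>1[OF z] by simp
    finally have "\<rho> z * (\<integral>\<^sup>+P. ennreal (g P z) \<partial>count_space \<P>) = \<rho> z * 1" .
    then show ?thesis using \<rho>2[OF z] by (subst (asm) ennreal_mult_cancel_left) auto
  qed
  have transfer: "(\<integral>\<^sup>+z. w z \<partial>?N) = (\<integral>\<^sup>+z. (\<integral>\<^sup>+P. ennreal (g P z) * w (br P z) \<partial>count_space \<P>) \<partial>?N)"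
    if "w \<in> borel_measurable ?N" for w :: "'m \<Rightarrow> ennreal"
  proof -
    have w[measurable]: "w \<in> borel_measurable ?n" using that sN by (simp cong: measurable_cong_sets)
    note [measurable] = meas_Z[OF Z \<rho>_meas]
    have "(\<integral>\<^sup>+z. w z \<partial>?N) = (\<integral>\<^sup>+z. \<rho> z * w z \<partial>?n)" by (rule N_eq[OF w])
    also have "\<dots> = (\<integral>\<^sup>+z. P0 (\<lambda>z. \<rho> z * w z) z \<partial>?n)" by (rule P0_integral[OF Z, symmetric]) measurable
    also have "\<dots> = (\<integral>\<^sup>+z. \<rho> z * (\<integral>\<^sup>+P. ennreal (g P z) * w (br P z) \<partial>count_space \<P>) \<partial>?n)"
    proof (rule nn_integral_cong)
      fix z assume "z \<in> space ?n"
      then have z: "z \<in> Z" by (simp add: space_\<nu>Z[OF Z])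
      have "P0 (\<lambda>z. \<rho> z * w z) z = (\<integral>\<^sup>+P. \<rho> z * (ennreal (g P z) * w (br P z)) \<partial>count_space \<P>)"
        unfolding P0_def by (rule nn_integral_cong) (simp add: \<rho>g z mult.assoc[symmetric])
      then show "P0 (\<lambda>z. \<rho> z * w z) z = \<rho> z * (\<integral>\<^sup>+P. ennreal (g P z) * w (br P z) \<partial>count_space \<P>)"
        by (simp add: nn_integral_cmult)
    qed
    also have "\<dots> = (\<integral>\<^sup>+z. (\<integral>\<^sup>+P. ennreal (g P z) * w (br P z) \<partial>count_space \<P>) \<partial>?N)"
    proof (rule N_eq[symmetric])
      interpret J: sigma_finite_measure "count_space \<P>" by (rule sigma_finite_measure_count_space_countable[OF part_count])
      have "(\<lambda>x. ennreal (g (snd x) (fst x)) * w (br (snd x) (fst x))) \<in> borel_measurable (?n \<Otimes>\<^sub>M count_space \<P>)"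
      proof (rule measurable_compose_countable'[OF _ measurable_snd part_count, where f = "\<lambda>P x. ennreal (g P (fst x)) * w (br P (fst x))"])
        fix P assume P: "P \<in> \<P>"
        note [measurable] = br_meas[OF Z P] gm[OF P]
        show "(\<lambda>x. ennreal (g P (fst x)) * w (br P (fst x))) \<in> borel_measurable (?n \<Otimes>\<^sub>M count_space \<P>)" by measurable
      qed
      then show "(\<lambda>z. \<integral>\<^sup>+P. ennreal (g P z) * w (br P z) \<partial>count_space \<P>) \<in> borel_measurable ?n"
        by (intro J.borel_measurable_nn_integral) (simp add: case_prod_beta')
    qed
    finally show ?thesis .
  qed
  have dist_g: "g P z \<le> exp (Cd * \<gamma> ^ n) * g P z'"
    if P: "P \<in> \<P>" and z: "z \<in> Z" "z' \<in> Z" "same_cyl n z z'" and \<gamma>: "r \<le> \<gamma>" for P z z' n \<gamma>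
  proof -
    note b = good_br[OF Z P z(1)] good_br[OF Z P z(2)]
    define d where "d = dist z z' powr \<eta>"
    have d0: "0 \<le> d" by (simp add: d_def)
    have "dist (br P z) (br P z') \<le> dist z z'"
    proof -
      have "1 * dist (br P z) (br P z') \<le> lam * dist (br P z) (br P z')" using lam by (intro mult_right_mono) auto
      then show ?thesis using expanding[OF P b(1,4)] b by simp
    qed
    then have db: "dist (br P z) (br P z') powr \<eta> \<le> d" unfolding d_def using \<eta> by (intro powr_mono2) auto
    have \<zeta>0: "0 < \<zeta> (br P z)" "0 < \<zeta> (br P z')" using \<zeta>_pos b good_sets[OF Z] by auto
    have 1: "\<zeta> (br P z) \<le> exp (C * d) * \<zeta> (br P z')" using \<zeta>_distortion[OF P b(1,4)] b by (simp add: d_def)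
    have "R (br P z) \<le> exp (C3 * dist (br P z) (br P z') powr \<eta>) * R (br P z')" by (rule Rreg[OF b(2,5)])
    also have "\<dots> \<le> exp (C3 * d) * R (br P z')"
      using db C3 R(2)[OF b(5)] by (intro mult_right_mono) (auto intro: mult_left_mono)
    finally have 2: "R (br P z) \<le> exp (C3 * d) * R (br P z')" .
    have 3: "R z' \<le> exp (C3 * d) * R z" using Rreg[OF z(2,1)] by (simp add: d_def dist_commute)
    have "\<zeta> (br P z) * R (br P z) * R z' \<le> (exp (C * d) * \<zeta> (br P z')) * (exp (C3 * d) * R (br P z')) * (exp (C3 * d) * R z)"
      using 1 2 3 \<zeta>0 R(2)[OF b(2)] R(2)[OF b(5)] R(2)[OF z(1)] R(2)[OF z(2)] by (intro mult_mono) auto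
    also have "\<dots> = exp ((C + 2 * C3) * d) * (\<zeta> (br P z') * R (br P z')) * R z"
    proof -
      have "exp ((C + 2 * C3) * d) = exp (C * d) * exp (C3 * d) * exp (C3 * d)"
        by (simp add: exp_add[symmetric] algebra_simps)
      then show ?thesis by simp
    qed
    finally have "g P z \<le> exp ((C + 2 * C3) * d) * g P z'"
      unfolding g_def using R(2)[OF z(1)] R(2)[OF z(2)] by (simp add: field_simps)
    also have "\<dots> \<le> exp (Cd * \<gamma> ^ n) * g P z'"
    proof (intro mult_right_mono g0 P z)
      have "d \<le> D powr \<eta> * r ^ n" unfolding d_def by (rule same_cyl_dist_powr_le[OF z(3)])
      also have "\<dots> \<le> D powr \<eta> * \<gamma> ^ n" using \<gamma> r by (intro mult_left_mono power_mono) auto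
      finally show "exp ((C + 2 * C3) * d) \<le> exp (Cd * \<gamma> ^ n)"
        unfolding Cd_def using C C3 by (simp add: mult.assoc mult_left_mono)
    qed
    finally show ?thesis .
  qed
  have "gibbs_markov ?N F \<P> (\<lambda>P. inv_into P F) g same_cyl \<gamma> Cd" if \<gamma>: "r \<le> \<gamma>" "\<gamma> < 1" for \<gamma>
  proof (intro gibbs_markov.intro gibbs_markov_axioms.intro)
    show "prob_space ?N"
    proof (rule prob_spaceI)
      have "emeasure ?N (space ?N) = emeasure \<mu> Z" unfolding spN using good_sets[OF Z] Z\<mu> by (intro emeasure_restrict_space) auto
      also have "\<dots> = (\<integral>\<^sup>+z. \<rho> z * indicator Z z \<partial>\<nu>)" using good_sets[OF Z] by (subst density_\<rho>[symmetric], subst emeasure_density) auto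
      also have "\<dots> = (\<integral>\<^sup>+z. \<rho> z \<partial>?n)" using good_Int[OF Z] by (subst nn_integral_restrict_space) (auto simp: space_\<nu>)
      also have "\<dots> = 1" using nn_integral_\<nu>Z[OF Z \<rho>_meas] \<rho>_integral by simp
      finally show "emeasure ?N (space ?N) = 1" .
    qed
    show "F \<in> measurable ?N ?N" using F_meas_Z[OF Z] sN by (simp cong: measurable_cong_sets)
    show "inv_into P F \<in> measurable ?N ?N" if "P \<in> \<P>" for P using br_meas[OF Z that] sN by (simp cong: measurable_cong_sets)
    show "0 < \<gamma>" using \<gamma> r by simp
    show "0 \<le> Cd" unfolding Cd_def using C C3 by simp
    show "\<gamma> < 1" by (rule \<gamma>(2))
    show "countable \<P>" by (rule part_count)
    show "F (inv_into P F z) = z" if "P \<in> \<P>" "z \<in> space ?N" for P z using good_br(3)[OF Z that(1)] that(2) spN by simp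
    show "g P \<in> borel_measurable ?N" if "P \<in> \<P>" for P by (rule meas[OF gm[OF that]])
    show "0 \<le> g P z" if "P \<in> \<P>" "z \<in> space ?N" for P z using g0[OF that(1)] that(2) spN by simp
    show "(\<integral>\<^sup>+P. ennreal (g P z) \<partial>count_space \<P>) = 1" if "z \<in> space ?N" for z using gsum that spN by simp
    show "(\<integral>\<^sup>+z. w z \<partial>?N) = (\<integral>\<^sup>+z. (\<integral>\<^sup>+P. ennreal (g P z) * w (inv_into P F z) \<partial>count_space \<P>) \<partial>?N)"
      if "w \<in> borel_measurable ?N" for w :: "'m \<Rightarrow> ennreal" by (rule transfer[OF that])
    show "same_cyl 0 z z'" for z z' by simp
    show "same_cyl n z' z" if "same_cyl n z z'" for n z z' by (rule same_cyl_sym[OF that])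
    show "same_cyl (Suc n) (inv_into P F z) (inv_into P F z')"
      if "P \<in> \<P>" "z \<in> space ?N" "z' \<in> space ?N" "same_cyl n z z'" for n P z z'
      using same_cyl_br[OF Z that(1) _ _ that(4)] that(2,3) spN by simp
    show "g P z \<le> exp (Cd * \<gamma> ^ n) * g P z'"
      if "P \<in> \<P>" "z \<in> space ?N" "z' \<in> space ?N" "same_cyl n z z'" for n P z z'
      using dist_g[OF that(1) _ _ that(4) \<gamma>(1)] that(2,3) spN by simp
  qed
  then show ?thesis using Z by blast
qed

end

section \<open>The suspension measure\<close>

locale nue =
  fixes T :: "real \<Rightarrow> 'm::metric_space \<Rightarrow> 'm"
    and X Y :: "'m set" and h :: "'m \<Rightarrow> real" and \<tau> :: "'m \<Rightarrow> nat" and \<mu>0 \<mu>Y :: "'m measure"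
    and \<P> :: "'m set set" and lam C \<eta> \<theta> C2 :: real and \<zeta>0 :: "'m \<Rightarrow> real"
  assumes bounded_M: "bounded (UNIV :: 'm set)"
    and sets_XY: "X \<in> sets borel" "Y \<in> sets borel" "Y \<subseteq> X"
    and semiflow0: "\<And>x. T 0 x = x"
    and semiflow_add: "\<And>s t x. 0 \<le> s \<Longrightarrow> 0 \<le> t \<Longrightarrow> T (s + t) x = T s (T t x)"
    and semiflow_meas: "(\<lambda>(t, x). T t x) \<in> measurable (restrict_space (lborel \<Otimes>\<^sub>M borel) ({0..} \<times> UNIV)) borel"
    and h_meas: "h \<in> borel_measurable (restrict_space borel X)"
    and h_pos: "\<And>x. x \<in> X \<Longrightarrow> h x > 0"
    and f_X: "\<And>x. x \<in> X \<Longrightarrow> fmap T h x \<in> X"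
    and \<tau>_meas: "\<tau> \<in> measurable (restrict_space borel Y) (count_space UNIV)"
    and \<tau>_pos: "\<And>y. y \<in> Y \<Longrightarrow> \<tau> y \<ge> 1"
    and F_Y: "\<And>y. y \<in> Y \<Longrightarrow> Fmap T h \<tau> y \<in> Y"
    and \<mu>0_sets: "sets \<mu>0 = sets (restrict_space borel X)"
    and \<mu>0_finite: "finite_measure \<mu>0"
    and part_count: "countable \<P>"
    and part_disj: "disjoint \<P>"
    and part_union: "\<Union>\<P> = Y"
    and part_sets: "\<And>P. P \<in> \<P> \<Longrightarrow> P \<in> sets borel \<and> P \<noteq> {}"
    and constants: "lam > 1" "C \<ge> 1" "0 < \<eta>" "\<eta> \<le> 1"
    and \<zeta>0_meas: "\<zeta>0 \<in> borel_measurable (restrict_space borel Y)"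
    and \<zeta>0_pos: "\<And>y. y \<in> Y \<Longrightarrow> \<zeta>0 y > 0"
    and markov: "\<And>P. P \<in> \<P> \<Longrightarrow> \<exists>P' Q. P' \<subseteq> P \<and> Q \<subseteq> Y \<and> P' \<in> sets borel \<and> Q \<in> sets borel
        \<and> emeasure \<mu>0 (P - P') = 0 \<and> emeasure \<mu>0 (Y - Q) = 0 \<and> bij_betw (Fmap T h \<tau>) P' Q
        \<and> (\<forall>A \<in> sets borel. A \<subseteq> P' \<longrightarrow> Fmap T h \<tau> ` A \<in> sets borel
             \<and> emeasure \<mu>0 A = (\<integral>\<^sup>+ z \<in> Fmap T h \<tau> ` A. ennreal (\<zeta>0 (inv_into P' (Fmap T h \<tau>) z)) \<partial>\<mu>0))"
    and expanding: "\<And>P y y'. P \<in> \<P> \<Longrightarrow> y \<in> P \<Longrightarrow> y' \<in> P \<Longrightarrow> dist (Fmap T h \<tau> y) (Fmap T h \<tau> y') \<ge> lam * dist y y'"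
    and distortion: "\<And>P y y'. P \<in> \<P> \<Longrightarrow> y \<in> P \<Longrightarrow> y' \<in> P \<Longrightarrow>
        \<bar>ln (\<zeta>0 y) - ln (\<zeta>0 y')\<bar> \<le> C * dist (Fmap T h \<tau> y) (Fmap T h \<tau> y') powr \<eta>"
    and \<mu>Y_sets: "sets \<mu>Y = sets (restrict_space borel Y)"
    and \<mu>Y_prob: "prob_space \<mu>Y"
    and \<mu>Y_inv: "invariant_on \<mu>Y Y (Fmap T h \<tau>)"
    and \<mu>Y_ac: "absolutely_continuous (restrict_space \<mu>0 Y) \<mu>Y"
    and h_L1: "integrable (tower_measure X (fmap T h) \<tau> \<mu>Y) h"
    and \<theta>_C2: "0 < \<theta>" "\<theta> < 1" "C2 \<ge> 1"
    and H_lip: "\<And>P y y'. P \<in> \<P> \<Longrightarrow> y \<in> P \<Longrightarrow> y' \<in> P \<Longrightarrow> y \<noteq> y' \<Longrightarrow>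
        \<bar>Hroof T h \<tau> y - Hroof T h \<tau> y'\<bar> \<le> C2 * dtheta \<theta> \<P> (Fmap T h \<tau>) y y' * (INF z\<in>P. Hroof T h \<tau> z)"
    and flow_contr: "\<And>P y y' t. P \<in> \<P> \<Longrightarrow> y \<in> P \<Longrightarrow> y' \<in> P \<Longrightarrow> 0 \<le> t \<Longrightarrow> t \<le> Hroof T h \<tau> y \<Longrightarrow> t \<le> Hroof T h \<tau> y' \<Longrightarrow>
        dist (T t y) (T t y') \<le> C2 * dtheta \<theta> \<P> (Fmap T h \<tau>) y y'"
begin

abbreviation f where "f \<equiv> fmap T h"
abbreviation F where "F \<equiv> Fmap T h \<tau>"
abbreviation H where "H \<equiv> Hroof T h \<tau>"
abbreviation \<mu>X where "\<mu>X \<equiv> tower_measure X f \<tau> \<mu>Y"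
abbreviation \<mu>M where "\<mu>M \<equiv> suspension_measure T h \<mu>X"
abbreviation bX where "bX \<equiv> restrict_space borel X"
abbreviation bY where "bY \<equiv> restrict_space borel Y"

sublocale Y: prob_space \<mu>Y by (rule \<mu>Y_prob)

lemma space_bX: "space bX = X" and space_bY: "space bY = Y"
  by (simp_all add: space_restrict_space)

lemma space_Y: "space \<mu>Y = Y"
  using sets_eq_imp_space_eq[OF \<mu>Y_sets] by (simp add: space_bY)

lemma meas_Y: "g \<in> measurable bY N \<longleftrightarrow> g \<in> measurable \<mu>Y N"
  using measurable_cong_sets[OF \<mu>Y_sets refl, of N] by simp

text \<open>The semiflow is measurable on nonnegative times only. This is why integrands over the
  whole line are written with \<open>T (max 0 u)\<close> below.\<close>

lemma T_measurable:
  assumes s: "s \<in> borel_measurable M" and g: "g \<in> measurable M borel" and "\<And>x. x \<in> space M \<Longrightarrow> 0 \<le> s x"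
  shows "(\<lambda>x. T (s x) (g x)) \<in> measurable M borel"
proof -
  have "(\<lambda>x. (s x, g x)) \<in> measurable M (lborel \<Otimes>\<^sub>M borel)"
    using s g by (intro measurable_Pair) (auto simp: measurable_lborel1)
  then have "(\<lambda>x. (s x, g x)) \<in> measurable M (restrict_space (lborel \<Otimes>\<^sub>M borel) ({0..} \<times> UNIV))"
    using assms(3) by (intro measurable_restrict_space2) auto
  from measurable_compose[OF this semiflow_meas] show ?thesis by simp
qed

lemma f_meas: "f \<in> measurable bX bX"
proof (rule measurable_restrict_space2)
  show "f \<in> measurable bX borel"
    unfolding fmap_def by (rule T_measurable[OF h_meas]) (auto intro: measurable_restrict_space1 less_imp_le h_pos simp: space_bX)
qed (use f_X in \<open>auto simp: space_bX\<close>)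

lemma f_pow_meas: "f ^^ l \<in> measurable bX bX"
proof (induction l)
  case (Suc l)
  then show ?case using measurable_comp[OF Suc f_meas] by (simp add: comp_def)
qed (simp add: id_def)

lemma bY_bX: "(\<lambda>y. y) \<in> measurable bY bX"
  by (rule measurable_restrict_space3) (use sets_XY in auto)

lemma f_pow_meas_Y: "(\<lambda>y. (f ^^ l) y) \<in> measurable \<mu>Y bX"
  using measurable_compose[OF bY_bX f_pow_meas] by (simp add: meas_Y)

lemma \<tau>_meas_Y [measurable]: "\<tau> \<in> measurable \<mu>Y (count_space UNIV)"
  using \<tau>_meas by (simp add: meas_Y)

lemma f_pow_X: "x \<in> X \<Longrightarrow> (f ^^ l) x \<in> X"
  by (induction l) (auto simp: f_X)

lemma F_meas_Y: "F \<in> measurable \<mu>Y \<mu>Y"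
proof -
  have "(\<lambda>y. (f ^^ \<tau> y) y) \<in> measurable \<mu>Y bX"
    by (rule measurable_compose_countable[OF f_pow_meas_Y \<tau>_meas_Y])
  then have "F \<in> measurable \<mu>Y bX" by (simp add: Fmap_def[abs_def])
  then have "F \<in> measurable \<mu>Y borel" by (rule measurable_restrict_space2_iff[THEN iffD1, THEN conjunct1])
  then have "F \<in> measurable \<mu>Y bY" by (rule measurable_restrict_space2[rotated]) (use F_Y in \<open>auto simp: space_Y\<close>)
  then show ?thesis using measurable_cong_sets[OF refl \<mu>Y_sets] by blast
qed

definition hs :: "nat \<Rightarrow> 'm \<Rightarrow> real" where "hs k x = (\<Sum>l<k. h ((f ^^ l) x))"

lemma hs_nonneg: "x \<in> X \<Longrightarrow> 0 \<le> hs k x"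
  unfolding hs_def using f_pow_X h_pos by (intro sum_nonneg less_imp_le) auto

lemma H_hs: "H y = hs (\<tau> y) y"
  by (simp add: Hroof_def hs_def)

lemma H_pos: "y \<in> Y \<Longrightarrow> 0 < H y"
proof -
  assume y: "y \<in> Y"
  then have "y \<in> X" using sets_XY by auto
  then show ?thesis unfolding H_hs hs_def using \<tau>_pos[OF y] f_pow_X h_pos
    by (intro sum_pos) (auto simp: lessThan_empty_iff)
qed

lemma T_hs: "x \<in> X \<Longrightarrow> T (hs k x) x = (f ^^ k) x"
proof (induction k)
  case (Suc k)
  have "T (hs (Suc k) x) x = T (h ((f ^^ k) x) + hs k x) x" by (simp add: hs_def add.commute)
  also have "\<dots> = T (h ((f ^^ k) x)) (T (hs k x) x)"
    using Suc.prems f_pow_X h_pos by (intro semiflow_add hs_nonneg) (auto intro: less_imp_le)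
  finally show ?case using Suc by (simp add: fmap_def[of T h "(f ^^ k) x"])
qed (simp add: hs_def semiflow0)

lemma T_H: "y \<in> Y \<Longrightarrow> T (H y) y = F y"
  using T_hs[of y "\<tau> y"] sets_XY by (auto simp: H_hs Fmap_def)

definition cX :: ennreal where "cX = ennreal (\<integral>y. real (\<tau> y) \<partial>\<mu>Y)"

text \<open>A measure given by \<open>measure_of\<close> takes the intended values only if these
  form a measure. The set function is therefore identified with the image of a density on
  \<open>\<mu>Y\<close> times counting measure, which also yields the integral formula.\<close>

lemma nn_integral_\<mu>X:
  assumes w: "w \<in> borel_measurable bX"
  shows "(\<integral>\<^sup>+x. w x \<partial>\<mu>X) = (\<integral>\<^sup>+y. (\<Sum>l<\<tau> y. w ((f ^^ l) y)) \<partial>\<mu>Y) * inverse cX"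
proof -
  define S where "S = density (\<mu>Y \<Otimes>\<^sub>M count_space UNIV) (\<lambda>(y, l :: nat). indicator {..<\<tau> y} l * inverse cX)"
  have sf: "sigma_finite_measure (count_space (UNIV :: nat set))" by (rule sigma_finite_measure_count_space_countable) simp
  interpret cs: sigma_finite_measure "count_space (UNIV :: nat set)" by (rule sf)
  have jm: "(\<lambda>x. (f ^^ snd x) (fst x)) \<in> measurable (\<mu>Y \<Otimes>\<^sub>M count_space UNIV) bX"
    by (rule measurable_compose_countable'[where f = "\<lambda>l x. (f ^^ l) (fst x)" and I = UNIV])
       (auto intro: measurable_compose[OF measurable_fst f_pow_meas_Y])
  have im: "(\<lambda>x. indicator {..<\<tau> (fst x)} (snd x) :: ennreal) \<in> borel_measurable (\<mu>Y \<Otimes>\<^sub>M count_space UNIV)"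
  proof (rule measurable_compose_countable'[where f = "\<lambda>l x. indicator {..<\<tau> (fst x)} l" and I = UNIV])
    fix l :: nat
    have "(\<lambda>x. \<tau> (fst x)) \<in> measurable (\<mu>Y \<Otimes>\<^sub>M count_space (UNIV :: nat set)) (count_space UNIV)" by measurable
    from measurable_compose[OF this, of "\<lambda>k. indicator {..<k} l :: ennreal" borel]
    show "(\<lambda>x. indicator {..<\<tau> (fst x)} l :: ennreal) \<in> borel_measurable (\<mu>Y \<Otimes>\<^sub>M count_space (UNIV :: nat set))" by simp
  qed auto
  have form: "(\<integral>\<^sup>+x. w x \<partial>distr S bX (\<lambda>(y, l). (f ^^ l) y)) = (\<integral>\<^sup>+y. (\<Sum>l<\<tau> y. w ((f ^^ l) y)) \<partial>\<mu>Y) * inverse cX"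
    if w: "w \<in> borel_measurable bX" for w
  proof -
    have wj: "(\<lambda>x. w ((f ^^ snd x) (fst x))) \<in> borel_measurable (\<mu>Y \<Otimes>\<^sub>M count_space UNIV)" by (rule measurable_compose[OF jm w])
    have "(\<integral>\<^sup>+x. w x \<partial>distr S bX (\<lambda>(y, l). (f ^^ l) y)) = (\<integral>\<^sup>+x. w ((f ^^ snd x) (fst x)) \<partial>S)"
      using jm w by (subst nn_integral_distr) (auto simp: S_def case_prod_beta')
    also have "\<dots> = (\<integral>\<^sup>+x. (indicator {..<\<tau> (fst x)} (snd x) * inverse cX) * w ((f ^^ snd x) (fst x)) \<partial>(\<mu>Y \<Otimes>\<^sub>M count_space UNIV))"
      unfolding S_def using im wj by (subst nn_integral_density) (auto simp: case_prod_beta')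
    also have "\<dots> = (\<integral>\<^sup>+y. (\<integral>\<^sup>+l. (indicator {..<\<tau> y} l * inverse cX) * w ((f ^^ l) y) \<partial>count_space UNIV) \<partial>\<mu>Y)"
      using im wj by (subst cs.nn_integral_fst[symmetric]) auto
    also have "\<dots> = (\<integral>\<^sup>+y. (\<Sum>l<\<tau> y. w ((f ^^ l) y)) * inverse cX \<partial>\<mu>Y)"
    proof (rule nn_integral_cong)
      fix y
      have "(\<integral>\<^sup>+l. (indicator {..<\<tau> y} l * inverse cX) * w ((f ^^ l) y) \<partial>count_space UNIV)
         = (\<integral>\<^sup>+l. (w ((f ^^ l) y) * inverse cX) * indicator {..<\<tau> y} l \<partial>count_space UNIV)"
        by (rule nn_integral_cong) (simp add: ac_simps)
      also have "\<dots> = (\<Sum>l<\<tau> y. w ((f ^^ l) y) * inverse cX)"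
        by (subst nn_integral_count_space_indicator[symmetric]) (auto simp: nn_integral_count_space_finite)
      finally show "(\<integral>\<^sup>+l. (indicator {..<\<tau> y} l * inverse cX) * w ((f ^^ l) y) \<partial>count_space UNIV) = (\<Sum>l<\<tau> y. w ((f ^^ l) y)) * inverse cX"
        by (simp add: sum_distrib_right)
    qed
    also have "\<dots> = (\<integral>\<^sup>+y. (\<Sum>l<\<tau> y. w ((f ^^ l) y)) \<partial>\<mu>Y) * inverse cX"
    proof (rule nn_integral_multc)
      show "(\<lambda>y. \<Sum>l<\<tau> y. w ((f ^^ l) y)) \<in> borel_measurable \<mu>Y"
        by (rule measurable_compose_countable[OF _ \<tau>_meas_Y, where f = "\<lambda>k y. \<Sum>l<k. w ((f ^^ l) y)"])
           (intro borel_measurable_sum measurable_compose[OF f_pow_meas_Y w])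
    qed
    finally show ?thesis .
  qed
  have "\<mu>X = distr S bX (\<lambda>(y, l). (f ^^ l) y)" (is "_ = ?D")
  proof -
    have "\<mu>X = measure_of X (sets bX) (emeasure ?D)"
      unfolding tower_measure_def
    proof (rule measure_of_eq)
      show "sets bX \<subseteq> Pow X" using sets.space_closed[of bX] by (simp add: space_bX)
      fix A assume "A \<in> sigma_sets X (sets bX)"
      then have A: "A \<in> sets bX" using sets.sigma_sets_eq[of bX] by (simp add: space_bX)
      have "emeasure ?D A = (\<integral>\<^sup>+x. indicator A x \<partial>?D)" using A by simp
      also have "\<dots> = (\<integral>\<^sup>+y. (\<Sum>l<\<tau> y. indicator A ((f ^^ l) y)) \<partial>\<mu>Y) * inverse cX" using A by (intro form) auto
      also have "(\<integral>\<^sup>+y. (\<Sum>l<\<tau> y. indicator A ((f ^^ l) y)) \<partial>\<mu>Y) = (\<integral>\<^sup>+y. of_nat (card {l. l < \<tau> y \<and> (f ^^ l) y \<in> A}) \<partial>\<mu>Y)"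
      proof (rule nn_integral_cong)
        fix y
        have "(\<Sum>l<\<tau> y. indicator A ((f ^^ l) y) :: ennreal) = (\<Sum>l\<in>{..<\<tau> y}. if (f ^^ l) y \<in> A then 1 else 0)"
          by (intro sum.cong) (auto simp: indicator_def)
        also have "\<dots> = of_nat (card {l. l < \<tau> y \<and> (f ^^ l) y \<in> A})"
          by (subst sum.If_cases) (auto simp: Int_def)
        finally show "(\<Sum>l<\<tau> y. indicator A ((f ^^ l) y) :: ennreal) = of_nat (card {l. l < \<tau> y \<and> (f ^^ l) y \<in> A})" .
      qed
      finally show "(\<integral>\<^sup>+y. of_nat (card {l. l < \<tau> y \<and> (f ^^ l) y \<in> A}) \<partial>\<mu>Y) / ennreal (\<integral>y. real (\<tau> y) \<partial>\<mu>Y) = emeasure ?D A"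
        by (simp add: cX_def divide_ennreal_def)
    qed
    also have "\<dots> = ?D" using measure_of_of_measure[of ?D] by (simp add: space_bX)
    finally show ?thesis .
  qed
  then show ?thesis using form[OF w] by simp
qed

lemma sets_\<mu>X: "sets \<mu>X = sets bX"
  unfolding tower_measure_def using sets.sigma_sets_eq[of bX] sets.space_closed[of bX] by (simp add: space_bX)

definition hbar :: ennreal where "hbar = ennreal (\<integral>x. h x \<partial>\<mu>X)"

lemma T_joint [measurable]: "(\<lambda>p. T (max 0 (snd p)) (fst p)) \<in> measurable (borel \<Otimes>\<^sub>M lborel) borel"
  by (rule T_measurable) auto

text \<open>As for \<open>\<mu>X\<close>, the defining set function is recognised as the image of a
  genuine measure, here a density on \<open>\<mu>X\<close> times Lebesgue measure.\<close>

lemma nn_integral_\<mu>M: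
  assumes w: "w \<in> borel_measurable borel"
  shows "(\<integral>\<^sup>+x. w x \<partial>\<mu>M) = (\<integral>\<^sup>+x. (\<integral>\<^sup>+u. indicator {0..h x} u * w (T (max 0 u) x) \<partial>lborel) \<partial>\<mu>X) * inverse hbar"
    and sets_\<mu>M: "sets \<mu>M = sets borel"
proof -
  define S where "S = density (\<mu>X \<Otimes>\<^sub>M lborel) (\<lambda>(x, u). indicator {0..h x} u * inverse hbar)"
  have idX: "(\<lambda>x. x) \<in> measurable \<mu>X borel"
    using measurable_cong_sets[OF sets_\<mu>X refl] measurable_ident[THEN measurable_restrict_space1] by (auto simp: id_def)
  have hX[measurable]: "h \<in> borel_measurable \<mu>X" using h_meas measurable_cong_sets[OF sets_\<mu>X refl] by blast
  have "(\<lambda>p. (fst p, snd p)) \<in> measurable (\<mu>X \<Otimes>\<^sub>M lborel) (borel \<Otimes>\<^sub>M lborel)"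
    by (intro measurable_Pair measurable_compose[OF measurable_fst idX] measurable_snd)
  from measurable_compose[OF this T_joint]
  have jm[measurable]: "(\<lambda>p. T (max 0 (snd p)) (fst p)) \<in> measurable (\<mu>X \<Otimes>\<^sub>M lborel) borel" by simp
  have im[measurable]: "(\<lambda>p. indicator {0..h (fst p)} (snd p) :: ennreal) \<in> borel_measurable (\<mu>X \<Otimes>\<^sub>M lborel)"
    unfolding indicator_def atLeastAtMost_iff by measurable
  have form: "(\<integral>\<^sup>+x. w x \<partial>distr S borel (\<lambda>(x, u). T (max 0 u) x))
      = (\<integral>\<^sup>+x. (\<integral>\<^sup>+u. indicator {0..h x} u * w (T (max 0 u) x) \<partial>lborel) \<partial>\<mu>X) * inverse hbar"
    if w[measurable]: "w \<in> borel_measurable borel" for w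
  proof -
    have "(\<integral>\<^sup>+x. w x \<partial>distr S borel (\<lambda>(x, u). T (max 0 u) x)) = (\<integral>\<^sup>+p. w (T (max 0 (snd p)) (fst p)) \<partial>S)"
      using jm by (subst nn_integral_distr) (auto simp: S_def case_prod_beta')
    also have "\<dots> = (\<integral>\<^sup>+p. (indicator {0..h (fst p)} (snd p) * inverse hbar) * w (T (max 0 (snd p)) (fst p)) \<partial>(\<mu>X \<Otimes>\<^sub>M lborel))"
      unfolding S_def by (subst nn_integral_density) (auto simp: case_prod_beta')
    also have "\<dots> = (\<integral>\<^sup>+p. (indicator {0..h (fst p)} (snd p) * w (T (max 0 (snd p)) (fst p))) * inverse hbar \<partial>(\<mu>X \<Otimes>\<^sub>M lborel))"
      by (rule nn_integral_cong) (simp add: ac_simps)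
    also have "\<dots> = (\<integral>\<^sup>+p. indicator {0..h (fst p)} (snd p) * w (T (max 0 (snd p)) (fst p)) \<partial>(\<mu>X \<Otimes>\<^sub>M lborel)) * inverse hbar"
      by (rule nn_integral_multc) simp
    also have "(\<integral>\<^sup>+p. indicator {0..h (fst p)} (snd p) * w (T (max 0 (snd p)) (fst p)) \<partial>(\<mu>X \<Otimes>\<^sub>M lborel))
       = (\<integral>\<^sup>+x. (\<integral>\<^sup>+u. indicator {0..h x} u * w (T (max 0 u) x) \<partial>lborel) \<partial>\<mu>X)"
      by (subst lborel.nn_integral_fst[symmetric]) auto
    finally show ?thesis .
  qed
  have "\<mu>M = distr S borel (\<lambda>(x, u). T (max 0 u) x)" (is "_ = ?D")
  proof -
    have "\<mu>M = measure_of UNIV (sets borel) (emeasure ?D)"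
      unfolding suspension_measure_def
    proof (rule measure_of_eq)
      fix A :: "'m set" assume "A \<in> sigma_sets UNIV (sets borel)"
      then have A[measurable]: "A \<in> sets borel" using sets.sigma_sets_eq[of "borel :: 'm measure"] by simp
      have "emeasure ?D A = (\<integral>\<^sup>+x. indicator A x \<partial>?D)" by simp
      also have "\<dots> = (\<integral>\<^sup>+x. (\<integral>\<^sup>+u. indicator {0..h x} u * indicator A (T (max 0 u) x) \<partial>lborel) \<partial>\<mu>X) * inverse hbar" by (rule form) auto
      also have "(\<integral>\<^sup>+x. (\<integral>\<^sup>+u. indicator {0..h x} u * indicator A (T (max 0 u) x) \<partial>lborel) \<partial>\<mu>X)
         = (\<integral>\<^sup>+x. emeasure lborel {u \<in> {0..h x}. T u x \<in> A} \<partial>\<mu>X)"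
      proof (rule nn_integral_cong)
        fix x
        have [measurable]: "(\<lambda>u. T (max 0 u) x) \<in> borel_measurable lborel" by (rule T_measurable) auto
        have "(\<integral>\<^sup>+u. indicator {0..h x} u * indicator A (T (max 0 u) x) \<partial>lborel) = (\<integral>\<^sup>+u. indicator {u \<in> {0..h x}. T u x \<in> A} u \<partial>lborel)"
          by (rule nn_integral_cong) (auto simp: indicator_def max_def)
        also have "\<dots> = emeasure lborel {u \<in> {0..h x}. T u x \<in> A}"
        proof (rule nn_integral_indicator)
          have "{u \<in> {0..h x}. T u x \<in> A} = {u \<in> space lborel. 0 \<le> u \<and> u \<le> h x \<and> T (max 0 u) x \<in> A}" by (auto simp: max_def)
          also have "\<dots> \<in> sets lborel" by measurable
          finally show "{u \<in> {0..h x}. T u x \<in> A} \<in> sets lborel" .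
        qed
        finally show "(\<integral>\<^sup>+u. indicator {0..h x} u * indicator A (T (max 0 u) x) \<partial>lborel) = emeasure lborel {u \<in> {0..h x}. T u x \<in> A}" .
      qed
      finally show "(\<integral>\<^sup>+x. emeasure lborel {u \<in> {0..h x}. T u x \<in> A} \<partial>\<mu>X) / ennreal (\<integral>x. h x \<partial>\<mu>X) = emeasure ?D A"
        by (simp add: hbar_def divide_ennreal_def)
    qed auto
    also have "\<dots> = ?D" using measure_of_of_measure[of ?D] by simp
    finally show ?thesis .
  qed
  then show "(\<integral>\<^sup>+x. w x \<partial>\<mu>M) = (\<integral>\<^sup>+x. (\<integral>\<^sup>+u. indicator {0..h x} u * w (T (max 0 u) x) \<partial>lborel) \<partial>\<mu>X) * inverse hbar"
    and "sets \<mu>M = sets borel" using form[OF w] by auto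
qed

lemma nn_integral_split_shift:
  fixes G :: "real \<Rightarrow> ennreal"
  assumes [measurable]: "G \<in> borel_measurable borel" and "0 \<le> a" "0 \<le> b"
  shows "(\<integral>\<^sup>+u. indicator {0..a + b} u * G u \<partial>lborel)
     = (\<integral>\<^sup>+u. indicator {0..a} u * G u \<partial>lborel) + (\<integral>\<^sup>+u. indicator {0..b} u * G (a + u) \<partial>lborel)"
proof -
  have "(\<integral>\<^sup>+u. indicator {0..a + b} u * G u \<partial>lborel) = (\<integral>\<^sup>+u. indicator {0..a} u * G u + indicator {a..a + b} u * G u \<partial>lborel)"
  proof (rule nn_integral_cong_AE)
    show "AE u in lborel. indicator {0..a + b} u * G u = indicator {0..a} u * G u + indicator {a..a + b} u * G u"
      using AE_lborel_singleton[of a] by eventually_elim (use assms in \<open>auto simp: indicator_def\<close>)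
  qed
  also have "\<dots> = (\<integral>\<^sup>+u. indicator {0..a} u * G u \<partial>lborel) + (\<integral>\<^sup>+u. indicator {a..a + b} u * G u \<partial>lborel)"
    by (rule nn_integral_add) auto
  also have "(\<integral>\<^sup>+u. indicator {a..a + b} u * G u \<partial>lborel) = (\<integral>\<^sup>+u. indicator {a..a + b} (a + 1 * u) * G (a + 1 * u) \<partial>lborel)"
    by (subst nn_integral_real_affine[where c = 1 and t = a]) auto
  also have "\<dots> = (\<integral>\<^sup>+u. indicator {0..b} u * G (a + u) \<partial>lborel)"
    by (rule nn_integral_cong) (auto simp: indicator_def)
  finally show ?thesis .
qed

text \<open>The fibres over the successive points of an \<open>f\<close>-orbit join, end to end,
  into a single flow segment of length \<open>hs k y\<close>; each junction is a single instant, a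
  Lebesgue null set.\<close>

lemma fibre_sum:
  assumes y: "y \<in> X" and w[measurable]: "w \<in> borel_measurable borel"
  shows "(\<Sum>l<k. \<integral>\<^sup>+u. indicator {0..h ((f ^^ l) y)} u * w (T (max 0 u) ((f ^^ l) y)) \<partial>lborel)
     = (\<integral>\<^sup>+u. indicator {0..hs k y} u * w (T (max 0 u) y) \<partial>lborel)"
proof (induction k)
  case 0
  have "(\<integral>\<^sup>+u. indicator {0..hs 0 y} u * w (T (max 0 u) y) \<partial>lborel) = (\<integral>\<^sup>+u. 0 \<partial>(lborel :: real measure))"
  proof (rule nn_integral_cong_AE)
    show "AE u in lborel. indicator {0..hs 0 y} u * w (T (max 0 u) y) = 0"
      using AE_lborel_singleton[of "0::real"] by eventually_elim (auto simp: hs_def indicator_def)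
  qed
  then show ?case by simp
next
  case (Suc k)
  have [measurable]: "(\<lambda>u. T (max 0 u) y) \<in> borel_measurable borel" by (rule T_measurable) auto
  have "(\<integral>\<^sup>+u. indicator {0..hs (Suc k) y} u * w (T (max 0 u) y) \<partial>lborel)
      = (\<integral>\<^sup>+u. indicator {0..hs k y} u * w (T (max 0 u) y) \<partial>lborel)
        + (\<integral>\<^sup>+u. indicator {0..h ((f ^^ k) y)} u * w (T (max 0 (hs k y + u)) y) \<partial>lborel)"
    using nn_integral_split_shift[of "\<lambda>u. w (T (max 0 u) y)" "hs k y" "h ((f ^^ k) y)"] hs_nonneg[OF y] h_pos[OF f_pow_X[OF y]]
    by (simp add: hs_def less_imp_le)
  also have "(\<integral>\<^sup>+u. indicator {0..h ((f ^^ k) y)} u * w (T (max 0 (hs k y + u)) y) \<partial>lborel)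
     = (\<integral>\<^sup>+u. indicator {0..h ((f ^^ k) y)} u * w (T (max 0 u) ((f ^^ k) y)) \<partial>lborel)"
  proof (rule nn_integral_cong)
    fix u :: real
    have "T (hs k y + u) y = T u ((f ^^ k) y)" if "0 \<le> u"
      using semiflow_add[OF that hs_nonneg[OF y, of k], of y] T_hs[OF y, of k] by (simp add: add.commute)
    then show "indicator {0..h ((f ^^ k) y)} u * w (T (max 0 (hs k y + u)) y) = indicator {0..h ((f ^^ k) y)} u * w (T (max 0 u) ((f ^^ k) y))"
      using hs_nonneg[OF y, of k] by (auto simp: indicator_def max_def)
  qed
  finally show ?case using Suc by simp
qed

text \<open>The two-stage construction collapses to one suspension over \<open>Y\<close> with roof
  \<open>H\<close>. The factor \<open>\<kappa>\<close> is the reciprocal of the product of the two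
  normalisations, and the point is that neither of them is zero or infinite.\<close>

lemma nn_integral_\<mu>M_Y:
  "\<exists>\<kappa>>0. \<forall>w\<in>borel_measurable borel. (\<integral>\<^sup>+x. w x \<partial>\<mu>M)
     = ennreal \<kappa> * (\<integral>\<^sup>+y. (\<integral>\<^sup>+u. indicator {0..H y} u * w (T (max 0 u) y) \<partial>lborel) \<partial>\<mu>Y)"
proof -
  have Hm: "(\<lambda>y. \<Sum>l<\<tau> y. ennreal (h ((f ^^ l) y))) \<in> borel_measurable \<mu>Y"
    by (rule measurable_compose_countable[OF _ \<tau>_meas_Y, where f = "\<lambda>k y. \<Sum>l<k. ennreal (h ((f ^^ l) y))"])
       (intro borel_measurable_sum measurable_compose[OF f_pow_meas_Y] measurable_compose[OF h_meas measurable_ennreal])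
  have HH: "(\<Sum>l<\<tau> y. ennreal (h ((f ^^ l) y))) = ennreal (H y)" if "y \<in> Y" for y
    unfolding Hroof_def using f_pow_X[of y] h_pos that sets_XY by (intro sum_ennreal) (auto intro: less_imp_le)
  have "(\<integral>\<^sup>+y. (\<Sum>l<\<tau> y. ennreal (h ((f ^^ l) y))) \<partial>\<mu>Y) \<noteq> 0"
  proof
    assume "(\<integral>\<^sup>+y. (\<Sum>l<\<tau> y. ennreal (h ((f ^^ l) y))) \<partial>\<mu>Y) = 0"
    then have "AE y in \<mu>Y. (\<Sum>l<\<tau> y. ennreal (h ((f ^^ l) y))) = 0" using nn_integral_0_iff_AE[OF Hm] by simp
    then have "AE y in \<mu>Y. False" using AE_space
    proof eventually_elim
      case (elim y)
      then have "ennreal (H y) = 0" using HH[of y] by (simp add: space_Y)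
      then show ?case using H_pos[of y] elim(2) by (simp add: space_Y)
    qed
    then show False by (simp add: Y.AE_False)
  qed
  moreover have "(\<integral>\<^sup>+x. ennreal (h x) \<partial>\<mu>X) = (\<integral>\<^sup>+y. (\<Sum>l<\<tau> y. ennreal (h ((f ^^ l) y))) \<partial>\<mu>Y) * inverse cX"
    by (rule nn_integral_\<mu>X) (intro measurable_compose[OF h_meas measurable_ennreal])
  moreover have "(\<integral>\<^sup>+x. ennreal (h x) \<partial>\<mu>X) = hbar"
    unfolding hbar_def using h_L1 h_pos sets_eq_imp_space_eq[OF sets_\<mu>X] space_bX
    by (intro nn_integral_eq_integral AE_I2) (auto intro: less_imp_le)
  ultimately have hb: "hbar = (\<integral>\<^sup>+y. (\<Sum>l<\<tau> y. ennreal (h ((f ^^ l) y))) \<partial>\<mu>Y) * inverse cX"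
    and ne: "(\<integral>\<^sup>+y. (\<Sum>l<\<tau> y. ennreal (h ((f ^^ l) y))) \<partial>\<mu>Y) \<noteq> 0" by auto
  \<comment> \<open>A non-integrable \<open>\<tau>\<close> would make \<open>cX\<close> zero by the
    default value of the Bochner integral and \<open>inverse cX\<close> infinite; then
    \<open>hbar\<close>, an embedded real number, would be infinite too.\<close>
  have "inverse cX \<noteq> \<top>"
  proof
    assume "inverse cX = \<top>"
    then have "hbar = \<top>" using hb ne by (simp add: ennreal_mult_top)
    then show False by (simp add: hbar_def)
  qed
  moreover have icX: "inverse cX \<noteq> 0" by (simp add: cX_def)
  moreover have "hbar \<noteq> 0" using hb ne icX by simp
  moreover have "hbar \<noteq> \<top>" by (simp add: hbar_def)
  ultimately have k: "inverse cX * inverse hbar \<noteq> 0" "inverse cX * inverse hbar \<noteq> \<top>"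
    by (auto simp: ennreal_mult_eq_top_iff ennreal_inverse_eq_top_iff)
  define \<kappa> where "\<kappa> = enn2real (inverse cX * inverse hbar)"
  have \<kappa>: "ennreal \<kappa> = inverse cX * inverse hbar" "\<kappa> > 0" using k
    by (auto simp: \<kappa>_def ennreal_enn2real_if enn2real_positive_iff less_top zero_less_iff_neq_zero)
  have "(\<integral>\<^sup>+x. w x \<partial>\<mu>M) = ennreal \<kappa> * (\<integral>\<^sup>+y. (\<integral>\<^sup>+u. indicator {0..H y} u * w (T (max 0 u) y) \<partial>lborel) \<partial>\<mu>Y)"
    if w[measurable]: "w \<in> borel_measurable borel" for w
  proof -
    have m: "(\<lambda>x. \<integral>\<^sup>+u. indicator {0..h x} u * w (T (max 0 u) x) \<partial>lborel) \<in> borel_measurable bX"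
    proof (rule lborel.borel_measurable_nn_integral)
      note [measurable] = h_meas
      have "(\<lambda>p. (fst p, snd p)) \<in> measurable (bX \<Otimes>\<^sub>M lborel) (borel \<Otimes>\<^sub>M lborel)"
        by (intro measurable_Pair measurable_compose[OF measurable_fst measurable_ident[THEN measurable_restrict_space1, unfolded id_def]] measurable_snd)
      from measurable_compose[OF this T_joint]
      have [measurable]: "(\<lambda>p. T (max 0 (snd p)) (fst p)) \<in> measurable (bX \<Otimes>\<^sub>M lborel) borel" by simp
      have [measurable]: "(\<lambda>p. indicator {0..h (fst p)} (snd p) :: ennreal) \<in> borel_measurable (bX \<Otimes>\<^sub>M lborel)"
        unfolding indicator_def atLeastAtMost_iff by measurable
      show "(\<lambda>(x, u). indicator {0..h x} u * w (T (max 0 u) x)) \<in> borel_measurable (bX \<Otimes>\<^sub>M lborel)"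
        unfolding case_prod_beta' by measurable
    qed
    have "(\<integral>\<^sup>+x. w x \<partial>\<mu>M) = (\<integral>\<^sup>+y. (\<Sum>l<\<tau> y. \<integral>\<^sup>+u. indicator {0..h ((f ^^ l) y)} u * w (T (max 0 u) ((f ^^ l) y)) \<partial>lborel) \<partial>\<mu>Y) * inverse cX * inverse hbar"
      by (subst nn_integral_\<mu>M[OF w], subst nn_integral_\<mu>X[OF m]) simp
    also have "(\<integral>\<^sup>+y. (\<Sum>l<\<tau> y. \<integral>\<^sup>+u. indicator {0..h ((f ^^ l) y)} u * w (T (max 0 u) ((f ^^ l) y)) \<partial>lborel) \<partial>\<mu>Y)
      = (\<integral>\<^sup>+y. (\<integral>\<^sup>+u. indicator {0..H y} u * w (T (max 0 u) y) \<partial>lborel) \<partial>\<mu>Y)"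
      by (rule nn_integral_cong, subst fibre_sum) (use sets_XY w in \<open>auto simp: space_Y H_hs\<close>)
    finally show ?thesis by (simp add: \<kappa> ac_simps)
  qed
  then show ?thesis using \<kappa>(2) by blast
qed

end

section \<open>Path integrals along the flow\<close>

lemma integrable_interval_bounded:
  fixes g :: "real \<Rightarrow> real"
  assumes "g \<in> borel_measurable borel" "\<And>u. u \<in> {s..t} \<Longrightarrow> \<bar>g u\<bar> \<le> B"
  shows "integrable lborel (\<lambda>u. indicator {s..t} u * g u)"
  using integrableI_bounded_set_indicator[of "{s..t}" lborel g B] assms by (auto simp: emeasure_lborel_Icc_eq)

lemma interval_integral_le:
  fixes g :: "real \<Rightarrow> real"
  assumes g: "g \<in> borel_measurable borel" and B: "\<And>u. u \<in> {0..t} \<Longrightarrow> \<bar>g u\<bar> \<le> B" and t: "0 \<le> t"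
  shows "\<bar>\<integral>u. indicator {0..t} u * g u \<partial>lborel\<bar> \<le> B * t"
proof -
  have "\<bar>\<integral>u. indicator {0..t} u * g u \<partial>lborel\<bar> \<le> (\<integral>u. \<bar>indicator {0..t} u * g u\<bar> \<partial>lborel)" by (rule integral_abs_bound)
  also have "\<dots> \<le> (\<integral>u. indicator {0..t} u * B \<partial>lborel)"
  proof (rule integral_mono)
    show "integrable lborel (\<lambda>u. \<bar>indicator {0..t} u * g u\<bar>)" using integrable_interval_bounded[OF g B] by (intro integrable_abs) auto
    show "integrable lborel (\<lambda>u. indicator {0..t} u * B)" using integrable_interval_bounded[of "\<lambda>_. B" 0 t "\<bar>B\<bar>"] by auto
  qed (use B in \<open>auto simp: indicator_def\<close>)
  also have "\<dots> = B * t" using t by simp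
  finally show ?thesis .
qed

lemma interval_integral_split:
  fixes g :: "real \<Rightarrow> real"
  assumes g[measurable]: "g \<in> borel_measurable borel" and B: "\<And>u. u \<in> {0..s + t} \<Longrightarrow> \<bar>g u\<bar> \<le> B" and st: "0 \<le> s" "0 \<le> t"
  shows "(\<integral>u. indicator {0..s + t} u * g u \<partial>lborel)
     = (\<integral>u. indicator {0..s} u * g u \<partial>lborel) + (\<integral>u. indicator {0..t} u * g (s + u) \<partial>lborel)"
proof -
  have "(\<integral>u. indicator {0..s + t} u * g u \<partial>lborel) = (\<integral>u. indicator {0..s} u * g u + indicator {s..s + t} u * g u \<partial>lborel)"
  proof (rule integral_cong_AE)
    show "AE u in lborel. indicator {0..s + t} u * g u = indicator {0..s} u * g u + indicator {s..s + t} u * g u"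
      using AE_lborel_singleton[of s] by eventually_elim (use st in \<open>auto simp: indicator_def\<close>)
  qed auto
  also have "\<dots> = (\<integral>u. indicator {0..s} u * g u \<partial>lborel) + (\<integral>u. indicator {s..s + t} u * g u \<partial>lborel)"
    using B st by (intro Bochner_Integration.integral_add integrable_interval_bounded[OF g, of _ _ B]) auto
  also have "(\<integral>u. indicator {s..s + t} u * g u \<partial>lborel) = (\<integral>u. indicator {s..s + t} (s + 1 * u) * g (s + 1 * u) \<partial>lborel)"
    by (subst lborel_integral_real_affine[where c = 1 and t = s]) auto
  also have "\<dots> = (\<integral>u. indicator {0..t} u * g (s + u) \<partial>lborel)"
    by (rule Bochner_Integration.integral_cong) (auto simp: indicator_def)
  finally show ?thesis .
qed

section \<open>Scalar integrals along orbits\<close>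

context nue
begin

text \<open>Scalar observables with supremum and Hoelder constant both normalised to 1; bounds
  uniform over this class scale to all \<open>v\<close>.\<close>

definition unit_fn :: "('m \<Rightarrow> real) \<Rightarrow> bool" where
  "unit_fn a \<longleftrightarrow> a \<in> borel_measurable borel \<and> (\<forall>x. \<bar>a x\<bar> \<le> 1) \<and> (\<forall>x y. \<bar>a x - a y\<bar> \<le> dist x y powr \<eta>)"

definition I1 :: "('m \<Rightarrow> real) \<Rightarrow> real \<Rightarrow> 'm \<Rightarrow> real" where
  "I1 a s x = (\<integral>u. indicator {0..s} u * a (T (max 0 u) x) \<partial>lborel)"

definition I2 :: "('m \<Rightarrow> real) \<Rightarrow> ('m \<Rightarrow> real) \<Rightarrow> real \<Rightarrow> 'm \<Rightarrow> real" where
  "I2 a b s x = (\<integral>u. indicator {0..s} u * (I1 a u x * b (T (max 0 u) x)) \<partial>lborel)"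

lemma unit_fnD: assumes "unit_fn a" shows "a \<in> borel_measurable borel" "\<bar>a x\<bar> \<le> 1"
  using assms by (auto simp: unit_fn_def)

lemma T_path [measurable]: "(\<lambda>u. T (max 0 u) x) \<in> borel_measurable borel"
  by (rule T_measurable) auto

lemma path_meas: "unit_fn a \<Longrightarrow> (\<lambda>u. a (T (max 0 u) x)) \<in> borel_measurable borel"
  by (rule measurable_compose[OF T_path]) (simp add: unit_fn_def)

lemma T_max_add: "0 \<le> s \<Longrightarrow> 0 \<le> u \<Longrightarrow> T (max 0 (s + u)) x = T (max 0 u) (T s x)"
  using semiflow_add[of u s x] by (simp add: add.commute)

lemma I1_le: "unit_fn a \<Longrightarrow> 0 \<le> s \<Longrightarrow> \<bar>I1 a s x\<bar> \<le> s"
  unfolding I1_def using interval_integral_le[OF path_meas, of a s x 1] unit_fnD(2)[of a] by simp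

lemma I1_add:
  assumes a: "unit_fn a" and s: "0 \<le> s" "0 \<le> t"
  shows "I1 a (s + t) x = I1 a s x + I1 a t (T s x)"
proof -
  have "I1 a (s + t) x = I1 a s x + (\<integral>u. indicator {0..t} u * a (T (max 0 (s + u)) x) \<partial>lborel)"
    unfolding I1_def using unit_fnD(2)[OF a] by (intro interval_integral_split[OF path_meas[OF a], of s t x 1] s) auto
  also have "(\<integral>u. indicator {0..t} u * a (T (max 0 (s + u)) x) \<partial>lborel) = I1 a t (T s x)"
    unfolding I1_def by (rule Bochner_Integration.integral_cong) (auto simp: indicator_def T_max_add[OF s(1)] simp del: max_def)
  finally show ?thesis .
qed

lemma I1_0: "I1 a 0 x = 0"
proof -
  have "I1 a 0 x = (\<integral>u. 0 \<partial>(lborel :: real measure))"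
    unfolding I1_def
  proof (rule integral_cong_AE)
    show "AE u in lborel. indicator {0..0} u * a (T (max 0 u) x) = 0"
      using AE_lborel_singleton[of "0::real"] by eventually_elim (auto simp: indicator_def)
    have "(\<lambda>u. indicator {0..0} u * a (T (max 0 u) x)) = (\<lambda>u. indicator {0..0} u * a (T 0 x))" by (auto simp: indicator_def fun_eq_iff)
    then show "(\<lambda>u. indicator {0..0} u * a (T (max 0 u) x)) \<in> borel_measurable lborel" by simp
  qed auto
  then show ?thesis by simp
qed

lemma I1_joint:
  assumes a: "unit_fn a" and [measurable]: "s \<in> borel_measurable M" "x \<in> measurable M borel"
  shows "(\<lambda>w. I1 a (s w) (x w)) \<in> borel_measurable M"
proof -
  note [measurable] = unit_fnD(1)[OF a]
  have [measurable]: "(\<lambda>p. T (max 0 (snd p)) (x (fst p))) \<in> measurable (M \<Otimes>\<^sub>M lborel) borel"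
    by (rule T_measurable) auto
  have "(\<lambda>p. indicator {0..s (fst p)} (snd p) * a (T (max 0 (snd p)) (x (fst p)))) \<in> borel_measurable (M \<Otimes>\<^sub>M lborel)"
    unfolding indicator_def atLeastAtMost_iff by measurable
  then show ?thesis unfolding I1_def
    by (intro lborel.borel_measurable_lebesgue_integral) (simp add: case_prod_beta')
qed

lemma I2_path_meas:
  assumes a: "unit_fn a" and b: "unit_fn b"
  shows "(\<lambda>u. I1 a u x * b (T (max 0 u) x)) \<in> borel_measurable borel"
  by (intro borel_measurable_times I1_joint[OF a] path_meas[OF b]) auto

lemma I2_joint:
  assumes a: "unit_fn a" and b: "unit_fn b" and [measurable]: "s \<in> borel_measurable M" "x \<in> measurable M borel"
  shows "(\<lambda>w. I2 a b (s w) (x w)) \<in> borel_measurable M"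
proof -
  note [measurable] = unit_fnD(1)[OF b]
  have [measurable]: "(\<lambda>p. T (max 0 (snd p)) (x (fst p))) \<in> measurable (M \<Otimes>\<^sub>M lborel) borel"
    by (rule T_measurable) auto
  have [measurable]: "(\<lambda>p. I1 a (snd p) (x (fst p))) \<in> borel_measurable (M \<Otimes>\<^sub>M lborel)"
    by (rule I1_joint[OF a]) auto
  have "(\<lambda>p. indicator {0..s (fst p)} (snd p) * (I1 a (snd p) (x (fst p)) * b (T (max 0 (snd p)) (x (fst p))))) \<in> borel_measurable (M \<Otimes>\<^sub>M lborel)"
    unfolding indicator_def atLeastAtMost_iff by measurable
  then show ?thesis unfolding I2_def
    by (intro lborel.borel_measurable_lebesgue_integral) (simp add: case_prod_beta')
qed

lemma I2_path_le:
  assumes a: "unit_fn a" and b: "unit_fn b" and u: "u \<in> {0..s}"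
  shows "\<bar>I1 a u x * b (T (max 0 u) x)\<bar> \<le> s"
proof -
  have "\<bar>I1 a u x\<bar> * \<bar>b (T (max 0 u) x)\<bar> \<le> s * 1"
    using I1_le[OF a, of u x] unit_fnD(2)[OF b] u by (intro mult_mono) auto
  then show ?thesis by (simp add: abs_mult)
qed

lemma I2_le: assumes "unit_fn a" "unit_fn b" "0 \<le> s" shows "\<bar>I2 a b s x\<bar> \<le> s * s"
  unfolding I2_def using I2_path_le[OF assms(1,2)] by (intro interval_integral_le[OF I2_path_meas] assms) auto

text \<open>Chen's relation for iterated integrals: splitting the time interval leaves one cross
  term, the product of the increments over the two parts.\<close>

lemma I2_add:
  assumes a: "unit_fn a" and b: "unit_fn b" and s: "0 \<le> s" "0 \<le> t"
  shows "I2 a b (s + t) x = I2 a b s x + I1 a s x * I1 b t (T s x) + I2 a b t (T s x)"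
proof -
  have "I2 a b (s + t) x = I2 a b s x + (\<integral>u. indicator {0..t} u * (I1 a (s + u) x * b (T (max 0 (s + u)) x)) \<partial>lborel)"
    unfolding I2_def by (rule interval_integral_split[OF I2_path_meas[OF a b] I2_path_le[OF a b] s])
  also have "(\<integral>u. indicator {0..t} u * (I1 a (s + u) x * b (T (max 0 (s + u)) x)) \<partial>lborel)
     = (\<integral>u. I1 a s x * (indicator {0..t} u * b (T (max 0 u) (T s x))) + indicator {0..t} u * (I1 a u (T s x) * b (T (max 0 u) (T s x))) \<partial>lborel)"
  proof (rule Bochner_Integration.integral_cong[OF refl])
    fix u :: real
    show "indicator {0..t} u * (I1 a (s + u) x * b (T (max 0 (s + u)) x))
      = I1 a s x * (indicator {0..t} u * b (T (max 0 u) (T s x))) + indicator {0..t} u * (I1 a u (T s x) * b (T (max 0 u) (T s x)))"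
      using I1_add[OF a s(1), of u x] T_max_add[OF s(1), of u x] by (cases "u \<in> {0..t}") (auto simp: algebra_simps)
  qed
  also have "\<dots> = I1 a s x * I1 b t (T s x) + I2 a b t (T s x)"
    unfolding I1_def[of b t] I2_def[of a b t]
    using integrable_interval_bounded[OF path_meas[OF b], of 0 t _ 1] unit_fnD(2)[OF b]
      integrable_interval_bounded[OF I2_path_meas[OF a b] I2_path_le[OF a b]]
    by (subst Bochner_Integration.integral_add) auto
  finally show ?thesis by simp
qed

lemma I2_0: assumes "unit_fn a" "unit_fn b" shows "I2 a b 0 x = 0"
  using I2_le[OF assms, of 0 x] by simp

section \<open>Decomposition along the returns to \<open>Y\<close>\<close>

definition HS :: "nat \<Rightarrow> 'm \<Rightarrow> real" where "HS k y = (\<Sum>j<k. H ((F ^^ j) y))"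

lemma F_pow_Y: "y \<in> Y \<Longrightarrow> (F ^^ k) y \<in> Y"
  by (induction k) (auto simp: F_Y)

lemma HS_nonneg: "y \<in> Y \<Longrightarrow> 0 \<le> HS k y"
  unfolding HS_def using F_pow_Y H_pos by (intro sum_nonneg less_imp_le) auto

lemma T_HS: "y \<in> Y \<Longrightarrow> T (HS k y) y = (F ^^ k) y"
proof (induction k)
  case (Suc k)
  have "T (HS (Suc k) y) y = T (H ((F ^^ k) y) + HS k y) y" by (simp add: HS_def add.commute)
  also have "\<dots> = T (H ((F ^^ k) y)) (T (HS k y) y)"
    using Suc.prems F_pow_Y H_pos by (intro semiflow_add HS_nonneg) (auto intro: less_imp_le)
  finally show ?case using Suc T_H F_pow_Y by simp
qed (simp add: HS_def semiflow0)

definition V :: "('m \<Rightarrow> real) \<Rightarrow> 'm \<Rightarrow> real" where "V a y = I1 a (H y) y"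

lemma I1_HS: "unit_fn a \<Longrightarrow> y \<in> Y \<Longrightarrow> I1 a (HS k y) y = (\<Sum>j<k. V a ((F ^^ j) y))"
proof (induction k)
  case (Suc k)
  have "I1 a (HS (Suc k) y) y = I1 a (HS k y + H ((F ^^ k) y)) y" by (simp add: HS_def)
  also have "\<dots> = I1 a (HS k y) y + I1 a (H ((F ^^ k) y)) (T (HS k y) y)"
    using Suc.prems F_pow_Y H_pos by (intro I1_add HS_nonneg) (auto intro: less_imp_le)
  finally show ?case using Suc by (simp add: T_HS V_def)
qed (simp add: HS_def I1_0)

text \<open>Chen's relation applied at each return. The cross terms assemble into the iterated sum
  of induced observables; the second sum collects the iterated integrals inside single
  returns.\<close>

lemma I2_HS:
  assumes a: "unit_fn a" and b: "unit_fn b" and y: "y \<in> Y"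
  shows "I2 a b (HS k y) y = (\<Sum>j<k. (\<Sum>i<j. V a ((F ^^ i) y)) * V b ((F ^^ j) y)) + (\<Sum>j<k. I2 a b (H ((F ^^ j) y)) ((F ^^ j) y))"
proof (induction k)
  case 0 then show ?case using I2_0[OF a b] by (simp add: HS_def)
next
  case (Suc k)
  have "I2 a b (HS (Suc k) y) y = I2 a b (HS k y + H ((F ^^ k) y)) y" by (simp add: HS_def)
  also have "\<dots> = I2 a b (HS k y) y + I1 a (HS k y) y * I1 b (H ((F ^^ k) y)) (T (HS k y) y) + I2 a b (H ((F ^^ k) y)) (T (HS k y) y)"
    using y F_pow_Y H_pos by (intro I2_add a b HS_nonneg) (auto intro: less_imp_le)
  finally show ?case using Suc by (simp add: T_HS[OF y] V_def I1_HS[OF a y])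
qed

text \<open>\<open>N\<close> is the number of completed returns at flow time \<open>u + t\<close>,
  counted from the base point. Its bound depends on \<open>t\<close> alone, because the part of the
  first return before \<open>u\<close> is not counted against \<open>t\<close>; \<open>Suc\<close>
  accounts for that first return.\<close>

lemma lap_number:
  assumes y: "y \<in> Y" and u: "0 \<le> u" "u \<le> H y" and t: "0 \<le> t" and h0: "0 < h0" "\<And>y. y \<in> Y \<Longrightarrow> h0 \<le> H y"
  shows "\<exists>N \<rho>. N \<le> Suc (nat \<lfloor>t / h0\<rfloor>) \<and> 0 \<le> \<rho> \<and> \<rho> \<le> H ((F ^^ N) y) \<and> u + t = HS N y + \<rho>"
proof -
  have HS_ge: "real k * h0 \<le> HS k y" for k
  proof -
    have "(\<Sum>j<k. h0) \<le> HS k y" unfolding HS_def using h0(2) F_pow_Y[OF y] by (intro sum_mono) auto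
    then show ?thesis by simp
  qed
  obtain k :: nat where "(u + t) / h0 < k" using reals_Archimedean2 by blast
  then have "u + t < real k * h0" using h0 by (simp add: field_simps)
  also have "\<dots> \<le> HS k y" by (rule HS_ge)
  also have "\<dots> \<le> HS (Suc k) y" using H_pos[OF F_pow_Y[OF y, of k]] by (simp add: HS_def)
  finally have ex: "\<exists>k. u + t < HS (Suc k) y" by blast
  define N where "N = (LEAST k. u + t < HS (Suc k) y)"
  have N1: "u + t < HS (Suc N) y" unfolding N_def by (rule LeastI_ex[OF ex])
  have N2: "HS N y \<le> u + t"
  proof (cases N)
    case 0 then show ?thesis using u t by (simp add: HS_def)
  next
    case (Suc m)
    then have "\<not> u + t < HS (Suc m) y" using not_less_Least[of m "\<lambda>k. u + t < HS (Suc k) y"] by (simp add: N_def)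
    then show ?thesis using Suc by simp
  qed
  have "N \<le> Suc (nat \<lfloor>t / h0\<rfloor>)"
  proof (cases N)
    case (Suc m)
    \<comment> \<open>The first return may be long and is kept exactly: \<open>u \<le> H y\<close>
      cancels against it, so that the other \<open>m\<close> returns must fit into time
      \<open>t\<close>.\<close>
    have "H y + real m * h0 \<le> HS (Suc m) y"
    proof -
      have "HS (Suc m) y = H y + (\<Sum>j<m. H ((F ^^ Suc j) y))" unfolding HS_def by (subst sum.lessThan_Suc_shift) simp
      moreover have "(\<Sum>j<m. h0) \<le> (\<Sum>j<m. H ((F ^^ Suc j) y))"
        using h0(2) F_pow_Y[OF y, of "Suc j" for j] by (intro sum_mono) blast
      ultimately show ?thesis by simp
    qed
    then have "real m * h0 \<le> t" using N2 u unfolding Suc by linarith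
    then have "real m \<le> t / h0" using h0 by (simp add: field_simps)
    then have "m \<le> nat \<lfloor>t / h0\<rfloor>" by (simp add: le_nat_floor)
    then show ?thesis using Suc by simp
  qed simp
  then show ?thesis using N1 N2 by (intro exI[of _ N] exI[of _ "u + t - HS N y"]) (auto simp: HS_def)
qed

text \<open>The integral is started at the base point. The complete returns give a Birkhoff sum,
  while the initial piece before \<open>u\<close> and the incomplete last return are each bounded by
  the largest roof value met.\<close>

lemma I1_lap_bound:
  assumes a: "unit_fn a" and y: "y \<in> Y" and u: "0 \<le> u" "u \<le> H y" and t: "0 \<le> t" and h0: "0 < h0" "\<And>y. y \<in> Y \<Longrightarrow> h0 \<le> H y"
    and n: "n = Suc (nat \<lfloor>t / h0\<rfloor>)"
  shows "\<bar>I1 a t (T u y)\<bar> \<le> runmax (\<lambda>k. \<bar>\<Sum>j<k. V a ((F ^^ j) y)\<bar>) n + 2 * runmax (\<lambda>k. \<bar>H ((F ^^ k) y)\<bar>) n"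
proof -
  obtain N \<rho> where N: "N \<le> n" "0 \<le> \<rho>" "\<rho> \<le> H ((F ^^ N) y)" "u + t = HS N y + \<rho>"
    using lap_number[OF y u t h0] n by blast
  have "I1 a (u + t) y = I1 a u y + I1 a t (T u y)" by (rule I1_add[OF a u(1) t])
  moreover have "I1 a (u + t) y = (\<Sum>j<N. V a ((F ^^ j) y)) + I1 a \<rho> ((F ^^ N) y)"
    unfolding N(4) using I1_add[OF a HS_nonneg[OF y, of N] N(2), of y] by (simp add: I1_HS[OF a y] T_HS[OF y])
  moreover have "\<bar>I1 a u y\<bar> \<le> u" "\<bar>I1 a \<rho> ((F ^^ N) y)\<bar> \<le> \<rho>" using I1_le[OF a] u N by auto
  moreover have "\<bar>\<Sum>j<N. V a ((F ^^ j) y)\<bar> \<le> runmax (\<lambda>k. \<bar>\<Sum>j<k. V a ((F ^^ j) y)\<bar>) n"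
    using runmax_ge[OF N(1), of "\<lambda>k. \<bar>\<Sum>j<k. V a ((F ^^ j) y)\<bar>"] .
  moreover have "\<bar>H ((F ^^ N) y)\<bar> \<le> runmax (\<lambda>k. \<bar>H ((F ^^ k) y)\<bar>) n" "\<bar>H ((F ^^ 0) y)\<bar> \<le> runmax (\<lambda>k. \<bar>H ((F ^^ k) y)\<bar>) n"
    using runmax_ge[OF N(1), of "\<lambda>k. \<bar>H ((F ^^ k) y)\<bar>"] runmax_ge[of 0 n "\<lambda>k. \<bar>H ((F ^^ k) y)\<bar>"] by auto
  ultimately show ?thesis using u N by simp
qed

text \<open>Chen's relation is applied at time \<open>u\<close> and at the last return. Of the
  \<open>4 * hm * hm\<close>, two come from the iterated integrals over the initial and the final
  piece, and two from the product of the initial increment with the bound of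
  \<open>I1_lap_bound\<close>.\<close>

lemma I2_lap_bound:
  assumes a: "unit_fn a" and b: "unit_fn b" and y: "y \<in> Y" and u: "0 \<le> u" "u \<le> H y" and t: "0 \<le> t" and h0: "0 < h0" "\<And>y. y \<in> Y \<Longrightarrow> h0 \<le> H y"
    and n: "n = Suc (nat \<lfloor>t / h0\<rfloor>)"
    and hm: "hm = runmax (\<lambda>k. \<bar>H ((F ^^ k) y)\<bar>) n"
  shows "\<bar>I2 a b t (T u y)\<bar> \<le> runmax (\<lambda>k. \<bar>\<Sum>j<k. (\<Sum>i<j. V a ((F ^^ i) y)) * V b ((F ^^ j) y)\<bar>) n
     + ((\<Sum>j<n. \<bar>H ((F ^^ j) y) * H ((F ^^ j) y)\<bar>)
     + hm * (runmax (\<lambda>k. \<bar>\<Sum>j<k. V a ((F ^^ j) y)\<bar>) n + (runmax (\<lambda>k. \<bar>\<Sum>j<k. V b ((F ^^ j) y)\<bar>) n + 4 * hm)))"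
proof -
  obtain N \<rho> where N: "N \<le> n" "0 \<le> \<rho>" "\<rho> \<le> H ((F ^^ N) y)" "u + t = HS N y + \<rho>"
    using lap_number[OF y u t h0] n by blast
  define A where "A = runmax (\<lambda>k. \<bar>\<Sum>j<k. V a ((F ^^ j) y)\<bar>) n"
  define B where "B = runmax (\<lambda>k. \<bar>\<Sum>j<k. V b ((F ^^ j) y)\<bar>) n"
  define I where "I = runmax (\<lambda>k. \<bar>\<Sum>j<k. (\<Sum>i<j. V a ((F ^^ i) y)) * V b ((F ^^ j) y)\<bar>) n"
  define Q where "Q = (\<Sum>j<n. \<bar>H ((F ^^ j) y) * H ((F ^^ j) y)\<bar>)"
  have hmN: "\<bar>H ((F ^^ N) y)\<bar> \<le> hm" "\<bar>H ((F ^^ 0) y)\<bar> \<le> hm"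
    unfolding hm using runmax_ge[OF N(1), of "\<lambda>k. \<bar>H ((F ^^ k) y)\<bar>"] runmax_ge[of 0 n "\<lambda>k. \<bar>H ((F ^^ k) y)\<bar>"] by auto
  then have \<rho>h: "\<rho> \<le> hm" and uh: "u \<le> hm" and hm0: "0 \<le> hm" using N u by auto
  have e1: "I2 a b (u + t) y = I2 a b u y + I1 a u y * I1 b t (T u y) + I2 a b t (T u y)" by (rule I2_add[OF a b u(1) t])
  have e2: "I2 a b (u + t) y = (\<Sum>j<N. (\<Sum>i<j. V a ((F ^^ i) y)) * V b ((F ^^ j) y)) + (\<Sum>j<N. I2 a b (H ((F ^^ j) y)) ((F ^^ j) y))
      + (\<Sum>j<N. V a ((F ^^ j) y)) * I1 b \<rho> ((F ^^ N) y) + I2 a b \<rho> ((F ^^ N) y)"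
    unfolding N(4) using I2_add[OF a b HS_nonneg[OF y, of N] N(2), of y] by (simp add: I1_HS[OF a y] I2_HS[OF a b y] T_HS[OF y])
  have t1: "\<bar>\<Sum>j<N. (\<Sum>i<j. V a ((F ^^ i) y)) * V b ((F ^^ j) y)\<bar> \<le> I"
    unfolding I_def using runmax_ge[OF N(1), of "\<lambda>k. \<bar>\<Sum>j<k. (\<Sum>i<j. V a ((F ^^ i) y)) * V b ((F ^^ j) y)\<bar>"] .
  have "\<bar>\<Sum>j<N. I2 a b (H ((F ^^ j) y)) ((F ^^ j) y)\<bar> \<le> (\<Sum>j<N. \<bar>H ((F ^^ j) y) * H ((F ^^ j) y)\<bar>)"
    using I2_le[OF a b] H_pos[OF F_pow_Y[OF y]]
    by (intro order_trans[OF sum_abs] sum_mono order_trans[OF I2_le[OF a b] abs_ge_self]) (auto intro: less_imp_le)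
  also have "\<dots> \<le> Q" unfolding Q_def using N(1) by (intro sum_mono2) auto
  finally have t2: "\<bar>\<Sum>j<N. I2 a b (H ((F ^^ j) y)) ((F ^^ j) y)\<bar> \<le> Q" .
  have VA: "\<bar>\<Sum>j<N. V a ((F ^^ j) y)\<bar> \<le> A" unfolding A_def using runmax_ge[OF N(1), of "\<lambda>k. \<bar>\<Sum>j<k. V a ((F ^^ j) y)\<bar>"] .
  then have "\<bar>\<Sum>j<N. V a ((F ^^ j) y)\<bar> * \<bar>I1 b \<rho> ((F ^^ N) y)\<bar> \<le> A * hm"
    using I1_le[OF b N(2), of "(F ^^ N) y"] \<rho>h by (intro mult_mono) auto
  then have t3: "\<bar>(\<Sum>j<N. V a ((F ^^ j) y)) * I1 b \<rho> ((F ^^ N) y)\<bar> \<le> A * hm" by (simp add: abs_mult)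
  have sq: "s * s \<le> hm * hm" if "0 \<le> s" "s \<le> hm" for s using that by (intro mult_mono) auto
  have t4: "\<bar>I2 a b \<rho> ((F ^^ N) y)\<bar> \<le> hm * hm" by (rule order_trans[OF I2_le[OF a b N(2)] sq[OF N(2) \<rho>h]])
  have t5: "\<bar>I2 a b u y\<bar> \<le> hm * hm" by (rule order_trans[OF I2_le[OF a b u(1)] sq[OF u(1) uh]])
  have "\<bar>I1 b t (T u y)\<bar> \<le> B + 2 * hm" unfolding B_def hm by (rule I1_lap_bound[OF b y u t h0 n])
  then have "\<bar>I1 a u y\<bar> * \<bar>I1 b t (T u y)\<bar> \<le> hm * (B + 2 * hm)"
    using I1_le[OF a u(1), of y] uh by (intro mult_mono) auto
  then have t6: "\<bar>I1 a u y * I1 b t (T u y)\<bar> \<le> hm * (B + 2 * hm)" by (simp add: abs_mult)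
  have "\<bar>I2 a b t (T u y)\<bar> \<le> I + Q + A * hm + hm * hm + hm * hm + hm * (B + 2 * hm)"
    using e1 e2 t1 t2 t3 t4 t5 t6 by linarith
  then show ?thesis unfolding A_def[symmetric] B_def[symmetric] I_def[symmetric] Q_def[symmetric] by (simp add: algebra_simps)
qed

end

section \<open>The flow satisfies the abstract hypotheses\<close>

context nue
begin

lemma sets_\<nu>: "sets (restrict_space \<mu>0 Y) = sets bY"
proof -
  have "sets (restrict_space \<mu>0 Y) = sets (restrict_space bX Y)" by (rule sets_restrict_space_cong[OF \<mu>0_sets])
  also have "\<dots> = sets bY"
    using sets_XY by (subst restrict_restrict_space) (auto simp: Int_absorb1)
  finally show ?thesis .
qed

lemma acip: "\<exists>D. full_branch_acip Y F \<P> (restrict_space \<mu>0 Y) \<zeta>0 lam C \<eta> D \<mu>Y"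
proof -
  obtain D where D: "\<And>x y :: 'm. dist x y \<le> D" using bounded_M by (auto simp: bounded_two_points)
  let ?\<nu> = "restrict_space \<mu>0 Y"
  have Y0: "Y \<inter> space \<mu>0 \<in> sets \<mu>0" "Y \<in> sets \<mu>0"
    using sets_XY sets_eq_imp_space_eq[OF \<mu>0_sets] \<mu>0_sets by (auto simp: space_bX sets_restrict_space_iff Int_absorb2)
  have \<nu>_iff: "A \<in> sets ?\<nu> \<longleftrightarrow> A \<in> sets borel \<and> A \<subseteq> Y" for A
    using sets_\<nu> sets_XY by (auto simp: sets_restrict_space_iff)
  have em: "emeasure ?\<nu> A = emeasure \<mu>0 A" if "A \<subseteq> Y" for A
    using that Y0 by (intro emeasure_restrict_space) auto
  have ni: "(\<integral>\<^sup>+z\<in>B. g z \<partial>?\<nu>) = (\<integral>\<^sup>+z\<in>B. g z \<partial>\<mu>0)" if "B \<subseteq> Y" for B and g :: "'m \<Rightarrow> ennreal"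
    unfolding nn_integral_restrict_space[OF Y0(1)] using that by (intro nn_integral_cong) (auto simp: indicator_def)
  have "full_branch Y F \<P> ?\<nu> \<zeta>0 lam C \<eta> D"
  proof (rule full_branch.intro)
    show "finite_measure ?\<nu>" by (rule finite_measure_restrict_space) (use \<mu>0_finite Y0 in auto)
    show "F \<in> measurable ?\<nu> ?\<nu>" using F_meas_Y measurable_cong_sets[of ?\<nu> \<mu>Y ?\<nu> \<mu>Y] sets_\<nu> \<mu>Y_sets by simp
    show "\<zeta>0 \<in> borel_measurable ?\<nu>" using \<zeta>0_meas measurable_cong_sets[OF sets_\<nu> refl] by blast
    fix P assume P: "P \<in> \<P>"
    have PY: "P \<subseteq> Y" using P part_union by auto
    define \<Phi> where "\<Phi> P' Q \<longleftrightarrow> P' \<subseteq> P \<and> Q \<subseteq> Y \<and> P' \<in> sets borel \<and> Q \<in> sets borel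
        \<and> emeasure \<mu>0 (P - P') = 0 \<and> emeasure \<mu>0 (Y - Q) = 0 \<and> bij_betw F P' Q
        \<and> (\<forall>A \<in> sets borel. A \<subseteq> P' \<longrightarrow> F ` A \<in> sets borel
             \<and> emeasure \<mu>0 A = (\<integral>\<^sup>+ z \<in> F ` A. ennreal (\<zeta>0 (inv_into P' F z)) \<partial>\<mu>0))" for P' Q
    obtain P' Q where PQ: "\<Phi> P' Q" using markov[OF P] unfolding \<Phi>_def by blast
    have P'Y: "P' \<subseteq> Y" using PQ PY by (auto simp: \<Phi>_def)
    have cv: "F ` A \<in> sets ?\<nu> \<and> emeasure ?\<nu> A = (\<integral>\<^sup>+ z \<in> F ` A. ennreal (\<zeta>0 (inv_into P' F z)) \<partial>?\<nu>)"
      if A: "A \<in> sets ?\<nu>" "A \<subseteq> P'" for A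
    proof -
      have FA: "F ` A \<subseteq> Y" using A F_Y P'Y by auto
      have "A \<in> sets borel" using A \<nu>_iff by auto
      with PQ A(2) have "F ` A \<in> sets borel \<and> emeasure \<mu>0 A = (\<integral>\<^sup>+ z \<in> F ` A. ennreal (\<zeta>0 (inv_into P' F z)) \<partial>\<mu>0)"
        unfolding \<Phi>_def by blast
      then show ?thesis using FA em[of A] A P'Y ni[OF FA] \<nu>_iff by auto
    qed
    have "P' \<subseteq> P \<and> P' \<in> sets ?\<nu> \<and> Q \<in> sets ?\<nu> \<and> emeasure ?\<nu> (P - P') = 0 \<and> emeasure ?\<nu> (Y - Q) = 0 \<and> bij_betw F P' Q"
      using PQ P'Y PY em[of "P - P'"] em[of "Y - Q"] \<nu>_iff unfolding \<Phi>_def by auto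
    with cv show "\<exists>P' Q. P' \<subseteq> P \<and> P' \<in> sets ?\<nu> \<and> Q \<in> sets ?\<nu>
        \<and> emeasure ?\<nu> (P - P') = 0 \<and> emeasure ?\<nu> (Y - Q) = 0 \<and> bij_betw F P' Q
        \<and> (\<forall>A \<in> sets ?\<nu>. A \<subseteq> P' \<longrightarrow> F ` A \<in> sets ?\<nu>
             \<and> emeasure ?\<nu> A = (\<integral>\<^sup>+ z \<in> F ` A. ennreal (\<zeta>0 (inv_into P' F z)) \<partial>?\<nu>))"
      by (intro exI[of _ P'] exI[of _ Q]) simp
  next
    show "0 \<le> C" using constants by simp
  qed (fact D sets_XY sets_\<nu> part_count part_disj part_union part_sets[THEN conjunct1] constants \<zeta>0_pos expanding distortion)+
  moreover have "full_branch_acip_axioms Y F ?\<nu> \<mu>Y"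
  proof (rule full_branch_acip_axioms.intro)
    show "sets \<mu>Y = sets ?\<nu>" by (simp only: \<mu>Y_sets sets_\<nu>)
    show "emeasure \<mu>Y (F -` A \<inter> Y) = emeasure \<mu>Y A" if "A \<in> sets ?\<nu>" for A
      using \<mu>Y_inv that unfolding invariant_on_def \<mu>Y_sets sets_\<nu> by blast
  qed (fact \<mu>Y_prob \<mu>Y_ac)+
  ultimately show ?thesis by (intro exI[of _ D] full_branch_acip.intro)
qed

lemma dtheta_bounds: "0 \<le> dtheta \<theta> \<P> F y y'" "dtheta \<theta> \<P> F y y' \<le> 1"
  using \<theta>_C2 by (auto simp: dtheta_def power_le_one split: enat.splits)

lemma dtheta_le:
  assumes "\<And>k. k < n \<Longrightarrow> same_cell \<P> ((F ^^ k) y) ((F ^^ k) y')"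
  shows "dtheta \<theta> \<P> F y y' \<le> \<theta> ^ n"
proof (cases "\<exists>n. \<not> same_cell \<P> ((F ^^ n) y) ((F ^^ n) y')")
  case True
  define m where "m = (LEAST n. \<not> same_cell \<P> ((F ^^ n) y) ((F ^^ n) y'))"
  have "\<not> same_cell \<P> ((F ^^ m) y) ((F ^^ m) y')" unfolding m_def by (rule LeastI_ex[OF True])
  then have "n \<le> m" using assms not_less by blast
  then have "\<theta> ^ m \<le> \<theta> ^ n" using \<theta>_C2 by (intro power_decreasing) auto
  then show ?thesis using True by (simp add: dtheta_def sep_time_def m_def)
qed (use \<theta>_C2 in \<open>auto simp: dtheta_def sep_time_def\<close>)

definition iH :: "'m set \<Rightarrow> real" where "iH P = (INF z\<in>P. H z)"

lemma part_Y: "P \<in> \<P> \<Longrightarrow> y \<in> P \<Longrightarrow> y \<in> Y"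
  using part_union by auto

lemma iH_le: assumes "P \<in> \<P>" "y \<in> P" shows "iH P \<le> H y"
  unfolding iH_def using assms H_pos part_Y
  by (intro cINF_lower bdd_belowI[of _ 0]) (auto intro: less_imp_le)

lemma iH_nonneg: assumes "P \<in> \<P>" shows "0 \<le> iH P"
  unfolding iH_def using assms H_pos part_Y part_sets by (intro cINF_greatest) (auto intro: less_imp_le)

text \<open>The Hoelder condition on the roof is relative to its infimum, and \<open>dtheta\<close>
  is at most 1, so all values of \<open>H\<close> on a cell are comparable.\<close>

lemma H_le_iH: assumes P: "P \<in> \<P>" and y: "y \<in> P" shows "H y \<le> (1 + C2) * iH P"
proof -
  have "H y - C2 * iH P \<le> H y'" if y': "y' \<in> P" for y'
  proof (cases "y = y'")
    case True then show ?thesis using \<theta>_C2 iH_nonneg[OF P] by auto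
  next
    case False
    have "C2 * dtheta \<theta> \<P> F y y' * iH P \<le> C2 * 1 * iH P"
      using dtheta_bounds \<theta>_C2 iH_nonneg[OF P] by (intro mult_right_mono mult_left_mono) auto
    then show ?thesis using H_lip[OF P y y' False] by (simp add: iH_def abs_le_iff)
  qed
  then have "H y - C2 * iH P \<le> iH P" unfolding iH_def[of P] using part_sets[OF P] by (intro cINF_greatest) auto
  then show ?thesis by (simp add: algebra_simps)
qed

text \<open>\<open>C2\<close> comes from the difference of the two roof values,
  \<open>(1 + C2) * C2\<close> from the divergence of the orbits over a common time of at most
  \<open>(1 + C2) * iH P\<close>.\<close>

definition L0 where "L0 = C2 + (1 + C2) * C2"

lemma V_le: assumes "unit_fn a" "y \<in> Y" shows "\<bar>V a y\<bar> \<le> H y"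
  unfolding V_def by (rule I1_le[OF assms(1) less_imp_le[OF H_pos[OF assms(2)]]])

text \<open>The orbits are compared up to the smaller of the two roof values; the remaining time is
  the difference of the roofs and costs no more, as \<open>a\<close> is bounded by 1. Since
  \<open>d \<le> 1\<close>, \<open>\<eta> \<le> 1\<close> and \<open>C2 \<ge> 1\<close>, both parts
  are expressed through \<open>C2 * d powr \<eta>\<close>.\<close>

lemma V_holder:
  assumes a: "unit_fn a" and P: "P \<in> \<P>" and y: "y \<in> P" "y' \<in> P"
  shows "\<bar>V a y - V a y'\<bar> \<le> L0 * dtheta \<theta> \<P> F y y' powr \<eta> * iH P"
proof -
  define d where "d = dtheta \<theta> \<P> F y y'"
  have d: "0 \<le> d" "d \<le> 1" using dtheta_bounds by (auto simp: d_def)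
  define m where "m = min (H y) (H y')"
  have m: "0 \<le> m" "m \<le> H y" "m \<le> H y'" using H_pos[OF part_Y[OF P y(1)]] H_pos[OF part_Y[OF P y(2)]] by (auto simp: m_def)
  have "V a y = I1 a m y + I1 a (H y - m) (T m y)" "V a y' = I1 a m y' + I1 a (H y' - m) (T m y')"
    unfolding V_def using I1_add[OF a m(1), of "H y - m" y] I1_add[OF a m(1), of "H y' - m" y'] m by auto
  moreover have "\<bar>I1 a (H y - m) (T m y)\<bar> \<le> H y - m" "\<bar>I1 a (H y' - m) (T m y')\<bar> \<le> H y' - m" using I1_le[OF a] m by auto
  moreover have "(H y - m) + (H y' - m) = \<bar>H y - H y'\<bar>" by (auto simp: m_def)
  ultimately have 1: "\<bar>V a y - V a y'\<bar> \<le> \<bar>I1 a m y - I1 a m y'\<bar> + \<bar>H y - H y'\<bar>" by linarith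
  have dd: "d \<le> d powr \<eta>"
    using d constants powr_mono'[of \<eta> 1 d] by (cases "d = 0") auto
  have 2: "\<bar>H y - H y'\<bar> \<le> C2 * d powr \<eta> * iH P"
  proof (cases "y = y'")
    case False
    have "\<bar>H y - H y'\<bar> \<le> C2 * d * iH P" using H_lip[OF P y False] by (simp add: d_def iH_def)
    also have "\<dots> \<le> C2 * d powr \<eta> * iH P" using dd \<theta>_C2 iH_nonneg[OF P] by (intro mult_right_mono mult_left_mono) auto
    finally show ?thesis .
  qed (use \<theta>_C2 iH_nonneg[OF P] in auto)
  have "I1 a m y - I1 a m y' = (\<integral>u. indicator {0..m} u * (a (T (max 0 u) y) - a (T (max 0 u) y')) \<partial>lborel)"
    unfolding I1_def right_diff_distrib using integrable_interval_bounded[OF path_meas[OF a], of 0 m _ 1] unit_fnD(2)[OF a]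
    by (intro Bochner_Integration.integral_diff[symmetric]) auto
  also have "\<bar>\<dots>\<bar> \<le> (C2 * d powr \<eta>) * m"
  proof (rule interval_integral_le[OF _ _ m(1)])
    show "(\<lambda>u. a (T (max 0 u) y) - a (T (max 0 u) y')) \<in> borel_measurable borel" by (intro borel_measurable_diff path_meas a)
    fix u assume u: "u \<in> {0..m}"
    have "\<bar>a (T (max 0 u) y) - a (T (max 0 u) y')\<bar> \<le> dist (T u y) (T u y') powr \<eta>" using a u by (auto simp: unit_fn_def)
    also have "\<dots> \<le> (C2 * d) powr \<eta>"
      using flow_contr[OF P y, of u] u m constants by (intro powr_mono2) (auto simp: d_def)
    also have "\<dots> = C2 powr \<eta> * d powr \<eta>" using d \<theta>_C2 by (simp add: powr_mult)
    also have "\<dots> \<le> C2 * d powr \<eta>"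
      using powr_mono[of \<eta> 1 C2] \<theta>_C2 constants by (intro mult_right_mono) auto
    finally show "\<bar>a (T (max 0 u) y) - a (T (max 0 u) y')\<bar> \<le> C2 * d powr \<eta>" .
  qed
  also have "\<dots> \<le> (C2 * d powr \<eta>) * ((1 + C2) * iH P)"
    using H_le_iH[OF P y(1)] m \<theta>_C2 by (intro mult_left_mono) auto
  finally have 3: "\<bar>I1 a m y - I1 a m y'\<bar> \<le> (C2 * d powr \<eta>) * ((1 + C2) * iH P)" .
  show ?thesis using 1 2 3 unfolding d_def[symmetric] L0_def by (simp add: algebra_simps)
qed

lemma inner_meas:
  assumes Hm: "H \<in> borel_measurable \<mu>Y" and w: "w \<in> borel_measurable borel"
  shows "(\<lambda>y. \<integral>\<^sup>+u. indicator {0..H y} u * w (T (max 0 u) y) \<partial>lborel) \<in> borel_measurable \<mu>Y"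
proof (rule lborel.borel_measurable_nn_integral)
  note [measurable] = Hm w
  have idY: "(\<lambda>y. y) \<in> measurable \<mu>Y borel"
    using measurable_ident[THEN measurable_restrict_space1] meas_Y by (auto simp: id_def)
  have [measurable]: "(\<lambda>p. T (max 0 (snd p)) (fst p)) \<in> measurable (\<mu>Y \<Otimes>\<^sub>M lborel) borel"
    by (rule T_measurable) (auto intro: measurable_compose[OF measurable_fst idY])
  show "(\<lambda>(y, u). indicator {0..H y} u * w (T (max 0 u) y)) \<in> borel_measurable (\<mu>Y \<Otimes>\<^sub>M lborel)"
    unfolding case_prod_beta' indicator_def atLeastAtMost_iff by measurable
qed

lemma fibre_length: "0 \<le> s \<Longrightarrow> (\<integral>\<^sup>+u. indicator {0..s} u * ennreal c \<partial>lborel) = ennreal s * ennreal c"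
  by (subst nn_integral_multc) auto

lemma H_AE: "AE y in \<mu>Y. 0 \<le> H y"
  by (rule AE_I2) (auto simp: space_Y intro: less_imp_le H_pos)

lemma finite_\<mu>M:
  assumes Hm: "H \<in> borel_measurable \<mu>Y" and HI: "(\<integral>\<^sup>+y. ennreal (H y) \<partial>\<mu>Y) < \<infinity>"
  shows "finite_measure \<mu>M"
proof -
  obtain \<kappa> where \<kappa>: "\<kappa> > 0" "\<And>w. w \<in> borel_measurable borel \<Longrightarrow> (\<integral>\<^sup>+x. w x \<partial>\<mu>M)
     = ennreal \<kappa> * (\<integral>\<^sup>+y. (\<integral>\<^sup>+u. indicator {0..H y} u * w (T (max 0 u) y) \<partial>lborel) \<partial>\<mu>Y)"
    using nn_integral_\<mu>M_Y by blast
  have "emeasure \<mu>M (space \<mu>M) = (\<integral>\<^sup>+x. ennreal 1 \<partial>\<mu>M)" by simp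
  also have "\<dots> = ennreal \<kappa> * (\<integral>\<^sup>+y. (\<integral>\<^sup>+u. indicator {0..H y} u * ennreal 1 \<partial>lborel) \<partial>\<mu>Y)" by (rule \<kappa>(2)) simp
  also have "\<dots> = ennreal \<kappa> * (\<integral>\<^sup>+y. ennreal (H y) \<partial>\<mu>Y)"
  proof -
    have "(\<integral>\<^sup>+y. (\<integral>\<^sup>+u. indicator {0..H y} u * ennreal 1 \<partial>lborel) \<partial>\<mu>Y) = (\<integral>\<^sup>+y. ennreal (H y) \<partial>\<mu>Y)"
      by (rule nn_integral_cong, subst fibre_length) (use H_pos in \<open>auto simp: space_Y intro: less_imp_le\<close>)
    then show ?thesis by simp
  qed
  also have "\<dots> < \<infinity>" using HI by (simp add: ennreal_mult_less_top)
  finally show ?thesis by (intro finite_measureI) simp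
qed

text \<open>The formula for \<open>\<mu>M\<close> is available for nonnegative functions. It is
  applied to \<open>a + 1\<close> and to 1, and the results are subtracted, all integrals being
  finite.\<close>

lemma V_mean:
  assumes Hm: "H \<in> borel_measurable \<mu>Y" and HI: "(\<integral>\<^sup>+y. ennreal (H y) \<partial>\<mu>Y) < \<infinity>"
    and a: "unit_fn a" and a0: "(\<integral>x. a x \<partial>\<mu>M) = 0"
  shows "V a \<in> borel_measurable \<mu>Y" "integrable \<mu>Y (V a)" "(\<integral>y. V a y \<partial>\<mu>Y) = 0"
proof -
  interpret fM: finite_measure \<mu>M by (rule finite_\<mu>M[OF Hm HI])
  obtain \<kappa> where \<kappa>: "\<kappa> > 0" "\<And>w. w \<in> borel_measurable borel \<Longrightarrow> (\<integral>\<^sup>+x. w x \<partial>\<mu>M)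
     = ennreal \<kappa> * (\<integral>\<^sup>+y. (\<integral>\<^sup>+u. indicator {0..H y} u * w (T (max 0 u) y) \<partial>lborel) \<partial>\<mu>Y)"
    using nn_integral_\<mu>M_Y by blast
  have idY: "(\<lambda>y. y) \<in> measurable \<mu>Y borel"
    using measurable_ident[THEN measurable_restrict_space1] meas_Y by (auto simp: id_def)
  show Vm[measurable]: "V a \<in> borel_measurable \<mu>Y" unfolding V_def[abs_def] by (rule I1_joint[OF a Hm idY])
  note [measurable] = Hm unit_fnD(1)[OF a]
  have iH: "integrable \<mu>Y H" by (rule integrableI_nonneg) (use HI H_AE in auto)
  show iV: "integrable \<mu>Y (V a)"
    by (rule Bochner_Integration.integrable_bound[OF iH Vm]) (auto simp: space_Y intro!: AE_I2 order_trans[OF V_le[OF a] abs_ge_self])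
  have am: "a \<in> borel_measurable \<mu>M" using unit_fnD(1)[OF a] by (simp only: measurable_cong_sets[OF sets_\<mu>M[of "\<lambda>_. 0", OF borel_measurable_const] refl, of borel])
  have ia: "integrable \<mu>M a" by (rule fM.integrable_const_bound[of _ 1]) (use unit_fnD(2)[OF a] am in auto)
  have fib: "(\<integral>\<^sup>+u. indicator {0..H y} u * ennreal (a (T (max 0 u) y) + 1) \<partial>lborel) = ennreal (V a y + H y)" if y: "y \<in> Y" for y
  proof -
    have a1: "0 \<le> a x + 1" for x using unit_fnD(2)[OF a, of x] by linarith
    have i1: "integrable lborel (\<lambda>u. indicator {0..H y} u * a (T (max 0 u) y))"
      using integrable_interval_bounded[OF path_meas[OF a], of 0 "H y" y 1] unit_fnD(2)[OF a] by auto
    have i2: "integrable lborel (\<lambda>u. indicator {0..H y} u * (1::real))"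
      using integrable_interval_bounded[of "\<lambda>_. 1" 0 "H y" 1] by auto
    have "(\<integral>\<^sup>+u. indicator {0..H y} u * ennreal (a (T (max 0 u) y) + 1) \<partial>lborel)
       = (\<integral>\<^sup>+u. ennreal (indicator {0..H y} u * a (T (max 0 u) y) + indicator {0..H y} u * 1) \<partial>lborel)"
      by (rule nn_integral_cong) (auto simp: indicator_def)
    also have "\<dots> = ennreal (\<integral>u. indicator {0..H y} u * a (T (max 0 u) y) + indicator {0..H y} u * 1 \<partial>lborel)"
      using i1 i2 a1 by (intro nn_integral_eq_integral Bochner_Integration.integrable_add AE_I2) (auto simp: indicator_def)
    also have "(\<integral>u. indicator {0..H y} u * a (T (max 0 u) y) + indicator {0..H y} u * 1 \<partial>lborel) = V a y + H y"
      using i1 i2 H_pos[OF y] by (simp add: V_def I1_def less_imp_le)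
    finally show ?thesis .
  qed
  have VH: "0 \<le> V a y + H y" if "y \<in> Y" for y using V_le[OF a that] by linarith
  have "(\<integral>\<^sup>+x. ennreal (a x + 1) \<partial>\<mu>M) = ennreal \<kappa> * (\<integral>\<^sup>+y. ennreal (V a y + H y) \<partial>\<mu>Y)"
    by (subst \<kappa>(2)) (auto intro!: arg_cong2[of _ _ _ _ "(*)"] nn_integral_cong simp: fib space_Y)
  also have "\<dots> = ennreal (\<kappa> * (\<integral>y. V a y + H y \<partial>\<mu>Y))"
    using iV iH VH \<kappa>(1) by (subst nn_integral_eq_integral) (auto simp: space_Y ennreal_mult' intro!: integral_nonneg_AE AE_I2)
  finally have e1: "(\<integral>\<^sup>+x. ennreal (a x + 1) \<partial>\<mu>M) = ennreal (\<kappa> * (\<integral>y. V a y + H y \<partial>\<mu>Y))" .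
  have "(\<integral>\<^sup>+x. ennreal 1 \<partial>\<mu>M) = ennreal \<kappa> * (\<integral>\<^sup>+y. ennreal (H y) \<partial>\<mu>Y)"
  proof -
    have "(\<integral>\<^sup>+y. (\<integral>\<^sup>+u. indicator {0..H y} u * ennreal 1 \<partial>lborel) \<partial>\<mu>Y) = (\<integral>\<^sup>+y. ennreal (H y) \<partial>\<mu>Y)"
      by (rule nn_integral_cong, subst fibre_length) (use H_pos in \<open>auto simp: space_Y intro: less_imp_le\<close>)
    then show ?thesis using \<kappa>(2)[of "\<lambda>_. ennreal 1"] by simp
  qed
  also have "\<dots> = ennreal (\<kappa> * (\<integral>y. H y \<partial>\<mu>Y))"
    using iH H_AE \<kappa>(1) by (subst nn_integral_eq_integral) (auto simp: ennreal_mult')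
  finally have e2: "(\<integral>\<^sup>+x. ennreal 1 \<partial>\<mu>M) = ennreal (\<kappa> * (\<integral>y. H y \<partial>\<mu>Y))" .
  have "(\<integral>\<^sup>+x. ennreal (a x + 1) \<partial>\<mu>M) = ennreal (\<integral>x. a x + 1 \<partial>\<mu>M)"
  proof (rule nn_integral_eq_integral)
    show "AE x in \<mu>M. 0 \<le> a x + 1"
    proof (rule AE_I2)
      fix x show "0 \<le> a x + 1" using unit_fnD(2)[OF a, of x] by linarith
    qed
  qed (use ia in auto)
  also have "(\<integral>x. a x + 1 \<partial>\<mu>M) = (\<integral>x. 1 \<partial>\<mu>M)" using ia a0 by simp
  also have "ennreal (\<integral>x. 1 \<partial>\<mu>M) = (\<integral>\<^sup>+x. ennreal 1 \<partial>\<mu>M)"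
    by (rule nn_integral_eq_integral[symmetric]) auto
  finally have "ennreal (\<kappa> * (\<integral>y. V a y + H y \<partial>\<mu>Y)) = ennreal (\<kappa> * (\<integral>y. H y \<partial>\<mu>Y))" using e1 e2 by simp
  moreover have "0 \<le> (\<integral>y. V a y + H y \<partial>\<mu>Y)" "0 \<le> (\<integral>y. H y \<partial>\<mu>Y)"
    using VH H_AE by (auto intro!: integral_nonneg_AE AE_I2 simp: space_Y)
  ultimately have "(\<integral>y. V a y + H y \<partial>\<mu>Y) = (\<integral>y. H y \<partial>\<mu>Y)" using \<kappa>(1) by simp
  then show "(\<integral>y. V a y \<partial>\<mu>Y) = 0" using iV iH by simp
qed

text \<open>Supplies the hypotheses of the abstract part: the induced observables of all centred
  \<open>unit_fn\<close> are admissible for one and the same system, so its constants serve all of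
  them.\<close>

lemma roof_setup:
  assumes Hm: "H \<in> borel_measurable \<mu>Y" and HI: "(\<integral>\<^sup>+y. ennreal (H y) \<partial>\<mu>Y) < \<infinity>"
  shows "\<exists>Z g rel \<gamma> Cd G K0. Z \<subseteq> Y \<and> Z \<in> sets \<mu>Y \<and>
     (\<forall>w\<in>borel_measurable \<mu>Y. (\<integral>\<^sup>+y. w y \<partial>\<mu>Y) = (\<integral>\<^sup>+y. w y \<partial>restrict_space \<mu>Y Z)) \<and>
     gibbs_markov_roof (restrict_space \<mu>Y Z) F \<P> (\<lambda>P. inv_into P F) g rel \<gamma> Cd G K0 H \<and>
     (\<forall>a. unit_fn a \<longrightarrow> (\<integral>x. a x \<partial>\<mu>M) = 0 \<longrightarrow>
        gibbs_markov_roof.admissible (restrict_space \<mu>Y Z) \<P> (\<lambda>P. inv_into P F) rel \<gamma> G H (V a))"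
proof -
  obtain D where D: "full_branch_acip Y F \<P> (restrict_space \<mu>0 Y) \<zeta>0 lam C \<eta> D \<mu>Y" using acip by blast
  interpret fb: full_branch_acip Y F \<P> "restrict_space \<mu>0 Y" \<zeta>0 lam C \<eta> D \<mu>Y by (rule D)
  \<comment> \<open>The slower of two rates: contraction of the flow along cylinders, raised to the
    Hoelder exponent, and regularity of the weights.\<close>
  define \<gamma> where "\<gamma> = max (\<theta> powr \<eta>) fb.r"
  have \<gamma>: "fb.r \<le> \<gamma>" "\<gamma> < 1" using fb.r powr_less_mono2[of \<eta> \<theta> 1] \<theta>_C2 constants by (auto simp: \<gamma>_def)
  obtain Z g Cd where Z: "fb.good Z" and gm: "gibbs_markov (restrict_space \<mu>Y Z) F \<P> (\<lambda>P. inv_into P F) g fb.same_cyl \<gamma> Cd"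
    using fb.gibbs_markov_exists \<gamma> by blast
  let ?N = "restrict_space \<mu>Y Z"
  have ZY: "Z \<subseteq> Y" and Zs: "Z \<in> sets \<mu>Y" using fb.good_sets[OF Z] fb.sets_\<mu> by auto
  have Zi: "Z \<inter> space \<mu>Y \<in> sets \<mu>Y" using ZY Zs by (simp add: space_Y Int_absorb2)
  interpret gm: gibbs_markov ?N F \<P> "\<lambda>P. inv_into P F" g fb.same_cyl \<gamma> Cd by (rule gm)
  have spN: "space ?N = Z" using ZY by (simp add: space_restrict_space space_Y Int_absorb2)
  have AEZ: "AE y in \<mu>Y. y \<in> Z"
  proof -
    have "Y - Z \<in> null_sets (restrict_space \<mu>0 Y)" using Z by (simp add: fb.good_def)
    then have "Y - Z \<in> null_sets \<mu>Y" using \<mu>Y_ac by (auto simp: absolutely_continuous_def)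
    then have "AE y in \<mu>Y. y \<notin> Y - Z" by (rule AE_not_in)
    then show ?thesis using AE_space by eventually_elim (auto simp: space_Y)
  qed
  have nnZ: "(\<integral>\<^sup>+y. w y \<partial>\<mu>Y) = (\<integral>\<^sup>+y. w y \<partial>?N)" for w
  proof -
    have "(\<integral>\<^sup>+y. w y \<partial>?N) = (\<integral>\<^sup>+y. w y * indicator Z y \<partial>\<mu>Y)" by (rule nn_integral_restrict_space[OF Zi])
    also have "\<dots> = (\<integral>\<^sup>+y. w y \<partial>\<mu>Y)" by (rule nn_integral_cong_AE) (use AEZ in \<open>auto simp: indicator_def\<close>)
    finally show ?thesis by simp
  qed
  define G where "G P = L0 * iH P" for P
  have "(1 + C2) * 1 \<le> (1 + C2) * C2" using \<theta>_C2 by (intro mult_left_mono) auto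
  then have "1 + C2 \<le> (1 + C2) * C2" by (simp only: mult_1_right)
  then have L0a: "1 + C2 \<le> L0" unfolding L0_def using \<theta>_C2 by (intro add_increasing) auto
  then have L0: "1 + C2 \<le> L0" "0 \<le> L0" using \<theta>_C2 by auto
  have G0: "0 \<le> G P" if "P \<in> \<P>" for P unfolding G_def using L0 iH_nonneg[OF that] by simp
  obtain EH where EH: "(\<integral>\<^sup>+y. ennreal (H y) \<partial>?N) = ennreal EH" "0 \<le> EH" using HI nnZ[of "\<lambda>y. ennreal (H y)"]
    by (cases "\<integral>\<^sup>+y. ennreal (H y) \<partial>?N") auto
  define K0 where "K0 = exp Cd * L0 * EH"
  have K0: "0 \<le> K0" using L0 EH by (simp add: K0_def)
  have Hn[measurable]: "H \<in> borel_measurable ?N" using Hm by (rule measurable_restrict_space1)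
  have br: "inv_into P F z \<in> P" "inv_into P F z \<in> Z" if "P \<in> \<P>" "z \<in> Z" for P z using fb.good_br[OF Z that] by auto
  \<comment> \<open>By distortion the weights at \<open>z\<close> are comparable to those at any
    other \<open>z'\<close>, and the infimum of \<open>H\<close> on a cell is at most its value at
    the preimage of \<open>z'\<close>. Averaging over \<open>z'\<close>, \<open>transfer\<close>
    turns the sum into the integral of \<open>H\<close>.\<close>
  have gG: "(\<integral>\<^sup>+P. ennreal (g P z * G P) \<partial>count_space \<P>) \<le> ennreal K0" if z: "z \<in> Z" for z
  proof -
    have pt: "(\<integral>\<^sup>+P. ennreal (g P z * G P) \<partial>count_space \<P>)
        \<le> ennreal (exp Cd * L0) * (\<integral>\<^sup>+P. ennreal (g P z') * ennreal (H (inv_into P F z')) \<partial>count_space \<P>)" if z': "z' \<in> Z" for z'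
    proof -
      have "(\<integral>\<^sup>+P. ennreal (g P z * G P) \<partial>count_space \<P>)
          \<le> (\<integral>\<^sup>+P. ennreal (exp Cd * L0) * (ennreal (g P z') * ennreal (H (inv_into P F z'))) \<partial>count_space \<P>)"
      proof (rule nn_integral_mono)
        fix P assume "P \<in> space (count_space \<P>)"
        then have P: "P \<in> \<P>" by simp
        have "g P z \<le> exp Cd * g P z'" using gm.g_distortion[OF P, of z z' 0] z z' spN by simp
        moreover have "G P \<le> L0 * H (inv_into P F z')" unfolding G_def using L0 iH_le[OF P br(1)[OF P z']] by (intro mult_left_mono) auto
        ultimately have "g P z * G P \<le> (exp Cd * g P z') * (L0 * H (inv_into P F z'))"
          using G0[OF P] gm.g_nonneg[OF P, of z'] z' spN by (intro mult_mono) auto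
        then have "ennreal (g P z * G P) \<le> ennreal ((exp Cd * L0) * (g P z' * H (inv_into P F z')))"
          by (intro ennreal_leI) (simp add: mult_ac)
        also have "\<dots> = ennreal (exp Cd * L0) * (ennreal (g P z') * ennreal (H (inv_into P F z')))"
          using gm.g_nonneg[OF P, of z'] z' spN L0 H_pos[OF part_Y[OF P br(1)[OF P z']]] by (subst ennreal_mult; simp add: ennreal_mult)
        finally show "ennreal (g P z * G P) \<le> ennreal (exp Cd * L0) * (ennreal (g P z') * ennreal (H (inv_into P F z')))" .
      qed
      then show ?thesis by (simp add: nn_integral_cmult)
    qed
    have "(\<integral>\<^sup>+P. ennreal (g P z * G P) \<partial>count_space \<P>) = (\<integral>\<^sup>+z'. (\<integral>\<^sup>+P. ennreal (g P z * G P) \<partial>count_space \<P>) \<partial>?N)"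
      by (simp add: gm.emeasure_space_1)
    also have "\<dots> \<le> (\<integral>\<^sup>+z'. ennreal (exp Cd * L0) * (\<integral>\<^sup>+P. ennreal (g P z') * ennreal (H (inv_into P F z')) \<partial>count_space \<P>) \<partial>?N)"
      by (intro nn_integral_mono pt) (simp add: spN)
    also have "\<dots> = ennreal (exp Cd * L0) * (\<integral>\<^sup>+z'. (\<integral>\<^sup>+P. ennreal (g P z') * ennreal (H (inv_into P F z')) \<partial>count_space \<P>) \<partial>?N)"
    proof (rule nn_integral_cmult)
      interpret J: sigma_finite_measure "count_space \<P>" by (rule gm.sigma_finite_J)
      note [measurable] = gm.joint_g measurable_compose[OF gm.joint_\<psi> Hn]
      show "(\<lambda>z'. \<integral>\<^sup>+P. ennreal (g P z') * ennreal (H (inv_into P F z')) \<partial>count_space \<P>) \<in> borel_measurable ?N"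
        by (rule J.borel_measurable_nn_integral) (simp add: case_prod_beta')
    qed
    also have "(\<integral>\<^sup>+z'. (\<integral>\<^sup>+P. ennreal (g P z') * ennreal (H (inv_into P F z')) \<partial>count_space \<P>) \<partial>?N) = ennreal EH"
      using gm.transfer[of "\<lambda>z. ennreal (H z)"] EH by simp
    also have "ennreal (exp Cd * L0) * ennreal EH = ennreal K0" using L0 EH by (simp add: K0_def ennreal_mult)
    finally show ?thesis .
  qed
  have roof: "gibbs_markov_roof ?N F \<P> (\<lambda>P. inv_into P F) g fb.same_cyl \<gamma> Cd G K0 H"
  proof (rule gibbs_markov_roof.intro[OF gm gibbs_markov_roof_axioms.intro])
    show "(\<integral>\<^sup>+P. ennreal (g P z * G P) \<partial>count_space \<P>) \<le> ennreal K0" if "z \<in> space ?N" for z using that gG spN by simp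
  qed (fact G0 K0 Hn)+
  interpret gr: gibbs_markov_roof ?N F \<P> "\<lambda>P. inv_into P F" g fb.same_cyl \<gamma> Cd G K0 H by (rule roof)
  have "gr.admissible (V a)" if a: "unit_fn a" and a0: "(\<integral>x. a x \<partial>\<mu>M) = 0" for a
    unfolding gr.admissible_def
  proof (intro conjI ballI allI impI)
    note Vm = V_mean[OF Hm HI a a0]
    show "V a \<in> borel_measurable ?N" using Vm(1) by (rule measurable_restrict_space1)
    have ind: "(\<integral>y. indicator Z y *\<^sub>R V a y \<partial>\<mu>Y) = (\<integral>y. V a y \<partial>\<mu>Y)"
      by (rule integral_cong_AE) (use AEZ Vm(1) Zs in \<open>auto simp: indicator_def\<close>)
    show "integrable ?N (V a)"
      using integrable_mult_indicator[OF Zs Vm(2)] by (subst integrable_restrict_space[OF Zi])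
    show "(\<integral>y. V a y \<partial>?N) = 0" using integral_restrict_space[OF Zi, of "V a"] ind Vm(3) by simp
  next
    fix z assume "z \<in> space ?N" then show "\<bar>V a z\<bar> \<le> H z" using V_le[OF a] ZY spN by auto
  next
    fix P z assume "P \<in> \<P>" "z \<in> space ?N"
    then have b: "inv_into P F z \<in> P" unfolding spN by (rule br(1))
    have "\<bar>V a (inv_into P F z)\<bar> \<le> H (inv_into P F z)" using V_le[OF a part_Y[OF \<open>P \<in> \<P>\<close> b]] .
    also have "\<dots> \<le> (1 + C2) * iH P" by (rule H_le_iH[OF \<open>P \<in> \<P>\<close> b])
    also have "\<dots> \<le> G P" unfolding G_def using L0 iH_nonneg[OF \<open>P \<in> \<P>\<close>] by (intro mult_right_mono) auto
    finally show "\<bar>V a (inv_into P F z)\<bar> \<le> G P" .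
  next
    fix n P z z' assume P: "P \<in> \<P>" and zz: "z \<in> space ?N" "z' \<in> space ?N" "fb.same_cyl n z z'"
    define y y' where "y = inv_into P F z" and "y' = inv_into P F z'"
    have y: "y \<in> P" "y' \<in> P" unfolding y_def y'_def using zz(1,2) unfolding spN by (auto intro: br(1)[OF P])
    have "fb.same_cyl (Suc n) y y'" using gm.rel_\<psi>[OF P zz] by (simp add: y_def y'_def)
    \<comment> \<open>The preimages share one cell more than \<open>z\<close> and
      \<open>z'\<close>.\<close>
    then have "dtheta \<theta> \<P> F y y' \<le> \<theta> ^ Suc n"
      by (intro dtheta_le) (auto simp: fb.same_cyl_def same_cell_def)
    also have "\<dots> \<le> \<theta> ^ n" using \<theta>_C2 by (intro power_decreasing) auto
    finally have "dtheta \<theta> \<P> F y y' powr \<eta> \<le> (\<theta> ^ n) powr \<eta>" using dtheta_bounds constants by (intro powr_mono2) auto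
    also have "\<dots> = (\<theta> powr \<eta>) ^ n" using \<theta>_C2 by (simp add: powr_realpow[symmetric] powr_powr mult.commute)
    also have "\<dots> \<le> \<gamma> ^ n" by (intro power_mono) (auto simp: \<gamma>_def)
    finally have "L0 * dtheta \<theta> \<P> F y y' powr \<eta> * iH P \<le> L0 * \<gamma> ^ n * iH P"
      using L0 iH_nonneg[OF P] by (intro mult_right_mono mult_left_mono) auto
    then have "\<bar>V a y - V a y'\<bar> \<le> \<gamma> ^ n * G P" using V_holder[OF a P y] by (simp add: G_def mult_ac)
    then show "\<bar>V a (inv_into P F z) - V a (inv_into P F z')\<bar> \<le> \<gamma> ^ n * G P" by (simp add: y_def y'_def)
  qed
  then show ?thesis using ZY Zs nnZ roof by blast
qed

end

section \<open>Moment bounds for the flow\<close>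

context nue
begin

text \<open>Where one power is lost. The fibre over \<open>y\<close> has length \<open>H y\<close>,
  so a function bounded there by \<open>G y powr (p - 1)\<close> contributes
  \<open>H y * G y powr (p - 1)\<close>, which Young's inequality controls by \<open>p\<close>-th
  moments. The function \<open>\<phi>\<close> is left abstract to cover both \<open>I1\<close> and
  \<open>I2\<close>.\<close>

lemma tower_bound:
  assumes Hm: "H \<in> borel_measurable \<mu>Y" and p: "2 \<le> p" and n: "1 \<le> n" and Z: "Z \<subseteq> Y" "Z \<in> sets \<mu>Y"
    and nnZ: "\<And>w. w \<in> borel_measurable \<mu>Y \<Longrightarrow> (\<integral>\<^sup>+y. w y \<partial>\<mu>Y) = (\<integral>\<^sup>+y. w y \<partial>restrict_space \<mu>Y Z)"
    and \<kappa>: "\<kappa> > 0" "\<And>w. w \<in> borel_measurable borel \<Longrightarrow> (\<integral>\<^sup>+x. w x \<partial>\<mu>M)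
     = ennreal \<kappa> * (\<integral>\<^sup>+y. (\<integral>\<^sup>+u. indicator {0..H y} u * w (T (max 0 u) y) \<partial>lborel) \<partial>\<mu>Y)"
    and Hc: "moment_le (restrict_space \<mu>Y Z) p H c"
    and G: "moment_le (restrict_space \<mu>Y Z) p G (K * real n powr (p / 2))" "\<And>y. y \<in> Z \<Longrightarrow> 0 \<le> G y"
    and \<phi>: "\<phi> \<in> borel_measurable borel"
      "\<And>y u. y \<in> Z \<Longrightarrow> 0 \<le> u \<Longrightarrow> u \<le> H y \<Longrightarrow> \<phi> (T u y) \<le> G y powr (p - 1)"
  shows "(\<integral>\<^sup>+x. ennreal (\<phi> x) \<partial>\<mu>M) \<le> ennreal (\<kappa> * (c + K) * real n powr ((p - 1) / 2))"
proof -
  let ?N = "restrict_space \<mu>Y Z"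
  have spN: "space ?N = Z" using Z by (simp add: space_restrict_space space_Y Int_absorb2)
  \<comment> \<open>\<open>G\<close> has size \<open>sqrt n\<close> and \<open>H\<close> size 1.
    Dividing \<open>G\<close> by \<open>s\<close> before Young's inequality extracts the factor
    \<open>e\<close>; without it the bound would grow like \<open>n powr (p / 2)\<close>.\<close>
  define s where "s = sqrt (real n)"
  have s: "0 < s" using n by (simp add: s_def)
  have sp: "s powr q = real n powr (q / 2)" for q unfolding s_def using n by (simp add: powr_half_sqrt[symmetric] powr_powr)
  have npos: "0 < real n powr q" for q using n by simp
  define e where "e = real n powr ((p - 1) / 2)"
  have K: "0 \<le> K"
  proof (rule mult_right_le_imp_le)
    show "0 * real n powr (p / 2) \<le> K * real n powr (p / 2)" using moment_leD(2)[OF G(1)] by simp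
  qed (rule npos)
  have Gs: "moment_le ?N p (\<lambda>y. 1 / s * G y) K"
  proof -
    have "\<bar>1 / s\<bar> powr p * (K * real n powr (p / 2)) = K" using s npos[of "p / 2"] by (simp add: powr_divide sp)
    then show ?thesis using moment_le_scale[OF G(1), of "1 / s"] by (simp only:)
  qed
  note [measurable] = moment_leD(1)[OF Hc] moment_leD(1)[OF Gs]
  have "(\<integral>\<^sup>+x. ennreal (\<phi> x) \<partial>\<mu>M) = ennreal \<kappa> * (\<integral>\<^sup>+y. (\<integral>\<^sup>+u. indicator {0..H y} u * ennreal (\<phi> (T (max 0 u) y)) \<partial>lborel) \<partial>\<mu>Y)"
    using \<phi>(1) by (intro \<kappa>(2)) auto
  also have "(\<integral>\<^sup>+y. (\<integral>\<^sup>+u. indicator {0..H y} u * ennreal (\<phi> (T (max 0 u) y)) \<partial>lborel) \<partial>\<mu>Y)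
      = (\<integral>\<^sup>+y. (\<integral>\<^sup>+u. indicator {0..H y} u * ennreal (\<phi> (T (max 0 u) y)) \<partial>lborel) \<partial>?N)"
    using \<phi>(1) by (intro nnZ inner_meas[OF Hm]) auto
  also have "\<dots> \<le> (\<integral>\<^sup>+y. ennreal e * (ennreal (\<bar>1 / s * G y\<bar> powr p) + ennreal (\<bar>H y\<bar> powr p)) \<partial>?N)"
  proof (rule nn_integral_mono)
    fix y assume "y \<in> space ?N"
    then have y: "y \<in> Z" "y \<in> Y" using Z spN by auto
    have "(\<integral>\<^sup>+u. indicator {0..H y} u * ennreal (\<phi> (T (max 0 u) y)) \<partial>lborel) \<le> (\<integral>\<^sup>+u. indicator {0..H y} u * ennreal (G y powr (p - 1)) \<partial>lborel)"
      using \<phi>(2)[OF y(1)] by (intro nn_integral_mono) (auto simp: indicator_def intro!: ennreal_leI)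
    also have "\<dots> = ennreal (H y) * ennreal (G y powr (p - 1))" by (rule fibre_length[OF less_imp_le[OF H_pos[OF y(2)]]])
    also have "\<dots> = ennreal (H y * G y powr (p - 1))" using H_pos[OF y(2)] by (simp add: ennreal_mult)
    also have "\<dots> \<le> ennreal (e * (\<bar>1 / s * G y\<bar> powr p + \<bar>H y\<bar> powr p))"
    proof (rule ennreal_leI)
      have g0: "0 \<le> 1 / s * G y" using s G(2)[OF y(1)] by simp
      have "G y powr (p - 1) = (s * (1 / s * G y)) powr (p - 1)" using s by simp
      also have "\<dots> = e * (1 / s * G y) powr (p - 1)" using s g0 by (simp only: powr_mult sp e_def)
      finally have "H y * G y powr (p - 1) = e * ((1 / s * G y) powr (p - 1) * H y)" by simp
      also have "\<dots> \<le> e * ((1 / s * G y) powr p + H y powr p)"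
        using powr_times_le[of p "1 / s * G y" "H y"] p g0 H_pos[OF y(2)] by (intro mult_left_mono) (auto simp: e_def)
      finally show "H y * G y powr (p - 1) \<le> e * (\<bar>1 / s * G y\<bar> powr p + \<bar>H y\<bar> powr p)"
        by (simp only: abs_of_nonneg[OF g0] abs_of_pos[OF H_pos[OF y(2)]])
    qed
    also have "\<dots> = ennreal e * (ennreal (\<bar>1 / s * G y\<bar> powr p) + ennreal (\<bar>H y\<bar> powr p))"
      by (simp add: ennreal_mult e_def)
    finally show "(\<integral>\<^sup>+u. indicator {0..H y} u * ennreal (\<phi> (T (max 0 u) y)) \<partial>lborel)
      \<le> ennreal e * (ennreal (\<bar>1 / s * G y\<bar> powr p) + ennreal (\<bar>H y\<bar> powr p))" .
  qed
  also have "\<dots> = ennreal e * ((\<integral>\<^sup>+y. ennreal (\<bar>1 / s * G y\<bar> powr p) \<partial>?N) + (\<integral>\<^sup>+y. ennreal (\<bar>H y\<bar> powr p) \<partial>?N))"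
  proof -
    have *: "(\<integral>\<^sup>+y. ennreal e * (a y + b y) \<partial>?N) = ennreal e * ((\<integral>\<^sup>+y. a y \<partial>?N) + (\<integral>\<^sup>+y. b y \<partial>?N))"
      if "a \<in> borel_measurable ?N" "b \<in> borel_measurable ?N" for a b
      using that by (simp add: nn_integral_cmult nn_integral_add)
    show ?thesis by (rule *) measurable
  qed
  also have "\<dots> \<le> ennreal e * (ennreal K + ennreal c)"
    by (intro mult_left_mono add_mono moment_leD(3)[OF Gs] moment_leD(3)[OF Hc]) auto
  also have "ennreal \<kappa> * \<dots> = ennreal (\<kappa> * (c + K) * e)"
    using \<kappa>(1) K moment_leD(2)[OF Hc] by (simp add: ennreal_mult[symmetric] ennreal_plus[symmetric] e_def mult_ac add.commute del: ennreal_plus)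
  finally show ?thesis by (simp add: e_def mult_left_mono)
qed

lemma moments_exist:
  assumes p: "2 \<le> p" and Hm: "H \<in> borel_measurable \<mu>Y" and Hp: "(\<integral>\<^sup>+y. ennreal (\<bar>H y\<bar> powr p) \<partial>\<mu>Y) < \<infinity>"
  shows "(\<integral>\<^sup>+y. ennreal (H y) \<partial>\<mu>Y) < \<infinity>"
proof -
  have "(\<integral>\<^sup>+y. ennreal (H y) \<partial>\<mu>Y) \<le> (\<integral>\<^sup>+y. 1 + ennreal (\<bar>H y\<bar> powr p) \<partial>\<mu>Y)"
  proof (rule nn_integral_mono)
    fix y assume "y \<in> space \<mu>Y"
    then have "0 < H y" using H_pos by (simp add: space_Y)
    have "H y \<le> 1 + \<bar>H y\<bar> powr p"
    proof (cases "H y \<le> 1")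
      case True then show ?thesis using powr_ge_zero[of "\<bar>H y\<bar>" p] by linarith
    next
      case False
      then have "H y powr 1 \<le> H y powr p" using p by (intro powr_mono) auto
      then show ?thesis using False by simp
    qed
    then have "ennreal (H y) \<le> ennreal (1 + \<bar>H y\<bar> powr p)" by (rule ennreal_leI)
    then show "ennreal (H y) \<le> 1 + ennreal (\<bar>H y\<bar> powr p)" by simp
  qed
  also have "\<dots> = 1 + (\<integral>\<^sup>+y. ennreal (\<bar>H y\<bar> powr p) \<partial>\<mu>Y)"
    using Hm by (subst nn_integral_add) (auto simp: Y.emeasure_space_1)
  also have "\<dots> < \<infinity>" using Hp by simp
  finally show ?thesis .
qed

lemma lap_scale:
  assumes "1 \<le> t" "0 < h0"
  shows "real (Suc (nat \<lfloor>t / h0\<rfloor>)) \<le> (1 / h0 + 1) * t"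
proof -
  have "real (nat \<lfloor>t / h0\<rfloor>) \<le> t / h0" using assms by simp
  then have "real (Suc (nat \<lfloor>t / h0\<rfloor>)) \<le> t / h0 + 1" by simp
  also have "\<dots> \<le> (1 / h0 + 1) * t" using assms by (simp add: algebra_simps)
  finally show ?thesis .
qed

text \<open>The lap count never drops below 1, so the estimate from the base does not decay as
  \<open>t\<close> tends to 0. For \<open>t \<le> 1\<close> a pointwise bound by the elapsed time is
  enough.\<close>

lemma extend_to_small_times:
  fixes \<phi> :: "real \<Rightarrow> 'm \<Rightarrow> real"
  assumes fin: "finite_measure \<mu>M" and h0: "0 < h0" and M: "0 \<le> M" and e: "0 \<le> e" and t: "0 < t"
    and large: "1 \<le> t \<Longrightarrow> (\<integral>\<^sup>+x. ennreal (\<phi> t x) \<partial>\<mu>M) \<le> ennreal (M * real (Suc (nat \<lfloor>t / h0\<rfloor>)) powr e)"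
    and small: "t \<le> 1 \<Longrightarrow> (\<And>x. \<phi> t x \<le> t powr e)"
  shows "(\<integral>\<^sup>+x. ennreal (\<phi> t x) \<partial>\<mu>M) \<le> ennreal ((M * (1 / h0 + 1) powr e + measure \<mu>M (space \<mu>M)) * t powr e)"
proof (cases "1 \<le> t")
  case True
  have "M * real (Suc (nat \<lfloor>t / h0\<rfloor>)) powr e \<le> M * ((1 / h0 + 1) * t) powr e"
    using lap_scale[OF True h0] M e by (intro mult_left_mono powr_mono2) auto
  also have "\<dots> = M * (1 / h0 + 1) powr e * t powr e" using h0 t by (simp add: powr_mult)
  also have "\<dots> \<le> (M * (1 / h0 + 1) powr e + measure \<mu>M (space \<mu>M)) * t powr e" by (intro mult_right_mono) auto
  finally show ?thesis using large[OF True] by (meson ennreal_leI order_trans)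
next
  case False
  interpret finite_measure \<mu>M by (rule fin)
  have "(\<integral>\<^sup>+x. ennreal (\<phi> t x) \<partial>\<mu>M) \<le> (\<integral>\<^sup>+x. ennreal (t powr e) \<partial>\<mu>M)"
    using small False by (intro nn_integral_mono ennreal_leI) auto
  also have "\<dots> = ennreal (measure \<mu>M (space \<mu>M) * t powr e)" by (simp add: emeasure_eq_measure ennreal_mult mult.commute)
  also have "\<dots> \<le> ennreal ((M * (1 / h0 + 1) powr e + measure \<mu>M (space \<mu>M)) * t powr e)"
    using M by (intro ennreal_leI mult_right_mono) auto
  finally show ?thesis .
qed

text \<open>Both terms of \<open>I1_lap_bound\<close> are of order \<open>sqrt n\<close> in
  \<open>L^p\<close> on the base: the Birkhoff maximum by cancellation, the maximal roof value
  because a maximum of \<open>n + 1\<close> terms costs only \<open>n powr (1 / p)\<close>.\<close>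

lemma I1_moment:
  assumes p: "2 \<le> p" and Hm: "H \<in> borel_measurable \<mu>Y" and Hp: "(\<integral>\<^sup>+y. ennreal (\<bar>H y\<bar> powr p) \<partial>\<mu>Y) < \<infinity>"
    and h0: "0 < h0" "\<And>y. y \<in> Y \<Longrightarrow> h0 \<le> H y"
  shows "\<exists>M\<ge>0. \<forall>a t. unit_fn a \<longrightarrow> (\<integral>x. a x \<partial>\<mu>M) = 0 \<longrightarrow> 0 < t \<longrightarrow>
     (\<integral>\<^sup>+x. ennreal (\<bar>I1 a t x\<bar> powr (p - 1)) \<partial>\<mu>M) \<le> ennreal (M * t powr ((p - 1) / 2))"
proof -
  have HI: "(\<integral>\<^sup>+y. ennreal (H y) \<partial>\<mu>Y) < \<infinity>" by (rule moments_exist[OF p Hm Hp])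
  obtain Z g rel \<gamma> Cd G K0 where Z: "Z \<subseteq> Y" "Z \<in> sets \<mu>Y"
    and nnZ: "\<And>w. w \<in> borel_measurable \<mu>Y \<Longrightarrow> (\<integral>\<^sup>+y. w y \<partial>\<mu>Y) = (\<integral>\<^sup>+y. w y \<partial>restrict_space \<mu>Y Z)"
    and roof: "gibbs_markov_roof (restrict_space \<mu>Y Z) F \<P> (\<lambda>P. inv_into P F) g rel \<gamma> Cd G K0 H"
    and adm: "\<And>a. unit_fn a \<Longrightarrow> (\<integral>x. a x \<partial>\<mu>M) = 0 \<Longrightarrow>
        gibbs_markov_roof.admissible (restrict_space \<mu>Y Z) \<P> (\<lambda>P. inv_into P F) rel \<gamma> G H (V a)"
    using roof_setup[OF Hm HI] by blast
  let ?N = "restrict_space \<mu>Y Z"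
  interpret gr: gibbs_markov_roof ?N F \<P> "\<lambda>P. inv_into P F" g rel \<gamma> Cd G K0 H by (rule roof)
  obtain \<kappa> where \<kappa>: "\<kappa> > 0" "\<And>w. w \<in> borel_measurable borel \<Longrightarrow> (\<integral>\<^sup>+x. w x \<partial>\<mu>M)
     = ennreal \<kappa> * (\<integral>\<^sup>+y. (\<integral>\<^sup>+u. indicator {0..H y} u * w (T (max 0 u) y) \<partial>lborel) \<partial>\<mu>Y)"
    using nn_integral_\<mu>M_Y by blast
  define c where "c = enn2real (\<integral>\<^sup>+y. ennreal (\<bar>H y\<bar> powr p) \<partial>\<mu>Y)"
  have Hc: "moment_le ?N p H c"
    using Hp nnZ[of "\<lambda>y. ennreal (\<bar>H y\<bar> powr p)"] Hm by (auto simp: moment_le_def c_def less_top)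
  have c0: "0 \<le> c" using moment_leD(2)[OF Hc] .
  obtain K where K: "K > 0" "\<And>W n. gr.admissible W \<Longrightarrow> 1 \<le> n \<Longrightarrow> moment_le ?N p (\<lambda>z. runmax (\<lambda>k. \<bar>gr.bsum W k z\<bar>) n) (K * real n powr (p / 2))"
    using gr.birkhoff_maximal[OF p Hc] by blast
  define K' where "K' = 2 powr p * (K + \<bar>2\<bar> powr p * (2 * c))"
  have K'0: "0 \<le> K'" using K c0 by (simp add: K'_def)
  have large: "(\<integral>\<^sup>+x. ennreal (\<bar>I1 a t x\<bar> powr (p - 1)) \<partial>\<mu>M) \<le> ennreal (\<kappa> * (c + K') * real (Suc (nat \<lfloor>t / h0\<rfloor>)) powr ((p - 1) / 2))"
    if a: "unit_fn a" and a0: "(\<integral>x. a x \<partial>\<mu>M) = 0" and t: "0 < t" for a t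
  proof -
    define n where "n = Suc (nat \<lfloor>t / h0\<rfloor>)"
    have n: "1 \<le> n" by (simp add: n_def)
    define A where "A y = runmax (\<lambda>k. \<bar>\<Sum>j<k. V a ((F ^^ j) y)\<bar>) n" for y
    define hm where "hm y = runmax (\<lambda>k. \<bar>H ((F ^^ k) y)\<bar>) n" for y
    have Ac: "moment_le ?N p A (K * real n powr (p / 2))"
      using K(2)[OF adm[OF a a0] n] by (simp add: A_def[abs_def] gr.bsum_def)
    have "moment_le ?N p hm (real (Suc n) * c)"
      unfolding hm_def by (rule moment_le_runmax) (rule gr.moment_le_funpow[OF Hc])
    moreover have "real (Suc n) * c \<le> 2 * c * real n powr (p / 2)"
    proof -
      have "real n powr 1 \<le> real n powr (p / 2)" using n p by (intro powr_mono) auto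
      then have "real (Suc n) \<le> 2 * real n powr (p / 2)" using n by simp
      then have "real (Suc n) * c \<le> (2 * real n powr (p / 2)) * c" using c0 by (rule mult_right_mono)
      then show ?thesis by (simp add: mult_ac)
    qed
    ultimately have hmc: "moment_le ?N p hm (2 * c * real n powr (p / 2))" by (rule moment_le_weaken)
    have "moment_le ?N p (\<lambda>y. A y + 2 * hm y) (2 powr p * (K * real n powr (p / 2) + \<bar>2\<bar> powr p * (2 * c * real n powr (p / 2))))"
      using moment_le_add[OF Ac moment_le_scale[OF hmc, of 2]] p by simp
    then have G: "moment_le ?N p (\<lambda>y. A y + 2 * hm y) (K' * real n powr (p / 2))" by (simp add: K'_def algebra_simps)
    have nn: "0 \<le> A y" "0 \<le> hm y" for y unfolding A_def hm_def by (auto intro!: runmax_nonneg)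
    show ?thesis
      unfolding n_def[symmetric]
    proof (rule tower_bound[OF Hm p n Z nnZ \<kappa> Hc G])
      show "(\<lambda>x. \<bar>I1 a t x\<bar> powr (p - 1)) \<in> borel_measurable borel"
        using I1_joint[OF a, of "\<lambda>_. t" borel "\<lambda>x. x"] by measurable
      fix y u assume y: "y \<in> Z" and u: "0 \<le> u" "u \<le> H y"
      have "\<bar>I1 a t (T u y)\<bar> \<le> A y + 2 * hm y"
        unfolding A_def hm_def using y Z by (intro I1_lap_bound[OF a _ u less_imp_le[OF t] h0 n_def]) auto
      then show "\<bar>I1 a t (T u y)\<bar> powr (p - 1) \<le> (A y + 2 * hm y) powr (p - 1)" using p by (intro powr_mono2) auto
    qed (use nn in auto)
  qed
  have "(\<integral>\<^sup>+x. ennreal (\<bar>I1 a t x\<bar> powr (p - 1)) \<partial>\<mu>M)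
      \<le> ennreal ((\<kappa> * (c + K') * (1 / h0 + 1) powr ((p - 1) / 2) + measure \<mu>M (space \<mu>M)) * t powr ((p - 1) / 2))"
    if a: "unit_fn a" and a0: "(\<integral>x. a x \<partial>\<mu>M) = 0" and t: "0 < t" for a t
  proof (rule extend_to_small_times[OF finite_\<mu>M[OF Hm HI] h0(1) _ _ t])
    show "\<bar>I1 a t x\<bar> powr (p - 1) \<le> t powr ((p - 1) / 2)" if "t \<le> 1" for x
    proof -
      have "\<bar>I1 a t x\<bar> powr (p - 1) \<le> t powr (p - 1)" using I1_le[OF a less_imp_le[OF t]] p by (intro powr_mono2) auto
      also have "\<dots> \<le> t powr ((p - 1) / 2)" using that t p by (intro powr_mono') auto
      finally show ?thesis .
    qed
  qed (use large[OF a a0 t] \<kappa> c0 K'0 p in auto)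
  moreover have "0 \<le> \<kappa> * (c + K') * (1 / h0 + 1) powr ((p - 1) / 2) + measure \<mu>M (space \<mu>M)" using \<kappa> c0 K'0 by simp
  ultimately show ?thesis by blast
qed

text \<open>The bound of \<open>I2_lap_bound\<close> is quadratic in the data and controlled in
  \<open>L^q\<close> with \<open>q = p / 2\<close>, where \<open>p \<ge> 4\<close> ensures
  \<open>q \<ge> 2\<close> as the martingale estimates require.\<close>

lemma I2_moment:
  assumes p: "4 \<le> p" and Hm: "H \<in> borel_measurable \<mu>Y" and Hp: "(\<integral>\<^sup>+y. ennreal (\<bar>H y\<bar> powr p) \<partial>\<mu>Y) < \<infinity>"
    and h0: "0 < h0" "\<And>y. y \<in> Y \<Longrightarrow> h0 \<le> H y"
  shows "\<exists>M\<ge>0. \<forall>a b t. unit_fn a \<longrightarrow> (\<integral>x. a x \<partial>\<mu>M) = 0 \<longrightarrow> unit_fn b \<longrightarrow> (\<integral>x. b x \<partial>\<mu>M) = 0 \<longrightarrow> 0 < t \<longrightarrow>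
     (\<integral>\<^sup>+x. ennreal (\<bar>I2 a b t x\<bar> powr ((p - 1) / 2)) \<partial>\<mu>M) \<le> ennreal (M * t powr ((p - 1) / 2))"
proof -
  have p2: "2 \<le> p" using p by simp
  have HI: "(\<integral>\<^sup>+y. ennreal (H y) \<partial>\<mu>Y) < \<infinity>" by (rule moments_exist[OF p2 Hm Hp])
  obtain Z g rel \<gamma> Cd G K0 where Z: "Z \<subseteq> Y" "Z \<in> sets \<mu>Y"
    and nnZ: "\<And>w. w \<in> borel_measurable \<mu>Y \<Longrightarrow> (\<integral>\<^sup>+y. w y \<partial>\<mu>Y) = (\<integral>\<^sup>+y. w y \<partial>restrict_space \<mu>Y Z)"
    and roof: "gibbs_markov_roof (restrict_space \<mu>Y Z) F \<P> (\<lambda>P. inv_into P F) g rel \<gamma> Cd G K0 H"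
    and adm: "\<And>a. unit_fn a \<Longrightarrow> (\<integral>x. a x \<partial>\<mu>M) = 0 \<Longrightarrow>
        gibbs_markov_roof.admissible (restrict_space \<mu>Y Z) \<P> (\<lambda>P. inv_into P F) rel \<gamma> G H (V a)"
    using roof_setup[OF Hm HI] by blast
  let ?N = "restrict_space \<mu>Y Z"
  interpret gr: gibbs_markov_roof ?N F \<P> "\<lambda>P. inv_into P F" g rel \<gamma> Cd G K0 H by (rule roof)
  obtain \<kappa> where \<kappa>: "\<kappa> > 0" "\<And>w. w \<in> borel_measurable borel \<Longrightarrow> (\<integral>\<^sup>+x. w x \<partial>\<mu>M)
     = ennreal \<kappa> * (\<integral>\<^sup>+y. (\<integral>\<^sup>+u. indicator {0..H y} u * w (T (max 0 u) y) \<partial>lborel) \<partial>\<mu>Y)"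
    using nn_integral_\<mu>M_Y by blast
  define q where "q = p / 2"
  have q: "2 \<le> q" "p = 2 * q" using p by (auto simp: q_def)
  define c where "c = enn2real (\<integral>\<^sup>+y. ennreal (\<bar>H y\<bar> powr p) \<partial>\<mu>Y)"
  have Hc: "moment_le ?N p H c"
    using Hp nnZ[of "\<lambda>y. ennreal (\<bar>H y\<bar> powr p)"] Hm by (auto simp: moment_le_def c_def less_top)
  have Hcq: "moment_le ?N (2 * q) H c" using Hc q by simp
  have c0: "0 \<le> c" using moment_leD(2)[OF Hc] .
  obtain K where K: "K > 0" "\<And>W n. gr.admissible W \<Longrightarrow> 1 \<le> n \<Longrightarrow> moment_le ?N p (\<lambda>z. runmax (\<lambda>k. \<bar>gr.bsum W k z\<bar>) n) (K * real n powr (p / 2))"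
    using gr.birkhoff_maximal[OF p2 Hc] by blast
  obtain K2 where K2: "K2 > 0" "\<And>U W n. gr.admissible U \<Longrightarrow> gr.admissible W \<Longrightarrow> 1 \<le> n \<Longrightarrow> moment_le ?N q (\<lambda>z. runmax (\<lambda>k. \<bar>gr.isum U W k z\<bar>) n) (K2 * real n powr q)"
    using gr.iterated_maximal[OF q(1) Hcq] by blast
  define k1 where "k1 = 2 powr p * (K + 2 powr p * (K + \<bar>4\<bar> powr p * (2 * c)))"
  define K' where "K' = 2 powr q * (K2 + 2 powr q * ((c + c) + (2 * c + k1)))"
  have K'0: "0 \<le> K'" using K K2 c0 by (simp add: K'_def k1_def)
  have large: "(\<integral>\<^sup>+x. ennreal (\<bar>I2 a b t x\<bar> powr ((p - 1) / 2)) \<partial>\<mu>M) \<le> ennreal (\<kappa> * (c + K') * real (Suc (nat \<lfloor>t / h0\<rfloor>)) powr ((p - 1) / 2))"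
    if a: "unit_fn a" and a0: "(\<integral>x. a x \<partial>\<mu>M) = 0" and b: "unit_fn b" and b0: "(\<integral>x. b x \<partial>\<mu>M) = 0" and t: "0 < t" for a b t
  proof -
    define n where "n = Suc (nat \<lfloor>t / h0\<rfloor>)"
    have n: "1 \<le> n" by (simp add: n_def)
    define R where "R = real n powr (p / 2)"
    have Rq: "real n powr q = R" by (simp add: R_def q_def)
    define A where "A y = runmax (\<lambda>k. \<bar>\<Sum>j<k. V a ((F ^^ j) y)\<bar>) n" for y
    define B where "B y = runmax (\<lambda>k. \<bar>\<Sum>j<k. V b ((F ^^ j) y)\<bar>) n" for y
    define I where "I y = runmax (\<lambda>k. \<bar>\<Sum>j<k. (\<Sum>i<j. V a ((F ^^ i) y)) * V b ((F ^^ j) y)\<bar>) n" for y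
    define Q where "Q y = (\<Sum>j<n. \<bar>H ((F ^^ j) y) * H ((F ^^ j) y)\<bar>)" for y
    define hm where "hm y = runmax (\<lambda>k. \<bar>H ((F ^^ k) y)\<bar>) n" for y
    have Ac: "moment_le ?N p A (K * R)" and Bc: "moment_le ?N p B (K * R)"
      using K(2)[OF adm[OF a a0] n] K(2)[OF adm[OF b b0] n] by (simp_all add: A_def[abs_def] B_def[abs_def] gr.bsum_def R_def)
    have Ic: "moment_le ?N q I (K2 * R)"
      using K2(2)[OF adm[OF a a0] adm[OF b b0] n] by (simp add: I_def[abs_def] gr.isum_def gr.bsum_def Rq)
    have Qc: "moment_le ?N q Q ((c + c) * R)"
    proof -
      have "moment_le ?N q (\<lambda>y. H y * H y) (c + c)" using moment_le_mult[OF Hcq Hcq] q by simp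
      from moment_le_sum[OF gr.moment_le_funpow[OF this] _ n] q show ?thesis by (simp add: Q_def[abs_def] Rq mult.commute)
    qed
    have "moment_le ?N p hm (real (Suc n) * c)"
      unfolding hm_def by (rule moment_le_runmax) (rule gr.moment_le_funpow[OF Hc])
    moreover have "real (Suc n) * c \<le> 2 * c * R"
    proof -
      have "real n powr 1 \<le> R" unfolding R_def using n p by (intro powr_mono) auto
      then have "real (Suc n) \<le> 2 * R" using n by simp
      then have "real (Suc n) * c \<le> (2 * R) * c" using c0 by (rule mult_right_mono)
      then show ?thesis by (simp add: mult_ac)
    qed
    ultimately have hmc: "moment_le ?N p hm (2 * c * R)" by (rule moment_le_weaken)
    have "moment_le ?N p (\<lambda>y. A y + (B y + 4 * hm y)) (2 powr p * (K * R + 2 powr p * (K * R + \<bar>4\<bar> powr p * (2 * c * R))))"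
      using p by (intro moment_le_add Ac Bc moment_le_scale hmc) auto
    then have ABc: "moment_le ?N p (\<lambda>y. A y + (B y + 4 * hm y)) (k1 * R)" by (simp add: k1_def algebra_simps)
    have "moment_le ?N q (\<lambda>y. hm y * (A y + (B y + 4 * hm y))) (2 * c * R + k1 * R)"
      using hmc ABc q by (intro moment_le_mult) auto
    then have "moment_le ?N q (\<lambda>y. I y + (Q y + hm y * (A y + (B y + 4 * hm y)))) (2 powr q * (K2 * R + 2 powr q * ((c + c) * R + (2 * c * R + k1 * R))))"
      using q by (intro moment_le_add Ic Qc) auto
    then have G2: "moment_le ?N q (\<lambda>y. I y + (Q y + hm y * (A y + (B y + 4 * hm y)))) (K' * R)" (is "moment_le ?N q ?G2 _")
      by (simp add: K'_def algebra_simps)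
    have nn: "0 \<le> A y" "0 \<le> B y" "0 \<le> I y" "0 \<le> Q y" "0 \<le> hm y" for y
      unfolding A_def B_def I_def Q_def hm_def by (auto intro!: runmax_nonneg sum_nonneg)
    have G20: "0 \<le> ?G2 y" for y using nn by simp
    have root: "sqrt x powr r = x powr (r / 2)" if "0 \<le> x" for x r :: real
      using that by (simp add: powr_half_sqrt[symmetric] powr_powr)
    \<comment> \<open>The square root moves the bound from \<open>L^(p/2)\<close> to
      \<open>L^p\<close>, and \<open>\<bar>I2\<bar> powr ((p - 1) / 2)\<close> is then bounded by
      the power \<open>p - 1\<close> of this root, as \<open>tower_bound\<close> expects.\<close>
    have G: "moment_le ?N p (\<lambda>y. sqrt (?G2 y)) (K' * real n powr (p / 2))"
      using G2 G20 unfolding moment_le_def R_def[symmetric] by (auto simp: root q_def[symmetric])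
    show ?thesis
      unfolding n_def[symmetric]
    proof (rule tower_bound[OF Hm p2 n Z nnZ \<kappa> Hc G])
      show "(\<lambda>x. \<bar>I2 a b t x\<bar> powr ((p - 1) / 2)) \<in> borel_measurable borel"
        using I2_joint[OF a b, of "\<lambda>_. t" borel "\<lambda>x. x"] by measurable
      fix y u assume y: "y \<in> Z" and u: "0 \<le> u" "u \<le> H y"
      have "\<bar>I2 a b t (T u y)\<bar> \<le> ?G2 y"
        unfolding A_def B_def I_def Q_def using y Z
        by (intro I2_lap_bound[OF a b _ u less_imp_le[OF t] h0 n_def]) (auto simp: hm_def)
      then have "\<bar>I2 a b t (T u y)\<bar> powr ((p - 1) / 2) \<le> ?G2 y powr ((p - 1) / 2)" using p by (intro powr_mono2) auto
      then show "\<bar>I2 a b t (T u y)\<bar> powr ((p - 1) / 2) \<le> sqrt (?G2 y) powr (p - 1)" using root[OF G20] by simp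
    qed (use G20 in auto)
  qed
  have "(\<integral>\<^sup>+x. ennreal (\<bar>I2 a b t x\<bar> powr ((p - 1) / 2)) \<partial>\<mu>M)
      \<le> ennreal ((\<kappa> * (c + K') * (1 / h0 + 1) powr ((p - 1) / 2) + measure \<mu>M (space \<mu>M)) * t powr ((p - 1) / 2))"
    if a: "unit_fn a" and a0: "(\<integral>x. a x \<partial>\<mu>M) = 0" and b: "unit_fn b" and b0: "(\<integral>x. b x \<partial>\<mu>M) = 0" and t: "0 < t" for a b t
  proof (rule extend_to_small_times[OF finite_\<mu>M[OF Hm HI] h0(1) _ _ t])
    show "\<bar>I2 a b t x\<bar> powr ((p - 1) / 2) \<le> t powr ((p - 1) / 2)" if "t \<le> 1" for x
    proof -
      have "\<bar>I2 a b t x\<bar> \<le> t * t" by (rule I2_le[OF a b less_imp_le[OF t]])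
      also have "\<dots> \<le> t" using that t by (simp add: mult_left_le)
      finally show ?thesis using p by (intro powr_mono2) auto
    qed
  qed (use large[OF a a0 b b0 t] \<kappa> c0 K'0 p in auto)
  moreover have "0 \<le> \<kappa> * (c + K') * (1 / h0 + 1) powr ((p - 1) / 2) + measure \<mu>M (space \<mu>M)" using \<kappa> c0 K'0 by simp
  ultimately show ?thesis by blast
qed

end

section \<open>From scalar components to vectors and matrices\<close>

lemma sum_powr_card_le:
  fixes a :: "'i \<Rightarrow> real"
  assumes "finite I" "0 \<le> q" "\<And>i. i \<in> I \<Longrightarrow> 0 \<le> a i"
  shows "(\<Sum>i\<in>I. a i) powr q \<le> real (card I) powr q * (\<Sum>i\<in>I. a i powr q)"
proof (cases "I = {}")
  case False
  define m where "m = Max (a ` I)"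
  have "m \<in> a ` I" unfolding m_def using assms False by (intro Max_in) auto
  then obtain j where j: "j \<in> I" "m = a j" by auto
  have "(\<Sum>i\<in>I. a i) \<le> (\<Sum>i\<in>I. m)" unfolding m_def using assms by (intro sum_mono Max_ge) auto
  then have "(\<Sum>i\<in>I. a i) powr q \<le> (real (card I) * m) powr q" using assms by (intro powr_mono2) (auto intro: sum_nonneg)
  also have "\<dots> = real (card I) powr q * a j powr q" using j assms by (simp add: powr_mult)
  also have "\<dots> \<le> real (card I) powr q * (\<Sum>i\<in>I. a i powr q)"
    using j assms by (intro mult_left_mono member_le_sum) auto
  finally show ?thesis .
qed simp

text \<open>The factor \<open>c0\<close> stays outside the root, which preserves the exact
  homogeneity in \<open>v\<close>; the loss is a constant depending on the number of
  components.\<close>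

lemma Lq_norm_le:
  fixes g :: "'a \<Rightarrow> 'b::real_normed_vector"
  assumes I: "finite I" and q: "0 < q" and c0: "0 \<le> c0" and M: "0 \<le> M"
    and g: "\<And>x. norm (g x) \<le> c0 * (\<Sum>i\<in>I. \<bar>G i x\<bar>)"
    and G: "\<And>i. i \<in> I \<Longrightarrow> G i \<in> borel_measurable \<mu>" "\<And>i. i \<in> I \<Longrightarrow> (\<integral>\<^sup>+x. ennreal (\<bar>G i x\<bar> powr q) \<partial>\<mu>) \<le> ennreal M"
  shows "Lq_norm \<mu> q g \<le> ennreal (c0 * real (card I) * (real (card I) * M) powr (1 / q))"
proof -
  define d where "d = real (card I)"
  define A where "A = (\<integral>\<^sup>+x. ennreal (norm (g x) powr q) \<partial>\<mu>)"
  have "A \<le> (\<integral>\<^sup>+x. ennreal ((c0 * d) powr q) * (\<Sum>i\<in>I. ennreal (\<bar>G i x\<bar> powr q)) \<partial>\<mu>)"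
    unfolding A_def
  proof (rule nn_integral_mono)
    fix x
    have "norm (g x) powr q \<le> (c0 * (\<Sum>i\<in>I. \<bar>G i x\<bar>)) powr q" using g q by (intro powr_mono2) auto
    also have "\<dots> = c0 powr q * (\<Sum>i\<in>I. \<bar>G i x\<bar>) powr q" using c0 by (simp add: powr_mult sum_nonneg)
    also have "\<dots> \<le> c0 powr q * (d powr q * (\<Sum>i\<in>I. \<bar>G i x\<bar> powr q))"
      unfolding d_def using q by (intro mult_left_mono sum_powr_card_le I) auto
    also have "\<dots> = (c0 * d) powr q * (\<Sum>i\<in>I. \<bar>G i x\<bar> powr q)" using c0 by (simp add: powr_mult d_def)
    finally show "ennreal (norm (g x) powr q) \<le> ennreal ((c0 * d) powr q) * (\<Sum>i\<in>I. ennreal (\<bar>G i x\<bar> powr q))"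
      by (simp add: ennreal_mult[symmetric] sum_nonneg ennreal_leI)
  qed
  also have "\<dots> = ennreal ((c0 * d) powr q) * (\<Sum>i\<in>I. \<integral>\<^sup>+x. ennreal (\<bar>G i x\<bar> powr q) \<partial>\<mu>)"
    using G(1) by (subst nn_integral_cmult) (auto simp del: sum_ennreal simp: nn_integral_sum)
  also have "\<dots> \<le> ennreal ((c0 * d) powr q) * (\<Sum>i\<in>I. ennreal M)" using G(2) by (intro mult_left_mono sum_mono) auto
  also have "\<dots> = ennreal ((c0 * d) powr q * (d * M))" using M by (simp add: ennreal_mult d_def ennreal_of_nat_eq_real_of_nat)
  finally have A: "A \<le> ennreal ((c0 * d) powr q * (d * M))" .
  have nn: "0 \<le> (c0 * d) powr q * (d * M)" using M by (simp add: d_def)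
  have fin: "A \<noteq> \<infinity>" using A by (auto simp: top_unique)
  have "enn2real A \<le> (c0 * d) powr q * (d * M)" using A nn by (metis enn2real_ennreal enn2real_mono ennreal_less_top)
  then have "enn2real A powr (1 / q) \<le> ((c0 * d) powr q * (d * M)) powr (1 / q)" using q by (intro powr_mono2) auto
  also have "\<dots> = c0 * d * (d * M) powr (1 / q)" using q c0 M by (simp add: powr_mult powr_powr d_def)
  finally show ?thesis using fin unfolding Lq_norm_def Let_def A_def[symmetric] d_def[symmetric] by (simp add: ennreal_leI)
qed

lemma holder_norm_bounds:
  fixes v :: "'m::metric_space \<Rightarrow> real^'d"
  assumes "bounded (range v)" "bdd_above {norm (v x - v x') / dist x x' powr \<eta> | x x'. x \<noteq> x'}"
  shows "norm (v x) \<le> holder_norm \<eta> v" "norm (v x - v y) \<le> holder_norm \<eta> v * dist x y powr \<eta>" "0 \<le> holder_norm \<eta> v"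
proof -
  let ?S = "{norm (v x - v x') / dist x x' powr \<eta> | x x'. x \<noteq> x'}"
  have bS: "bdd_above (insert 0 ?S)" using assms(2) by (rule bdd_above_insert[THEN iffD2])
  have h0: "0 \<le> holder_const \<eta> v" unfolding holder_const_def by (rule cSup_upper[OF _ bS]) simp
  obtain B where "\<And>x. norm (v x) \<le> B" using assms(1) by (auto simp: bounded_iff)
  then have bv: "bdd_above (range (\<lambda>x. norm (v x)))" by (intro bdd_aboveI[of _ B]) auto
  have s: "norm (v x) \<le> (SUP x. norm (v x))" for x by (rule cSUP_upper[OF _ bv]) simp
  have s0: "0 \<le> (SUP x. norm (v x))" using s[of undefined] norm_ge_zero[of "v undefined"] by linarith
  show "norm (v x) \<le> holder_norm \<eta> v" unfolding holder_norm_def using s[of x] h0 by linarith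
  show "0 \<le> holder_norm \<eta> v" unfolding holder_norm_def using s0 h0 by linarith
  show "norm (v x - v y) \<le> holder_norm \<eta> v * dist x y powr \<eta>"
  proof (cases "x = y")
    case False
    have "norm (v x - v y) / dist x y powr \<eta> \<le> holder_const \<eta> v"
      unfolding holder_const_def using False by (intro cSup_upper[OF _ bS]) auto
    also have "\<dots> \<le> holder_norm \<eta> v" unfolding holder_norm_def using s0 by linarith
    finally show ?thesis using False by (simp add: field_simps)
  qed simp
qed

context nue
begin

text \<open>Normalisation by the Hoelder norm. In the degenerate case \<open>B = 0\<close> the
  function vanishes, and division by zero yields the zero observable, for which all claims
  persist.\<close>

lemma C0eta_components:
  fixes v :: "'m \<Rightarrow> real^'d"
  assumes v: "v \<in> C0eta \<eta> \<mu>M" and fin: "finite_measure \<mu>M"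
  defines "B \<equiv> holder_norm \<eta> v"
  shows "v \<in> borel_measurable borel" "unit_fn (\<lambda>x. v x $ i / B)" "(\<integral>x. v x $ i / B \<partial>\<mu>M) = 0" "v x $ i = B * (v x $ i / B)"
    "norm (v x) \<le> B" "0 \<le> B"
proof -
  interpret finite_measure \<mu>M by (rule fin)
  have vb: "bounded (range v)" "bdd_above {norm (v x - v x') / dist x x' powr \<eta> | x x'. x \<noteq> x'}" and v0: "(\<integral>x. v x \<partial>\<mu>M) = 0"
    using v by (auto simp: C0eta_def)
  note hb = holder_norm_bounds[OF vb, folded B_def]
  show B1: "norm (v x) \<le> B" for x by (rule hb(1))
  show B0: "0 \<le> B" by (rule hb(3))
  have "continuous_on UNIV v"
    unfolding continuous_on_iff
  proof (intro ballI allI impI)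
    fix x :: 'm and e :: real assume e: "0 < e"
    \<comment> \<open>Chosen so that \<open>B * d powr \<eta> = B * e / (B + 1) < e\<close>, also
      when \<open>B\<close> is zero.\<close>
    define d where "d = (e / (B + 1)) powr (1 / \<eta>)"
    have d: "0 < d" using e B0 by (simp add: d_def)
    moreover have "dist (v y) (v x) < e" if "dist y x < d" for y
    proof -
      have "dist y x powr \<eta> \<le> d powr \<eta>" using that constants by (intro powr_mono2) auto
      also have "\<dots> = e / (B + 1)" using constants e B0 by (simp add: d_def powr_powr)
      finally have "B * dist y x powr \<eta> \<le> B * (e / (B + 1))" using B0 by (intro mult_left_mono)
      also have "\<dots> < e" using e B0 by (simp add: field_simps)
      finally show ?thesis using hb(2)[of y x] by (simp add: dist_norm)
    qed
    ultimately show "\<exists>d>0. \<forall>x'\<in>UNIV. dist x' x < d \<longrightarrow> dist (v x') (v x) < e" by blast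
  qed
  then show vm[measurable]: "v \<in> borel_measurable borel" by (rule borel_measurable_continuous_onI)
  have ci: "\<bar>v x $ i\<bar> \<le> B" for x using component_le_norm_cart[of "v x" i] B1[of x] by linarith
  show "v x $ i = B * (v x $ i / B)" using ci[of x] by (cases "B = 0") auto
  have im: "(\<lambda>x. v x $ i) \<in> borel_measurable borel"
    by (rule measurable_compose[OF vm, of "\<lambda>w. w $ i"]) (intro borel_measurable_continuous_onI continuous_intros)
  show "unit_fn (\<lambda>x. v x $ i / B)"
    unfolding unit_fn_def
  proof (intro conjI allI)
    show "(\<lambda>x. v x $ i / B) \<in> borel_measurable borel" using im by measurable
    show "\<bar>v x $ i / B\<bar> \<le> 1" for x using ci[of x] B0 by (cases "B = 0") (auto simp: abs_divide)
    show "\<bar>v x $ i / B - v y $ i / B\<bar> \<le> dist x y powr \<eta>" for x y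
    proof (cases "B = 0")
      case False
      have "\<bar>v x $ i - v y $ i\<bar> \<le> B * dist x y powr \<eta>"
        using component_le_norm_cart[of "v x - v y" i] hb(2)[of x y] by simp
      then show ?thesis using False B0 by (simp add: diff_divide_distrib[symmetric] abs_divide field_simps)
    qed simp
  qed
  have vM: "v \<in> borel_measurable \<mu>M"
    using vm by (simp only: measurable_cong_sets[OF sets_\<mu>M[of "\<lambda>_. 0", OF borel_measurable_const] refl, of borel])
  have "integrable \<mu>M v" by (rule integrable_const_bound[of _ B]) (use B1 vM in auto)
  then have "(\<integral>x. v x $ i \<partial>\<mu>M) = (\<integral>x. v x \<partial>\<mu>M) $ i"
    by (rule integral_bounded_linear[OF bounded_linear_vec_nth])
  then show "(\<integral>x. v x $ i / B \<partial>\<mu>M) = 0" using v0 by simp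
qed

lemma vector_path_integrable:
  fixes w :: "real \<Rightarrow> 'b::euclidean_space"
  assumes "w \<in> borel_measurable borel" "\<And>u. u \<in> {0..t} \<Longrightarrow> norm (w u) \<le> B"
  shows "integrable lborel (\<lambda>u. indicator {0..t} u *\<^sub>R w u)"
  using integrableI_bounded_set_indicator[of "{0..t}" lborel w B] assms by (auto simp: emeasure_lborel_Icc_eq)

lemma vt_eq:
  fixes v :: "'m \<Rightarrow> real^'d"
  shows "vt T v t x = (\<integral>u. indicator {0..t} u *\<^sub>R v (T (max 0 u) x) \<partial>lborel)"
  unfolding vt_def set_lebesgue_integral_def by (rule Bochner_Integration.integral_cong) (auto simp: indicator_def max_def)

lemma vt_component:
  fixes v :: "'m \<Rightarrow> real^'d"
  assumes v: "v \<in> C0eta \<eta> \<mu>M" and fin: "finite_measure \<mu>M"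
  shows "vt T v t x $ i = holder_norm \<eta> v * I1 (\<lambda>x. v x $ i / holder_norm \<eta> v) t x"
proof -
  define B where "B = holder_norm \<eta> v"
  note vc = C0eta_components[OF v fin, folded B_def]
  have i: "integrable lborel (\<lambda>u. indicator {0..t} u *\<^sub>R v (T (max 0 u) x))"
    by (rule vector_path_integrable[of _ _ B]) (use vc in \<open>auto intro: measurable_compose[OF T_path]\<close>)
  have "vt T v t x $ i = (\<integral>u. (indicator {0..t} u *\<^sub>R v (T (max 0 u) x)) $ i \<partial>lborel)"
    unfolding vt_eq by (rule integral_bounded_linear[OF bounded_linear_vec_nth i, symmetric])
  also have "\<dots> = (\<integral>u. B * (indicator {0..t} u * (v (T (max 0 u) x) $ i / B)) \<partial>lborel)"
    by (rule Bochner_Integration.integral_cong) (use vc(4)[of _ i] in \<open>auto simp: indicator_def\<close>)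
  also have "\<dots> = B * I1 (\<lambda>x. v x $ i / B) t x" unfolding I1_def by simp
  finally show ?thesis by (simp add: B_def)
qed

lemma vt_norm_le:
  fixes v :: "'m \<Rightarrow> real^'d"
  assumes v: "v \<in> C0eta \<eta> \<mu>M" and fin: "finite_measure \<mu>M"
  shows "norm (vt T v t x) \<le> holder_norm \<eta> v * (\<Sum>i\<in>UNIV. \<bar>I1 (\<lambda>x. v x $ i / holder_norm \<eta> v) t x\<bar>)"
  using norm_le_l1_cart[of "vt T v t x"] C0eta_components(6)[OF v fin]
  by (simp add: vt_component[OF v fin] abs_mult sum_distrib_left)

lemma bounded_linear_outer: "bounded_linear (\<lambda>a. outer a b)" for b :: "real^'d"
  unfolding linear_conv_bounded_linear[symmetric]
  by (rule linearI) (auto simp: outer_def vec_eq_iff algebra_simps)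

text \<open>By linearity of \<open>outer\<close> in its first argument the inner integral is
  \<open>outer (vt T v s x) (v (T s x))\<close>. Passing to matrix entries under the outer integral
  uses that this path is integrable as a matrix-valued function.\<close>

lemma St_component:
  fixes v :: "'m \<Rightarrow> real^'d"
  assumes v: "v \<in> C0eta \<eta> \<mu>M" and fin: "finite_measure \<mu>M" and t: "0 \<le> t"
  shows "St T v t x $ i $ j = (holder_norm \<eta> v)\<^sup>2 * I2 (\<lambda>x. v x $ i / holder_norm \<eta> v) (\<lambda>x. v x $ j / holder_norm \<eta> v) t x"
proof -
  define B where "B = holder_norm \<eta> v"
  note vc = C0eta_components[OF v fin, folded B_def]
  define p where "p u = v (T (max 0 u) x)" for u
  have pm[measurable]: "p \<in> borel_measurable borel" unfolding p_def using vc(1) by (intro measurable_compose[OF T_path])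
  have pB: "norm (p u) \<le> B" for u unfolding p_def by (rule vc(5))
  define W where "W u = outer (vt T v u x) (p u)" for u
  have inner: "(LINT r:{0..s}|lborel. outer (v (T r x)) (v (T s x))) = W s" if s: "0 \<le> s" for s
  proof -
    have "(LINT r:{0..s}|lborel. outer (v (T r x)) (v (T s x))) = (\<integral>r. outer (indicator {0..s} r *\<^sub>R p r) (p s) \<partial>lborel)"
      unfolding set_lebesgue_integral_def
      by (rule Bochner_Integration.integral_cong) (use s in \<open>auto simp: indicator_def p_def outer_def vec_eq_iff\<close>)
    also have "\<dots> = outer (\<integral>r. indicator {0..s} r *\<^sub>R p r \<partial>lborel) (p s)"
      by (rule integral_bounded_linear[OF bounded_linear_outer vector_path_integrable[OF pm pB]])
    finally show ?thesis by (simp add: W_def vt_eq p_def)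
  qed
  have vtm: "(\<lambda>u. vt T v u x) \<in> borel_measurable borel"
  proof -
    have "(\<lambda>q. indicator {0..fst q} (snd q) *\<^sub>R p (snd q)) \<in> borel_measurable (borel \<Otimes>\<^sub>M lborel)"
      unfolding indicator_def atLeastAtMost_iff by measurable
    then show ?thesis unfolding vt_eq p_def[symmetric]
      by (intro lborel.borel_measurable_lebesgue_integral) (simp add: case_prod_beta')
  qed
  have "continuous_on UNIV (\<lambda>q. outer (fst q) (snd q) :: real^'d^'d)"
    unfolding outer_def by (intro continuous_intros)
  then have Wm: "W \<in> borel_measurable borel"
    unfolding W_def by (intro borel_measurable_continuous_Pair[OF vtm pm]) simp
  have comp: "W u $ k $ l = B\<^sup>2 * (I1 (\<lambda>x. v x $ k / B) u x * (v (T (max 0 u) x) $ l / B))" for u k l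
    using vc(4)[of "T (max 0 u) x" l] unfolding W_def outer_def p_def
    by (simp add: vt_component[OF v fin] B_def[symmetric] power2_eq_square)
  have Wi: "integrable lborel (\<lambda>u. indicator {0..t} u *\<^sub>R W u)"
  proof (rule vector_path_integrable[OF Wm])
    fix u assume u: "u \<in> {0..t}"
    have "norm (W u) \<le> (\<Sum>k\<in>UNIV. norm (W u $ k))" unfolding norm_vec_def by (rule L2_set_le_sum) simp
    also have "\<dots> \<le> (\<Sum>k\<in>UNIV. \<Sum>l\<in>UNIV. \<bar>W u $ k $ l\<bar>)" by (intro sum_mono norm_le_l1_cart)
    also have "\<dots> \<le> (\<Sum>k\<in>(UNIV :: 'd set). \<Sum>l\<in>(UNIV :: 'd set). B\<^sup>2 * t)"
    proof (intro sum_mono)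
      fix k l :: 'd
      have "\<bar>I1 (\<lambda>x. v x $ k / B) u x * (v (T (max 0 u) x) $ l / B)\<bar> \<le> t" by (rule I2_path_le[OF vc(2) vc(2) u])
      then have "B\<^sup>2 * \<bar>I1 (\<lambda>x. v x $ k / B) u x * (v (T (max 0 u) x) $ l / B)\<bar> \<le> B\<^sup>2 * t" by (rule mult_left_mono) simp
      then show "\<bar>W u $ k $ l\<bar> \<le> B\<^sup>2 * t" by (simp only: comp abs_mult[of "B\<^sup>2"] abs_power2)
    qed
    finally show "norm (W u) \<le> (\<Sum>k\<in>(UNIV :: 'd set). \<Sum>l\<in>(UNIV :: 'd set). B\<^sup>2 * t)" .
  qed
  have "St T v t x = (\<integral>u. indicator {0..t} u *\<^sub>R W u \<partial>lborel)"
    unfolding St_def set_lebesgue_integral_def[of lborel "{0..t}"]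
    by (rule Bochner_Integration.integral_cong) (auto simp: indicator_def inner)
  then have "St T v t x $ i = (\<integral>u. (indicator {0..t} u *\<^sub>R W u) $ i \<partial>lborel)"
    using integral_bounded_linear[OF bounded_linear_vec_nth Wi, of i] by simp
  then have "St T v t x $ i $ j = (\<integral>u. (indicator {0..t} u *\<^sub>R W u) $ i $ j \<partial>lborel)"
    using integral_bounded_linear[OF bounded_linear_vec_nth integrable_bounded_linear[OF bounded_linear_vec_nth Wi, of i], of j] by simp
  also have "\<dots> = (\<integral>u. B\<^sup>2 * (indicator {0..t} u * (I1 (\<lambda>x. v x $ i / B) u x * (v (T (max 0 u) x) $ j / B))) \<partial>lborel)"
    by (rule Bochner_Integration.integral_cong) (auto simp: comp indicator_def)
  also have "\<dots> = B\<^sup>2 * I2 (\<lambda>x. v x $ i / B) (\<lambda>x. v x $ j / B) t x" unfolding I2_def by simp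
  finally show ?thesis by (simp add: B_def)
qed

lemma St_norm_le:
  fixes v :: "'m \<Rightarrow> real^'d"
  assumes v: "v \<in> C0eta \<eta> \<mu>M" and fin: "finite_measure \<mu>M" and t: "0 \<le> t"
  shows "norm (St T v t x) \<le> (holder_norm \<eta> v)\<^sup>2 *
    (\<Sum>ij\<in>UNIV. \<bar>I2 (\<lambda>x. v x $ fst ij / holder_norm \<eta> v) (\<lambda>x. v x $ snd ij / holder_norm \<eta> v) t x\<bar>)"
proof -
  have "norm (St T v t x) \<le> (\<Sum>i\<in>UNIV. norm (St T v t x $ i))" unfolding norm_vec_def by (rule L2_set_le_sum) simp
  also have "\<dots> \<le> (\<Sum>i\<in>UNIV. \<Sum>j\<in>UNIV. \<bar>St T v t x $ i $ j\<bar>)" by (intro sum_mono norm_le_l1_cart)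
  also have "\<dots> = (\<Sum>ij\<in>UNIV. \<bar>St T v t x $ fst ij $ snd ij\<bar>)"
    by (simp add: sum.cartesian_product case_prod_beta')
  finally show ?thesis by (simp add: St_component[OF v fin t] abs_mult sum_distrib_left)
qed

lemma root_powr: "0 \<le> x \<Longrightarrow> 0 < q \<Longrightarrow> (x * t powr r) powr (1 / q) = x powr (1 / q) * t powr (r / q)" for x q r t :: real
  by (simp add: powr_mult powr_powr)

theorem vt_moment:
  assumes p: "2 \<le> p" and Hm: "H \<in> borel_measurable \<mu>Y" and Hp: "(\<integral>\<^sup>+y. ennreal (\<bar>H y\<bar> powr p) \<partial>\<mu>Y) < \<infinity>"
    and h0: "0 < h0" "\<And>y. y \<in> Y \<Longrightarrow> h0 \<le> H y"
  shows "\<exists>K>0. \<forall>v \<in> (C0eta \<eta> \<mu>M :: ('m \<Rightarrow> real^'d) set). \<forall>t>0.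
     Lq_norm \<mu>M (p - 1) (vt T v t) \<le> ennreal (K * t powr (1/2) * holder_norm \<eta> v)"
proof -
  note fin = finite_\<mu>M[OF Hm moments_exist[OF p Hm Hp]]
  obtain M where M: "M \<ge> 0" "\<And>a t. unit_fn a \<Longrightarrow> (\<integral>x. a x \<partial>\<mu>M) = 0 \<Longrightarrow> 0 < t \<Longrightarrow>
     (\<integral>\<^sup>+x. ennreal (\<bar>I1 a t x\<bar> powr (p - 1)) \<partial>\<mu>M) \<le> ennreal (M * t powr ((p - 1) / 2))"
    using I1_moment[OF p Hm Hp h0] by blast
  define d where "d = real CARD('d)"
  \<comment> \<open>The summand 1 makes \<open>K\<close> positive even when \<open>M\<close> is
    zero.\<close>
  define K where "K = d * (d * M) powr (1 / (p - 1)) + 1"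
  have "K > 0" unfolding K_def d_def by (intro add_nonneg_pos) auto
  moreover have "Lq_norm \<mu>M (p - 1) (vt T v t) \<le> ennreal (K * t powr (1/2) * holder_norm \<eta> v)"
    if v: "v \<in> C0eta \<eta> \<mu>M" and t: "0 < t" for v :: "'m \<Rightarrow> real^'d" and t
  proof -
    define B where "B = holder_norm \<eta> v"
    note vc = C0eta_components[OF v fin, folded B_def]
    have "Lq_norm \<mu>M (p - 1) (vt T v t) \<le> ennreal (B * d * (d * (M * t powr ((p - 1) / 2))) powr (1 / (p - 1)))"
      unfolding d_def
    proof (rule Lq_norm_le)
      show "norm (vt T v t x) \<le> B * (\<Sum>i\<in>UNIV. \<bar>I1 (\<lambda>x. v x $ i / B) t x\<bar>)" for x
        using vt_norm_le[OF v fin] by (simp add: B_def)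
      show "I1 (\<lambda>x. v x $ i / B) t \<in> borel_measurable \<mu>M" for i
        using I1_joint[OF vc(2)[of i], of "\<lambda>_. t" borel "\<lambda>x. x"]
        by (simp only: measurable_cong_sets[OF sets_\<mu>M[of "\<lambda>_. 0", OF borel_measurable_const] refl, of borel] borel_measurable_const measurable_ident_sets)
    qed (use p vc M t in auto)
    also have "(d * (M * t powr ((p - 1) / 2))) powr (1 / (p - 1)) = (d * M) powr (1 / (p - 1)) * t powr (1 / 2)"
    proof -
      have "(p - 1) / 2 / (p - 1) = 1 / 2" "0 \<le> d * M" "0 < p - 1" using p M by (auto simp: d_def)
      then show ?thesis using root_powr[of "d * M" "p - 1" t "(p - 1) / 2"] by (simp only: mult.assoc)
    qed
    also have "ennreal (B * d * ((d * M) powr (1 / (p - 1)) * t powr (1 / 2))) \<le> ennreal (K * t powr (1/2) * B)"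
      using vc(6) by (intro ennreal_leI) (simp add: K_def algebra_simps)
    finally show ?thesis by (simp add: B_def)
  qed
  ultimately show ?thesis by blast
qed

theorem St_moment:
  assumes p: "4 \<le> p" and Hm: "H \<in> borel_measurable \<mu>Y" and Hp: "(\<integral>\<^sup>+y. ennreal (\<bar>H y\<bar> powr p) \<partial>\<mu>Y) < \<infinity>"
    and h0: "0 < h0" "\<And>y. y \<in> Y \<Longrightarrow> h0 \<le> H y"
  shows "\<exists>K>0. \<forall>v \<in> (C0eta \<eta> \<mu>M :: ('m \<Rightarrow> real^'d) set). \<forall>t>0.
     Lq_norm \<mu>M ((p - 1) / 2) (St T v t) \<le> ennreal (K * t * (holder_norm \<eta> v)\<^sup>2)"
proof -
  have p2: "2 \<le> p" using p by simp
  note fin = finite_\<mu>M[OF Hm moments_exist[OF p2 Hm Hp]]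
  obtain M where M: "M \<ge> 0" "\<And>a b t. unit_fn a \<Longrightarrow> (\<integral>x. a x \<partial>\<mu>M) = 0 \<Longrightarrow> unit_fn b \<Longrightarrow> (\<integral>x. b x \<partial>\<mu>M) = 0 \<Longrightarrow> 0 < t \<Longrightarrow>
     (\<integral>\<^sup>+x. ennreal (\<bar>I2 a b t x\<bar> powr ((p - 1) / 2)) \<partial>\<mu>M) \<le> ennreal (M * t powr ((p - 1) / 2))"
    using I2_moment[OF p Hm Hp h0] by blast
  define d where "d = real CARD('d \<times> 'd)"
  define q where "q = (p - 1) / 2"
  have q: "0 < q" using p by (simp add: q_def)
  define K where "K = d * (d * M) powr (1 / q) + 1"
  have "K > 0" unfolding K_def d_def by (intro add_nonneg_pos) auto
  moreover have "Lq_norm \<mu>M q (St T v t) \<le> ennreal (K * t * (holder_norm \<eta> v)\<^sup>2)"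
    if v: "v \<in> C0eta \<eta> \<mu>M" and t: "0 < t" for v :: "'m \<Rightarrow> real^'d" and t
  proof -
    define B where "B = holder_norm \<eta> v"
    note vc = C0eta_components[OF v fin, folded B_def]
    have "Lq_norm \<mu>M q (St T v t) \<le> ennreal (B\<^sup>2 * d * (d * (M * t powr q)) powr (1 / q))"
      unfolding d_def
    proof (rule Lq_norm_le)
      show "norm (St T v t x) \<le> B\<^sup>2 * (\<Sum>ij\<in>UNIV. \<bar>I2 (\<lambda>x. v x $ fst ij / B) (\<lambda>x. v x $ snd ij / B) t x\<bar>)" for x
        using St_norm_le[OF v fin less_imp_le[OF t]] by (simp add: B_def)
      show "I2 (\<lambda>x. v x $ fst ij / B) (\<lambda>x. v x $ snd ij / B) t \<in> borel_measurable \<mu>M" for ij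
        using I2_joint[OF vc(2)[of "fst ij"] vc(2)[of "snd ij"], of "\<lambda>_. t" borel "\<lambda>x. x"]
        by (simp only: measurable_cong_sets[OF sets_\<mu>M[of "\<lambda>_. 0", OF borel_measurable_const] refl, of borel] borel_measurable_const measurable_ident_sets)
      show "(\<integral>\<^sup>+x. ennreal (\<bar>I2 (\<lambda>x. v x $ fst ij / B) (\<lambda>x. v x $ snd ij / B) t x\<bar> powr q) \<partial>\<mu>M) \<le> ennreal (M * t powr q)" for ij
        unfolding q_def using M(2) vc t by blast
    qed (use q M t in auto)
    also have "(d * (M * t powr q)) powr (1 / q) = (d * M) powr (1 / q) * t"
    proof -
      have "0 \<le> d * M" "q / q = 1" "t powr 1 = t" using M q t by (auto simp: d_def)
      then show ?thesis using root_powr[of "d * M" q t q] q by (simp only: mult.assoc)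
    qed
    also have "ennreal (B\<^sup>2 * d * ((d * M) powr (1 / q) * t)) \<le> ennreal (K * t * B\<^sup>2)"
      using t by (intro ennreal_leI) (simp add: K_def algebra_simps)
    finally show ?thesis by (simp add: B_def)
  qed
  ultimately show ?thesis unfolding q_def by blast
qed

lemma H_inf:
  assumes "(INF y\<in>Y. H y) > 0" "y \<in> Y"
  shows "(INF y\<in>Y. H y) \<le> H y"
  using assms H_pos by (intro cINF_lower bdd_belowI[of _ 0]) (auto intro: less_imp_le)

end

theorem theorem2p8:
  fixes T :: "real \<Rightarrow> 'm::metric_space \<Rightarrow> 'm"
    and X Y :: "'m set"
    and h :: "'m \<Rightarrow> real"
    and \<tau> :: "'m \<Rightarrow> nat"
    and \<mu>0 \<mu>Y \<mu>X \<mu>M :: "'m measure"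
    and \<P> :: "'m set set"
    and lam C \<eta> \<theta> C2 :: real
    and \<zeta>0 :: "'m \<Rightarrow> real"
  defines "F \<equiv> Fmap T h \<tau>"
    and "H \<equiv> Hroof T h \<tau>"
  assumes bounded_M: "bounded (UNIV :: 'm set)"
    and sets_XY: "X \<in> sets borel" "Y \<in> sets borel" "Y \<subseteq> X"
    and semiflow0: "\<And>x. T 0 x = x"
    and semiflow_add: "\<And>s t x. 0 \<le> s \<Longrightarrow> 0 \<le> t \<Longrightarrow> T (s + t) x = T s (T t x)"
    and semiflow_meas: "(\<lambda>(t, x). T t x) \<in> measurable (restrict_space (lborel \<Otimes>\<^sub>M borel) ({0..} \<times> UNIV)) borel"
    and h_meas: "h \<in> borel_measurable (restrict_space borel X)"
    and h_pos: "\<And>x. x \<in> X \<Longrightarrow> h x > 0"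
    and f_X: "\<And>x. x \<in> X \<Longrightarrow> fmap T h x \<in> X"
    and \<tau>_meas: "\<tau> \<in> measurable (restrict_space borel Y) (count_space UNIV)"
    and \<tau>_pos: "\<And>y. y \<in> Y \<Longrightarrow> \<tau> y \<ge> 1"
    and F_Y: "\<And>y. y \<in> Y \<Longrightarrow> F y \<in> Y"
    and \<mu>0_sets: "sets \<mu>0 = sets (restrict_space borel X)"
    and \<mu>0_finite: "finite_measure \<mu>0"
    and \<mu>0_Y: "emeasure \<mu>0 Y > 0"
    and f_nonsing: "nonsingular_on \<mu>0 X (fmap T h)"
    and f_ergodic: "ergodic_on \<mu>0 X (fmap T h)"
    and \<tau>_L1: "integrable (restrict_space \<mu>0 Y) (\<lambda>y. real (\<tau> y))"
    and part_count: "countable \<P>"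
    and part_disj: "disjoint \<P>"
    and part_union: "\<Union>\<P> = Y"
    and part_sets: "\<And>P. P \<in> \<P> \<Longrightarrow> P \<in> sets borel \<and> P \<noteq> {}"
    and \<tau>_const: "\<And>P y y'. P \<in> \<P> \<Longrightarrow> y \<in> P \<Longrightarrow> y' \<in> P \<Longrightarrow> \<tau> y = \<tau> y'"
    and constants: "lam > 1" "C \<ge> 1" "0 < \<eta>" "\<eta> \<le> 1"
    and \<zeta>0_meas: "\<zeta>0 \<in> borel_measurable (restrict_space borel Y)"
    and \<zeta>0_pos: "\<And>y. y \<in> Y \<Longrightarrow> \<zeta>0 y > 0"
    and markov: "\<And>P. P \<in> \<P> \<Longrightarrow> \<exists>P' Q. P' \<subseteq> P \<and> Q \<subseteq> Y \<and> P' \<in> sets borel \<and> Q \<in> sets borel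
        \<and> emeasure \<mu>0 (P - P') = 0 \<and> emeasure \<mu>0 (Y - Q) = 0 \<and> bij_betw F P' Q
        \<and> (\<forall>A \<in> sets borel. A \<subseteq> P' \<longrightarrow> F ` A \<in> sets borel
             \<and> emeasure \<mu>0 A = (\<integral>\<^sup>+ z \<in> F ` A. ennreal (\<zeta>0 (inv_into P' F z)) \<partial>\<mu>0))"
    and expanding: "\<And>P y y'. P \<in> \<P> \<Longrightarrow> y \<in> P \<Longrightarrow> y' \<in> P \<Longrightarrow> dist (F y) (F y') \<ge> lam * dist y y'"
    and distortion: "\<And>P y y'. P \<in> \<P> \<Longrightarrow> y \<in> P \<Longrightarrow> y' \<in> P \<Longrightarrow>
        \<bar>ln (\<zeta>0 y) - ln (\<zeta>0 y')\<bar> \<le> C * dist (F y) (F y') powr \<eta>"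
    and \<mu>Y_sets: "sets \<mu>Y = sets (restrict_space borel Y)"
    and \<mu>Y_prob: "prob_space \<mu>Y"
    and \<mu>Y_inv: "invariant_on \<mu>Y Y F"
    and \<mu>Y_erg: "ergodic_on \<mu>Y Y F"
    and \<mu>Y_ac: "absolutely_continuous (restrict_space \<mu>0 Y) \<mu>Y"
    and \<mu>X_def: "\<mu>X = tower_measure X (fmap T h) \<tau> \<mu>Y"
    and h_L1: "integrable \<mu>X h"
    and \<mu>M_def: "\<mu>M = suspension_measure T h \<mu>X"
    and \<theta>_C2: "0 < \<theta>" "\<theta> < 1" "C2 \<ge> 1"
    and H_lip: "\<And>P y y'. P \<in> \<P> \<Longrightarrow> y \<in> P \<Longrightarrow> y' \<in> P \<Longrightarrow> y \<noteq> y' \<Longrightarrow>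
        \<bar>H y - H y'\<bar> \<le> C2 * dtheta \<theta> \<P> F y y' * (INF z\<in>P. H z)"
    and flow_contr: "\<And>P y y' t. P \<in> \<P> \<Longrightarrow> y \<in> P \<Longrightarrow> y' \<in> P \<Longrightarrow> 0 \<le> t \<Longrightarrow> t \<le> H y \<Longrightarrow> t \<le> H y' \<Longrightarrow>
        dist (T t y) (T t y') \<le> C2 * dtheta \<theta> \<P> F y y'"
  shows
    "(\<forall>p::real. p \<ge> 2 \<and> H \<in> borel_measurable \<mu>Y \<and> (\<integral>\<^sup>+ y. ennreal (\<bar>H y\<bar> powr p) \<partial>\<mu>Y) < \<infinity>
        \<and> (INF y\<in>Y. H y) > 0 \<longrightarrow>
       (\<exists>K>0. \<forall>v \<in> (C0eta \<eta> \<mu>M :: ('m \<Rightarrow> real^'d) set). \<forall>t>0.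
          Lq_norm \<mu>M (p - 1) (vt T v t) \<le> ennreal (K * t powr (1/2) * holder_norm \<eta> v)))
   \<and> (\<forall>p::real. p \<ge> 4 \<and> H \<in> borel_measurable \<mu>Y \<and> (\<integral>\<^sup>+ y. ennreal (\<bar>H y\<bar> powr p) \<partial>\<mu>Y) < \<infinity>
        \<and> (INF y\<in>Y. H y) > 0 \<longrightarrow>
       (\<exists>K>0. \<forall>v \<in> (C0eta \<eta> \<mu>M :: ('m \<Rightarrow> real^'d) set). \<forall>t>0.
          Lq_norm \<mu>M ((p - 1) / 2) (St T v t) \<le> ennreal (K * t * (holder_norm \<eta> v)\<^sup>2)))"
proof -
  interpret nue T X Y h \<tau> \<mu>0 \<mu>Y \<P> lam C \<eta> \<theta> C2 \<zeta>0
    using bounded_M sets_XY semiflow0 semiflow_add semiflow_meas h_meas h_pos f_X \<tau>_meas \<tau>_pos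
      F_Y[unfolded F_def] \<mu>0_sets \<mu>0_finite part_count part_disj part_union part_sets constants
      \<zeta>0_meas \<zeta>0_pos markov[unfolded F_def] expanding[unfolded F_def] distortion[unfolded F_def]
      \<mu>Y_sets \<mu>Y_prob \<mu>Y_inv[unfolded F_def] \<mu>Y_ac h_L1[unfolded \<mu>X_def] \<theta>_C2
      H_lip[unfolded F_def H_def] flow_contr[unfolded F_def H_def]
    by (rule nue.intro)
  \<comment> \<open>The infimum of \<open>H\<close> over \<open>Y\<close> itself serves as the lower
    bound \<open>h0\<close> of the return times.\<close>
  show ?thesis
    unfolding H_def \<mu>M_def \<mu>X_def
    using vt_moment[OF _ _ _ _ H_inf, where 'd = 'd] St_moment[OF _ _ _ _ H_inf, where 'd = 'd]
    by (intro conjI allI impI; elim conjE) presburger+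
qed

end
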